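(* Let $L=\partial_x^2+\partial_{y_1}^2-\partial_{y_2}^2$ on $\mathbb R\times\mathbb T^2$, and for dyadic $N\ge2$ and $T>0$ let $$\mathcal S(N,T)=\left\|e^{itL}P_{\le N}\right\|_{L^2(\mathbb R\times\mathbb T^2)\to L^{10/3}([0,T]\times\mathbb R\times\mathbb T^2)}.$$ Then the following hold for all dyadic $N\ge2$, with implicit constants independent of $N$ and $T$. (i) $\mathcal S(N,T)\eqsim (N^2T)^{3/10}$ if $0<T\le N^{-2}$. (ii) $\mathcal S(N,T)\eqsim 1$ if $N^{-2}\le T\le N^{-1}$. (iii) $\mathcal S(N,T)\eqsim (NT)^{1/5}$ if $T\ge1$. (iv) If $N^{-1}<T<1$, then $(NT)^{1/5}\lesssim \mathcal S(N,T)\lesssim \min\{(NT)^{3/10},\,T^{1/10}N^{1/5}\}$. (v) For each fixed $T_0>0$, $\mathcal S(N,T_0)\eqsim_{T_0} N^{1/5}$ for all dyadic $N\ge 2$, with constants allowed to depend on $T_0$ but not on $N$. (vi) For every family $(T_N)$ indexed by dyadic $N\ge2$ with $T_N\in(0,1]$, $$\sup_N \mathcal S(N,T_N)<\infty\quad\Longleftrightarrow\quad \sup_N N\,T_N<\infty .$$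
   Context: $\mathbb T=\mathbb R/(2\pi\mathbb Z)$ with Lebesgue measure on $[0,2\pi)$. Points of $\mathbb R\times\mathbb T^2$ are written $(x,y)=(x,y_1,y_2)$. The Fourier transform is $$\widehat f(\xi,k)=(2\pi)^{-3/2}\int_{\mathbb R}\int_{\mathbb T^2}f(x,y)e^{-i(x\xi+y\cdot k)}\,dy\,dx,\qquad (\xi,k)\in\mathbb R\times\mathbb Z^2.$$ The propagator $e^{itL}$ is the Fourier multiplier operator with symbol $e^{-it(\xi^2+k_1^2-k_2^2)}$. Fix an even function $\chi\in C_c^\infty(\mathbb R)$ with values in $[0,1]$, equal to $1$ on $[-1,1]$ and supported in $[-2,2]$. For dyadic $N\ge2$ (a power of two), $P_{\le N}$ is defined by $\widehat{P_{\le N}f}(\xi,k)=\chi\bigl(N^{-1}\sqrt{\xi^2+|k|^2}\bigr)\widehat f(\xi,k)$. The notation $A\lesssim B$ means $A\le CB$ with $C$ independent of $N,T$ (it may depend on the fixed cutoff $\chi$), and $A\eqsim B$ means $A\lesssim B$ and $B\lesssim A$; subscripts record additional dependence of the constants. *)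

theory Defs
  imports "HOL-Analysis.Analysis"
begin

section \<open>Lebesgue norms\<close>

definition Lp_norm :: "real \<Rightarrow> 'a measure \<Rightarrow> ('a \<Rightarrow> complex) \<Rightarrow> ennreal" where
  "Lp_norm p M f =
     (let I = \<integral>\<^sup>+ z. ennreal (norm (f z) powr p) \<partial>M
      in if I = \<infinity> then \<infinity> else ennreal (enn2real I powr (1 / p)))"

definition Lp_space :: "real \<Rightarrow> 'a measure \<Rightarrow> ('a \<Rightarrow> complex) set" where
  "Lp_space p M = {f \<in> borel_measurable M. Lp_norm p M f < \<infinity>}"

section \<open>Fourier analysis on the product of the line and the two-dimensional torus\<close>

text \<open>The torus is represented by the fundamental domain from 0 (included) to
  2 pi (excluded); functions of (x, y1, y2) matter only for y1, y2 in that domain.\<close>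

definition torus :: "real measure" where
  "torus = restrict_space lborel {0..<2 * pi}"

definition RT2 :: "(real \<times> real \<times> real) measure" where
  "RT2 = lborel \<Otimes>\<^sub>M (torus \<Otimes>\<^sub>M torus)"

definition RZ2 :: "(real \<times> int \<times> int) measure" where
  "RZ2 = lborel \<Otimes>\<^sub>M (count_space UNIV \<Otimes>\<^sub>M count_space UNIV)"

definition phase :: "real \<times> real \<times> real \<Rightarrow> real \<times> int \<times> int \<Rightarrow> real" where
  "phase = (\<lambda>(x, y1, y2) (\<xi>, k1, k2). x * \<xi> + y1 * of_int k1 + y2 * of_int k2)"

definition fourier_L1 :: "(real \<times> real \<times> real \<Rightarrow> complex) \<Rightarrow> (real \<times> int \<times> int \<Rightarrow> complex)" where
  "fourier_L1 f \<zeta> =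
     of_real ((2 * pi) powr (- 3 / 2)) * (LINT z|RT2. f z * cis (- phase z \<zeta>))"

text \<open>The Fourier transform of a square-integrable function is, as usual, the limit in the
  square mean of the integrals over bounded regions. The limit is determined only almost
  everywhere, so a measurable representative is chosen.\<close>

definition fourier_L2 :: "(real \<times> real \<times> real \<Rightarrow> complex) \<Rightarrow> (real \<times> int \<times> int \<Rightarrow> complex)" where
  "fourier_L2 f =
     (SOME F. F \<in> Lp_space 2 RZ2 \<and>
        (\<lambda>n::nat. Lp_norm 2 RZ2
           (\<lambda>\<zeta>. F \<zeta> - fourier_L1 (\<lambda>z. if \<bar>fst z\<bar> \<le> real n then f z else 0) \<zeta>))
        \<longlonglongrightarrow> 0)"

definition inverse_fourier :: "(real \<times> int \<times> int \<Rightarrow> complex) \<Rightarrow> (real \<times> real \<times> real \<Rightarrow> complex)" where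
  "inverse_fourier F z =
     of_real ((2 * pi) powr (- 3 / 2)) * (LINT \<zeta>|RZ2. F \<zeta> * cis (phase z \<zeta>))"

text \<open>The inverse transform is an absolutely convergent integral for every square-integrable
  \<open>f\<close> provided that \<open>m\<close> is bounded, measurable and of bounded support; only such symbols are
  used below.\<close>

definition fourier_multiplier ::
    "(real \<times> int \<times> int \<Rightarrow> complex) \<Rightarrow> (real \<times> real \<times> real \<Rightarrow> complex)
      \<Rightarrow> (real \<times> real \<times> real \<Rightarrow> complex)" where
  "fourier_multiplier m f = inverse_fourier (\<lambda>\<zeta>. m \<zeta> * fourier_L2 f \<zeta>)"

section \<open>The frequency-localised propagator and its Strichartz norm\<close>

definition smooth_cutoff :: "(real \<Rightarrow> real) \<Rightarrow> bool" where
  "smooth_cutoff \<eta> \<longleftrightarrow>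
     (\<forall>n x. (deriv ^^ n) \<eta> differentiable (at x)) \<and>
     (\<forall>x. \<eta> (- x) = \<eta> x) \<and>
     (\<forall>x. 0 \<le> \<eta> x \<and> \<eta> x \<le> 1) \<and>
     (\<forall>x\<in>{-1..1}. \<eta> x = 1) \<and>
     closure {x. \<eta> x \<noteq> 0} \<subseteq> {-2..2}"

definition propagator_symbol :: "real \<Rightarrow> real \<times> int \<times> int \<Rightarrow> complex" where
  "propagator_symbol t = (\<lambda>(\<xi>, k1, k2). cis (- t * (\<xi>\<^sup>2 + (of_int k1)\<^sup>2 - (of_int k2)\<^sup>2)))"

definition projection_symbol :: "(real \<Rightarrow> real) \<Rightarrow> nat \<Rightarrow> real \<times> int \<times> int \<Rightarrow> complex" where
  "projection_symbol \<eta> N =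
     (\<lambda>(\<xi>, k1, k2). of_real (\<eta> (sqrt (\<xi>\<^sup>2 + (of_int k1)\<^sup>2 + (of_int k2)\<^sup>2) / real N)))"

text \<open>The composition of the propagator with the projection, that is, the multiplier operator
  whose symbol is the product of the two symbols.\<close>

definition localised_propagator ::
    "(real \<Rightarrow> real) \<Rightarrow> nat \<Rightarrow> real \<Rightarrow> (real \<times> real \<times> real \<Rightarrow> complex)
      \<Rightarrow> (real \<times> real \<times> real \<Rightarrow> complex)" where
  "localised_propagator \<eta> N t =
     fourier_multiplier (\<lambda>\<zeta>. propagator_symbol t \<zeta> * projection_symbol \<eta> N \<zeta>)"

definition strichartz_norm :: "(real \<Rightarrow> real) \<Rightarrow> nat \<Rightarrow> real \<Rightarrow> ennreal" where
  "strichartz_norm \<eta> N T =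
     (SUP f \<in> {f \<in> Lp_space 2 RT2. Lp_norm 2 RT2 f \<le> 1}.
        Lp_norm (10 / 3) (restrict_space lborel {0..T} \<Otimes>\<^sub>M RT2)
          (\<lambda>(t, z). localised_propagator \<eta> N t f z))"

section \<open>Dyadic scales and inequalities up to constants\<close>

definition dyadic_scales :: "nat set" where
  "dyadic_scales = {N. N \<ge> 2 \<and> (\<exists>j. N = 2 ^ j)}"

text \<open>The index set collects the parameters of which the implicit constant is independent.\<close>

definition lesssim_on :: "'i set \<Rightarrow> ('i \<Rightarrow> ennreal) \<Rightarrow> ('i \<Rightarrow> ennreal) \<Rightarrow> bool" where
  "lesssim_on I A B \<longleftrightarrow> (\<exists>C::real. C > 0 \<and> (\<forall>i\<in>I. A i \<le> ennreal C * B i))"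

definition eqsim_on :: "'i set \<Rightarrow> ('i \<Rightarrow> ennreal) \<Rightarrow> ('i \<Rightarrow> ennreal) \<Rightarrow> bool" where
  "eqsim_on I A B \<longleftrightarrow> lesssim_on I A B \<and> lesssim_on I B A"

end

theory Submission
  imports Defs "HOL-Probability.Characteristic_Functions"
begin

text \<open>
  The propagator composed with the projection is, up to the factor \<open>(2 * pi) powr (- 3/2)\<close>, the
  extension operator \<open>ext F t z\<close>, the integral of \<open>F \<zeta> * cis (phase z \<zeta> - t * hyp \<zeta>)\<close> over the
  frequencies, applied to the transform \<open>F\<close> of the datum times the cutoff: a function of energy at
  most one on a box of side comparable to \<open>N\<close>.  So the theorem is about the largest possible
  \<open>strichartz_mass F 0 T\<close>, the space-time integral of the power 10/3 of \<open>ext F\<close>, whose power 3/10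
  is the operator norm.

  Three upper bounds are needed.  First, \<open>ext F\<close> is at most of size \<open>N powr (3/2)\<close> and has bounded
  energy at every time, so the mass is at most of order \<open>N\<^sup>2 * T\<close> (\<open>bernstein_mass\<close>).
  Secondly, up to a time of order \<open>1 / N\<close> a wave of frequency at most \<open>N\<close> cannot go around the torus: the
  kernel of the localised propagator decays like \<open>\<bar>t\<bar> powr (- 3/2)\<close> as on Euclidean space
  (\<open>kernel_bound\<close>), because the exponential sums in the torus variables have at most one
  stationary point (\<open>kusmin_landau\<close>).  Since 10/3 is the Euclidean exponent in dimension three,
  the \<open>TT*\<close> argument with fractional integration bounds the mass on such an interval by a constant
  (\<open>strichartz_short_time\<close>), and the mass on \<open>{0..T}\<close> by a multiple of \<open>N * T + 1\<close>.
  Thirdly, for \<open>T \<ge> 1\<close> the fourth power of \<open>ext F\<close> has integral of order at most \<open>N * sqrt T\<close>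
  (\<open>quartic_estimate\<close>): by a large sieve inequality in time (\<open>gaussian_large_sieve\<close>) it suffices to
  measure the frequencies in a box at distance at most \<open>1 / T\<close> from a quadric
  \<open>\<xi>\<^sup>2 + a * b = const\<close> (\<open>cone_count\<close>), where \<open>a\<close> and \<open>b\<close> are integers because the form
  \<open>k1\<^sup>2 - k2\<^sup>2\<close> is a product of two linear forms.  Interpolation with the energy gives a mass of order
  at most \<open>T powr (1/3) * (N * sqrt (max 1 T)) powr (2/3)\<close>.

  Both extremal examples are Gaussian packets, estimated from below on the set where all their
  phases are close to zero (\<open>strichartz_norm_packet\<close>).  The packet of all frequencies up to \<open>N\<close> is
  focused during a time of order \<open>1 / N\<^sup>2\<close> and shows that the first bound is sharp there
  (\<open>lower_bound_point_mass\<close>).  The packet of the frequencies \<open>(l, - l)\<close> does not disperse in the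
  torus variables at all, since the form vanishes on that line, and disperses in the remaining
  variable only after the time \<open>T\<close> if its frequencies there are of size \<open>1 / sqrt T\<close>; it yields
  \<open>(N * T) powr (1/5)\<close> (\<open>lower_bound_null_line\<close>) and shows that the third bound is sharp for \<open>T \<ge> 1\<close>.

  The six claims combine these five bounds; between the times \<open>1 / N\<^sup>2\<close> and \<open>1 / N\<close> the lower bound
  comes from the time \<open>1 / N\<^sup>2\<close>, since the norm increases with \<open>T\<close>.
\<close>

section \<open>Kernel operators and the Gaussian large sieve\<close>

lemma borel_measurable_cis [measurable]:
  "f \<in> borel_measurable M \<Longrightarrow> (\<lambda>x. cis (f x)) \<in> borel_measurable M"
  by (rule borel_measurable_continuous_on[where f = cis])
    (auto simp: cis_conv_exp intro!: continuous_intros)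

lemma borel_measurable_cnj [measurable]:
  "f \<in> borel_measurable M \<Longrightarrow> (\<lambda>x. cnj (f x)) \<in> borel_measurable M"
  by (rule borel_measurable_continuous_on[where f = cnj]) (auto intro!: continuous_intros)

lemma ennreal_le_add: "a \<le> b + c \<Longrightarrow> 0 \<le> b \<Longrightarrow> 0 \<le> c \<Longrightarrow> ennreal a \<le> ennreal b + ennreal c"
  by (metis ennreal_leI ennreal_plus)

lemma norm_integral_le_nn_integral:
  fixes f :: "'a \<Rightarrow> complex"
  shows "ennreal (norm (LINT x|M. f x)) \<le> (\<integral>\<^sup>+x. ennreal (norm (f x)) \<partial>M)"
proof (cases "integrable M f")
  case True
  then show ?thesis by (rule integral_norm_bound_ennreal)
qed (simp add: not_integrable_integral_eq)

lemma cauchy_schwarz_integral: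
  fixes f g :: "'a \<Rightarrow> complex"
  assumes [measurable]: "f \<in> borel_measurable M" "g \<in> borel_measurable M"
  shows "ennreal ((norm (LINT x|M. f x * g x))\<^sup>2)
    \<le> (\<integral>\<^sup>+x. ennreal ((norm (f x))\<^sup>2) \<partial>M) * (\<integral>\<^sup>+x. ennreal ((norm (g x))\<^sup>2) \<partial>M)"
proof -
  have "ennreal ((norm (LINT x|M. f x * g x))\<^sup>2) = (ennreal (norm (LINT x|M. f x * g x)))\<^sup>2"
    by (simp add: ennreal_power)
  also have "\<dots> \<le> (\<integral>\<^sup>+x. ennreal (norm (f x * g x)) \<partial>M)\<^sup>2"
    by (intro power_mono norm_integral_le_nn_integral) auto
  also have "\<dots> = (\<integral>\<^sup>+x. ennreal (norm (f x)) * ennreal (norm (g x)) \<partial>M)\<^sup>2"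
    by (simp add: norm_mult ennreal_mult)
  also have "\<dots> \<le> (\<integral>\<^sup>+x. (ennreal (norm (f x)))\<^sup>2 \<partial>M) * (\<integral>\<^sup>+x. (ennreal (norm (g x)))\<^sup>2 \<partial>M)"
    by (rule Cauchy_Schwarz_nn_integral) auto
  finally show ?thesis by (simp add: ennreal_power)
qed

lemma (in pair_sigma_finite) integrable_product:
  fixes f :: "'a \<Rightarrow> complex" and g :: "'b \<Rightarrow> complex"
  assumes f: "integrable M1 f" and g: "integrable M2 g"
  shows "integrable (M1 \<Otimes>\<^sub>M M2) (\<lambda>(x, y). f x * g y)"
proof -
  have [measurable]: "f \<in> borel_measurable M1" "g \<in> borel_measurable M2" using f g by auto
  have "(\<integral>\<^sup>+p. ennreal (norm (case p of (x, y) \<Rightarrow> f x * g y)) \<partial>(M1 \<Otimes>\<^sub>M M2))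
     = (\<integral>\<^sup>+x. \<integral>\<^sup>+y. ennreal (norm (f x)) * ennreal (norm (g y)) \<partial>M2 \<partial>M1)"
    by (subst M2.nn_integral_fst[symmetric]) (auto simp: norm_mult ennreal_mult)
  also have "\<dots> = (\<integral>\<^sup>+x. ennreal (norm (f x)) \<partial>M1) * (\<integral>\<^sup>+y. ennreal (norm (g y)) \<partial>M2)"
    by (simp add: nn_integral_cmult nn_integral_multc)
  also have "\<dots> < \<infinity>" using f g by (simp add: integrable_iff_bounded ennreal_mult_less_top)
  finally show ?thesis by (simp add: integrable_iff_bounded)
qed

lemma (in pair_sigma_finite) integral_product:
  fixes f :: "'a \<Rightarrow> complex" and g :: "'b \<Rightarrow> complex"
  assumes f: "integrable M1 f" and g: "integrable M2 g"
  shows "(LINT p|(M1 \<Otimes>\<^sub>M M2). f (fst p) * g (snd p)) = (LINT x|M1. f x) * (LINT y|M2. g y)"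
proof -
  have "(LINT p|(M1 \<Otimes>\<^sub>M M2). f (fst p) * g (snd p)) = (LINT x|M1. LINT y|M2. f x * g y)"
    using integral_fst'[OF integrable_product[OF f g]] by (simp only: case_prod_beta' fst_conv snd_conv)
  also have "\<dots> = (LINT x|M1. f x) * (LINT y|M2. g y)" by simp
  finally show ?thesis .
qed

text \<open>Duality arguments move an operator from one factor of a pairing to the other.  Boundedness of the
  kernel makes the double integral absolutely convergent, so that Fubini's theorem applies.\<close>

lemma (in pair_sigma_finite) adjoint_kernel_operator:
  fixes e :: "'a \<Rightarrow> 'b \<Rightarrow> complex" and F :: "'a \<Rightarrow> complex" and g :: "'b \<Rightarrow> complex"
  assumes F: "integrable M1 F" and g: "integrable M2 g"
    and e[measurable]: "case_prod e \<in> borel_measurable (M1 \<Otimes>\<^sub>M M2)" and le: "\<And>x y. norm (e x y) \<le> 1"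
  shows "(LINT y|M2. (LINT x|M1. F x * e x y) * cnj (g y))
       = (LINT x|M1. F x * cnj (LINT y|M2. g y * cnj (e x y)))"
proof -
  have [measurable]: "F \<in> borel_measurable M1" "g \<in> borel_measurable M2" using F g by auto
  have g': "integrable M2 (\<lambda>y. cnj (g y))" using g by simp
  have "integrable (M1 \<Otimes>\<^sub>M M2) (\<lambda>(x,y). F x * e x y * cnj (g y))"
  proof (rule Bochner_Integration.integrable_bound[OF integrable_product[OF F g']])
    show "AE p in M1 \<Otimes>\<^sub>M M2. norm (case p of (x, y) \<Rightarrow> F x * e x y * cnj (g y))
        \<le> norm (case p of (x, y) \<Rightarrow> F x * cnj (g y))"
      using le by (intro AE_I2) (simp add: case_prod_beta norm_mult mult_right_mono mult_left_le)
    have "(\<lambda>p. F (fst p) * case_prod e p * cnj (g (snd p))) \<in> borel_measurable (M1 \<Otimes>\<^sub>M M2)"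
      by measurable
    then show "(\<lambda>(x, y). F x * e x y * cnj (g y)) \<in> borel_measurable (M1 \<Otimes>\<^sub>M M2)"
      by (simp add: case_prod_beta')
  qed
  from Fubini_integral[OF this]
  have "(LINT y|M2. LINT x|M1. F x * e x y * cnj (g y)) = (LINT x|M1. LINT y|M2. F x * e x y * cnj (g y))" .
  moreover have "cnj (LINT y|M2. g y * cnj (e x y)) = (LINT y|M2. e x y * cnj (g y))" for x
    by (simp add: mult.commute flip: Bochner_Integration.integral_cnj)
  moreover have "(LINT y|M2. (LINT x|M1. F x * e x y) * cnj (g y)) = (LINT y|M2. LINT x|M1. F x * e x y * cnj (g y))"
    by simp
  moreover have "(LINT x|M1. LINT y|M2. F x * e x y * cnj (g y)) = (LINT x|M1. F x * (LINT y|M2. e x y * cnj (g y)))"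
    by (simp add: mult.assoc)
  ultimately show ?thesis by (simp only:)
qed

lemma gaussian_fourier_transform:
  assumes "\<epsilon> > 0"
  shows "integrable lborel (\<lambda>t. complex_of_real (exp (- (\<epsilon> * t)\<^sup>2 / 2)) * cis (t * s))"
    and "(LINT t|lborel. complex_of_real (exp (- (\<epsilon> * t)\<^sup>2 / 2)) * cis (t * s))
       = complex_of_real (sqrt (2 * pi) / \<epsilon> * exp (- s\<^sup>2 / (2 * \<epsilon>\<^sup>2)))"
proof -
  let ?h = "\<lambda>r t. complex_of_real (exp (- t\<^sup>2 / 2)) * cis (t * r)"
  have eq: "?h r t = complex_of_real (sqrt (2*pi)) * (std_normal_density t *\<^sub>R iexp (r * t))" for r t
  proof -
    have "exp (- t\<^sup>2 / 2) = sqrt (2*pi) * std_normal_density t"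
      unfolding std_normal_density_def by simp
    then have "complex_of_real (exp (- t\<^sup>2 / 2)) = complex_of_real (sqrt (2*pi)) * complex_of_real (std_normal_density t)"
      by (simp only: of_real_mult)
    then show ?thesis by (simp only: scaleR_conv_of_real cis_conv_exp mult.assoc mult.commute[of t r])
  qed
  have int1: "integrable lborel (\<lambda>t. std_normal_density t *\<^sub>R iexp (r * t))" for r :: real
  proof (rule Bochner_Integration.integrable_bound[where f = "std_normal_density"])
    show "integrable lborel std_normal_density"
      using integrable_std_normal_moment_abs[of 0] by (simp only: power_0 mult_1_right)
    show "AE t in lborel. norm (std_normal_density t *\<^sub>R iexp (r * t)) \<le> norm (std_normal_density t)"
      by (intro AE_I2) (simp only: norm_scaleR norm_exp_i_times norm_mult real_norm_def mult_1_right of_real_mult[symmetric] order_refl)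
  qed measurable
  have int: "integrable lborel (?h r)" for r
    unfolding eq using int1 by (intro integrable_mult_right) auto
  have "(LINT t|lborel. std_normal_density t *\<^sub>R iexp (r * t)) = complex_of_real (exp (- (r^2) / 2))" for r
    using fun_cong[OF char_std_normal_distribution, of r] unfolding char_def
    by (subst (asm) integral_density) (auto simp: normal_density_nonneg)
  then have val: "(LINT t|lborel. ?h r t) = complex_of_real (sqrt (2 * pi) * exp (- r\<^sup>2 / 2))" for r
    unfolding eq by (subst integral_mult_right_zero) simp
  have sub: "?h (s / \<epsilon>) (0 + \<epsilon> * t) = complex_of_real (exp (- (\<epsilon> * t)\<^sup>2 / 2)) * cis (t * s)" for t
    using assms by simp
  show "integrable lborel (\<lambda>t. complex_of_real (exp (- (\<epsilon> * t)\<^sup>2 / 2)) * cis (t * s))"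
    using lborel_integrable_real_affine[OF int[of "s/\<epsilon>"], of \<epsilon> 0] assms unfolding sub by simp
  have "(LINT t|lborel. ?h (s/\<epsilon>) t) = \<epsilon> *\<^sub>R (LINT t|lborel. complex_of_real (exp (- (\<epsilon> * t)\<^sup>2 / 2)) * cis (t * s))"
    using lborel_integral_real_affine[of \<epsilon> "?h (s/\<epsilon>)" 0] assms unfolding sub by simp
  then show "(LINT t|lborel. complex_of_real (exp (- (\<epsilon> * t)\<^sup>2 / 2)) * cis (t * s))
       = complex_of_real (sqrt (2 * pi) / \<epsilon> * exp (- s\<^sup>2 / (2 * \<epsilon>\<^sup>2)))"
    using assms unfolding val by (simp add: scaleR_conv_of_real field_simps power_divide)
qed

lemma gaussian_integral:
  assumes "\<epsilon> > 0"
  shows "integrable lborel (\<lambda>t. exp (- (\<epsilon> * t)\<^sup>2 / 2))"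
    and "(LINT t|lborel. exp (- (\<epsilon> * t)\<^sup>2 / 2)) = sqrt (2 * pi) / \<epsilon>"
proof -
  have 1: "integrable lborel (\<lambda>t. complex_of_real (exp (- (\<epsilon> * t)\<^sup>2 / 2)))"
    using gaussian_fourier_transform(1)[OF assms, of 0] by simp
  then show "integrable lborel (\<lambda>t. exp (- (\<epsilon> * t)\<^sup>2 / 2))" by (subst (asm) complex_of_real_integrable_eq)
  then show "(LINT t|lborel. exp (- (\<epsilon> * t)\<^sup>2 / 2)) = sqrt (2 * pi) / \<epsilon>"
    using gaussian_fourier_transform(2)[OF assms, of 0]
    by (simp only: mult_zero_right cis_zero mult_1_right integral_complex_of_real of_real_eq_iff) simp
qed

lemma gaussian_nn_integral:
  assumes "\<epsilon> > 0"
  shows "(\<integral>\<^sup>+t. ennreal (exp (- (\<epsilon> * t)\<^sup>2 / 2)) \<partial>lborel) = ennreal (sqrt (2 * pi) / \<epsilon>)"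
  by (subst nn_integral_eq_integral) (use gaussian_integral[OF assms] in auto)

text \<open>The square of the inner integral is a double integral over \<open>X\<close>, in which the integral over \<open>t\<close>
  of the Gaussian weight is a Gaussian of width \<open>\<epsilon>\<close> in the difference of two phases.  The
  resulting quadratic form in \<open>a\<close> is bounded by Schur's test.  The constant \<open>A\<close> measures how many
  phases can lie within \<open>\<epsilon>\<close> of one another.\<close>

lemma gaussian_large_sieve:
  fixes X :: "'a measure" and a :: "'a \<Rightarrow> complex" and \<phi> :: "'a \<Rightarrow> real"
  assumes X: "sigma_finite_measure X" and a: "integrable X a"
    and \<phi>[measurable]: "\<phi> \<in> borel_measurable X" and \<epsilon>: "\<epsilon> > 0"
    and A: "\<And>\<tau>. (\<integral>\<^sup>+x. ennreal (sqrt (2 * pi) / \<epsilon> * exp (- (\<phi> x - \<tau>)\<^sup>2 / (2 * \<epsilon>\<^sup>2))) \<partial>X) \<le> A"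
  shows "(\<integral>\<^sup>+t. ennreal (exp (- (\<epsilon> * t)\<^sup>2 / 2) * (norm (LINT x|X. a x * cis (t * \<phi> x)))\<^sup>2) \<partial>lborel)
      \<le> A * (\<integral>\<^sup>+x. ennreal ((norm (a x))\<^sup>2) \<partial>X)"
proof -
  interpret X: sigma_finite_measure X by fact
  interpret XX: pair_sigma_finite X X ..
  interpret P: sigma_finite_measure "X \<Otimes>\<^sub>M X" by (rule sigma_finite_pair_measure[OF X X])
  interpret T: pair_sigma_finite lborel "X \<Otimes>\<^sub>M X" ..
  have [measurable]: "a \<in> borel_measurable X" using a by auto
  define g where "g s = sqrt (2 * pi) / \<epsilon> * exp (- s\<^sup>2 / (2 * \<epsilon>\<^sup>2))" for s
  have g0: "g s \<ge> 0" for s using \<epsilon> by (simp add: g_def)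
  have [measurable]: "g \<in> borel_measurable borel" unfolding g_def by measurable
  define I where "I t = (LINT x|X. a x * cis (t * \<phi> x))" for t
  define w where "w t = exp (- (\<epsilon> * t)\<^sup>2 / 2)" for t
  have [measurable]: "w \<in> borel_measurable borel" unfolding w_def by measurable
  have I_meas[measurable]: "I \<in> borel_measurable borel"
    unfolding I_def by measurable
  have aint: "integrable X (\<lambda>x. a x * cis (t * \<phi> x))" for t
    by (rule Bochner_Integration.integrable_bound[OF a]) (auto simp: norm_mult)
  have aa: "integrable (X \<Otimes>\<^sub>M X) (\<lambda>(x, x'). a x * cnj (a x'))"
    using XX.integrable_product[OF a, of "\<lambda>x. cnj (a x)"] a by simp
  have sq: "complex_of_real ((norm (I t))\<^sup>2) = (LINT p|(X \<Otimes>\<^sub>M X). a (fst p) * cnj (a (snd p)) * cis (t * (\<phi> (fst p) - \<phi> (snd p))))" for t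
  proof -
    have "complex_of_real ((norm (I t))\<^sup>2) = I t * cnj (I t)" by (rule complex_norm_square)
    also have "cnj (I t) = (LINT x|X. cnj (a x * cis (t * \<phi> x)))" unfolding I_def by (rule Bochner_Integration.integral_cnj[symmetric])
    also have "I t * \<dots> = (LINT p|(X \<Otimes>\<^sub>M X). a (fst p) * cis (t * \<phi> (fst p)) * cnj (a (snd p) * cis (t * \<phi> (snd p))))"
      unfolding I_def by (intro XX.integral_product[symmetric] aint integrable_cnj)
    also have "\<dots> = (LINT p|(X \<Otimes>\<^sub>M X). a (fst p) * cnj (a (snd p)) * cis (t * (\<phi> (fst p) - \<phi> (snd p))))"
      by (intro Bochner_Integration.integral_cong refl)
        (simp add: right_diff_distrib cis_cnj cis_mult mult_ac distrib_left diff_conv_add_uminus del: add_uminus_conv_diff)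
    finally show ?thesis .
  qed
  have wint: "integrable lborel (\<lambda>t. complex_of_real (w t))"
    unfolding w_def using gaussian_integral(1)[OF \<epsilon>] by simp
  have big: "integrable (lborel \<Otimes>\<^sub>M (X \<Otimes>\<^sub>M X))
     (\<lambda>(t,p). complex_of_real (w t) * (a (fst p) * cnj (a (snd p)) * cis (t * (\<phi> (fst p) - \<phi> (snd p)))))"
    by (rule Bochner_Integration.integrable_bound[OF T.integrable_product[OF wint aa]])
      (auto simp: norm_mult)
  have "(LINT t|lborel. complex_of_real (w t * (norm (I t))\<^sup>2))
    = (LINT t|lborel. LINT p|(X \<Otimes>\<^sub>M X). complex_of_real (w t) * (a (fst p) * cnj (a (snd p)) * cis (t * (\<phi> (fst p) - \<phi> (snd p)))))"
    using sq by simp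
  also have "\<dots> = (LINT p|(X \<Otimes>\<^sub>M X). LINT t|lborel. complex_of_real (w t) * (a (fst p) * cnj (a (snd p)) * cis (t * (\<phi> (fst p) - \<phi> (snd p)))))"
    by (rule T.Fubini_integral[symmetric]) (use big in simp)
  also have "\<dots> = (LINT p|(X \<Otimes>\<^sub>M X). a (fst p) * cnj (a (snd p)) * complex_of_real (g (\<phi> (fst p) - \<phi> (snd p))))"
  proof (intro Bochner_Integration.integral_cong refl)
    fix p
    have "(LINT t|lborel. complex_of_real (w t) * (a (fst p) * cnj (a (snd p)) * cis (t * (\<phi> (fst p) - \<phi> (snd p)))))
       = (LINT t|lborel. a (fst p) * cnj (a (snd p)) * (complex_of_real (w t) * cis (t * (\<phi> (fst p) - \<phi> (snd p)))))"
      by (simp add: mult_ac)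
    also have "\<dots> = a (fst p) * cnj (a (snd p)) * complex_of_real (g (\<phi> (fst p) - \<phi> (snd p)))"
      unfolding w_def g_def by (subst integral_mult_right_zero) (simp only: gaussian_fourier_transform[OF \<epsilon>])
    finally show "(LINT t|lborel. complex_of_real (w t) * (a (fst p) * cnj (a (snd p)) * cis (t * (\<phi> (fst p) - \<phi> (snd p)))))
       = a (fst p) * cnj (a (snd p)) * complex_of_real (g (\<phi> (fst p) - \<phi> (snd p)))" .
  qed
  finally have main: "(LINT t|lborel. complex_of_real (w t * (norm (I t))\<^sup>2))
     = (LINT p|(X \<Otimes>\<^sub>M X). a (fst p) * cnj (a (snd p)) * complex_of_real (g (\<phi> (fst p) - \<phi> (snd p))))" .
  have Ib: "norm (I t) \<le> (LINT x|X. norm (a x))" for t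
    unfolding I_def by (rule order.trans[OF integral_norm_bound]) (simp add: norm_mult)
  have wI: "integrable lborel (\<lambda>t. w t * (norm (I t))\<^sup>2)"
  proof (rule Bochner_Integration.integrable_bound)
    show "integrable lborel (\<lambda>t. w t * (LINT x|X. norm (a x))\<^sup>2)"
      unfolding w_def using gaussian_integral(1)[OF \<epsilon>] by simp
    show "AE t in lborel. norm (w t * (norm (I t))\<^sup>2) \<le> norm (w t * (LINT x|X. norm (a x))\<^sup>2)"
      using Ib by (auto simp: w_def abs_mult intro!: mult_left_mono power_mono)
  qed auto
  have "(\<integral>\<^sup>+t. ennreal (w t * (norm (I t))\<^sup>2) \<partial>lborel) = ennreal (LINT t|lborel. w t * (norm (I t))\<^sup>2)"
    using wI by (intro nn_integral_eq_integral) (auto simp: w_def)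
  also have "\<dots> \<le> ennreal (norm (LINT t|lborel. complex_of_real (w t * (norm (I t))\<^sup>2)))"
    by (subst integral_complex_of_real) (auto intro!: ennreal_leI)
  also have "\<dots> \<le> (\<integral>\<^sup>+p. ennreal (norm (a (fst p) * cnj (a (snd p)) * complex_of_real (g (\<phi> (fst p) - \<phi> (snd p))))) \<partial>(X \<Otimes>\<^sub>M X))"
    unfolding main by (rule norm_integral_le_nn_integral)
  also have "\<dots> = (\<integral>\<^sup>+x. \<integral>\<^sup>+x'. ennreal (norm (a x) * norm (a x') * g (\<phi> x - \<phi> x')) \<partial>X \<partial>X)"
    by (subst X.nn_integral_fst[symmetric]) (auto simp: norm_mult g0)
  also have "\<dots> \<le> (\<integral>\<^sup>+x. \<integral>\<^sup>+x'. (ennreal ((norm (a x))\<^sup>2 / 2 * g (\<phi> x - \<phi> x')) + ennreal ((norm (a x'))\<^sup>2 / 2 * g (\<phi> x - \<phi> x'))) \<partial>X \<partial>X)"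
  proof (intro nn_integral_mono)
    fix x x'
    have "norm (a x) * norm (a x') \<le> (norm (a x))\<^sup>2 / 2 + (norm (a x'))\<^sup>2 / 2"
      using sum_squares_bound[of "norm (a x)" "norm (a x')"] by simp
    then have "norm (a x) * norm (a x') * g (\<phi> x - \<phi> x')
       \<le> (norm (a x))\<^sup>2 / 2 * g (\<phi> x - \<phi> x') + (norm (a x'))\<^sup>2 / 2 * g (\<phi> x - \<phi> x')"
      using g0[of "\<phi> x - \<phi> x'"] by (metis distrib_right mult_right_mono)
    then show "ennreal (norm (a x) * norm (a x') * g (\<phi> x - \<phi> x'))
       \<le> ennreal ((norm (a x))\<^sup>2 / 2 * g (\<phi> x - \<phi> x')) + ennreal ((norm (a x'))\<^sup>2 / 2 * g (\<phi> x - \<phi> x'))"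
      by (rule ennreal_le_add) (simp_all add: g0)
  qed
  also have "\<dots> = (\<integral>\<^sup>+x. \<integral>\<^sup>+x'. ennreal ((norm (a x))\<^sup>2 / 2 * g (\<phi> x - \<phi> x')) \<partial>X \<partial>X)
      + (\<integral>\<^sup>+x. \<integral>\<^sup>+x'. ennreal ((norm (a x'))\<^sup>2 / 2 * g (\<phi> x - \<phi> x')) \<partial>X \<partial>X)"
    by (simp add: nn_integral_add)
  also have "(\<integral>\<^sup>+x. \<integral>\<^sup>+x'. ennreal ((norm (a x'))\<^sup>2 / 2 * g (\<phi> x - \<phi> x')) \<partial>X \<partial>X)
     = (\<integral>\<^sup>+x. \<integral>\<^sup>+x'. ennreal ((norm (a x))\<^sup>2 / 2 * g (\<phi> x - \<phi> x')) \<partial>X \<partial>X)"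
    by (subst XX.Fubini') (auto simp: g_def power2_commute)
  also have "\<dots> + \<dots> = 2 * \<dots>" by (simp add: mult_2)
  also have "(\<integral>\<^sup>+x. \<integral>\<^sup>+x'. ennreal ((norm (a x))\<^sup>2 / 2 * g (\<phi> x - \<phi> x')) \<partial>X \<partial>X)
     \<le> (\<integral>\<^sup>+x. ennreal ((norm (a x))\<^sup>2 / 2) * A \<partial>X)"
  proof (intro nn_integral_mono)
    fix x
    have "(\<integral>\<^sup>+x'. ennreal ((norm (a x))\<^sup>2 / 2 * g (\<phi> x - \<phi> x')) \<partial>X)
        = ennreal ((norm (a x))\<^sup>2 / 2) * (\<integral>\<^sup>+x'. ennreal (g (\<phi> x' - \<phi> x)) \<partial>X)"
      by (subst nn_integral_cmult[symmetric]) (auto simp: ennreal_mult[symmetric] g0, simp add: g_def power2_commute)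
    also have "\<dots> \<le> ennreal ((norm (a x))\<^sup>2 / 2) * A"
      using A unfolding g_def by (intro mult_left_mono) auto
    finally show "(\<integral>\<^sup>+x'. ennreal ((norm (a x))\<^sup>2 / 2 * g (\<phi> x - \<phi> x')) \<partial>X) \<le> ennreal ((norm (a x))\<^sup>2 / 2) * A" .
  qed
  also have "2 * (\<integral>\<^sup>+x. ennreal ((norm (a x))\<^sup>2 / 2) * A \<partial>X) = A * (\<integral>\<^sup>+x. 2 * ennreal ((norm (a x))\<^sup>2 / 2) \<partial>X)"
    by (subst nn_integral_multc) (auto simp: nn_integral_cmult mult_ac)
  also have "\<dots> = A * (\<integral>\<^sup>+x. ennreal ((norm (a x))\<^sup>2) \<partial>X)"
    by (intro arg_cong2[where f = "(*)"] refl nn_integral_cong) (simp add: ennreal_mult'[symmetric] flip: ennreal_numeral)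
  finally show ?thesis unfolding I_def w_def by (simp add: mult_left_mono)
qed

section \<open>Bessel inequalities on the product of the line and the torus\<close>

lemma sigma_finite_torus: "sigma_finite_measure torus"
  unfolding torus_def by (intro sigma_finite_measure_restrict_space sigma_finite_lborel) auto

lemma sigma_finite_RT2: "sigma_finite_measure RT2"
  unfolding RT2_def by (intro sigma_finite_pair_measure sigma_finite_torus sigma_finite_lborel)

abbreviation Z2 :: "(int \<times> int) measure" where "Z2 \<equiv> count_space UNIV"

lemma RZ2_eq: "RZ2 = lborel \<Otimes>\<^sub>M Z2"
  unfolding RZ2_def by (simp add: pair_measure_countable)

lemma sigma_finite_Z2: "sigma_finite_measure Z2"
  by (rule sigma_finite_measure_count_space_countable) auto

lemma sigma_finite_RZ2: "sigma_finite_measure RZ2"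
  unfolding RZ2_eq by (intro sigma_finite_pair_measure sigma_finite_Z2 sigma_finite_lborel)

lemma space_RZ2 [simp]: "space RZ2 = UNIV"
  by (simp add: RZ2_eq space_pair_measure)

lemma measurable_RT2 [measurable]:
  "fst \<in> borel_measurable RT2"
  "(\<lambda>z. fst (snd z)) \<in> borel_measurable RT2"
  "(\<lambda>z. snd (snd z)) \<in> borel_measurable RT2"
proof -
  have [measurable]: "(\<lambda>x. x) \<in> borel_measurable torus"
    unfolding torus_def by (intro measurable_restrict_space1) simp
  show "fst \<in> borel_measurable RT2" "(\<lambda>z. fst (snd z)) \<in> borel_measurable RT2"
    "(\<lambda>z. snd (snd z)) \<in> borel_measurable RT2"
    unfolding RT2_def by measurable
qed

lemma measurable_RZ2 [measurable]:
  "fst \<in> borel_measurable RZ2"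
  "(\<lambda>\<zeta>. fst (snd \<zeta>)) \<in> measurable RZ2 (count_space UNIV)"
  "(\<lambda>\<zeta>. snd (snd \<zeta>)) \<in> measurable RZ2 (count_space UNIV)"
  unfolding RZ2_def by measurable

text \<open>The symbol of the operator \<open>- L\<close>.\<close>

definition hyp :: "real \<times> int \<times> int \<Rightarrow> real" where
  "hyp \<zeta> = (fst \<zeta>)\<^sup>2 + (of_int (fst (snd \<zeta>)))\<^sup>2 - (of_int (snd (snd \<zeta>)))\<^sup>2"

lemma phase_eq: "phase z \<zeta> = fst z * fst \<zeta> + fst (snd z) * of_int (fst (snd \<zeta>)) + snd (snd z) * of_int (snd (snd \<zeta>))"
  by (simp add: phase_def case_prod_beta)

lemma measurable_phase [measurable (raw)]:
  assumes "f \<in> measurable M RT2" "g \<in> measurable M RZ2"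
  shows "(\<lambda>x. phase (f x) (g x)) \<in> borel_measurable M"
proof -
  have [measurable]: "(\<lambda>x. fst (f x)) \<in> borel_measurable M"
      "(\<lambda>x. fst (snd (f x))) \<in> borel_measurable M" "(\<lambda>x. snd (snd (f x))) \<in> borel_measurable M"
    using measurable_compose[OF assms(1) measurable_RT2(1)]
      measurable_compose[OF assms(1) measurable_RT2(2)] measurable_compose[OF assms(1) measurable_RT2(3)] by simp_all
  have [measurable]: "(\<lambda>x. fst (g x)) \<in> borel_measurable M"
      "(\<lambda>x. fst (snd (g x))) \<in> measurable M (count_space UNIV)" "(\<lambda>x. snd (snd (g x))) \<in> measurable M (count_space UNIV)"
    using measurable_compose[OF assms(2) measurable_RZ2(1)]
      measurable_compose[OF assms(2) measurable_RZ2(2)] measurable_compose[OF assms(2) measurable_RZ2(3)] by simp_all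
  show ?thesis unfolding phase_eq by measurable
qed

lemma measurable_phase_point [measurable]: "(\<lambda>\<zeta>. phase z \<zeta>) \<in> borel_measurable RZ2"
  unfolding phase_eq by measurable

lemma measurable_hyp [measurable]: "hyp \<in> borel_measurable RZ2"
  unfolding hyp_def by measurable

lemma phase_add: "phase z (\<zeta> + \<zeta>') = phase z \<zeta> + phase z \<zeta>'"
  by (simp add: phase_eq algebra_simps)

text \<open>When the phases are the points of the line itself, the constant of the large sieve inequality
  does not depend on the width.\<close>

lemma gaussian_kernel_mass:
  assumes e: "\<epsilon> > 0"
  shows "(\<integral>\<^sup>+x. ennreal (sqrt (2 * pi) / \<epsilon> * exp (- (x - \<tau>)\<^sup>2 / (2 * \<epsilon>\<^sup>2))) \<partial>lborel) = ennreal (2 * pi)"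
proof -
  have "(\<integral>\<^sup>+x. ennreal (sqrt (2 * pi) / \<epsilon> * exp (- (x - \<tau>)\<^sup>2 / (2 * \<epsilon>\<^sup>2))) \<partial>lborel)
     = (\<integral>\<^sup>+x. ennreal (sqrt (2 * pi) / \<epsilon> * exp (- ((\<tau> + 1 * x) - \<tau>)\<^sup>2 / (2 * \<epsilon>\<^sup>2))) \<partial>lborel)"
    by (subst nn_integral_real_affine[where c = 1 and t = \<tau>]) auto
  also have "\<dots> = (\<integral>\<^sup>+x. ennreal (sqrt (2 * pi) / \<epsilon>) * ennreal (exp (- (1 / \<epsilon> * x)\<^sup>2 / 2)) \<partial>lborel)"
    using e by (intro nn_integral_cong, subst ennreal_mult[symmetric]) (auto simp: power_divide mult.commute)
  also have "\<dots> = ennreal (sqrt (2 * pi) / \<epsilon>) * ennreal (sqrt (2 * pi) / (1 / \<epsilon>))"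
    using e by (subst nn_integral_cmult) (simp_all only: gaussian_nn_integral zero_less_divide_1_iff, auto)
  also have "\<dots> = ennreal (2 * pi)"
    using e by (subst ennreal_mult[symmetric]) auto
  finally show ?thesis .
qed

text \<open>The large sieve with weights that increase to one; Fatou's lemma removes the weight.\<close>

lemma bessel_line:
  assumes c: "integrable lborel c"
  shows "(\<integral>\<^sup>+x. ennreal ((norm (LINT \<xi>|lborel. c \<xi> * cis (x * \<xi>)))\<^sup>2) \<partial>lborel)
    \<le> ennreal (2 * pi) * (\<integral>\<^sup>+\<xi>. ennreal ((norm (c \<xi>))\<^sup>2) \<partial>lborel)"
proof -
  have [measurable]: "c \<in> borel_measurable borel" using c by simp
  define I where "I x = (LINT \<xi>|lborel. c \<xi> * cis (x * \<xi>))" for x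
  have [measurable]: "I \<in> borel_measurable borel" unfolding I_def by measurable
  define w where "w n x = exp (- (1 / real (Suc n) * x)\<^sup>2 / 2)" for n x
  have [measurable]: "w n \<in> borel_measurable borel" for n unfolding w_def by measurable
  have bound: "(\<integral>\<^sup>+x. ennreal (w n x * (norm (I x))\<^sup>2) \<partial>lborel)
      \<le> ennreal (2 * pi) * (\<integral>\<^sup>+\<xi>. ennreal ((norm (c \<xi>))\<^sup>2) \<partial>lborel)" for n
    unfolding w_def I_def
  proof (rule gaussian_large_sieve[OF sigma_finite_lborel c])
    fix \<tau> :: real
    show "(\<integral>\<^sup>+x. ennreal (sqrt (2 * pi) / (1 / real (Suc n)) * exp (- (x - \<tau>)\<^sup>2 / (2 * (1 / real (Suc n))\<^sup>2))) \<partial>lborel) \<le> ennreal (2 * pi)"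
      by (subst gaussian_kernel_mass) auto
  qed auto
  have lim: "(\<lambda>n. w n x * (norm (I x))\<^sup>2) \<longlonglongrightarrow> (norm (I x))\<^sup>2" for x
  proof -
    have "(\<lambda>n. 1 / real (Suc n)) \<longlonglongrightarrow> 0"
      using LIMSEQ_inverse_real_of_nat unfolding inverse_eq_divide .
    then have "(\<lambda>n. exp (- (1 / real (Suc n) * x)\<^sup>2 / 2) * (norm (I x))\<^sup>2) \<longlonglongrightarrow> exp (- (0 * x)\<^sup>2 / 2) * (norm (I x))\<^sup>2"
      by (rule isCont_tendsto_compose[rotated, where g = "\<lambda>u. exp (- (u * x)\<^sup>2 / 2) * (norm (I x))\<^sup>2"]) simp
    then show ?thesis by (simp add: w_def)
  qed
  have "(\<integral>\<^sup>+x. ennreal ((norm (I x))\<^sup>2) \<partial>lborel) = (\<integral>\<^sup>+x. liminf (\<lambda>n. ennreal (w n x * (norm (I x))\<^sup>2)) \<partial>lborel)"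
    by (intro nn_integral_cong lim_imp_Liminf[symmetric] tendsto_ennrealI lim) auto
  also have "\<dots> \<le> liminf (\<lambda>n. \<integral>\<^sup>+x. ennreal (w n x * (norm (I x))\<^sup>2) \<partial>lborel)"
    by (rule nn_integral_liminf) auto
  also have "\<dots> \<le> ennreal (2 * pi) * (\<integral>\<^sup>+\<xi>. ennreal ((norm (c \<xi>))\<^sup>2) \<partial>lborel)"
    by (rule Liminf_le) (auto simp: bound)
  finally show ?thesis unfolding I_def .
qed

lemma measurable_torus_id: "(\<lambda>x. x) \<in> borel_measurable torus"
  unfolding torus_def by (intro measurable_restrict_space1) simp

lemma finite_torus: "emeasure torus (space torus) < \<infinity>"
  by (simp add: torus_def emeasure_restrict_space space_restrict_space)

lemma integral_torus_character:
  "integrable torus (\<lambda>y. cis (of_int n * y))"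
  "(LINT y|torus. cis (of_int n * y)) = (if n = 0 then 2 * pi else 0)"
proof -
  show "integrable torus (\<lambda>y. cis (of_int n * y))"
    using finite_torus measurable_torus_id by (intro integrableI_bounded) auto
  show "(LINT y|torus. cis (of_int n * y)) = (if n = 0 then 2 * pi else 0)"
  proof -
    have "(LINT y|torus. cis (of_int n * y)) = (LINT y|lborel. indicator {0..<2*pi} y *\<^sub>R cis (of_int n * y))"
      unfolding torus_def by (subst integral_restrict_space) auto
    also have "\<dots> = (LINT y|lborel. indicator {0..2*pi} y *\<^sub>R cis (of_int n * y))"
    proof (rule integral_cong_AE)
      have "AE y in lborel. y \<noteq> 2 * pi" by (rule AE_lborel_singleton)
      then show "AE y in lborel. indicator {0..<2*pi} y *\<^sub>R cis (of_int n * y) = indicator {0..2*pi} y *\<^sub>R cis (of_int n * y)"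
        by eventually_elim (auto simp: indicator_def)
    qed auto
    also have "\<dots> = (if n = 0 then 2 * pi else 0)"
    proof (cases "n = 0")
      case True
      then show ?thesis by (simp add: scaleR_conv_of_real)
    next
      case False
      define \<Phi> where "\<Phi> y = cis (of_int n * y) / (\<i> * of_int n)" for y :: real
      have "(LINT y|lborel. indicator {0..2*pi} y *\<^sub>R cis (of_int n * y)) = \<Phi> (2 * pi) - \<Phi> 0"
      proof (rule integral_FTC_Icc)
        show "0 \<le> 2 * pi" by simp
        show "(\<Phi> has_vector_derivative cis (of_int n * y)) (at y within {0..2 * pi})" for y
        proof -
          have "((\<lambda>z. exp (\<i> * (of_int n * z)) / (\<i> * of_int n)) has_field_derivative
              exp (\<i> * (of_int n * of_real y))) (at (complex_of_real y))"
            using False by (auto intro!: derivative_eq_intros simp: mult_ac)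
          from has_vector_derivative_real_field[OF this] show ?thesis
            unfolding \<Phi>_def cis_conv_exp by simp
        qed
        show "continuous_on {0..2 * pi} (\<lambda>y. cis (of_int n * y))"
          unfolding cis_conv_exp by (intro continuous_intros)
      qed
      also have "\<dots> = 0"
        unfolding \<Phi>_def using cis_multiple_2pi[of "of_int n"] by (simp add: mult_ac)
      finally show ?thesis using False by simp
    qed
    finally show ?thesis .
  qed
qed

abbreviation (input) character :: "int \<times> int \<Rightarrow> real \<times> real \<Rightarrow> complex" where
  "character k y \<equiv> cis (fst y * of_int (fst k) + snd y * of_int (snd k))"

lemma character_orthogonality:
  shows "integrable (torus \<Otimes>\<^sub>M torus) (\<lambda>y. character k y * cnj (character l y))"
    and "(LINT y|(torus \<Otimes>\<^sub>M torus). character k y * cnj (character l y)) = (if k = l then (2 * pi)\<^sup>2 else 0)"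
proof -
  interpret P: pair_sigma_finite torus torus
    by (intro pair_sigma_finite.intro sigma_finite_torus)
  have eq: "character k y * cnj (character l y)
      = cis (of_int (fst k - fst l) * fst y) * cis (of_int (snd k - snd l) * snd y)" for y
    by (simp add: cis_cnj cis_mult algebra_simps)
  show "integrable (torus \<Otimes>\<^sub>M torus) (\<lambda>y. character k y * cnj (character l y))"
    unfolding eq using P.integrable_product[OF integral_torus_character(1) integral_torus_character(1)]
    by (simp only: case_prod_beta')
  show "(LINT y|(torus \<Otimes>\<^sub>M torus). character k y * cnj (character l y)) = (if k = l then (2 * pi)\<^sup>2 else 0)"
    unfolding eq P.integral_product[OF integral_torus_character(1) integral_torus_character(1)]
      integral_torus_character(2)
    by (auto simp: prod_eq_iff power2_eq_square)
qed

lemma torus_parseval: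
  assumes "finite K"
  shows "(\<integral>\<^sup>+y. ennreal ((norm (\<Sum>k\<in>K. c k * character k y))\<^sup>2) \<partial>(torus \<Otimes>\<^sub>M torus))
       = ennreal ((2 * pi)\<^sup>2 * (\<Sum>k\<in>K. (norm (c k))\<^sup>2))"
proof -
  have eq: "complex_of_real ((norm (\<Sum>k\<in>K. c k * character k y))\<^sup>2)
      = (\<Sum>k\<in>K. \<Sum>l\<in>K. c k * cnj (c l) * (character k y * cnj (character l y)))" for y
    unfolding complex_norm_square by (simp add: sum_product mult_ac)
  have int: "integrable (torus \<Otimes>\<^sub>M torus) (\<lambda>y. complex_of_real ((norm (\<Sum>k\<in>K. c k * character k y))\<^sup>2))"
    unfolding eq by (intro Bochner_Integration.integrable_sum integrable_mult_right character_orthogonality)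
  have "complex_of_real (LINT y|(torus \<Otimes>\<^sub>M torus). (norm (\<Sum>k\<in>K. c k * character k y))\<^sup>2)
      = (LINT y|(torus \<Otimes>\<^sub>M torus). (\<Sum>k\<in>K. \<Sum>l\<in>K. c k * cnj (c l) * (character k y * cnj (character l y))))"
    by (simp only: eq integral_complex_of_real[symmetric])
  also have "\<dots> = (\<Sum>k\<in>K. \<Sum>l\<in>K. c k * cnj (c l) * (if k = l then (2 * pi)\<^sup>2 else 0))"
    by (subst Bochner_Integration.integral_sum,
        intro Bochner_Integration.integrable_sum integrable_mult_right character_orthogonality,
        intro sum.cong refl, subst Bochner_Integration.integral_sum,
        intro integrable_mult_right character_orthogonality, intro sum.cong refl,
        subst integral_mult_right_zero, simp only: character_orthogonality)
  also have "\<dots> = (\<Sum>k\<in>K. c k * cnj (c k) * (2 * pi)\<^sup>2)"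
    using assms by (intro sum.cong refl) (simp add: if_distrib sum.delta cong: if_cong)
  also have "\<dots> = complex_of_real ((2 * pi)\<^sup>2 * (\<Sum>k\<in>K. (norm (c k))\<^sup>2))"
    unfolding of_real_mult of_real_sum complex_norm_square sum_distrib_left
    by (simp add: mult_ac)
  finally have "(LINT y|(torus \<Otimes>\<^sub>M torus). (norm (\<Sum>k\<in>K. c k * character k y))\<^sup>2)
      = (2 * pi)\<^sup>2 * (\<Sum>k\<in>K. (norm (c k))\<^sup>2)"
    by (simp only: of_real_eq_iff)
  moreover have "integrable (torus \<Otimes>\<^sub>M torus) (\<lambda>y. (norm (\<Sum>k\<in>K. c k * character k y))\<^sup>2)"
    using int by (simp only: complex_of_real_integrable_eq)
  ultimately show ?thesis
    by (subst nn_integral_eq_integral) auto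
qed

lemma phase_split: "cis (phase (x, y) (\<xi>, k)) = cis (x * \<xi>) * character k y"
  by (simp add: phase_eq cis_mult add.assoc)

text \<open>For fixed \<open>x\<close> this is Parseval's identity in the torus variables; the coefficients are integrals over
  the line, to which the inequality on the line applies.\<close>

lemma bessel_synthesis:
  assumes F: "integrable RZ2 F" and K: "finite K" and supp: "\<And>\<xi> k. k \<notin> K \<Longrightarrow> F (\<xi>, k) = 0"
  shows "(\<integral>\<^sup>+z. ennreal ((norm (LINT \<zeta>|RZ2. F \<zeta> * cis (phase z \<zeta>)))\<^sup>2) \<partial>RT2)
     \<le> ennreal ((2 * pi) ^ 3) * (\<integral>\<^sup>+\<zeta>. ennreal ((norm (F \<zeta>))\<^sup>2) \<partial>RZ2)"
proof -
  interpret P: pair_sigma_finite lborel Z2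
    by (intro pair_sigma_finite.intro sigma_finite_lborel sigma_finite_Z2)
  interpret Q: pair_sigma_finite lborel "torus \<Otimes>\<^sub>M torus"
    by (intro pair_sigma_finite.intro sigma_finite_lborel sigma_finite_pair_measure sigma_finite_torus)
  have [measurable]: "F \<in> borel_measurable RZ2" using F by auto
  have Fk: "integrable lborel (\<lambda>\<xi>. F (\<xi>, k))" for k
    using P.AE_integrable_snd[of "\<lambda>\<xi> k. F (\<xi>, k)"] F
    by (cases k) (auto simp: RZ2_eq AE_count_space)
  have [measurable]: "(\<lambda>\<xi>. F (\<xi>, k)) \<in> borel_measurable borel" for k using Fk[of k] by simp
  define c where "c x k = (LINT \<xi>|lborel. F (\<xi>, k) * cis (x * \<xi>))" for x k
  have [measurable]: "(\<lambda>x. c x k) \<in> borel_measurable borel" for k unfolding c_def by measurable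
  have c0: "k \<notin> K \<Longrightarrow> c x k = 0" for x k
    by (simp add: c_def supp)
  have expand: "(LINT \<zeta>|RZ2. F \<zeta> * cis (phase (x, y) \<zeta>)) = (\<Sum>k\<in>K. c x k * character k y)" for x y
  proof -
    have int: "integrable RZ2 (\<lambda>\<zeta>. F \<zeta> * cis (phase (x, y) \<zeta>))"
      by (rule Bochner_Integration.integrable_bound[OF F]) (auto simp: norm_mult)
    have "(LINT \<zeta>|RZ2. F \<zeta> * cis (phase (x, y) \<zeta>)) = (LINT k|Z2. LINT \<xi>|lborel. F (\<xi>, k) * cis (phase (x, y) (\<xi>, k)))"
      using P.integral_snd[of "\<lambda>\<xi> k. F (\<xi>, k) * cis (phase (x, y) (\<xi>, k))"] int
      by (simp add: RZ2_eq case_prod_beta')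
    also have "\<dots> = (LINT k|Z2. c x k * character k y)"
      by (simp only: phase_split mult.assoc[symmetric] integral_mult_left_zero c_def)
    also have "\<dots> = (\<Sum>k | c x k * character k y \<noteq> 0. c x k * character k y)"
    proof (subst lebesgue_integral_count_space_finite_support)
      have "{k \<in> UNIV. c x k * character k y \<noteq> 0} \<subseteq> K" using c0 by auto
      then show "finite {k \<in> UNIV. c x k * character k y \<noteq> 0}" using K finite_subset by blast
    qed simp
    also have "\<dots> = (\<Sum>k\<in>K. c x k * character k y)"
      using K c0 by (intro sum.mono_neutral_left) auto
    finally show ?thesis .
  qed
  have meas: "(\<lambda>z. ennreal ((norm (LINT \<zeta>|RZ2. F \<zeta> * cis (phase z \<zeta>)))\<^sup>2)) \<in> borel_measurable RT2"
  proof -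
    interpret R: sigma_finite_measure RZ2 by (rule sigma_finite_RZ2)
    show ?thesis by measurable
  qed
  have "(\<integral>\<^sup>+z. ennreal ((norm (LINT \<zeta>|RZ2. F \<zeta> * cis (phase z \<zeta>)))\<^sup>2) \<partial>RT2)
     = (\<integral>\<^sup>+x. \<integral>\<^sup>+y. ennreal ((norm (LINT \<zeta>|RZ2. F \<zeta> * cis (phase (x, y) \<zeta>)))\<^sup>2) \<partial>(torus \<Otimes>\<^sub>M torus) \<partial>lborel)"
    using meas unfolding RT2_def by (subst Q.M2.nn_integral_fst) auto
  also have "\<dots> = (\<integral>\<^sup>+x. ennreal ((2 * pi)\<^sup>2 * (\<Sum>k\<in>K. (norm (c x k))\<^sup>2)) \<partial>lborel)"
    by (simp only: expand torus_parseval[OF K])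
  also have "\<dots> = (\<integral>\<^sup>+x. (\<Sum>k\<in>K. ennreal ((2 * pi)\<^sup>2) * ennreal ((norm (c x k))\<^sup>2)) \<partial>lborel)"
    by (intro nn_integral_cong) (simp add: sum_distrib_left ennreal_mult flip: sum_ennreal)
  also have "\<dots> = (\<Sum>k\<in>K. ennreal ((2 * pi)\<^sup>2) * (\<integral>\<^sup>+x. ennreal ((norm (c x k))\<^sup>2) \<partial>lborel))"
    by (simp add: nn_integral_sum nn_integral_cmult)
  also have "\<dots> \<le> (\<Sum>k\<in>K. ennreal ((2 * pi)\<^sup>2) * (ennreal (2 * pi) * (\<integral>\<^sup>+\<xi>. ennreal ((norm (F (\<xi>, k)))\<^sup>2) \<partial>lborel)))"
    unfolding c_def by (intro sum_mono mult_left_mono bessel_line Fk) auto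
  also have "\<dots> = ennreal ((2 * pi) ^ 3) * (\<Sum>k\<in>K. (\<integral>\<^sup>+\<xi>. ennreal ((norm (F (\<xi>, k)))\<^sup>2) \<partial>lborel))"
    by (simp only: sum_distrib_left mult.assoc[symmetric] ennreal_mult[symmetric] zero_le_power2
          pi_ge_zero zero_le_mult_iff zero_le_numeral simp_thms power3_eq_cube power2_eq_square)
  also have "(\<Sum>k\<in>K. (\<integral>\<^sup>+\<xi>. ennreal ((norm (F (\<xi>, k)))\<^sup>2) \<partial>lborel)) = (\<integral>\<^sup>+k. (\<integral>\<^sup>+\<xi>. ennreal ((norm (F (\<xi>, k)))\<^sup>2) \<partial>lborel) \<partial>Z2)"
    using K supp by (subst nn_integral_count_space'[of K]) auto
  also have "\<dots> = (\<integral>\<^sup>+\<zeta>. ennreal ((norm (F \<zeta>))\<^sup>2) \<partial>RZ2)"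
    using P.nn_integral_snd[of "\<lambda>\<zeta>. ennreal ((norm (F \<zeta>))\<^sup>2)"] unfolding RZ2_eq[symmetric]
    by simp
  finally show ?thesis .
qed

definition freq_box :: "real \<Rightarrow> (real \<times> int \<times> int) set" where
  "freq_box M = {-M..M} \<times> ({-\<lfloor>M\<rfloor>..\<lfloor>M\<rfloor>} \<times> {-\<lfloor>M\<rfloor>..\<lfloor>M\<rfloor>})"

lemma mem_freq_box: "\<zeta> \<in> freq_box M \<longleftrightarrow> \<bar>fst \<zeta>\<bar> \<le> M \<and> \<bar>of_int (fst (snd \<zeta>))\<bar> \<le> M \<and> \<bar>of_int (snd (snd \<zeta>))\<bar> \<le> M"
proof -
  have "\<bar>real_of_int k\<bar> \<le> M \<longleftrightarrow> - \<lfloor>M\<rfloor> \<le> k \<and> k \<le> \<lfloor>M\<rfloor>" for k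
    by (auto simp: abs_le_iff le_floor_iff minus_le_iff[of _ k])
  then show ?thesis by (cases \<zeta>) (auto simp: freq_box_def abs_le_iff)
qed

lemma sets_freq_box [measurable]: "freq_box M \<in> sets RZ2"
  unfolding freq_box_def RZ2_eq by (intro pair_measureI) auto

lemma emeasure_freq_box: 
  assumes "M \<ge> 0"
  shows "emeasure RZ2 (freq_box M) = ennreal (2 * M * (2 * of_int \<lfloor>M\<rfloor> + 1)\<^sup>2)"
proof -
  interpret Z: sigma_finite_measure Z2 by (rule sigma_finite_Z2)
  have "emeasure RZ2 (freq_box M) = emeasure lborel {-M..M} * emeasure Z2 ({-\<lfloor>M\<rfloor>..\<lfloor>M\<rfloor>} \<times> {-\<lfloor>M\<rfloor>..\<lfloor>M\<rfloor>})"
    unfolding freq_box_def RZ2_eq by (rule Z.emeasure_pair_measure_Times) auto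
  also have "emeasure lborel {-M..M} = ennreal (2 * M)" using assms by simp
  also have "emeasure Z2 ({-\<lfloor>M\<rfloor>..\<lfloor>M\<rfloor>} \<times> {-\<lfloor>M\<rfloor>..\<lfloor>M\<rfloor>}) = ennreal ((2 * of_int \<lfloor>M\<rfloor> + 1)\<^sup>2)"
    using assms by (subst emeasure_count_space_finite)
      (auto simp: card_cartesian_product power2_eq_square ennreal_of_nat_eq_real_of_nat)
  finally show ?thesis using assms by (simp add: ennreal_mult)
qed

lemma integrable_on_freq_box:
  assumes [measurable]: "F \<in> borel_measurable RZ2" and "\<And>\<zeta>. \<zeta> \<notin> freq_box M \<Longrightarrow> F \<zeta> = (0::complex)"
    and "\<And>\<zeta>. norm (F \<zeta>) \<le> B" and "M \<ge> 0"
  shows "integrable RZ2 F"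
proof (rule Bochner_Integration.integrable_bound[where f = "\<lambda>\<zeta>. B * indicator (freq_box M) \<zeta>"])
  show "integrable RZ2 (\<lambda>\<zeta>. B * indicator (freq_box M) \<zeta>)"
    using emeasure_freq_box[OF assms(4)] by (intro integrable_mult_right integrable_real_indicator) auto
  show "AE \<zeta> in RZ2. norm (F \<zeta>) \<le> norm (B * indicator (freq_box M) \<zeta>)"
    using assms(2) order.trans[OF assms(3) abs_ge_self] by (intro AE_I2) (auto simp: indicator_def)
qed measurable

text \<open>Dual to the inequality for the synthesis of functions: synthesising the transform of \<open>g\<close>, cut to a
  box, and pairing the result with \<open>g\<close> gives back the energy of the cut transform.  By
  the Cauchy--Schwarz inequality that energy \<open>X\<close> satisfies \<open>X * X \<le> X * G\<close>, uniformly in the box.\<close>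

lemma bessel_analysis:
  assumes g: "integrable RT2 g"
  shows "(\<integral>\<^sup>+\<zeta>. ennreal ((norm (LINT z|RT2. g z * cis (- phase z \<zeta>)))\<^sup>2) \<partial>RZ2)
     \<le> ennreal ((2 * pi) ^ 3) * (\<integral>\<^sup>+z. ennreal ((norm (g z))\<^sup>2) \<partial>RT2)"
proof -
  interpret P: pair_sigma_finite RZ2 RT2
    by (intro pair_sigma_finite.intro sigma_finite_RZ2 sigma_finite_RT2)
  have [measurable]: "g \<in> borel_measurable RT2" using g by auto
  define h where "h \<zeta> = (LINT z|RT2. g z * cis (- phase z \<zeta>))" for \<zeta>
  have [measurable]: "h \<in> borel_measurable RZ2" unfolding h_def by measurable
  have hb: "norm (h \<zeta>) \<le> (LINT z|RT2. norm (g z))" for \<zeta>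
    unfolding h_def by (rule order.trans[OF integral_norm_bound]) (simp add: norm_mult)
  define G where "G = ennreal ((2 * pi) ^ 3) * (\<integral>\<^sup>+z. ennreal ((norm (g z))\<^sup>2) \<partial>RT2)"
  define H where "H n \<zeta> = indicator (freq_box (real n)) \<zeta> * h \<zeta>" for n :: nat and \<zeta>
  have [measurable]: "H n \<in> borel_measurable RZ2" for n unfolding H_def by measurable
  have Hb: "norm (H n \<zeta>) \<le> (LINT z|RT2. norm (g z))" for n \<zeta>
    using hb[of \<zeta>] unfolding H_def by (auto simp: indicator_def norm_mult)
  have Hint: "integrable RZ2 (H n)" for n
    by (rule integrable_on_freq_box[of _ "real n", OF _ _ Hb]) (auto simp: H_def)
  have bound: "(\<integral>\<^sup>+\<zeta>. ennreal ((norm (H n \<zeta>))\<^sup>2) \<partial>RZ2) \<le> G" for n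
  proof -
    let ?E = "\<lambda>z. LINT \<zeta>|RZ2. H n \<zeta> * cis (phase z \<zeta>)"
    have [measurable]: "?E \<in> borel_measurable RT2" by measurable
    define X where "X = (\<integral>\<^sup>+\<zeta>. ennreal ((norm (H n \<zeta>))\<^sup>2) \<partial>RZ2)"
    have Hsq: "integrable RZ2 (\<lambda>\<zeta>. (norm (H n \<zeta>))\<^sup>2)"
    proof (rule Bochner_Integration.integrable_bound[where f = "\<lambda>\<zeta>. (LINT z|RT2. norm (g z)) * norm (H n \<zeta>)"])
      show "integrable RZ2 (\<lambda>\<zeta>. (LINT z|RT2. norm (g z)) * norm (H n \<zeta>))" using Hint[of n] by simp
      show "AE \<zeta> in RZ2. norm ((norm (H n \<zeta>))\<^sup>2) \<le> norm ((LINT z|RT2. norm (g z)) * norm (H n \<zeta>))"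
        using Hb[of n] by (intro AE_I2) (auto simp: power2_eq_square abs_mult intro!: mult_right_mono order.trans[OF _ abs_ge_self])
    qed measurable
    have X_eq: "X = ennreal (LINT \<zeta>|RZ2. (norm (H n \<zeta>))\<^sup>2)"
      unfolding X_def using Hsq by (intro nn_integral_eq_integral) auto
    have "(LINT z|RT2. ?E z * cnj (g z)) = (LINT \<zeta>|RZ2. H n \<zeta> * cnj (LINT z|RT2. g z * cnj (cis (phase z \<zeta>))))"
      by (rule P.adjoint_kernel_operator[OF Hint g, of "\<lambda>\<zeta> z. cis (phase z \<zeta>)"]) auto
    also have "\<dots> = (LINT \<zeta>|RZ2. complex_of_real ((norm (H n \<zeta>))\<^sup>2))"
      unfolding cis_cnj h_def[symmetric]
      by (intro Bochner_Integration.integral_cong refl) (auto simp: H_def indicator_def complex_norm_square simp del: of_real_power)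
    also have "\<dots> = complex_of_real (LINT \<zeta>|RZ2. (norm (H n \<zeta>))\<^sup>2)" by (rule integral_complex_of_real)
    finally have eq: "norm (LINT z|RT2. ?E z * cnj (g z)) = (LINT \<zeta>|RZ2. (norm (H n \<zeta>))\<^sup>2)" by simp
    have "X * X = ennreal ((norm (LINT z|RT2. ?E z * cnj (g z)))\<^sup>2)"
      unfolding eq X_eq by (simp add: power2_eq_square ennreal_mult)
    also have "\<dots> \<le> (\<integral>\<^sup>+z. ennreal ((norm (?E z))\<^sup>2) \<partial>RT2) * (\<integral>\<^sup>+z. ennreal ((norm (cnj (g z)))\<^sup>2) \<partial>RT2)"
      by (rule cauchy_schwarz_integral) auto
    also have "\<dots> \<le> (ennreal ((2 * pi) ^ 3) * X) * (\<integral>\<^sup>+z. ennreal ((norm (g z))\<^sup>2) \<partial>RT2)"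
      unfolding X_def using Hint[of n]
    proof (intro mult_mono)
      show "(\<integral>\<^sup>+z. ennreal ((norm (?E z))\<^sup>2) \<partial>RT2) \<le> ennreal ((2 * pi) ^ 3) * (\<integral>\<^sup>+\<zeta>. ennreal ((norm (H n \<zeta>))\<^sup>2) \<partial>RZ2)"
        by (rule bessel_synthesis[OF Hint, of "{-int n..int n} \<times> {-int n..int n}"]) (auto simp: H_def freq_box_def)
    qed auto
    finally have "X * X \<le> X * G" by (simp add: G_def mult_ac)
    then show ?thesis
      using ennreal_mult_le_mult_iff[of X X G] X_eq unfolding X_def[symmetric] by (cases "X = 0") auto
  qed
  have lim: "(\<lambda>n. (norm (H n \<zeta>))\<^sup>2) \<longlonglongrightarrow> (norm (h \<zeta>))\<^sup>2" for \<zeta>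
  proof (rule tendsto_eventually)
    obtain m :: nat where m: "\<bar>fst \<zeta>\<bar> \<le> real m" "\<bar>real_of_int (fst (snd \<zeta>))\<bar> \<le> real m" "\<bar>real_of_int (snd (snd \<zeta>))\<bar> \<le> real m"
      using real_arch_simple[of "max \<bar>fst \<zeta>\<bar> (max \<bar>real_of_int (fst (snd \<zeta>))\<bar> \<bar>real_of_int (snd (snd \<zeta>))\<bar>)"] by auto
    show "\<forall>\<^sub>F n in sequentially. (norm (H n \<zeta>))\<^sup>2 = (norm (h \<zeta>))\<^sup>2"
      using eventually_ge_at_top[of m]
      by eventually_elim (use m in \<open>auto simp: H_def mem_freq_box indicator_def\<close>)
  qed
  have "(\<integral>\<^sup>+\<zeta>. ennreal ((norm (h \<zeta>))\<^sup>2) \<partial>RZ2) = (\<integral>\<^sup>+\<zeta>. liminf (\<lambda>n. ennreal ((norm (H n \<zeta>))\<^sup>2)) \<partial>RZ2)"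
    by (intro nn_integral_cong lim_imp_Liminf[symmetric] tendsto_ennrealI lim) auto
  also have "\<dots> \<le> liminf (\<lambda>n. \<integral>\<^sup>+\<zeta>. ennreal ((norm (H n \<zeta>))\<^sup>2) \<partial>RZ2)"
    by (rule nn_integral_liminf) auto
  also have "\<dots> \<le> G"
    by (rule Liminf_le) (auto simp: bound)
  finally show ?thesis unfolding h_def G_def .
qed

section \<open>Completeness of the space of square-integrable functions\<close>

definition energy :: "'a measure \<Rightarrow> ('a \<Rightarrow> complex) \<Rightarrow> ennreal" where
  "energy M f = (\<integral>\<^sup>+x. ennreal ((norm (f x))\<^sup>2) \<partial>M)"

lemma Lp_norm_le_iff:
  assumes p: "p > 0" and c: "c \<ge> 0"
  shows "Lp_norm p M f \<le> ennreal c \<longleftrightarrow> (\<integral>\<^sup>+z. ennreal (norm (f z) powr p) \<partial>M) \<le> ennreal (c powr p)"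
proof -
  define I where "I = (\<integral>\<^sup>+z. ennreal (norm (f z) powr p) \<partial>M)"
  show ?thesis
  proof (cases I rule: ennreal_cases)
    case (real r)
    have "r powr (1 / p) \<le> c \<longleftrightarrow> r \<le> c powr p"
    proof
      assume "r powr (1 / p) \<le> c"
      then have "(r powr (1 / p)) powr p \<le> c powr p" using p by (intro powr_mono2) auto
      then show "r \<le> c powr p" using p real by (simp add: powr_powr)
    next
      assume "r \<le> c powr p"
      then have "r powr (1 / p) \<le> (c powr p) powr (1 / p)" using p real by (intro powr_mono2) auto
      then show "r powr (1 / p) \<le> c" using p c by (simp add: powr_powr)
    qed
    then show ?thesis unfolding Lp_norm_def Let_def I_def[symmetric] using real c by simp
  next
    case top
    then show ?thesis unfolding Lp_norm_def Let_def I_def[symmetric] by (simp add: top_unique)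
  qed
qed

lemma norm_powr_two [simp]: "norm (z::complex) powr 2 = (norm z)\<^sup>2"
  by (cases "z = 0") (auto simp: powr_numeral)

lemma Lp_norm_2_le_iff: "c \<ge> 0 \<Longrightarrow> Lp_norm 2 M f \<le> ennreal c \<longleftrightarrow> energy M f \<le> ennreal (c\<^sup>2)"
  using Lp_norm_le_iff[of 2 c M f] by (cases "c = 0") (simp_all add: energy_def powr_numeral)

lemma Lp_norm_2_finite_iff: "Lp_norm 2 M f < \<infinity> \<longleftrightarrow> energy M f < \<infinity>"
  unfolding Lp_norm_def energy_def Let_def by (auto simp: less_top)

lemma Lp_space_2_iff: "f \<in> Lp_space 2 M \<longleftrightarrow> f \<in> borel_measurable M \<and> energy M f < \<infinity>"
  unfolding Lp_space_def mem_Collect_eq Lp_norm_2_finite_iff ..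

lemma tendsto_0_ennreal_iff:
  fixes f :: "'a \<Rightarrow> ennreal"
  shows "(f \<longlongrightarrow> 0) F \<longleftrightarrow> (\<forall>c>0. \<forall>\<^sub>F x in F. f x \<le> ennreal c)"
proof safe
  fix c :: real assume "(f \<longlongrightarrow> 0) F" "c > 0"
  then have "\<forall>\<^sub>F x in F. f x < ennreal c" by (intro order_tendstoD(2)[where y = 0]) auto
  then show "\<forall>\<^sub>F x in F. f x \<le> ennreal c" by eventually_elim simp
next
  assume *: "\<forall>c>0. \<forall>\<^sub>F x in F. f x \<le> ennreal c"
  show "(f \<longlongrightarrow> 0) F"
  proof (rule order_tendstoI)
    fix a :: ennreal assume "0 < a"
    then obtain b where b: "0 < b" "b < a" using dense by blast
    then obtain c where c: "0 < ennreal c" "ennreal c < a"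
      by (cases b rule: ennreal_cases) auto
    then have "c > 0" by simp
    with * have "\<forall>\<^sub>F x in F. f x \<le> ennreal c" by blast
    then show "\<forall>\<^sub>F x in F. f x < a" by eventually_elim (use c in auto)
  qed auto
qed

lemma tendsto_Lp_norm_2_iff: "((\<lambda>n. Lp_norm 2 M (f n)) \<longlongrightarrow> 0) F \<longleftrightarrow> ((\<lambda>n. energy M (f n)) \<longlongrightarrow> 0) F"
  unfolding tendsto_0_ennreal_iff
proof safe
  fix c :: real
  assume *: "\<forall>c>0. \<forall>\<^sub>F x in F. Lp_norm 2 M (f x) \<le> ennreal c" and "c > 0"
  then show "\<forall>\<^sub>F x in F. energy M (f x) \<le> ennreal c"
    using *[rule_format, of "sqrt c"] by (simp add: Lp_norm_2_le_iff)
next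
  fix c :: real
  assume *: "\<forall>c>0. \<forall>\<^sub>F x in F. energy M (f x) \<le> ennreal c" and "c > 0"
  then show "\<forall>\<^sub>F x in F. Lp_norm 2 M (f x) \<le> ennreal c"
    using *[rule_format, of "c\<^sup>2"] by (simp add: Lp_norm_2_le_iff)
qed

lemma norm_sq_le_weighted:
  fixes a b :: complex
  assumes "\<delta> > 0"
  shows "(norm a)\<^sup>2 \<le> (1 + \<delta>) * (norm b)\<^sup>2 + (1 + 1 / \<delta>) * (norm (a - b))\<^sup>2"
proof -
  define u v where "u = norm b" and "v = norm (a - b)"
  have "norm a \<le> u + v" unfolding u_def v_def using norm_triangle_ineq[of b "a - b"] by simp
  then have "(norm a)\<^sup>2 \<le> (u + v)\<^sup>2" by (intro power_mono) auto
  also have "(u + v)\<^sup>2 \<le> (1 + \<delta>) * u\<^sup>2 + (1 + 1 / \<delta>) * v\<^sup>2"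
  proof -
    have "0 \<le> (\<delta> * u - v)\<^sup>2 / \<delta>" using assms by simp
    also have "\<dots> = \<delta> * u\<^sup>2 - 2 * u * v + v\<^sup>2 / \<delta>" using assms by (simp add: power2_eq_square field_simps)
    finally show ?thesis by (simp add: power2_eq_square algebra_simps)
  qed
  finally show ?thesis unfolding u_def v_def .
qed

text \<open>The factor in front of the energy of \<open>g\<close> can be taken as close to one as desired, which preserves
  sharp bounds in the limit.\<close>

lemma energy_le_weighted:
  assumes [measurable]: "f \<in> borel_measurable M" "g \<in> borel_measurable M" and "\<delta> > 0"
  shows "energy M f \<le> ennreal (1 + \<delta>) * energy M g + ennreal (1 + 1 / \<delta>) * energy M (\<lambda>x. f x - g x)"
proof -
  have "energy M f \<le> (\<integral>\<^sup>+x. ennreal (1 + \<delta>) * ennreal ((norm (g x))\<^sup>2) + ennreal (1 + 1 / \<delta>) * ennreal ((norm (f x - g x))\<^sup>2) \<partial>M)"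
    unfolding energy_def
  proof (intro nn_integral_mono)
    fix x
    show "ennreal ((norm (f x))\<^sup>2) \<le> ennreal (1 + \<delta>) * ennreal ((norm (g x))\<^sup>2) + ennreal (1 + 1 / \<delta>) * ennreal ((norm (f x - g x))\<^sup>2)"
      using ennreal_le_add[OF norm_sq_le_weighted[OF assms(3), of "f x" "g x"]] assms(3)
      by (simp add: ennreal_mult)
  qed
  also have "\<dots> = ennreal (1 + \<delta>) * energy M g + ennreal (1 + 1 / \<delta>) * energy M (\<lambda>x. f x - g x)"
    unfolding energy_def by (simp add: nn_integral_add nn_integral_cmult)
  finally show ?thesis .
qed

text \<open>Along a subsequence whose increments have energy at most \<open>(1/4) ^ j\<close> the increments are
  summable almost everywhere, because their energies remain summable after multiplication by
  \<open>2 ^ j\<close>.  Fatou's lemma then identifies the limit.\<close>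

lemma L2_complete:
  fixes h :: "nat \<Rightarrow> 'a \<Rightarrow> complex" and e :: "nat \<Rightarrow> ennreal"
  assumes [measurable]: "\<And>n. h n \<in> borel_measurable M"
    and cauchy: "\<And>n m. n \<le> m \<Longrightarrow> energy M (\<lambda>x. h m x - h n x) \<le> e n" and e: "e \<longlonglongrightarrow> 0"
  obtains F where "F \<in> borel_measurable M" "\<And>n. energy M (\<lambda>x. F x - h n x) \<le> e n"
proof -
  have "\<exists>N. \<forall>m\<ge>N. e m \<le> ennreal ((1/4) ^ j)" for j
    using e unfolding tendsto_0_ennreal_iff eventually_sequentially by simp
  then obtain N where N: "\<And>j m. m \<ge> N j \<Longrightarrow> e m \<le> ennreal ((1/4) ^ j)" by metis
  define r where "r j = (\<Sum>i\<le>j. Suc (N i))" for j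
  have r_mono: "strict_mono r" unfolding strict_mono_Suc_iff r_def by simp
  have r_ge: "r j \<ge> N j" for j
    unfolding r_def using member_le_sum[of j "{..j}" "\<lambda>i. Suc (N i)"] by simp
  define d where "d j x = h (r (Suc j)) x - h (r j) x" for j x
  have [measurable]: "d j \<in> borel_measurable M" for j unfolding d_def by measurable
  have d_energy: "energy M (d j) \<le> ennreal ((1/4) ^ j)" for j
    unfolding d_def using cauchy[of "r j" "r (Suc j)"] N[OF r_ge[of j]] strict_monoD[OF r_mono, of j "Suc j"]
    by (meson lessI less_imp_le order.trans)
  have "(\<integral>\<^sup>+x. (\<Sum>j. ennreal (2 ^ j) * ennreal ((norm (d j x))\<^sup>2)) \<partial>M)
      = (\<Sum>j. ennreal (2 ^ j) * energy M (d j))"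
    unfolding energy_def by (subst nn_integral_suminf) (auto simp: nn_integral_cmult)
  also have "\<dots> \<le> (\<Sum>j. ennreal ((1/2) ^ j))"
  proof (intro suminf_le)
    fix j
    have "ennreal (2 ^ j) * energy M (d j) \<le> ennreal (2 ^ j) * ennreal ((1/4) ^ j)"
      by (intro mult_left_mono d_energy) auto
    also have "\<dots> = ennreal ((1/2) ^ j)"
      by (subst ennreal_mult[symmetric]) (auto simp: power_mult_distrib[symmetric])
    finally show "ennreal (2 ^ j) * energy M (d j) \<le> ennreal ((1/2) ^ j)" .
  qed auto
  also have "\<dots> = ennreal (\<Sum>j. (1/2) ^ j)" by (rule suminf_ennreal2) (auto intro: summable_geometric)
  also have "\<dots> < \<infinity>" by simp
  finally have "AE x in M. (\<Sum>j. ennreal (2 ^ j) * ennreal ((norm (d j x))\<^sup>2)) \<noteq> \<infinity>"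
    by (intro nn_integral_PInf_AE) auto
  then have conv: "AE x in M. convergent (\<lambda>j. h (r j) x)"
  proof eventually_elim
    fix x assume "(\<Sum>j. ennreal (2 ^ j) * ennreal ((norm (d j x))\<^sup>2)) \<noteq> \<infinity>"
    then obtain C where C: "(\<Sum>j. ennreal (2 ^ j) * ennreal ((norm (d j x))\<^sup>2)) = ennreal C" "C \<ge> 0"
      by (cases "(\<Sum>j. ennreal (2 ^ j) * ennreal ((norm (d j x))\<^sup>2))" rule: ennreal_cases) auto
    have bound: "norm (d j x) \<le> sqrt C * sqrt (1/2) ^ j" for j
    proof -
      have "ennreal (2 ^ j * (norm (d j x))\<^sup>2) \<le> (\<Sum>j. ennreal (2 ^ j) * ennreal ((norm (d j x))\<^sup>2))"
        using sum_le_suminf[of "\<lambda>j. ennreal (2 ^ j) * ennreal ((norm (d j x))\<^sup>2)" "{j}"] by (simp add: ennreal_mult)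
      then have "2 ^ j * (norm (d j x))\<^sup>2 \<le> C" unfolding C(1) using C(2) by simp
      then have "(norm (d j x))\<^sup>2 \<le> C * (1/2) ^ j" by (simp add: field_simps power_one_over)
      then have "sqrt ((norm (d j x))\<^sup>2) \<le> sqrt (C * (1/2) ^ j)" by (rule real_sqrt_le_mono)
      then show ?thesis by (simp add: real_sqrt_mult real_sqrt_power del: real_sqrt_divide)
    qed
    have "summable (\<lambda>j. sqrt C * sqrt (1/2) ^ j)"
      by (intro summable_mult summable_geometric) (simp add: real_sqrt_lt_1_iff del: real_sqrt_divide)
    then have "summable (\<lambda>j. d j x)"
      by (rule summable_comparison_test'[where N = 0]) (rule bound)
    then have "convergent (\<lambda>n. h (r 0) x + (\<Sum>j<n. d j x))"
      unfolding summable_iff_convergent by (intro convergent_add convergent_const)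
    then show "convergent (\<lambda>j. h (r j) x)"
      unfolding d_def by (simp add: sum_lessThan_telescope[of "\<lambda>j. h (r j) x"])
  qed
  define F where "F x = lim (\<lambda>j. h (r j) x)" for x
  have F[measurable]: "F \<in> borel_measurable M" unfolding F_def by measurable
  show thesis
  proof (rule that[OF F])
    fix n
    have "energy M (\<lambda>x. F x - h n x) \<le> (\<integral>\<^sup>+x. liminf (\<lambda>j. ennreal ((norm (h (r j) x - h n x))\<^sup>2)) \<partial>M)"
      unfolding energy_def
    proof (intro nn_integral_mono_AE)
      show "AE x in M. ennreal ((norm (F x - h n x))\<^sup>2) \<le> liminf (\<lambda>j. ennreal ((norm (h (r j) x - h n x))\<^sup>2))"
        using conv
      proof eventually_elim
        fix x assume "convergent (\<lambda>j. h (r j) x)"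
        then have "(\<lambda>j. h (r j) x) \<longlonglongrightarrow> F x" unfolding F_def by (simp add: convergent_LIMSEQ_iff)
        then have "(\<lambda>j. ennreal ((norm (h (r j) x - h n x))\<^sup>2)) \<longlonglongrightarrow> ennreal ((norm (F x - h n x))\<^sup>2)"
          by (intro tendsto_ennrealI tendsto_intros)
        then show "ennreal ((norm (F x - h n x))\<^sup>2) \<le> liminf (\<lambda>j. ennreal ((norm (h (r j) x - h n x))\<^sup>2))"
          by (subst lim_imp_Liminf) auto
      qed
    qed
    also have "\<dots> \<le> liminf (\<lambda>j. energy M (\<lambda>x. h (r j) x - h n x))"
      unfolding energy_def by (rule nn_integral_liminf) auto
    also have "\<dots> \<le> e n"
    proof (rule Liminf_le)
      show "\<forall>\<^sub>F j in sequentially. energy M (\<lambda>x. h (r j) x - h n x) \<le> e n"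
        using eventually_ge_at_top[of n]
        by eventually_elim (use cauchy strict_mono_imp_increasing[OF r_mono] order.trans in blast)
    qed auto
    finally show "energy M (\<lambda>x. F x - h n x) \<le> e n" .
  qed
qed

section \<open>The Fourier transform of square-integrable functions\<close>

lemma measurable_fourier_L1 [measurable]:
  assumes [measurable]: "g \<in> borel_measurable RT2"
  shows "fourier_L1 g \<in> borel_measurable RZ2"
proof -
  interpret sigma_finite_measure RT2 by (rule sigma_finite_RT2)
  show ?thesis unfolding fourier_L1_def[abs_def] by measurable
qed

lemma two_pi_normalisation: "((2 * pi) powr (- 3 / 2))\<^sup>2 * (2 * pi) ^ 3 = (1::real)"
proof -
  have "((2 * pi) powr (- 3 / 2))\<^sup>2 = (2 * pi) powr (- 3)"
    by (simp add: powr_powr powr_numeral[symmetric] del: powr_numeral)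
  also have "\<dots> = 1 / (2 * pi) ^ 3" by (simp add: powr_minus_divide powr_numeral)
  finally show ?thesis by simp
qed

lemma energy_fourier_L1:
  assumes g: "integrable RT2 g"
  shows "energy RZ2 (fourier_L1 g) \<le> energy RT2 g"
proof -
  have [measurable]: "g \<in> borel_measurable RT2" using g by auto
  interpret sigma_finite_measure RT2 by (rule sigma_finite_RT2)
  have "energy RZ2 (fourier_L1 g) = ennreal (((2 * pi) powr (- 3 / 2))\<^sup>2) * (\<integral>\<^sup>+\<zeta>. ennreal ((norm (LINT z|RT2. g z * cis (- phase z \<zeta>)))\<^sup>2) \<partial>RZ2)"
    unfolding energy_def fourier_L1_def
    by (subst nn_integral_cmult[symmetric], measurable)
      (auto simp: norm_mult power_mult_distrib ennreal_mult intro!: nn_integral_cong)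
  also have "\<dots> \<le> ennreal (((2 * pi) powr (- 3 / 2))\<^sup>2) * (ennreal ((2 * pi) ^ 3) * energy RT2 g)"
    unfolding energy_def by (intro mult_left_mono bessel_analysis g) auto
  also have "\<dots> = energy RT2 g"
    by (subst mult.assoc[symmetric], subst ennreal_mult[symmetric]) (simp_all only: two_pi_normalisation, simp_all)
  finally show ?thesis .
qed

lemma fourier_L1_diff:
  assumes f: "integrable RT2 f" and g: "integrable RT2 g"
  shows "fourier_L1 f \<zeta> - fourier_L1 g \<zeta> = fourier_L1 (\<lambda>z. f z - g z) \<zeta>"
proof -
  have *: "integrable RT2 (\<lambda>z. h z * cis (- phase z \<zeta>))" if "integrable RT2 h" for h
  proof (rule Bochner_Integration.integrable_bound[OF that])
    have [measurable]: "h \<in> borel_measurable RT2" using that by auto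
    have [measurable]: "(\<lambda>z. phase z \<zeta>) \<in> borel_measurable RT2" unfolding phase_eq by measurable
    show "(\<lambda>z. h z * cis (- phase z \<zeta>)) \<in> borel_measurable RT2" by measurable
  qed (simp add: norm_mult)
  show ?thesis unfolding fourier_L1_def
    by (simp add: left_diff_distrib right_diff_distrib Bochner_Integration.integral_diff[OF *[OF f] *[OF g]])
qed

definition trunc :: "(real \<times> real \<times> real \<Rightarrow> complex) \<Rightarrow> nat \<Rightarrow> (real \<times> real \<times> real \<Rightarrow> complex)" where
  "trunc f n z = (if \<bar>fst z\<bar> \<le> real n then f z else 0)"

lemma sets_slab [measurable]: "{z \<in> space RT2. \<bar>fst z\<bar> \<le> real n} \<in> sets RT2"
  unfolding RT2_def by measurable

lemma measurable_trunc [measurable]: "f \<in> borel_measurable RT2 \<Longrightarrow> trunc f n \<in> borel_measurable RT2"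
  unfolding trunc_def[abs_def] by (intro measurable_If[OF _ _ sets_slab]) auto

lemma emeasure_slab: "emeasure RT2 {z \<in> space RT2. \<bar>fst z\<bar> \<le> real n} < \<infinity>"
proof -
  interpret T: sigma_finite_measure torus by (rule sigma_finite_torus)
  interpret TT: sigma_finite_measure "torus \<Otimes>\<^sub>M torus"
    by (intro sigma_finite_pair_measure sigma_finite_torus)
  have "{z \<in> space RT2. \<bar>fst z\<bar> \<le> real n} = {-real n..real n} \<times> (space torus \<times> space torus)"
    by (auto simp: RT2_def space_pair_measure abs_le_iff)
  then have "emeasure RT2 {z \<in> space RT2. \<bar>fst z\<bar> \<le> real n}
     = emeasure lborel {-real n..real n} * (emeasure torus (space torus) * emeasure torus (space torus))"
    unfolding RT2_def by (simp add: TT.emeasure_pair_measure_Times T.emeasure_pair_measure_Times)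
  also have "\<dots> < \<infinity>" using finite_torus by (simp add: ennreal_mult_less_top)
  finally show ?thesis .
qed

lemma integrable_trunc:
  assumes [measurable]: "f \<in> borel_measurable RT2" and fin: "energy RT2 f < \<infinity>"
  shows "integrable RT2 (trunc f n)"
proof (rule integrableI_bounded)
  have "(\<integral>\<^sup>+z. ennreal (norm (trunc f n z)) \<partial>RT2)
     \<le> (\<integral>\<^sup>+z. indicator {z \<in> space RT2. \<bar>fst z\<bar> \<le> real n} z + ennreal ((norm (f z))\<^sup>2) \<partial>RT2)"
  proof (intro nn_integral_mono)
    fix z assume z: "z \<in> space RT2"
    have "norm (f z) \<le> 1 + (norm (f z))\<^sup>2"
      using sum_squares_bound[of "norm (f z)" 1] norm_ge_zero[of "f z"] by (simp del: norm_ge_zero)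
    then show "ennreal (norm (trunc f n z)) \<le> indicator {z \<in> space RT2. \<bar>fst z\<bar> \<le> real n} z + ennreal ((norm (f z))\<^sup>2)"
      using ennreal_le_add[of "norm (f z)" 1 "(norm (f z))\<^sup>2"] z by (auto simp: trunc_def)
  qed
  also have "\<dots> = emeasure RT2 {z \<in> space RT2. \<bar>fst z\<bar> \<le> real n} + energy RT2 f"
    unfolding energy_def by (subst nn_integral_add) auto
  also have "\<dots> < \<infinity>" using emeasure_slab fin by simp
  finally show "(\<integral>\<^sup>+z. ennreal (norm (trunc f n z)) \<partial>RT2) < \<infinity>" .
qed measurable

lemma trunc_tail_tendsto:
  assumes [measurable]: "f \<in> borel_measurable RT2" and fin: "energy RT2 f < \<infinity>"
  shows "(\<lambda>n. energy RT2 (\<lambda>z. f z - trunc f n z)) \<longlonglongrightarrow> 0"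
proof -
  have "(\<lambda>n. energy RT2 (\<lambda>z. f z - trunc f n z)) \<longlonglongrightarrow> (\<integral>\<^sup>+z. 0 \<partial>RT2)"
    unfolding energy_def
  proof (rule nn_integral_dominated_convergence[where w = "\<lambda>z. ennreal ((norm (f z))\<^sup>2)"])
    show "AE z in RT2. (\<lambda>n. ennreal ((norm (f z - trunc f n z))\<^sup>2)) \<longlonglongrightarrow> 0"
    proof (intro AE_I2 tendsto_eventually)
      fix z :: "real \<times> real \<times> real"
      obtain m :: nat where "\<bar>fst z\<bar> \<le> real m" using real_arch_simple by blast
      then show "\<forall>\<^sub>F n in sequentially. ennreal ((norm (f z - trunc f n z))\<^sup>2) = 0"
        unfolding eventually_sequentially by (intro exI[of _ m]) (auto simp: trunc_def)
    qed
  qed (use fin in \<open>auto simp: trunc_def energy_def\<close>)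
  then show ?thesis by simp
qed

lemma trunc_tail_decreasing:
  "n \<le> m \<Longrightarrow> energy RT2 (\<lambda>z. trunc f m z - trunc f n z) \<le> energy RT2 (\<lambda>z. f z - trunc f n z)"
  unfolding energy_def by (intro nn_integral_mono ennreal_leI) (auto simp: trunc_def)

text \<open>The transforms of the truncations form a Cauchy sequence, because the transform does not increase
  energy; so the choice in the definition of \<open>fourier_L2\<close> is made from a nonempty set.\<close>

lemma fourier_L2_spec:
  assumes [measurable]: "f \<in> borel_measurable RT2" and fin: "energy RT2 f < \<infinity>"
  shows "fourier_L2 f \<in> borel_measurable RZ2" "energy RZ2 (fourier_L2 f) < \<infinity>"
    and "(\<lambda>n. energy RZ2 (\<lambda>\<zeta>. fourier_L2 f \<zeta> - fourier_L1 (trunc f n) \<zeta>)) \<longlonglongrightarrow> 0"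
proof -
  let ?e = "\<lambda>n. energy RT2 (\<lambda>z. f z - trunc f n z)"
  note int = integrable_trunc[OF assms]
  have "energy RZ2 (\<lambda>\<zeta>. fourier_L1 (trunc f m) \<zeta> - fourier_L1 (trunc f n) \<zeta>) \<le> ?e n" if "n \<le> m" for n m
    unfolding fourier_L1_diff[OF int int]
    by (rule order.trans[OF energy_fourier_L1 trunc_tail_decreasing[OF that]])
      (intro Bochner_Integration.integrable_diff int)
  then obtain F where F[measurable]: "F \<in> borel_measurable RZ2"
      and Fe: "\<And>n. energy RZ2 (\<lambda>\<zeta>. F \<zeta> - fourier_L1 (trunc f n) \<zeta>) \<le> ?e n"
    by (rule L2_complete[rotated, OF _ trunc_tail_tendsto[OF assms], where h = "\<lambda>n. fourier_L1 (trunc f n)" and M = RZ2]) auto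
  have "energy RZ2 F \<le> ennreal (1 + 1) * energy RZ2 (fourier_L1 (trunc f 0)) + ennreal (1 + 1 / 1) * energy RZ2 (\<lambda>\<zeta>. F \<zeta> - fourier_L1 (trunc f 0) \<zeta>)"
    by (rule energy_le_weighted) auto
  also have "\<dots> < \<infinity>"
  proof -
    have le: "energy RT2 (trunc f 0) \<le> energy RT2 f" "?e 0 \<le> energy RT2 f"
      unfolding energy_def by (intro nn_integral_mono ennreal_leI; auto simp: trunc_def)+
    have "energy RZ2 (fourier_L1 (trunc f 0)) < \<infinity>"
      using energy_fourier_L1[OF int[of 0]] le fin by (simp add: le_less_trans)
    moreover have "energy RZ2 (\<lambda>\<zeta>. F \<zeta> - fourier_L1 (trunc f 0) \<zeta>) < \<infinity>"
      using Fe[of 0] le fin by (simp add: le_less_trans)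
    ultimately show ?thesis by (simp add: ennreal_mult_less_top)
  qed
  finally have Ffin: "energy RZ2 F < \<infinity>" .
  have "(\<lambda>n. energy RZ2 (\<lambda>\<zeta>. F \<zeta> - fourier_L1 (trunc f n) \<zeta>)) \<longlonglongrightarrow> 0"
    using tendsto_sandwich[OF _ _ tendsto_const trunc_tail_tendsto[OF assms]] Fe by simp
  then have "\<exists>F. F \<in> Lp_space 2 RZ2 \<and> (\<lambda>n. Lp_norm 2 RZ2 (\<lambda>\<zeta>. F \<zeta> - fourier_L1 (\<lambda>z. if \<bar>fst z\<bar> \<le> real n then f z else 0) \<zeta>)) \<longlonglongrightarrow> 0"
    using Ffin F unfolding Lp_space_2_iff tendsto_Lp_norm_2_iff trunc_def[abs_def] by blast
  from someI_ex[OF this]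
  have "fourier_L2 f \<in> Lp_space 2 RZ2 \<and> (\<lambda>n. Lp_norm 2 RZ2 (\<lambda>\<zeta>. fourier_L2 f \<zeta> - fourier_L1 (\<lambda>z. if \<bar>fst z\<bar> \<le> real n then f z else 0) \<zeta>)) \<longlonglongrightarrow> 0"
    unfolding fourier_L2_def .
  then show "fourier_L2 f \<in> borel_measurable RZ2" "energy RZ2 (fourier_L2 f) < \<infinity>"
    "(\<lambda>n. energy RZ2 (\<lambda>\<zeta>. fourier_L2 f \<zeta> - fourier_L1 (trunc f n) \<zeta>)) \<longlonglongrightarrow> 0"
    unfolding Lp_space_2_iff tendsto_Lp_norm_2_iff trunc_def[abs_def] by blast+
qed

text \<open>The bound holds for the transforms of the truncations and passes to their limit.\<close>

lemma energy_fourier_L2: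
  assumes [measurable]: "f \<in> borel_measurable RT2" and le: "energy RT2 f \<le> 1"
  shows "energy RZ2 (fourier_L2 f) \<le> 1"
proof (rule ennreal_le_epsilon)
  fix \<delta> :: real assume \<delta>: "\<delta> > 0"
  have fin: "energy RT2 f < \<infinity>" using le by (simp add: le_less_trans[OF _ ennreal_one_less_top])
  note spec = fourier_L2_spec[OF assms(1) fin]
  have [measurable]: "fourier_L2 f \<in> borel_measurable RZ2" by (rule spec)
  \<comment> \<open>with the weight \<open>\<delta> / 2\<close> below, an approximation to this accuracy makes the total error \<open>\<delta>\<close>\<close>
  define c where "c = \<delta> / 2 / (1 + 2 / \<delta>)"
  have c: "c > 0" unfolding c_def using \<delta> by (intro divide_pos_pos add_pos_pos) auto
  then obtain n where n: "energy RZ2 (\<lambda>\<zeta>. fourier_L2 f \<zeta> - fourier_L1 (trunc f n) \<zeta>) \<le> ennreal c"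
    using spec(3) unfolding tendsto_0_ennreal_iff eventually_sequentially by blast
  have "energy RZ2 (fourier_L1 (trunc f n)) \<le> energy RT2 (trunc f n)"
    by (rule energy_fourier_L1[OF integrable_trunc[OF assms(1) fin]])
  also have "\<dots> \<le> energy RT2 f"
    unfolding energy_def by (intro nn_integral_mono ennreal_leI) (auto simp: trunc_def)
  finally have n': "energy RZ2 (fourier_L1 (trunc f n)) \<le> ennreal 1" using le by simp
  have "energy RZ2 (fourier_L2 f) \<le> ennreal (1 + \<delta> / 2) * energy RZ2 (fourier_L1 (trunc f n))
      + ennreal (1 + 1 / (\<delta> / 2)) * energy RZ2 (\<lambda>\<zeta>. fourier_L2 f \<zeta> - fourier_L1 (trunc f n) \<zeta>)"
    using \<delta> by (intro energy_le_weighted) auto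
  also have "\<dots> \<le> ennreal (1 + \<delta> / 2) * ennreal 1 + ennreal (1 + 1 / (\<delta> / 2)) * ennreal c"
    by (intro add_mono mult_left_mono n n') auto
  also have "\<dots> = ennreal ((1 + \<delta> / 2) * 1 + (1 + 1 / (\<delta> / 2)) * c)"
    using \<delta> c by (subst ennreal_plus) (auto simp: ennreal_mult)
  also have "(1 + \<delta> / 2) * 1 + (1 + 1 / (\<delta> / 2)) * c = 1 + \<delta>"
  proof -
    have "1 + 2 / \<delta> > 0" using \<delta> by (intro add_pos_pos) auto
    then have nz: "1 + 2 / \<delta> \<noteq> 0" by simp
    have "s * (\<delta> / 2 / s) = \<delta> / 2" if "s \<noteq> 0" for s :: real using that by simp
    note cancel = this[OF nz]
    have two: "1 + 1 / (\<delta> / 2) = 1 + 2 / \<delta>" by simp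
    show ?thesis unfolding c_def two cancel by simp
  qed
  finally show "energy RZ2 (fourier_L2 f) \<le> 1 + ennreal \<delta>" using \<delta> by simp
qed

text \<open>The transforms of the truncations converge in energy to both sides.\<close>

lemma fourier_L2_eq_fourier_L1:
  assumes f: "integrable RT2 f" and fin: "energy RT2 f < \<infinity>"
  shows "AE \<zeta> in RZ2. fourier_L2 f \<zeta> = fourier_L1 f \<zeta>"
proof -
  have [measurable]: "f \<in> borel_measurable RT2" using f by auto
  have f': "f \<in> borel_measurable RT2" by simp
  note spec = fourier_L2_spec[OF f' fin]
  note int = integrable_trunc[OF f' fin]
  have [measurable]: "fourier_L2 f \<in> borel_measurable RZ2" by (rule spec)
  let ?D = "energy RZ2 (\<lambda>\<zeta>. fourier_L2 f \<zeta> - fourier_L1 f \<zeta>)"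
  have "?D \<le> 0 + ennreal c" if c: "c > 0" for c
  proof -
    have "\<forall>\<^sub>F n in sequentially. energy RZ2 (\<lambda>\<zeta>. fourier_L2 f \<zeta> - fourier_L1 (trunc f n) \<zeta>) \<le> ennreal (c / 4)
        \<and> energy RT2 (\<lambda>z. f z - trunc f n z) \<le> ennreal (c / 4)"
      using spec(3) trunc_tail_tendsto[OF f' fin] c unfolding tendsto_0_ennreal_iff
      by (intro eventually_conj) (meson divide_pos_pos zero_less_numeral)+
    then obtain n where n: "energy RZ2 (\<lambda>\<zeta>. fourier_L2 f \<zeta> - fourier_L1 (trunc f n) \<zeta>) \<le> ennreal (c / 4)"
        "energy RT2 (\<lambda>z. f z - trunc f n z) \<le> ennreal (c / 4)"
      unfolding eventually_sequentially by blast
    have "energy RZ2 (\<lambda>\<zeta>. fourier_L1 f \<zeta> - fourier_L1 (trunc f n) \<zeta>) \<le> ennreal (c / 4)"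
      unfolding fourier_L1_diff[OF f int]
      by (rule order.trans[OF energy_fourier_L1 n(2)]) (intro Bochner_Integration.integrable_diff int f)
    then have n': "energy RZ2 (\<lambda>\<zeta>. fourier_L2 f \<zeta> - fourier_L1 f \<zeta> - (fourier_L2 f \<zeta> - fourier_L1 (trunc f n) \<zeta>)) \<le> ennreal (c / 4)"
      by (simp add: energy_def norm_minus_commute)
    have "?D \<le> ennreal (1 + 1) * energy RZ2 (\<lambda>\<zeta>. fourier_L2 f \<zeta> - fourier_L1 (trunc f n) \<zeta>)
      + ennreal (1 + 1 / 1) * energy RZ2 (\<lambda>\<zeta>. fourier_L2 f \<zeta> - fourier_L1 f \<zeta> - (fourier_L2 f \<zeta> - fourier_L1 (trunc f n) \<zeta>))"
      by (rule energy_le_weighted) auto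
    also have "\<dots> \<le> ennreal (1 + 1) * ennreal (c / 4) + ennreal (1 + 1 / 1) * ennreal (c / 4)"
      by (intro add_mono mult_left_mono n n') auto
    also have "\<dots> = ennreal ((1 + 1) * (c / 4) + (1 + 1 / 1) * (c / 4))"
      using c by (simp only: ennreal_mult ennreal_plus mult_nonneg_nonneg add_nonneg_nonneg zero_le_one div_by_1
            zero_le_divide_iff zero_le_numeral less_imp_le simp_thms)
    finally show ?thesis by simp
  qed
  then have "?D \<le> 0" by (rule ennreal_le_epsilon)
  then have "?D = 0" by simp
  then have "AE \<zeta> in RZ2. ennreal ((norm (fourier_L2 f \<zeta> - fourier_L1 f \<zeta>))\<^sup>2) = 0"
    unfolding energy_def by (subst (asm) nn_integral_0_iff_AE) auto
  then show ?thesis by eventually_elim simp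
qed

section \<open>Exponential sums and the decay of the propagator kernel\<close>

lemma cot_decreasing:
  assumes "0 < a" "a \<le> b" "b < pi"
  shows "cot b \<le> cot (a::real)"
proof -
  have sa: "sin a > 0" "sin b > 0" using assms by (auto intro!: sin_gt_zero)
  have "sin (b - a) \<ge> 0" using assms by (intro sin_ge_zero) auto
  then have "cos b * sin a \<le> cos a * sin b" by (simp add: sin_diff mult.commute)
  then show ?thesis using sa by (simp add: cot_def field_simps)
qed

text \<open>These values lie on a vertical line, so that along monotone \<open>d\<close> their total variation telescopes.\<close>

lemma cis_minus_one_inverse:
  assumes "0 < d" "d < 2 * pi"
  shows "cis d \<noteq> 1" "1 / (cis d - 1) = Complex (- 1 / 2) (- cot (d / 2) / 2)"
proof -
  have s: "sin (d / 2) > 0" using assms by (intro sin_gt_zero) auto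
  have c: "cos d = 1 - 2 * (sin (d / 2))\<^sup>2" "sin d = 2 * sin (d / 2) * cos (d / 2)"
    using cos_double_sin[of "d / 2"] sin_double[of "d / 2"] by simp_all
  have eq: "(cis d - 1) * Complex (- 1 / 2) (- cot (d / 2) / 2) = 1"
  proof -
    have sq: "sin (d / 2) * sin (d / 2) + cos (d / 2) * cos (d / 2) = 1"
      using sin_cos_squared_add[of "d / 2"] by (simp add: power2_eq_square)
    have "- 1 / 2 * (cos d - 1) + cot (d / 2) / 2 * sin d = sin (d / 2) * sin (d / 2) + cos (d / 2) * cos (d / 2)"
      using s by (simp add: c cot_def power2_eq_square)
    moreover have "(cos d - 1) * (cot (d / 2) / 2) + sin d / 2 = 0"
      using s by (simp add: c cot_def power2_eq_square)
    ultimately have "- 1 / 2 * (cos d - 1) + cot (d / 2) / 2 * sin d = 1" "(cos d - 1) * (cot (d / 2) / 2) + sin d / 2 = 0"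
      unfolding sq by blast+
    then show ?thesis
      by (intro complex_eqI) (simp_all add: field_simps)
  qed
  show "cis d \<noteq> 1" using eq by auto
  then show "1 / (cis d - 1) = Complex (- 1 / 2) (- cot (d / 2) / 2)"
    using eq by (simp add: field_simps)
qed

text \<open>The increments of the phase stay away from the multiples of \<open>2 * pi\<close>, so each term is the
  difference \<open>z (Suc k) - z k\<close> of consecutive terms times the bounded factor \<open>w k = 1 / (cis (d k) - 1)\<close>.
  Summation by parts leaves the boundary terms and the total variation of \<open>w\<close>, which telescopes
  because the increments \<open>d\<close> are monotone.\<close>

lemma kusmin_landau:
  fixes \<phi> :: "nat \<Rightarrow> real"
  assumes \<theta>: "0 < \<theta>" "\<theta> \<le> pi"
    and lower: "\<And>k. k < n \<Longrightarrow> \<theta> \<le> \<phi> (Suc k) - \<phi> k" and upper: "\<And>k. k < n \<Longrightarrow> \<phi> (Suc k) - \<phi> k \<le> 2 * pi - \<theta>"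
    and decr: "\<And>k. Suc k < n \<Longrightarrow> \<phi> (Suc (Suc k)) - \<phi> (Suc k) \<le> \<phi> (Suc k) - \<phi> k"
  shows "norm (\<Sum>k<n. cis (\<phi> k)) \<le> 4 * cot (\<theta> / 2) + 4"
proof (cases n)
  case 0
  have "cot (\<theta> / 2) \<ge> 0" using \<theta> by (auto simp: cot_def intro!: divide_nonneg_nonneg cos_ge_zero sin_ge_zero)
  then show ?thesis using 0 by simp
next
  case (Suc m)
  define d where "d k = \<phi> (Suc k) - \<phi> k" for k
  define w where "w k = 1 / (cis (d k) - 1)" for k
  define z where "z k = cis (\<phi> k)" for k
  define C where "C = cot (\<theta> / 2)"
  have dk: "0 < d k" "d k < 2 * pi" "\<theta> \<le> d k" "d k \<le> 2 * pi - \<theta>" if "k < n" for k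
    using lower[OF that] upper[OF that] \<theta> unfolding d_def by auto
  have cotC: "\<bar>cot (d k / 2)\<bar> \<le> C" if "k < n" for k
  proof -
    have "cot (d k / 2) \<le> C" unfolding C_def using dk[OF that] \<theta> by (intro cot_decreasing) auto
    moreover have "cot (pi - \<theta> / 2) \<le> cot (d k / 2)" using dk[OF that] \<theta> by (intro cot_decreasing) auto
    moreover have "cot (pi - \<theta> / 2) = - C" unfolding C_def by (simp add: cot_def)
    ultimately show ?thesis by (simp add: abs_le_iff)
  qed
  have w_eq: "w k = Complex (- 1 / 2) (- cot (d k / 2) / 2)" if "k < n" for k
    unfolding w_def using cis_minus_one_inverse(2)[OF dk(1,2)[OF that]] .
  have w_norm: "norm (w k) \<le> 1 / 2 + C / 2" if "k < n" for k
    unfolding w_eq[OF that] using cmod_le[of "Complex (- 1 / 2) (- cot (d k / 2) / 2)"] cotC[OF that] by simp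
  have w_diff: "norm (w k - w (Suc k)) = cot (d (Suc k) / 2) / 2 - cot (d k / 2) / 2" if "Suc k < n" for k
  proof -
    have "cot (d k / 2) \<le> cot (d (Suc k) / 2)"
      using decr[OF that] dk[OF that] dk[of k] that unfolding d_def by (intro cot_decreasing) auto
    then show ?thesis using that by (simp add: w_eq cmod_def)
  qed
  have zk: "z k = (z (Suc k) - z k) * w k" if "k < n" for k
  proof -
    have "z (Suc k) = z k * cis (d k)" unfolding z_def d_def by (simp add: cis_mult)
    then show ?thesis unfolding w_def using cis_minus_one_inverse(1)[OF dk(1,2)[OF that]]
      by (simp add: field_simps)
  qed
  have parts: "(\<Sum>k<Suc j. (z (Suc k) - z k) * w k)
      = z (Suc j) * w j - z 0 * w 0 + (\<Sum>k<j. z (Suc k) * (w k - w (Suc k)))" for j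
    by (induction j) (simp_all add: algebra_simps)
  have "norm (\<Sum>k<n. z k) = norm (z n * w m - z 0 * w 0 + (\<Sum>k<m. z (Suc k) * (w k - w (Suc k))))"
    using parts[of m] zk unfolding Suc by (metis (no_types, lifting) lessThan_iff sum.cong)
  also have "\<dots> \<le> norm (z n * w m) + norm (z 0 * w 0) + norm (\<Sum>k<m. z (Suc k) * (w k - w (Suc k)))"
    by (meson norm_triangle_ineq norm_triangle_ineq4 add_mono order.trans order_refl)
  also have "\<dots> \<le> (1 / 2 + C / 2) + (1 / 2 + C / 2) + (\<Sum>k<m. cot (d (Suc k) / 2) / 2 - cot (d k / 2) / 2)"
  proof (intro add_mono)
    show "norm (z n * w m) \<le> 1 / 2 + C / 2" "norm (z 0 * w 0) \<le> 1 / 2 + C / 2"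
      using w_norm Suc by (simp_all add: norm_mult z_def)
    show "norm (\<Sum>k<m. z (Suc k) * (w k - w (Suc k))) \<le> (\<Sum>k<m. cot (d (Suc k) / 2) / 2 - cot (d k / 2) / 2)"
      using w_diff Suc by (intro sum_norm_le) (simp add: norm_mult z_def)
  qed
  also have "(\<Sum>k<m. cot (d (Suc k) / 2) / 2 - cot (d k / 2) / 2) = cot (d m / 2) / 2 - cot (d 0 / 2) / 2"
    by (rule sum_lessThan_telescope)
  also have "\<dots> \<le> C" using cotC[of m] cotC[of 0] Suc by (auto simp: abs_le_iff)
  finally have "norm (\<Sum>k<n. z k) \<le> 1 + 2 * C" by simp
  moreover have "C \<ge> 0" using cotC[of 0] Suc by auto
  ultimately show ?thesis unfolding z_def C_def by simp
qed

lemma cot_half_le: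
  assumes "0 < \<theta>" "\<theta> \<le> 2"
  shows "cot (\<theta> / 2) \<le> 4 / (\<theta>::real)"
proof -
  have s: "sin (\<theta> / 2) \<ge> \<theta> / 4"
  proof -
    have "(\<Sum>m<3. sin_coeff m * (\<theta> / 2) ^ m) = \<theta> / 2" by (simp add: numeral_3_eq_3 sin_coeff_def)
    then have "\<bar>sin (\<theta> / 2) - \<theta> / 2\<bar> \<le> inverse (fact 3) * (\<theta> / 2) ^ 3"
      using Maclaurin_sin_bound[of "\<theta> / 2" 3] assms by simp
    moreover have "fact 3 = (6::real)" by (simp add: fact_numeral)
    ultimately have "\<theta> / 2 - (\<theta> / 2) ^ 3 / 6 \<le> sin (\<theta> / 2)"
      by (simp only: abs_le_iff) simp
    moreover have "(\<theta> / 2) ^ 3 / 6 \<le> \<theta> / 4"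
    proof -
      have "(\<theta> / 2) ^ 2 \<le> 1" using assms by (simp add: power_le_one)
      then have "(\<theta> / 2) * (\<theta> / 2) ^ 2 \<le> \<theta> / 2 * 1" using assms by (intro mult_left_mono) auto
      then show ?thesis using assms by (simp add: power3_eq_cube power2_eq_square)
    qed
    ultimately show ?thesis by linarith
  qed
  have "cot (\<theta> / 2) \<le> 1 / sin (\<theta> / 2)"
    using s assms by (simp add: cot_def divide_right_mono)
  also have "\<dots> \<le> 1 / (\<theta> / 4)" using s assms by (intro divide_left_mono mult_pos_pos) auto
  finally show ?thesis using assms by simp
qed

text \<open>The increments \<open>\<alpha> - t * (2 * k + 1)\<close> of the phase decrease slowly, and over the whole range of
  summation by less than a full turn.  They are at most \<open>\<theta> = sqrt t\<close> in absolute value for at most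
  \<open>1 / \<theta> + 1\<close> indices, which are estimated trivially; on either side the
  Kusmin--Landau inequality applies, after adding a full turn where the increments are negative.\<close>

lemma quadratic_sum_reduced:
  fixes \<alpha> t :: real
  assumes t: "0 < t" "t \<le> 1 / 4" and n: "2 * t * real n \<le> 1" and \<alpha>: "\<bar>\<alpha>\<bar> \<le> pi"
  shows "norm (\<Sum>k<n. cis (\<alpha> * real k - t * (real k)\<^sup>2)) \<le> 48 / sqrt t"
proof -
  define \<phi> where "\<phi> k = \<alpha> * real k - t * (real k)\<^sup>2" for k :: nat
  define \<theta> where "\<theta> = sqrt t"
  have th: "0 < \<theta>" "\<theta> \<le> 1 / 2" "\<theta> * \<theta> = t"
    using t real_sqrt_le_mono[of t "1/4"] by (auto simp: \<theta>_def real_sqrt_divide)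
  have pi3: "3 < pi" using pi_gt3 .
  have d: "\<phi> (Suc k) - \<phi> k = \<alpha> - t * (2 * real k + 1)" for k
    by (simp add: \<phi>_def power2_eq_square algebra_simps)
  \<comment> \<open>the block of indices with stationary phase runs from \<open>p\<close> to \<open>q - 1\<close>\<close>
  define A where "A = {k. k < n \<and> \<theta> \<le> \<alpha> - t * (2 * real k + 1)}"
  define p where "p = card A"
  have down: "k' \<in> A" if "k \<in> A" "k' \<le> k" for k k'
  proof -
    have "t * (2 * real k' + 1) \<le> t * (2 * real k + 1)" using t that by (intro mult_left_mono) auto
    then show ?thesis using that by (auto simp: A_def)
  qed
  have "finite A" by (simp add: A_def)
  have A_eq: "A = {..<p}"
  proof -
    have "\<exists>p. A = {..<p}"
    proof (cases "A = {}")
      case False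
      then have "A = {..<Suc (Max A)}"
        using down[of "Max A"] Max_in[OF \<open>finite A\<close>] Max_ge[OF \<open>finite A\<close>] by (auto simp: less_Suc_eq_le)
      then show ?thesis by blast
    qed (auto intro: exI[of _ 0])
    then show ?thesis unfolding p_def by auto
  qed
  define B where "B = {k. k < n \<and> - \<theta> < \<alpha> - t * (2 * real k + 1)}"
  define q where "q = card B"
  have downB: "k' \<in> B" if "k \<in> B" "k' \<le> k" for k k'
  proof -
    have "t * (2 * real k' + 1) \<le> t * (2 * real k + 1)" using t that by (intro mult_left_mono) auto
    then show ?thesis using that by (auto simp: B_def)
  qed
  have "finite B" by (simp add: B_def)
  have B_eq: "B = {..<q}"
  proof -
    have "\<exists>q. B = {..<q}"
    proof (cases "B = {}")
      case False
      then have "B = {..<Suc (Max B)}"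
        using downB[of "Max B"] Max_in[OF \<open>finite B\<close>] Max_ge[OF \<open>finite B\<close>] by (auto simp: less_Suc_eq_le)
      then show ?thesis by blast
    qed (auto intro: exI[of _ 0])
    then show ?thesis unfolding q_def by auto
  qed
  have "A \<subseteq> B" using th by (auto simp: A_def B_def)
  then have pq: "p \<le> q" unfolding A_eq B_eq by auto
  have "B \<subseteq> {..<n}" by (auto simp: B_def)
  then have qn: "q \<le> n" unfolding B_eq by simp
  have small: "t * (2 * real k + 1) \<le> 1 + 1/4" "0 \<le> t * (2 * real k + 1)" if "k < n" for k
  proof -
    have "2 * t * real k \<le> 2 * t * real n" using t that by (intro mult_left_mono) auto
    then have "2 * t * real k \<le> 1" using n by linarith
    then show "t * (2 * real k + 1) \<le> 1 + 1/4" using t by (simp add: algebra_simps)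
    show "0 \<le> t * (2 * real k + 1)" using t by simp
  qed
  have cot_bd: "4 * cot (\<theta> / 2) + 4 \<le> 18 / \<theta>"
  proof -
    have "4 * cot (\<theta> / 2) \<le> 16 / \<theta>" using cot_half_le[of \<theta>] th by simp
    moreover have "4 \<le> 2 / \<theta>" using th by (simp add: field_simps)
    ultimately show ?thesis by (simp add: add_divide_distrib[symmetric])
  qed
  have 1: "norm (\<Sum>k<p. cis (\<phi> k)) \<le> 18 / \<theta>"
  proof (rule order.trans[OF kusmin_landau[of \<theta> p \<phi>] cot_bd])
    show "\<theta> \<le> pi" using th pi3 by linarith
    show "\<theta> \<le> \<phi> (Suc k) - \<phi> k" if "k < p" for k
      using that A_eq unfolding d A_def by auto
    show "\<phi> (Suc k) - \<phi> k \<le> 2 * pi - \<theta>" if "k < p" for k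
    proof -
      have "k < n" using that A_eq unfolding A_def by auto
      then show ?thesis unfolding d using small(2)[of k] \<alpha> th pi3 by (simp add: abs_le_iff)
    qed
    show "\<phi> (Suc (Suc k)) - \<phi> (Suc k) \<le> \<phi> (Suc k) - \<phi> k" for k
      unfolding d using t by (simp add: algebra_simps)
  qed (use th in auto)
  have 2: "norm (\<Sum>k=p..<q. cis (\<phi> k)) \<le> 3 / \<theta>"
  proof -
    have "norm (\<Sum>k=p..<q. cis (\<phi> k)) \<le> (\<Sum>k=p..<q. 1)" by (intro sum_norm_le) auto
    also have "\<dots> = real (q - p)" by simp
    also have "\<dots> \<le> 1 / \<theta> + 1"
    proof (cases "q - p \<le> 1")
      case False
      then have "p \<notin> A" "q - 1 \<in> B" "p < n" "p \<in> B" using A_eq B_eq qn by auto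
      then have "\<alpha> - t * (2 * real p + 1) < \<theta>" "- \<theta> < \<alpha> - t * (2 * real (q - 1) + 1)"
        by (auto simp: A_def B_def)
      then have "t * (2 * real (q - 1) + 1) - t * (2 * real p + 1) < 2 * \<theta>" by linarith
      then have "\<theta> * \<theta> * (real (q - 1) - real p) < \<theta>" using th(3) by (simp add: algebra_simps)
      then have "\<theta> * (\<theta> * (real (q - 1) - real p)) < \<theta> * 1" by (simp only: mult.assoc mult_1_right)
      then have "\<theta> * (real (q - 1) - real p) < 1" using th(1) by (simp only: mult_less_cancel_left_pos)
      then have "real (q - 1) - real p \<le> 1 / \<theta>" using th by (simp add: field_simps)
      then show ?thesis using False by simp
    next
      case True
      then have "real (q - p) \<le> 1" by simp
      moreover have "0 \<le> 1 / \<theta>" using th by simp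
      ultimately show ?thesis by linarith
    qed
    also have "\<dots> \<le> 3 / \<theta>"
    proof -
      have "1 \<le> 1 / \<theta>" using th by simp
      then show ?thesis using add_divide_distrib[of 1 2 \<theta>] by simp
    qed
    finally show ?thesis .
  qed
  have 3: "norm (\<Sum>k=q..<n. cis (\<phi> k)) \<le> 18 / \<theta>"
  proof -
    \<comment> \<open>a full turn is added to each increment, which makes the increments positive\<close>
    define \<psi> where "\<psi> j = \<phi> (q + j) + 2 * pi * real j" for j
    have dpsi: "\<psi> (Suc j) - \<psi> j = \<alpha> - t * (2 * real (q + j) + 1) + 2 * pi" for j
      using d[of "q + j"] by (simp add: \<psi>_def algebra_simps)
    have "(\<Sum>k=q..<n. cis (\<phi> k)) = (\<Sum>j<n - q. cis (\<phi> (q + j)))"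
      using sum.shift_bounds_nat_ivl[of "\<lambda>k. cis (\<phi> k)" 0 q "n - q"] qn
      by (simp add: lessThan_atLeast0 add.commute)
    also have "\<dots> = (\<Sum>j<n - q. cis (\<psi> j))"
      unfolding \<psi>_def by (intro sum.cong refl) (simp add: cis_mult[symmetric])
    finally have eq: "(\<Sum>k=q..<n. cis (\<phi> k)) = (\<Sum>j<n - q. cis (\<psi> j))" .
    have "norm (\<Sum>j<n - q. cis (\<psi> j)) \<le> 18 / \<theta>"
    proof (rule order.trans[OF kusmin_landau[of \<theta> "n - q" \<psi>] cot_bd])
      show "\<theta> \<le> pi" using th pi3 by linarith
      show "\<theta> \<le> \<psi> (Suc j) - \<psi> j" if "j < n - q" for j
      proof -
        have "q + j < n" using that by simp
        from small(1)[OF this] show ?thesis unfolding dpsi using \<alpha> th pi3 by (simp only: abs_le_iff) linarith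
      qed
      show "\<psi> (Suc j) - \<psi> j \<le> 2 * pi - \<theta>" if "j < n - q" for j
      proof -
        have "q + j \<notin> B" unfolding B_eq by simp
        then show ?thesis unfolding dpsi using that by (auto simp: B_def)
      qed
      show "\<psi> (Suc (Suc j)) - \<psi> (Suc j) \<le> \<psi> (Suc j) - \<psi> j" for j
        unfolding dpsi using t by (simp add: algebra_simps)
    qed (use th in auto)
    then show ?thesis unfolding eq .
  qed
  have "(\<Sum>k<n. cis (\<phi> k)) = (\<Sum>k<p. cis (\<phi> k)) + (\<Sum>k=p..<q. cis (\<phi> k)) + (\<Sum>k=q..<n. cis (\<phi> k))"
    unfolding lessThan_atLeast0 using pq qn by (simp add: sum.atLeastLessThan_concat)
  also have "norm \<dots> \<le> 18 / \<theta> + 3 / \<theta> + 18 / \<theta>"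
    by (intro order.trans[OF norm_triangle_ineq] add_mono 1 2 3)
  also have "\<dots> \<le> 48 / \<theta>" using th by (simp add: add_divide_distrib[symmetric] divide_right_mono)
  finally show ?thesis unfolding \<phi>_def \<theta>_def .
qed

text \<open>Changing \<open>\<alpha>\<close> by a multiple of \<open>2 * pi\<close> does not change the terms, and conjugation changes the
  sign of \<open>t\<close>.\<close>

lemma quadratic_sum_bound:
  fixes \<alpha> t c :: real
  assumes t: "0 < \<bar>t\<bar>" "\<bar>t\<bar> \<le> 1 / 4" and n: "2 * \<bar>t\<bar> * real n \<le> 1"
  shows "norm (\<Sum>k<n. cis (c + \<alpha> * real k - t * (real k)\<^sup>2)) \<le> 48 / sqrt \<bar>t\<bar>"
proof -
  have pos: "norm (\<Sum>k<n. cis (\<alpha> * real k - t * (real k)\<^sup>2)) \<le> 48 / sqrt t" if "t > 0" "t \<le> 1/4" "2 * t * real n \<le> 1" for \<alpha> t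
  proof -
    define m :: int where "m = round (\<alpha> / (2 * pi))"
    define \<beta> where "\<beta> = \<alpha> - 2 * pi * of_int m"
    have "\<bar>of_int m - \<alpha> / (2 * pi)\<bar> \<le> 1 / 2" unfolding m_def by (rule of_int_round_abs_le)
    then have "\<bar>2 * pi * (of_int m - \<alpha> / (2 * pi))\<bar> \<le> 2 * pi * (1 / 2)"
      by (subst abs_mult) (simp add: mult_left_mono del: abs_mult)
    then have "\<bar>\<beta>\<bar> \<le> pi" unfolding \<beta>_def by (simp add: right_diff_distrib abs_minus_commute)
    moreover have "cis (\<alpha> * real k - t * (real k)\<^sup>2) = cis (\<beta> * real k - t * (real k)\<^sup>2)" for k :: nat
    proof -
      have "\<alpha> * real k - t * (real k)\<^sup>2 = (\<beta> * real k - t * (real k)\<^sup>2) + 2 * pi * of_int (m * int k)"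
        unfolding \<beta>_def by (simp add: algebra_simps)
      then show ?thesis by (simp only: cis_mult[symmetric]) (simp del: of_int_mult add: cis_multiple_2pi)
    qed
    ultimately show ?thesis using quadratic_sum_reduced[OF that, of \<beta>] by simp
  qed
  have shift: "(\<Sum>k<n. cis (c + \<alpha> * real k - t * (real k)\<^sup>2)) = cis c * (\<Sum>k<n. cis (\<alpha> * real k - t * (real k)\<^sup>2))"
    unfolding sum_distrib_left cis_mult by (simp add: add_diff_eq)
  have "norm (\<Sum>k<n. cis (\<alpha> * real k - t * (real k)\<^sup>2)) \<le> 48 / sqrt \<bar>t\<bar>"
  proof (cases "t > 0")
    case True
    then show ?thesis using pos[of t \<alpha>] assms by simp
  next
    case False
    have "(\<Sum>k<n. cis (\<alpha> * real k - t * (real k)\<^sup>2)) = cnj (\<Sum>k<n. cis (- \<alpha> * real k - (- t) * (real k)\<^sup>2))"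
      by (simp add: cis_cnj)
    then have "norm (\<Sum>k<n. cis (\<alpha> * real k - t * (real k)\<^sup>2)) = norm (\<Sum>k<n. cis (- \<alpha> * real k - (- t) * (real k)\<^sup>2))"
      by (simp only: complex_mod_cnj)
    also have "\<dots> \<le> 48 / sqrt (- t)" using False assms by (intro pos) auto
    finally show ?thesis using False by simp
  qed
  then show ?thesis unfolding shift by (simp add: norm_mult)
qed

lemma quadratic_sum_symmetric:
  fixes \<alpha> t :: real and M :: nat
  assumes t: "0 < \<bar>t\<bar>" "\<bar>t\<bar> * (8 * real M) \<le> 1" and M: "M \<ge> 1"
  shows "norm (\<Sum>k\<in>{-int M..int M}. cis (\<alpha> * of_int k - t * (of_int k)\<^sup>2)) \<le> 48 / sqrt \<bar>t\<bar>"
proof -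
  have bij: "bij_betw (\<lambda>j. int j - int M) {..<2 * M + 1} {-int M..int M}"
    by (rule bij_betwI[where g = "\<lambda>k. nat (k + int M)"]) auto
  have "(\<Sum>k\<in>{-int M..int M}. cis (\<alpha> * of_int k - t * (of_int k)\<^sup>2))
     = (\<Sum>j<2 * M + 1. cis (\<alpha> * of_int (int j - int M) - t * (of_int (int j - int M))\<^sup>2))"
    by (rule sum.reindex_bij_betw[OF bij, symmetric])
  also have "\<dots> = (\<Sum>j<2 * M + 1. cis ((- \<alpha> * real M - t * (real M)\<^sup>2) + (\<alpha> + 2 * t * real M) * real j - t * (real j)\<^sup>2))"
    by (intro sum.cong refl arg_cong[where f = cis]) (simp add: power2_eq_square algebra_simps)
  also have "norm \<dots> \<le> 48 / sqrt \<bar>t\<bar>"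
  proof (rule quadratic_sum_bound[OF t(1)])
    have "\<bar>t\<bar> * 8 \<le> \<bar>t\<bar> * (8 * real M)" using M by (intro mult_left_mono) auto
    then show "\<bar>t\<bar> \<le> 1 / 4" using t(2) by linarith
    have "\<bar>t\<bar> * (4 * real M + 2) \<le> \<bar>t\<bar> * (8 * real M)" using M by (intro mult_left_mono) auto
    then show "2 * \<bar>t\<bar> * real (2 * M + 1) \<le> 1" using t(2) by (simp add: algebra_simps)
  qed
  finally show ?thesis .
qed

text \<open>The integral is the average of the sums over the translates of the integer lattice, so that bounds
  for exponential sums carry over to oscillatory integrals.\<close>

lemma integral_Icc_sum_translates:
  fixes f :: "real \<Rightarrow> complex"
  assumes f: "continuous_on UNIV f"
  shows "(LINT x|lborel. indicator {a..a + real n} x *\<^sub>R f x) = (LINT s|lborel. indicator {0..1} s *\<^sub>R (\<Sum>j<n. f (a + real j + s)))"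
proof -
  have c: "continuous_on S f" for S using f by (rule continuous_on_subset) auto
  have c': "continuous_on S (\<lambda>s. f (a + real j + s))" for S j
    by (rule continuous_on_compose2[OF f]) (auto intro!: continuous_intros)
  have L: "(LINT x|lborel. indicator {u..v} x *\<^sub>R g x) = integral {u..v} g" if "continuous_on {u..v} g" for u v :: real and g :: "real \<Rightarrow> complex"
    using set_borel_integral_eq_integral(2)[OF borel_integrable_atLeastAtMost'[OF that]]
    unfolding set_lebesgue_integral_def .
  have "integral {a..a + real n} f = (\<Sum>j<n. integral {0..1} (\<lambda>s. f (a + real j + s)))"
  proof (induction n)
    case (Suc n)
    have "integral {a..a + real (Suc n)} f = integral {a..a + real n} f + integral {a + real n..a + real (Suc n)} f"
      by (rule Henstock_Kurzweil_Integration.integral_combine[symmetric]) (auto intro: integrable_continuous_real c)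
    also have "integral {a + real n..a + real (Suc n)} f = integral {0..1} (\<lambda>s. f (a + real n + s))"
      using integral_shift[of 0 "a + real n" 1 f] c by (simp add: o_def add.commute add.left_commute)
    finally show ?case using Suc by simp
  qed simp
  also have "\<dots> = integral {0..1} (\<lambda>s. \<Sum>j<n. f (a + real j + s))"
    by (rule integral_sum[symmetric]) (auto intro: integrable_continuous_real c')
  finally show ?thesis
    by (simp add: L[OF c] L[OF continuous_on_sum[OF c']])
qed

lemma quadratic_integral_bound:
  fixes \<alpha> t :: real and M :: nat
  assumes t: "0 < \<bar>t\<bar>" "\<bar>t\<bar> * (8 * real M) \<le> 1" and M: "M \<ge> 1"
  shows "norm (LINT \<xi>|lborel. indicator {-real M..real M} \<xi> *\<^sub>R cis (\<alpha> * \<xi> - t * \<xi>\<^sup>2)) \<le> 48 / sqrt \<bar>t\<bar>"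
proof -
  let ?f = "\<lambda>\<xi>. cis (\<alpha> * \<xi> - t * \<xi>\<^sup>2)"
  have cont: "continuous_on UNIV ?f" unfolding cis_conv_exp by (intro continuous_intros)
  have bd: "norm (\<Sum>j<2 * M. ?f (- real M + real j + s)) \<le> 48 / sqrt \<bar>t\<bar>" for s
  proof -
    have "(\<Sum>j<2 * M. ?f (- real M + real j + s))
      = (\<Sum>j<2 * M. cis ((\<alpha> * (s - real M) - t * (s - real M)\<^sup>2) + (\<alpha> - 2 * t * (s - real M)) * real j - t * (real j)\<^sup>2))"
      by (intro sum.cong refl arg_cong[where f = cis]) (simp add: power2_eq_square algebra_simps)
    also have "norm \<dots> \<le> 48 / sqrt \<bar>t\<bar>"
    proof (rule quadratic_sum_bound[OF t(1)])
      have "\<bar>t\<bar> * 8 \<le> \<bar>t\<bar> * (8 * real M)" using M by (intro mult_left_mono) auto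
      then show "\<bar>t\<bar> \<le> 1 / 4" using t(2) by linarith
      have "\<bar>t\<bar> * (4 * real M) \<le> \<bar>t\<bar> * (8 * real M)" using M by (intro mult_left_mono) auto
      then show "2 * \<bar>t\<bar> * real (2 * M) \<le> 1" using t(2) by (simp add: algebra_simps)
    qed
    finally show ?thesis .
  qed
  have "(LINT \<xi>|lborel. indicator {-real M..real M} \<xi> *\<^sub>R ?f \<xi>)
      = (LINT s|lborel. indicator {0..1} s *\<^sub>R (\<Sum>j<2 * M. ?f (- real M + real j + s)))"
    using integral_Icc_sum_translates[OF cont, of "- real M" "2 * M"] by simp
  also have "norm \<dots> \<le> (LINT s::real|lborel. indicator {0..1} s * (48 / sqrt \<bar>t\<bar>))"
  proof (rule order.trans[OF Bochner_Integration.integral_norm_bound Bochner_Integration.integral_mono])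
    have "continuous_on {0..1} (\<lambda>s. \<Sum>j<2 * M. ?f (- real M + real j + s))"
      unfolding cis_conv_exp by (intro continuous_intros)
    from borel_integrable_atLeastAtMost'[OF this]
    show "integrable lborel (\<lambda>s. norm (indicator {0..1} s *\<^sub>R (\<Sum>j<2 * M. ?f (- real M + real j + s))))"
      unfolding set_integrable_def by (rule integrable_norm)
    show "norm (indicator {0..1} s *\<^sub>R (\<Sum>j<2 * M. ?f (- real M + real j + s))) \<le> indicator {0..1} s * (48 / sqrt \<bar>t\<bar>)" for s :: real
      using bd[of s] by (auto simp: indicator_def)
    show "integrable lborel (\<lambda>s::real. indicator {0..1} s * (48 / sqrt \<bar>t\<bar>))"
      by (intro integrable_mult_left integrable_real_indicator) auto
  qed
  also have "\<dots> = 48 / sqrt \<bar>t\<bar>" by simp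
  finally show ?thesis .
qed

text \<open>On a box the kernel is the product of an oscillatory integral and two exponential sums, each of
  which is at most \<open>48 / sqrt \<bar>t\<bar>\<close>.  The signature of the form does
  not affect this decay.\<close>

lemma kernel_bound:
  fixes M :: nat
  assumes t: "0 < \<bar>t\<bar>" "\<bar>t\<bar> * (8 * real M) \<le> 1" and M: "M \<ge> 1"
  shows "norm (LINT \<zeta>|RZ2. indicator (freq_box (real M)) \<zeta> * cis (phase w \<zeta> - t * hyp \<zeta>)) \<le> 48 ^ 3 / (sqrt \<bar>t\<bar>) ^ 3"
proof -
  interpret P: pair_sigma_finite lborel Z2
    by (intro pair_sigma_finite.intro sigma_finite_lborel sigma_finite_Z2)
  let ?S = "{-int M..int M}"
  let ?f = "\<lambda>\<xi>. complex_of_real (indicator {-real M..real M} \<xi>) * cis (fst w * \<xi> - t * \<xi>\<^sup>2)"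
  let ?g = "\<lambda>k. complex_of_real (indicator (?S \<times> ?S) k) * (cis (fst (snd w) * of_int (fst k) - t * (of_int (fst k))\<^sup>2)
        * cis (snd (snd w) * of_int (snd k) - (- t) * (of_int (snd k))\<^sup>2))"
  have eq: "indicator (freq_box (real M)) \<zeta> * cis (phase w \<zeta> - t * hyp \<zeta>) = ?f (fst \<zeta>) * ?g (snd \<zeta>)" for \<zeta>
  proof -
    have "cis (phase w \<zeta> - t * hyp \<zeta>) = cis (fst w * fst \<zeta> - t * (fst \<zeta>)\<^sup>2)
       * (cis (fst (snd w) * of_int (fst (snd \<zeta>)) - t * (of_int (fst (snd \<zeta>)))\<^sup>2)
        * cis (snd (snd w) * of_int (snd (snd \<zeta>)) - (- t) * (of_int (snd (snd \<zeta>)))\<^sup>2))"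
      by (simp add: cis_mult phase_eq hyp_def algebra_simps)
    then show ?thesis
      by (auto simp: indicator_def freq_box_def mem_Times_iff)
  qed
  have f: "integrable lborel ?f"
  proof -
    have "continuous_on {-real M..real M} (\<lambda>\<xi>. cis (fst w * \<xi> - t * \<xi>\<^sup>2))"
      unfolding cis_conv_exp by (intro continuous_intros)
    from borel_integrable_atLeastAtMost'[OF this] show ?thesis
      by (simp add: set_integrable_def scaleR_conv_of_real)
  qed
  have fin: "finite {k \<in> UNIV. ?g k \<noteq> 0}"
    by (rule finite_subset[of _ "?S \<times> ?S"]) (auto simp: indicator_def)
  have g: "integrable Z2 ?g"
  proof (rule integrableI_bounded)
    have "(\<integral>\<^sup>+k. ennreal (norm (?g k)) \<partial>Z2) = (\<Sum>k\<in>?S \<times> ?S. ennreal (norm (?g k)))"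
      by (rule nn_integral_count_space') (auto simp: indicator_def)
    then show "(\<integral>\<^sup>+k. ennreal (norm (?g k)) \<partial>Z2) < \<infinity>" by (simp add: sum_ennreal)
  qed simp
  have gsum: "(LINT k|Z2. ?g k) = (\<Sum>k\<in>?S. cis (fst (snd w) * of_int k - t * (of_int k)\<^sup>2)) * (\<Sum>k\<in>?S. cis (snd (snd w) * of_int k - (- t) * (of_int k)\<^sup>2))"
  proof -
    have "(LINT k|Z2. ?g k) = (\<Sum>k | k \<in> UNIV \<and> ?g k \<noteq> 0. ?g k)"
      using fin by (subst lebesgue_integral_count_space_finite_support) auto
    also have "\<dots> = (\<Sum>k\<in>?S \<times> ?S. ?g k)"
      by (intro sum.mono_neutral_left) (auto simp: indicator_def)
    also have "\<dots> = (\<Sum>k\<in>?S \<times> ?S. cis (fst (snd w) * of_int (fst k) - t * (of_int (fst k))\<^sup>2)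
        * cis (snd (snd w) * of_int (snd k) - (- t) * (of_int (snd k))\<^sup>2))"
      by (intro sum.cong refl) simp
    finally show ?thesis by (simp only: sum_product sum.cartesian_product case_prod_beta')
  qed
  have "(LINT \<zeta>|RZ2. indicator (freq_box (real M)) \<zeta> * cis (phase w \<zeta> - t * hyp \<zeta>)) = (LINT \<xi>|lborel. ?f \<xi>) * (LINT k|Z2. ?g k)"
    unfolding eq RZ2_eq by (rule P.integral_product[OF f g])
  then have "norm (LINT \<zeta>|RZ2. indicator (freq_box (real M)) \<zeta> * cis (phase w \<zeta> - t * hyp \<zeta>))
     = norm (LINT \<xi>|lborel. ?f \<xi>) * (norm (\<Sum>k\<in>?S. cis (fst (snd w) * of_int k - t * (of_int k)\<^sup>2)) * norm (\<Sum>k\<in>?S. cis (snd (snd w) * of_int k - (- t) * (of_int k)\<^sup>2)))"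
    by (simp only: gsum norm_mult)
  also have "\<dots> \<le> 48 / sqrt \<bar>t\<bar> * (48 / sqrt \<bar>t\<bar> * (48 / sqrt \<bar>t\<bar>))"
    using quadratic_integral_bound[OF t M, of "fst w"] quadratic_sum_symmetric[OF t M, of "fst (snd w)"]
      quadratic_sum_symmetric[of "- t" M "snd (snd w)"] t M
    by (intro mult_mono) (auto simp: scaleR_conv_of_real)
  also have "\<dots> = 48 ^ 3 / (sqrt \<bar>t\<bar>) ^ 3" by (simp add: power3_eq_cube)
  finally show ?thesis .
qed

section \<open>Interpolation and fractional integration\<close>

lemma nn_integral_powr_0:
  assumes "a > - 1" "c \<ge> 0"
  shows "(\<integral>\<^sup>+x. ennreal (x powr a) * indicator {0..c} x \<partial>lborel) = ennreal (c powr (a + 1) / (a + 1))"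
  by (rule nn_integral_has_integral_lebesgue'[OF _ has_integral_powr_from_0[OF assms]]) simp

text \<open>Marcinkiewicz interpolation between a bound from \<open>L\<^sup>1\<close> to bounded functions and a bound on energies,
  for a pair of dual exponents.  At the height \<open>l\<close> the function \<open>g\<close> is cut where
  \<open>l * norm (g x) powr (p - 1) = 2 * D * S\<close>: the image of the large part is then at most \<open>l / 2\<close>, so
  that only the image of the small part counts, and its level set is bounded by Chebyshev's
  inequality.\<close>

lemma dual_exponent_interpolation:
  fixes Z :: "'z measure" and U :: "('z \<Rightarrow> complex) \<Rightarrow> 'z \<Rightarrow> complex" and D S p r :: real
  assumes Z: "sigma_finite_measure Z" and p: "1 < p" "p < 2" and r: "r = p / (p - 1)"
    and meas: "\<And>h. integrable Z h \<Longrightarrow> U h \<in> borel_measurable Z"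
    and add: "\<And>h h' z. integrable Z h \<Longrightarrow> integrable Z h' \<Longrightarrow> U (\<lambda>x. h x + h' x) z = U h z + U h' z"
    and sup: "\<And>h z. integrable Z h \<Longrightarrow> ennreal (norm (U h z)) \<le> ennreal D * (\<integral>\<^sup>+x. ennreal (norm (h x)) \<partial>Z)"
    and l2: "\<And>h. integrable Z h \<Longrightarrow> energy Z (U h) \<le> A * energy Z h"
    and g: "integrable Z g" and S: "(\<integral>\<^sup>+x. ennreal (norm (g x) powr p) \<partial>Z) \<le> ennreal S"
    and pos: "D > 0" "S > 0"
  shows "(\<integral>\<^sup>+x. ennreal (norm (U g x) powr r) \<partial>Z) \<le> ennreal (4 * r / (r - 2) * (2 * D * S) powr (r - 2) * S) * A"
proof -
  interpret Z: sigma_finite_measure Z by fact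
  interpret LZ: pair_sigma_finite lborel Z by (intro pair_sigma_finite.intro sigma_finite_lborel Z)
  have [measurable]: "g \<in> borel_measurable Z" using g by auto
  have [measurable]: "U g \<in> borel_measurable Z" by (rule meas[OF g])
  have r2: "r > 2" using p unfolding r by (simp add: field_simps)
  have exps: "(p - 1) * (r - 2) = 2 - p" using p unfolding r by (simp add: field_simps)
  define c where "c = 2 * D * S"
  have c: "c > 0" using pos by (simp add: c_def)
  define small where "small l x = (if l * norm (g x) powr (p - 1) \<le> c then g x else 0)" for l x
  define large where "large l x = (if l * norm (g x) powr (p - 1) \<le> c then 0 else g x)" for l x
  have [measurable]: "small l \<in> borel_measurable Z" "large l \<in> borel_measurable Z" for l
    unfolding small_def large_def by measurable
  have int: "integrable Z (small l)" "integrable Z (large l)" for l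
    by (rule Bochner_Integration.integrable_bound[OF g]; auto simp: small_def large_def)+
  have split: "U g x = U (small l) x + U (large l) x" for l x
  proof -
    have "g = (\<lambda>x. small l x + large l x)" by (auto simp: small_def large_def)
    then show ?thesis using add[OF int(1) int(2)] by metis
  qed
  have large_bd: "norm (U (large l) x) \<le> l / 2" if l: "l > 0" for l x
  proof -
    have "(\<integral>\<^sup>+x. ennreal (norm (large l x)) \<partial>Z) \<le> (\<integral>\<^sup>+x. ennreal (l / c) * ennreal (norm (g x) powr p) \<partial>Z)"
    proof (intro nn_integral_mono)
      fix x
      have "norm (large l x) \<le> l / c * norm (g x) powr p"
      proof (cases "l * norm (g x) powr (p - 1) \<le> c")
        case False
        have "norm (g x) * c \<le> norm (g x) * (l * norm (g x) powr (p - 1))"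
          using False by (intro mult_left_mono) auto
        also have "\<dots> = l * norm (g x) powr p"
          using powr_mult_base[of "norm (g x)" "p - 1"] by (simp add: mult_ac)
        finally show ?thesis using False c by (simp add: large_def field_simps)
      qed (use c l in \<open>simp add: large_def\<close>)
      then show "ennreal (norm (large l x)) \<le> ennreal (l / c) * ennreal (norm (g x) powr p)"
        using c l by (simp add: ennreal_mult[symmetric] ennreal_leI)
    qed
    also have "\<dots> \<le> ennreal (l / c) * ennreal S"
      using S by (simp add: nn_integral_cmult mult_left_mono)
    finally have "ennreal (norm (U (large l) x)) \<le> ennreal D * (ennreal (l / c) * ennreal S)"
      using sup[OF int(2)[of l], of x] by (meson mult_left_mono order.trans zero_le)
    also have "\<dots> = ennreal (l / 2)"
      using pos l c by (simp add: ennreal_mult[symmetric] c_def)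
    finally show ?thesis using l by simp
  qed
  \<comment> \<open>the power \<open>r\<close> of the norm is integrated over its level sets, with this weight\<close>
  define w where "w l = ennreal (r * l powr (r - 1))" for l
  have [measurable]: "w \<in> borel_measurable borel" unfolding w_def by measurable
  have layer: "ennreal (u powr r) = (\<integral>\<^sup>+l. w l * indicator {0..u} l \<partial>lborel)" if "u \<ge> 0" for u
  proof -
    have "(\<integral>\<^sup>+l. w l * indicator {0..u} l \<partial>lborel) = (\<integral>\<^sup>+l. ennreal r * (ennreal (l powr (r - 1)) * indicator {0..u} l) \<partial>lborel)"
      using r2 by (intro nn_integral_cong) (simp add: w_def ennreal_mult mult.assoc)
    also have "\<dots> = ennreal r * ennreal (u powr (r - 1 + 1) / (r - 1 + 1))"
      using that r2 by (subst nn_integral_cmult) (auto simp: nn_integral_powr_0)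
    also have "\<dots> = ennreal (u powr r)" using r2 by (simp add: ennreal_mult[symmetric])
    finally show ?thesis by simp
  qed
  define v where "v l = ennreal (4 * r * l powr (r - 3))" for l
  have [measurable]: "v \<in> borel_measurable borel" unfolding v_def by measurable
  have level: "w l * (\<integral>\<^sup>+x. indicator {0..norm (U g x)} l \<partial>Z) \<le> v l * (A * energy Z (small l)) * indicator {0..} l" for l
  proof (cases "l > 0")
    case True
    have "(\<integral>\<^sup>+x. indicator {0..norm (U g x)} l \<partial>Z) \<le> (\<integral>\<^sup>+x. ennreal (4 / l\<^sup>2) * ennreal ((norm (U (small l) x))\<^sup>2) \<partial>Z)"
    proof (intro nn_integral_mono)
      fix x
      show "indicator {0..norm (U g x)} l \<le> ennreal (4 / l\<^sup>2) * ennreal ((norm (U (small l) x))\<^sup>2)"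
      proof (cases "l \<le> norm (U g x)")
        case le: True
        have "norm (U g x) \<le> norm (U (small l) x) + norm (U (large l) x)" unfolding split[of x l] by (rule norm_triangle_ineq)
        then have "l / 2 \<le> norm (U (small l) x)" using large_bd[OF True, of x] le by linarith
        then have "(l / 2)\<^sup>2 \<le> (norm (U (small l) x))\<^sup>2" using True by (intro power_mono) auto
        then have "1 \<le> 4 / l\<^sup>2 * (norm (U (small l) x))\<^sup>2" using True by (simp add: field_simps)
        then have "ennreal 1 \<le> ennreal (4 / l\<^sup>2 * (norm (U (small l) x))\<^sup>2)" by (rule ennreal_leI)
        also have "\<dots> = ennreal (4 / l\<^sup>2) * ennreal ((norm (U (small l) x))\<^sup>2)" by (rule ennreal_mult) auto
        finally show ?thesis using le True by (simp only: indicator_simps atLeastAtMost_iff less_imp_le simp_thms ennreal_1)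
      qed (simp add: indicator_def)
    qed
    also have "\<dots> = ennreal (4 / l\<^sup>2) * energy Z (U (small l))"
      unfolding energy_def using meas[OF int(1)] by (subst nn_integral_cmult) auto
    also have "\<dots> \<le> ennreal (4 / l\<^sup>2) * (A * energy Z (small l))"
      by (intro mult_left_mono l2 int) auto
    finally have "w l * (\<integral>\<^sup>+x. indicator {0..norm (U g x)} l \<partial>Z) \<le> w l * (ennreal (4 / l\<^sup>2) * (A * energy Z (small l)))"
      by (rule mult_left_mono) auto
    also have "\<dots> = v l * (A * energy Z (small l))"
    proof -
      have "l powr (r - 1) * (4 / l\<^sup>2) = 4 * l powr (r - 3)"
        using True powr_diff[of l "r - 1" 2] by (simp add: powr_numeral)
      then have "r * (l powr (r - 1) * (4 / l\<^sup>2)) = r * (4 * l powr (r - 3))" by (simp only:)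
      then have "r * l powr (r - 1) * (4 / l\<^sup>2) = 4 * r * l powr (r - 3)" by (simp only: mult_ac)
      then have "w l * ennreal (4 / l\<^sup>2) = v l"
        unfolding w_def v_def using r2 by (subst ennreal_mult[symmetric]) auto
      then show ?thesis by (simp only: mult.assoc[symmetric])
    qed
    finally show ?thesis using True by simp
  next
    case False
    then have "l = 0 \<or> l < 0" by auto
    then show ?thesis using r2 by (auto simp: w_def indicator_def)
  qed
  have "(\<integral>\<^sup>+x. ennreal (norm (U g x) powr r) \<partial>Z) = (\<integral>\<^sup>+x. \<integral>\<^sup>+l. w l * indicator {0..norm (U g x)} l \<partial>lborel \<partial>Z)"
    by (simp add: layer)
  also have "\<dots> = (\<integral>\<^sup>+l. \<integral>\<^sup>+x. w l * indicator {0..norm (U g x)} l \<partial>Z \<partial>lborel)"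
    by (rule LZ.Fubini') (simp add: indicator_def)
  also have "\<dots> = (\<integral>\<^sup>+l. w l * (\<integral>\<^sup>+x. indicator {0..norm (U g x)} l \<partial>Z) \<partial>lborel)"
    by (intro nn_integral_cong nn_integral_cmult) (simp add: indicator_def)
  also have "\<dots> \<le> (\<integral>\<^sup>+l. v l * (A * energy Z (small l)) * indicator {0..} l \<partial>lborel)"
    by (intro nn_integral_mono level)
  also have "\<dots> = (\<integral>\<^sup>+l. A * (\<integral>\<^sup>+x. v l * indicator {0..} l * ennreal ((norm (small l x))\<^sup>2) \<partial>Z) \<partial>lborel)"
    unfolding energy_def by (simp add: nn_integral_cmult mult_ac)
  also have "\<dots> = A * (\<integral>\<^sup>+l. \<integral>\<^sup>+x. v l * indicator {0..} l * ennreal ((norm (small l x))\<^sup>2) \<partial>Z \<partial>lborel)"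
    unfolding small_def by (intro nn_integral_cmult) measurable
  also have "(\<integral>\<^sup>+l. \<integral>\<^sup>+x. v l * indicator {0..} l * ennreal ((norm (small l x))\<^sup>2) \<partial>Z \<partial>lborel)
     = (\<integral>\<^sup>+x. \<integral>\<^sup>+l. v l * indicator {0..} l * ennreal ((norm (small l x))\<^sup>2) \<partial>lborel \<partial>Z)"
    unfolding small_def by (intro LZ.Fubini'[symmetric]) measurable
  also have "\<dots> \<le> (\<integral>\<^sup>+x. ennreal (4 * r / (r - 2) * c powr (r - 2)) * ennreal (norm (g x) powr p) \<partial>Z)"
  proof (intro nn_integral_mono)
    fix x
    show "(\<integral>\<^sup>+l. v l * indicator {0..} l * ennreal ((norm (small l x))\<^sup>2) \<partial>lborel)
       \<le> ennreal (4 * r / (r - 2) * c powr (r - 2)) * ennreal (norm (g x) powr p)"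
    proof (cases "g x = 0")
      case True
      then show ?thesis by (simp add: small_def)
    next
      case False
      define u where "u = norm (g x)"
      have u: "u > 0" using False by (simp add: u_def)
      define L where "L = c * u powr (1 - p)"
      have L: "L \<ge> 0" using c by (simp add: L_def)
      have iff: "l * u powr (p - 1) \<le> c \<longleftrightarrow> l \<le> L" for l
      proof -
        have "u powr (1 - p) = 1 / u powr (p - 1)" using powr_minus_divide[of u "p - 1"] by simp
        then show ?thesis unfolding L_def using u by (simp add: pos_le_divide_eq)
      qed
      have "(\<integral>\<^sup>+l. v l * indicator {0..} l * ennreal ((norm (small l x))\<^sup>2) \<partial>lborel)
         = (\<integral>\<^sup>+l. ennreal (4 * r * u\<^sup>2) * (ennreal (l powr (r - 3)) * indicator {0..L} l) \<partial>lborel)"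
        using r2 iff
        by (intro nn_integral_cong)
          (auto simp: small_def u_def[symmetric] v_def indicator_def ennreal_mult[symmetric] mult_ac)
      also have "\<dots> = ennreal (4 * r * u\<^sup>2) * ennreal (L powr (r - 3 + 1) / (r - 3 + 1))"
        using L r2 by (subst nn_integral_cmult) (auto simp: nn_integral_powr_0)
      also have "\<dots> = ennreal (4 * r / (r - 2) * (u\<^sup>2 * L powr (r - 2)))"
        using r2 by (simp add: ennreal_mult[symmetric] mult_ac)
      also have "u\<^sup>2 * L powr (r - 2) = c powr (r - 2) * u powr p"
      proof -
        have "L powr (r - 2) = c powr (r - 2) * u powr (- (2 - p))"
          unfolding L_def using c u exps by (simp add: powr_mult powr_powr algebra_simps)
        moreover have "u\<^sup>2 * u powr (- (2 - p)) = u powr p"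
          using u powr_add[of u 2 "- (2 - p)"] by (simp add: powr_numeral)
        ultimately show ?thesis by (simp add: mult_ac)
      qed
      finally show ?thesis unfolding u_def using r2 by (simp add: ennreal_mult[symmetric] mult_ac)
    qed
  qed
  also have "\<dots> \<le> ennreal (4 * r / (r - 2) * c powr (r - 2)) * ennreal S"
    using S by (simp add: nn_integral_cmult mult_left_mono)
  finally have "(\<integral>\<^sup>+x. ennreal (norm (U g x) powr r) \<partial>Z) \<le> A * (ennreal (4 * r / (r - 2) * c powr (r - 2)) * ennreal S)"
    by (simp add: mult_left_mono)
  then show ?thesis unfolding c_def using pos r2 by (simp add: ennreal_mult[symmetric] mult_ac)
qed

text \<open>Within the distance \<open>m\<close> of the singularity the weight is integrated in full; elsewhere it is at most
  \<open>m powr (- \<gamma>)\<close>.\<close>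

lemma riesz_potential_indicator:
  assumes g: "0 < \<gamma>" "\<gamma> < 1" and m: "m > 0"
    and [measurable]: "E \<in> sets borel" and E: "emeasure lborel E \<le> ennreal m"
  shows "(\<integral>\<^sup>+s. indicator E s * ennreal (\<bar>t - s\<bar> powr (- \<gamma>)) \<partial>lborel) \<le> ennreal ((2 / (1 - \<gamma>) + 1) * m powr (1 - \<gamma>))"
proof -
  define k where "k s = ennreal (s powr (- \<gamma>)) * indicator {0..m} s" for s :: real
  have [measurable]: "k \<in> borel_measurable borel" unfolding k_def by measurable
  have k_int: "(\<integral>\<^sup>+s. k s \<partial>lborel) = ennreal (m powr (1 - \<gamma>) / (1 - \<gamma>))"
    unfolding k_def using nn_integral_powr_0[of "- \<gamma>" m] g m by simp
  have "(\<integral>\<^sup>+s. indicator E s * ennreal (\<bar>t - s\<bar> powr (- \<gamma>)) \<partial>lborel)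
     \<le> (\<integral>\<^sup>+s. (k (- t + 1 * s) + k (t + (- 1) * s)) + ennreal (m powr (- \<gamma>)) * indicator E s \<partial>lborel)"
  proof (intro nn_integral_mono)
    fix s
    show "indicator E s * ennreal (\<bar>t - s\<bar> powr (- \<gamma>)) \<le> (k (- t + 1 * s) + k (t + (- 1) * s)) + ennreal (m powr (- \<gamma>)) * indicator E s"
    proof (cases "\<bar>t - s\<bar> \<le> m")
      case True
      then have "ennreal (\<bar>t - s\<bar> powr (- \<gamma>)) \<le> k (- t + 1 * s) + k (t + (- 1) * s)"
        by (cases "t \<le> s") (auto simp: k_def indicator_def)
      then show ?thesis by (auto simp: indicator_def intro: order.trans add_increasing2)
    next
      case False
      then have "\<bar>t - s\<bar> powr (- \<gamma>) \<le> m powr (- \<gamma>)" using m g by (intro powr_mono2') auto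
      then show ?thesis by (auto simp: indicator_def intro!: add_increasing ennreal_leI)
    qed
  qed
  also have "\<dots> = (\<integral>\<^sup>+s. k (- t + 1 * s) \<partial>lborel) + (\<integral>\<^sup>+s. k (t + (- 1) * s) \<partial>lborel) + ennreal (m powr (- \<gamma>)) * emeasure lborel E"
    by (simp add: nn_integral_add nn_integral_cmult)
  also have "(\<integral>\<^sup>+s. k (- t + 1 * s) \<partial>lborel) = (\<integral>\<^sup>+s. k s \<partial>lborel)"
    using nn_integral_real_affine[of k 1 "- t"] by simp
  also have "(\<integral>\<^sup>+s. k (t + (- 1) * s) \<partial>lborel) = (\<integral>\<^sup>+s. k s \<partial>lborel)"
    using nn_integral_real_affine[of k "- 1" t] by simp
  also have "(\<integral>\<^sup>+s. k s \<partial>lborel) + (\<integral>\<^sup>+s. k s \<partial>lborel) + ennreal (m powr (- \<gamma>)) * emeasure lborel E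
     \<le> ennreal (m powr (1 - \<gamma>) / (1 - \<gamma>)) + ennreal (m powr (1 - \<gamma>) / (1 - \<gamma>)) + ennreal (m powr (- \<gamma>)) * ennreal m"
    unfolding k_int by (intro add_left_mono mult_left_mono E) auto
  also have "\<dots> = ennreal (m powr (1 - \<gamma>) / (1 - \<gamma>) + m powr (1 - \<gamma>) / (1 - \<gamma>) + m powr (- \<gamma>) * m)"
  proof -
    have nn: "0 \<le> m powr (1 - \<gamma>) / (1 - \<gamma>)" "0 \<le> m powr (- \<gamma>)" "0 \<le> m" using g m by auto
    then show ?thesis by (simp only: ennreal_plus ennreal_mult add_nonneg_nonneg mult_nonneg_nonneg)
  qed
  also have "m powr (- \<gamma>) * m = m powr (1 - \<gamma>)"
    using m powr_mult_base[of m "- \<gamma>"] by (simp add: mult.commute)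
  also have "m powr (1 - \<gamma>) / (1 - \<gamma>) + m powr (1 - \<gamma>) / (1 - \<gamma>) + m powr (1 - \<gamma>) = (2 / (1 - \<gamma>) + 1) * m powr (1 - \<gamma>)"
    by (simp add: algebra_simps)
  finally show ?thesis .
qed

text \<open>By symmetry only the pairs with \<open>\<phi> s \<le> \<phi> t\<close> matter.  For those the inner integral is taken
  over the level sets of \<open>\<phi>\<close> at the heights up to \<open>\<phi> t\<close>, whose measure is bounded by Chebyshev's
  inequality; \<open>\<gamma>\<close> is the exponent for which the result is a power \<open>p - 1\<close> of \<open>\<phi> t\<close>.\<close>

lemma hardy_littlewood_sobolev_quadratic:
  fixes \<phi> :: "real \<Rightarrow> real"
  assumes [measurable]: "\<phi> \<in> borel_measurable borel" and nn: "\<And>t. \<phi> t \<ge> 0"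
    and p: "1 < p" "p < 2" and V: "V > 0" and le: "(\<integral>\<^sup>+t. ennreal (\<phi> t powr p) \<partial>lborel) \<le> ennreal V"
    and \<gamma>: "\<gamma> = 2 - 2 / p"
  shows "(\<integral>\<^sup>+t. \<integral>\<^sup>+s. ennreal (\<phi> t * \<phi> s * \<bar>t - s\<bar> powr (- \<gamma>)) \<partial>lborel \<partial>lborel)
     \<le> ennreal (2 * (2 / (1 - \<gamma>) + 1) / (p - 1) * V powr (2 / p))"
proof -
  have g: "0 < \<gamma>" "\<gamma> < 1" using p unfolding \<gamma> by (auto simp: field_simps)
  have exps: "p * (1 - \<gamma>) = 2 - p" using p unfolding \<gamma> by (simp add: field_simps)
  define C where "C = 2 / (1 - \<gamma>) + 1"
  have C: "C > 0" using g by (simp add: C_def add_pos_pos)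
  define k where "k t s = ennreal (\<bar>t - s\<bar> powr (- \<gamma>))" for t s :: real
  have [measurable]: "case_prod k \<in> borel_measurable (borel \<Otimes>\<^sub>M borel)" unfolding k_def by measurable
  have [measurable]: "k t \<in> borel_measurable borel" for t unfolding k_def by measurable
  have cheb: "(\<integral>\<^sup>+s. indicator {s. b \<le> \<phi> s} s * k t s \<partial>lborel) \<le> ennreal (C * V powr (1 - \<gamma>) * b powr (p - 2))"
    if b: "b > 0" for b t
  proof -
    have "emeasure lborel {s. b \<le> \<phi> s} = (\<integral>\<^sup>+s. indicator {s. b \<le> \<phi> s} s \<partial>lborel)" by simp
    also have "\<dots> \<le> (\<integral>\<^sup>+s. ennreal (b powr (- p)) * ennreal (\<phi> s powr p) \<partial>lborel)"
    proof (intro nn_integral_mono)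
      fix s
      have "1 \<le> b powr (- p) * \<phi> s powr p" if "b \<le> \<phi> s"
      proof -
        have "b powr p \<le> \<phi> s powr p" using that b p by (intro powr_mono2) auto
        then have "b powr (- p) * b powr p \<le> b powr (- p) * \<phi> s powr p" by (intro mult_left_mono) auto
        moreover have "b powr (- p) * b powr p = 1" using b powr_add[of b "- p" p] by simp
        ultimately show ?thesis by (simp only:)
      qed
      from ennreal_leI[OF this]
      show "indicator {s. b \<le> \<phi> s} s \<le> ennreal (b powr (- p)) * ennreal (\<phi> s powr p)"
        by (auto simp: indicator_def ennreal_mult)
    qed
    also have "\<dots> \<le> ennreal (b powr (- p)) * ennreal V" using le by (simp add: nn_integral_cmult mult_left_mono)
    also have "\<dots> = ennreal (V * b powr (- p))" using V by (simp add: ennreal_mult[symmetric] mult.commute)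
    finally have "(\<integral>\<^sup>+s. indicator {s. b \<le> \<phi> s} s * k t s \<partial>lborel) \<le> ennreal (C * (V * b powr (- p)) powr (1 - \<gamma>))"
      unfolding k_def C_def using g V b by (intro riesz_potential_indicator) auto
    also have "(V * b powr (- p)) powr (1 - \<gamma>) = V powr (1 - \<gamma>) * b powr (p - 2)"
    proof -
      have "- p * (1 - \<gamma>) = p - 2" using exps by simp
      then show ?thesis using V b by (simp only: powr_mult powr_powr powr_ge_zero less_imp_le)
    qed
    finally show ?thesis by (simp add: mult.assoc)
  qed
  have inner: "(\<integral>\<^sup>+s. ennreal (\<phi> s) * (if \<phi> s \<le> \<phi> t then k t s else 0) \<partial>lborel) \<le> ennreal (C * V powr (1 - \<gamma>) / (p - 1) * \<phi> t powr (p - 1))" for t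
  proof -
    have "(\<integral>\<^sup>+s. ennreal (\<phi> s) * (if \<phi> s \<le> \<phi> t then k t s else 0) \<partial>lborel)
      \<le> (\<integral>\<^sup>+s. \<integral>\<^sup>+b. indicator {0..\<phi> t} b * (indicator {s. b \<le> \<phi> s} s * k t s) \<partial>lborel \<partial>lborel)"
    proof (intro nn_integral_mono)
      fix s
      show "ennreal (\<phi> s) * (if \<phi> s \<le> \<phi> t then k t s else 0) \<le> (\<integral>\<^sup>+b. indicator {0..\<phi> t} b * (indicator {s. b \<le> \<phi> s} s * k t s) \<partial>lborel)"
      proof (cases "\<phi> s \<le> \<phi> t")
        case True
        have "ennreal (\<phi> s) * k t s = (\<integral>\<^sup>+b. indicator {0..\<phi> s} b * k t s \<partial>lborel)"
          using nn[of s] by (subst nn_integral_multc) auto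
        also have "\<dots> \<le> (\<integral>\<^sup>+b. indicator {0..\<phi> t} b * (indicator {s. b \<le> \<phi> s} s * k t s) \<partial>lborel)"
          using True by (intro nn_integral_mono) (auto simp: indicator_def)
        finally show ?thesis using True by simp
      qed simp
    qed
    also have "\<dots> = (\<integral>\<^sup>+b. \<integral>\<^sup>+s. indicator {0..\<phi> t} b * (indicator {s. b \<le> \<phi> s} s * k t s) \<partial>lborel \<partial>lborel)"
      by (rule lborel_pair.Fubini'[symmetric]) (simp add: indicator_def)
    also have "\<dots> \<le> (\<integral>\<^sup>+b. ennreal (C * V powr (1 - \<gamma>)) * (ennreal (b powr (p - 2)) * indicator {0..\<phi> t} b) \<partial>lborel)"
    proof (intro nn_integral_mono_AE)
      have "AE b in lborel. b \<noteq> (0::real)" by (rule AE_lborel_singleton)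
      then show "AE b in lborel. (\<integral>\<^sup>+s. indicator {0..\<phi> t} b * (indicator {s. b \<le> \<phi> s} s * k t s) \<partial>lborel)
          \<le> ennreal (C * V powr (1 - \<gamma>)) * (ennreal (b powr (p - 2)) * indicator {0..\<phi> t} b)"
      proof eventually_elim
        fix b :: real assume "b \<noteq> 0"
        then show "(\<integral>\<^sup>+s. indicator {0..\<phi> t} b * (indicator {s. b \<le> \<phi> s} s * k t s) \<partial>lborel)
          \<le> ennreal (C * V powr (1 - \<gamma>)) * (ennreal (b powr (p - 2)) * indicator {0..\<phi> t} b)"
          using cheb[of b t] C by (cases "b \<in> {0..\<phi> t}") (auto simp: ennreal_mult)
      qed
    qed
    also have "\<dots> = ennreal (C * V powr (1 - \<gamma>)) * ennreal (\<phi> t powr (p - 2 + 1) / (p - 2 + 1))"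
      using p nn by (subst nn_integral_cmult) (auto simp: nn_integral_powr_0)
    also have "\<dots> = ennreal (C * V powr (1 - \<gamma>) / (p - 1) * \<phi> t powr (p - 1))"
      using C p by (simp add: ennreal_mult[symmetric])
    finally show ?thesis .
  qed
  define h where "h t s = ennreal (\<phi> t) * (ennreal (\<phi> s) * (if \<phi> s \<le> \<phi> t then k t s else 0))" for t s
  have [measurable]: "case_prod h \<in> borel_measurable (borel \<Otimes>\<^sub>M borel)"
    unfolding h_def k_def by measurable
  have half: "(\<integral>\<^sup>+t. \<integral>\<^sup>+s. h t s \<partial>lborel \<partial>lborel) \<le> ennreal (C / (p - 1) * V powr (2 / p))"
  proof -
    have "(\<integral>\<^sup>+t. \<integral>\<^sup>+s. h t s \<partial>lborel \<partial>lborel) = (\<integral>\<^sup>+t. ennreal (\<phi> t) * (\<integral>\<^sup>+s. ennreal (\<phi> s) * (if \<phi> s \<le> \<phi> t then k t s else 0) \<partial>lborel) \<partial>lborel)"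
      unfolding h_def by (intro nn_integral_cong nn_integral_cmult) measurable
    also have "\<dots> \<le> (\<integral>\<^sup>+t. ennreal (\<phi> t) * ennreal (C * V powr (1 - \<gamma>) / (p - 1) * \<phi> t powr (p - 1)) \<partial>lborel)"
      by (intro nn_integral_mono mult_left_mono inner) auto
    also have "\<dots> = (\<integral>\<^sup>+t. ennreal (C * V powr (1 - \<gamma>) / (p - 1)) * ennreal (\<phi> t powr p) \<partial>lborel)"
    proof (intro nn_integral_cong)
      fix t
      have "\<phi> t * (C * V powr (1 - \<gamma>) / (p - 1) * \<phi> t powr (p - 1)) = C * V powr (1 - \<gamma>) / (p - 1) * \<phi> t powr p"
        using powr_mult_base[OF nn, of t "p - 1"] by (simp add: mult_ac)
      then show "ennreal (\<phi> t) * ennreal (C * V powr (1 - \<gamma>) / (p - 1) * \<phi> t powr (p - 1)) = ennreal (C * V powr (1 - \<gamma>) / (p - 1)) * ennreal (\<phi> t powr p)"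
        using C p nn by (simp only: ennreal_mult[symmetric] mult_nonneg_nonneg divide_nonneg_nonneg powr_ge_zero less_imp_le diff_ge_0_iff_ge)
    qed
    also have "\<dots> \<le> ennreal (C * V powr (1 - \<gamma>) / (p - 1)) * ennreal V"
      using le by (simp add: nn_integral_cmult mult_left_mono)
    also have "\<dots> = ennreal (C / (p - 1) * (V * V powr (1 - \<gamma>)))"
      using C p V by (simp add: ennreal_mult[symmetric] mult_ac)
    also have "V * V powr (1 - \<gamma>) = V powr (2 / p)"
      using powr_mult_base[of V "1 - \<gamma>"] V unfolding \<gamma> by simp
    finally show ?thesis .
  qed
  have "(\<integral>\<^sup>+t. \<integral>\<^sup>+s. ennreal (\<phi> t * \<phi> s * \<bar>t - s\<bar> powr (- \<gamma>)) \<partial>lborel \<partial>lborel) \<le> (\<integral>\<^sup>+t. \<integral>\<^sup>+s. h t s + h s t \<partial>lborel \<partial>lborel)"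
  proof (intro nn_integral_mono)
    fix t s
    have eq: "ennreal (\<phi> t * \<phi> s * \<bar>t - s\<bar> powr (- \<gamma>)) = ennreal (\<phi> t) * (ennreal (\<phi> s) * k t s)"
      using nn by (simp add: k_def ennreal_mult[symmetric] mult.assoc)
    have sym: "k s t = k t s" by (simp add: k_def abs_minus_commute)
    show "ennreal (\<phi> t * \<phi> s * \<bar>t - s\<bar> powr (- \<gamma>)) \<le> h t s + h s t"
      unfolding eq by (cases "\<phi> s \<le> \<phi> t") (auto simp: h_def sym mult.left_commute)
  qed
  also have "\<dots> = (\<integral>\<^sup>+t. \<integral>\<^sup>+s. h t s \<partial>lborel \<partial>lborel) + (\<integral>\<^sup>+t. \<integral>\<^sup>+s. h s t \<partial>lborel \<partial>lborel)"
    by (simp add: nn_integral_add)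
  also have "(\<integral>\<^sup>+t. \<integral>\<^sup>+s. h s t \<partial>lborel \<partial>lborel) = (\<integral>\<^sup>+t. \<integral>\<^sup>+s. h t s \<partial>lborel \<partial>lborel)"
    by (rule lborel_pair.Fubini') simp
  also have "(\<integral>\<^sup>+t. \<integral>\<^sup>+s. h t s \<partial>lborel \<partial>lborel) + (\<integral>\<^sup>+t. \<integral>\<^sup>+s. h t s \<partial>lborel \<partial>lborel) \<le> ennreal (C / (p - 1) * V powr (2 / p)) + ennreal (C / (p - 1) * V powr (2 / p))"
    by (intro add_mono half)
  also have "\<dots> = ennreal (2 * C / (p - 1) * V powr (2 / p))"
    using C p by (subst ennreal_plus[symmetric]) auto
  finally show ?thesis unfolding C_def .
qed

text \<open>Young's inequality for the two factors divided by their norms.\<close>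

lemma holder_nn_integral:
  fixes f g :: "'a \<Rightarrow> real"
  assumes [measurable]: "f \<in> borel_measurable M" "g \<in> borel_measurable M"
    and nn: "\<And>x. f x \<ge> 0" "\<And>x. g x \<ge> 0" and pq: "p > 1" "q > 1" "1 / p + 1 / q = 1"
    and X: "X > 0" "(\<integral>\<^sup>+x. ennreal (f x powr p) \<partial>M) \<le> ennreal X"
    and Y: "Y > 0" "(\<integral>\<^sup>+x. ennreal (g x powr q) \<partial>M) \<le> ennreal Y"
  shows "(\<integral>\<^sup>+x. ennreal (f x * g x) \<partial>M) \<le> ennreal (X powr (1 / p) * Y powr (1 / q))"
proof -
  define a b where "a = X powr (1 / p)" and "b = Y powr (1 / q)"
  have ab: "a > 0" "b > 0" "a powr p = X" "b powr q = Y"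
    using X Y pq by (auto simp: a_def b_def powr_powr)
  have "(\<integral>\<^sup>+x. ennreal (f x * g x) \<partial>M)
     \<le> (\<integral>\<^sup>+x. ennreal (a * b / p / X) * ennreal (f x powr p) + ennreal (a * b / q / Y) * ennreal (g x powr q) \<partial>M)"
  proof (intro nn_integral_mono)
    fix x
    have "f x / a * (g x / b) \<le> (f x / a) powr p / p + (g x / b) powr q / q"
      using Youngs_inequality[of p q "f x / a" "g x / b"] pq nn ab by simp
    then have "f x / a * (g x / b) \<le> f x powr p / X / p + g x powr q / Y / q"
      using ab nn by (simp add: powr_divide)
    then have "a * b * (f x / a * (g x / b)) \<le> a * b * (f x powr p / X / p + g x powr q / Y / q)"
      using ab by (intro mult_left_mono) auto
    then have "f x * g x \<le> a * b / p / X * f x powr p + a * b / q / Y * g x powr q"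
      using ab by (simp add: field_simps)
    then show "ennreal (f x * g x) \<le> ennreal (a * b / p / X) * ennreal (f x powr p) + ennreal (a * b / q / Y) * ennreal (g x powr q)"
      using ab pq X Y by (subst (1 2) ennreal_mult[symmetric]) (auto intro!: ennreal_le_add)
  qed
  also have "\<dots> \<le> ennreal (a * b / p / X) * ennreal X + ennreal (a * b / q / Y) * ennreal Y"
    using X Y by (simp add: nn_integral_add nn_integral_cmult add_mono mult_left_mono)
  also have "\<dots> = ennreal (a * b / p + a * b / q)"
    using X Y ab pq by (simp add: ennreal_mult[symmetric])
  also have "a * b / p + a * b / q = a * b * (1 / p + 1 / q)" by (simp add: algebra_simps)
  finally show ?thesis unfolding pq(3) a_def b_def by simp
qed

section \<open>The extension operator\<close>

text \<open>The Fourier extension operator of the quadric that is the graph of \<open>hyp\<close>, as a function of time and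
  position.\<close>

definition ext :: "(real \<times> int \<times> int \<Rightarrow> complex) \<Rightarrow> real \<Rightarrow> real \<times> real \<times> real \<Rightarrow> complex" where
  "ext F t z = (LINT \<zeta>|RZ2. F \<zeta> * cis (phase z \<zeta> - t * hyp \<zeta>))"

text \<open>Boxes are used instead of balls because sums and integrals over boxes factor.\<close>

definition band :: "nat \<Rightarrow> (real \<times> int \<times> int \<Rightarrow> complex) set" where
  "band M = {F \<in> borel_measurable RZ2. (\<forall>\<zeta>. \<zeta> \<notin> freq_box (real M) \<longrightarrow> F \<zeta> = 0) \<and> energy RZ2 F \<le> 1}"

lemma measurable_hyp' [measurable (raw)]:
  "g \<in> measurable M RZ2 \<Longrightarrow> (\<lambda>x. hyp (g x)) \<in> borel_measurable M"
  by (rule measurable_compose[OF _ measurable_hyp])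

lemma measurable_ext [measurable (raw)]:
  assumes [measurable]: "F \<in> borel_measurable RZ2" "f \<in> borel_measurable M" "g \<in> measurable M RT2"
  shows "(\<lambda>x. ext F (f x) (g x)) \<in> borel_measurable M"
proof -
  interpret sigma_finite_measure RZ2 by (rule sigma_finite_RZ2)
  show ?thesis unfolding ext_def by measurable
qed

definition box_volume :: "nat \<Rightarrow> real" where "box_volume M = 2 * real M * (2 * real M + 1)\<^sup>2"

lemma emeasure_box: "emeasure RZ2 (freq_box (real M)) = ennreal (box_volume M)"
  by (simp add: emeasure_freq_box box_volume_def)

lemma band_L1:
  assumes F: "F \<in> band M"
  shows "integrable RZ2 F" "(LINT \<zeta>|RZ2. norm (F \<zeta>)) \<le> sqrt (box_volume M)"
proof -
  have [measurable]: "F \<in> borel_measurable RZ2" and supp: "\<And>\<zeta>. \<zeta> \<notin> freq_box (real M) \<Longrightarrow> F \<zeta> = 0"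
    and en: "energy RZ2 F \<le> 1" using F by (auto simp: band_def)
  have v0: "0 \<le> box_volume M" by (simp add: box_volume_def)
  have "(\<integral>\<^sup>+\<zeta>. ennreal (norm (F \<zeta>)) \<partial>RZ2)\<^sup>2 = (\<integral>\<^sup>+\<zeta>. ennreal (norm (F \<zeta>)) * indicator (freq_box (real M)) \<zeta> \<partial>RZ2)\<^sup>2"
    using supp by (intro arg_cong[where f = "\<lambda>x. x\<^sup>2"] nn_integral_cong) (auto simp: indicator_def)
  also have "\<dots> \<le> (\<integral>\<^sup>+\<zeta>. (ennreal (norm (F \<zeta>)))\<^sup>2 \<partial>RZ2) * (\<integral>\<^sup>+\<zeta>. (indicator (freq_box (real M)) \<zeta>)\<^sup>2 \<partial>RZ2)"
    by (rule Cauchy_Schwarz_nn_integral) auto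
  also have "(\<integral>\<^sup>+\<zeta>. (indicator (freq_box (real M)) \<zeta>)\<^sup>2 \<partial>RZ2) = (\<integral>\<^sup>+\<zeta>. indicator (freq_box (real M)) \<zeta> \<partial>RZ2)"
    by (intro nn_integral_cong) (auto simp: indicator_def)
  also have "\<dots> = ennreal (box_volume M)" by (simp add: emeasure_box)
  also have "(\<integral>\<^sup>+\<zeta>. (ennreal (norm (F \<zeta>)))\<^sup>2 \<partial>RZ2) = energy RZ2 F"
    unfolding energy_def by (simp add: ennreal_power)
  also have "energy RZ2 F * ennreal (box_volume M) \<le> 1 * ennreal (box_volume M)"
    by (intro mult_right_mono en) auto
  finally have *: "(\<integral>\<^sup>+\<zeta>. ennreal (norm (F \<zeta>)) \<partial>RZ2)\<^sup>2 \<le> ennreal (box_volume M)" by simp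
  have "(\<integral>\<^sup>+\<zeta>. ennreal (norm (F \<zeta>)) \<partial>RZ2) \<noteq> \<infinity>"
    using * by (auto simp: top_unique)
  then show int: "integrable RZ2 F" by (intro integrableI_bounded) (auto simp: less_top)
  have "(\<integral>\<^sup>+\<zeta>. ennreal (norm (F \<zeta>)) \<partial>RZ2) = ennreal (LINT \<zeta>|RZ2. norm (F \<zeta>))"
    using int by (intro nn_integral_eq_integral) auto
  with * have "ennreal ((LINT \<zeta>|RZ2. norm (F \<zeta>))\<^sup>2) \<le> ennreal (box_volume M)"
    by (simp add: ennreal_power)
  then have "(LINT \<zeta>|RZ2. norm (F \<zeta>))\<^sup>2 \<le> box_volume M" using v0 by simp
  then show "(LINT \<zeta>|RZ2. norm (F \<zeta>)) \<le> sqrt (box_volume M)" by (rule real_le_rsqrt)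
qed

lemma ext_bound:
  assumes F: "F \<in> band M"
  shows "norm (ext F t z) \<le> sqrt (box_volume M)"
  unfolding ext_def
  by (rule order.trans[OF Bochner_Integration.integral_norm_bound]) (use band_L1(2)[OF F] in \<open>simp add: norm_mult\<close>)

definition box_support :: "nat \<Rightarrow> (int \<times> int) set" where "box_support M = {-int M..int M} \<times> {-int M..int M}"

lemma not_in_box_support: "k \<notin> box_support M \<Longrightarrow> (\<xi>, k) \<notin> freq_box (real M)"
  by (auto simp: box_support_def freq_box_def)

lemma finite_box_support: "finite (box_support M)" by (simp add: box_support_def)

lemma ext_synthesis: "ext F t z = (LINT \<zeta>|RZ2. (F \<zeta> * cis (- t * hyp \<zeta>)) * cis (phase z \<zeta>))"
  unfolding ext_def by (simp add: mult.assoc cis_mult add.commute)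

lemma energy_ext_le:
  assumes F: "integrable RZ2 F" and supp: "\<And>\<zeta>. \<zeta> \<notin> freq_box (real M) \<Longrightarrow> F \<zeta> = 0"
  shows "energy RT2 (ext F t) \<le> ennreal ((2 * pi) ^ 3) * energy RZ2 F"
proof -
  have [measurable]: "F \<in> borel_measurable RZ2" using F by auto
  have "energy RT2 (ext F t) \<le> ennreal ((2 * pi) ^ 3) * (\<integral>\<^sup>+\<zeta>. ennreal ((norm (F \<zeta> * cis (- t * hyp \<zeta>)))\<^sup>2) \<partial>RZ2)"
    unfolding energy_def ext_synthesis
  proof (rule bessel_synthesis[OF _ finite_box_support[of M]])
    show "integrable RZ2 (\<lambda>\<zeta>. F \<zeta> * cis (- t * hyp \<zeta>))"
      by (rule Bochner_Integration.integrable_bound[OF F]) (auto simp: norm_mult)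
  qed (use supp not_in_box_support in auto)
  then show ?thesis by (simp add: energy_def norm_mult)
qed

lemma energy_ext:
  assumes F: "F \<in> band M"
  shows "energy RT2 (ext F t) \<le> ennreal ((2 * pi) ^ 3)"
proof -
  have "energy RT2 (ext F t) \<le> ennreal ((2 * pi) ^ 3) * energy RZ2 F"
    using F band_L1(1)[OF F] by (intro energy_ext_le) (auto simp: band_def)
  also have "\<dots> \<le> ennreal ((2 * pi) ^ 3) * 1" using F by (intro mult_left_mono) (auto simp: band_def)
  finally show ?thesis by simp
qed

section \<open>The dispersive inequality at a fixed time\<close>

definition fourier_raw :: "(real \<times> real \<times> real \<Rightarrow> complex) \<Rightarrow> real \<times> int \<times> int \<Rightarrow> complex" where
  "fourier_raw g \<zeta> = (LINT z|RT2. g z * cis (- phase z \<zeta>))"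

text \<open>A multiple of the propagator for the time \<open>\<tau>\<close>, restricted to the frequencies in a box and applied to
  the function \<open>g\<close> itself, not to its transform.\<close>

definition box_propagator :: "nat \<Rightarrow> real \<Rightarrow> (real \<times> real \<times> real \<Rightarrow> complex) \<Rightarrow> real \<times> real \<times> real \<Rightarrow> complex" where
  "box_propagator M \<tau> g = ext (\<lambda>\<zeta>. indicator (freq_box (real M)) \<zeta> * fourier_raw g \<zeta>) \<tau>"

lemma measurable_fourier_raw [measurable]:
  assumes [measurable]: "g \<in> borel_measurable RT2"
  shows "fourier_raw g \<in> borel_measurable RZ2"
proof -
  interpret sigma_finite_measure RT2 by (rule sigma_finite_RT2)
  show ?thesis unfolding fourier_raw_def[abs_def] by measurable
qed

lemma integrable_times_cis:
  assumes "integrable M g" and [measurable]: "f \<in> borel_measurable M"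
  shows "integrable M (\<lambda>x. g x * cis (f x))"
proof -
  have [measurable]: "g \<in> borel_measurable M" using assms(1) by auto
  show ?thesis by (rule Bochner_Integration.integrable_bound[OF assms(1)]) (auto simp: norm_mult)
qed

lemma fourier_raw_bound: "norm (fourier_raw g \<zeta>) \<le> (LINT z|RT2. norm (g z))"
  unfolding fourier_raw_def by (rule order.trans[OF Bochner_Integration.integral_norm_bound]) (simp add: norm_mult)

lemma fourier_raw_add:
  "integrable RT2 g \<Longrightarrow> integrable RT2 h \<Longrightarrow> fourier_raw (\<lambda>z. g z + h z) \<zeta> = fourier_raw g \<zeta> + fourier_raw h \<zeta>"
  unfolding fourier_raw_def distrib_right
  by (rule Bochner_Integration.integral_add) (auto intro!: integrable_times_cis)

lemma integrable_box_fourier: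
  assumes g: "integrable RT2 g"
  shows "integrable RZ2 (\<lambda>\<zeta>. indicator (freq_box (real M)) \<zeta> * fourier_raw g \<zeta>)"
proof (rule integrable_on_freq_box[of _ "real M" "LINT z|RT2. norm (g z)"])
  have [measurable]: "g \<in> borel_measurable RT2" using g by auto
  show "(\<lambda>\<zeta>. indicator (freq_box (real M)) \<zeta> * fourier_raw g \<zeta>) \<in> borel_measurable RZ2" by measurable
  show "norm (indicator (freq_box (real M)) \<zeta> * fourier_raw g \<zeta>) \<le> (LINT z|RT2. norm (g z))" for \<zeta>
    using fourier_raw_bound[of g \<zeta>] by (auto simp: indicator_def norm_mult)
qed auto

lemma phase_diff: "phase z \<zeta> - phase z' \<zeta> = phase (z - z') \<zeta>"
  by (simp add: phase_eq algebra_simps)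

lemma box_propagator_sup:
  assumes g: "integrable RT2 g" and t: "0 < \<bar>\<tau>\<bar>" "\<bar>\<tau>\<bar> * (8 * real M) \<le> 1" and M: "M \<ge> 1"
  shows "ennreal (norm (box_propagator M \<tau> g z)) \<le> ennreal (48 ^ 3 / (sqrt \<bar>\<tau>\<bar>) ^ 3) * (\<integral>\<^sup>+z. ennreal (norm (g z)) \<partial>RT2)"
proof -
  interpret P: pair_sigma_finite RZ2 RT2
    by (intro pair_sigma_finite.intro sigma_finite_RZ2 sigma_finite_RT2)
  have [measurable]: "g \<in> borel_measurable RT2" using g by auto
  let ?I = "\<lambda>\<zeta>. indicator (freq_box (real M)) \<zeta> :: complex"
  let ?f = "\<lambda>\<zeta> z'. ?I \<zeta> * cis (phase z \<zeta> - \<tau> * hyp \<zeta>) * (g z' * cis (- phase z' \<zeta>))"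
  have I: "integrable RZ2 ?I"
    by (rule integrable_on_freq_box[of _ "real M" 1]) (auto simp: indicator_def)
  have int: "integrable (RZ2 \<Otimes>\<^sub>M RT2) (case_prod ?f)"
  proof (rule Bochner_Integration.integrable_bound[OF P.integrable_product[OF I g]])
    show "case_prod ?f \<in> borel_measurable (RZ2 \<Otimes>\<^sub>M RT2)" by measurable
  qed (auto simp: norm_mult)
  have "box_propagator M \<tau> g z = (LINT \<zeta>|RZ2. LINT z'|RT2. ?f \<zeta> z')"
    unfolding box_propagator_def ext_def fourier_raw_def
    by (intro Bochner_Integration.integral_cong refl) (simp only: integral_mult_right_zero, simp only: mult_ac)
  also have "\<dots> = (LINT z'|RT2. LINT \<zeta>|RZ2. ?f \<zeta> z')"
    by (rule P.Fubini_integral[symmetric]) (rule int)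
  also have "\<dots> = (LINT z'|RT2. g z' * (LINT \<zeta>|RZ2. ?I \<zeta> * cis (phase (z - z') \<zeta> - \<tau> * hyp \<zeta>)))"
  proof (intro Bochner_Integration.integral_cong refl)
    fix z'
    have "?f \<zeta> z' = g z' * (?I \<zeta> * cis (phase (z - z') \<zeta> - \<tau> * hyp \<zeta>))" for \<zeta>
      unfolding phase_diff[symmetric] by (simp add: cis_mult mult_ac algebra_simps)
    then show "(LINT \<zeta>|RZ2. ?f \<zeta> z') = g z' * (LINT \<zeta>|RZ2. ?I \<zeta> * cis (phase (z - z') \<zeta> - \<tau> * hyp \<zeta>))"
      by (simp only: integral_mult_right_zero)
  qed
  finally have "ennreal (norm (box_propagator M \<tau> g z))
     \<le> (\<integral>\<^sup>+z'. ennreal (norm (g z' * (LINT \<zeta>|RZ2. ?I \<zeta> * cis (phase (z - z') \<zeta> - \<tau> * hyp \<zeta>)))) \<partial>RT2)"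
    by (simp add: norm_integral_le_nn_integral)
  also have "\<dots> \<le> (\<integral>\<^sup>+z'. ennreal (48 ^ 3 / (sqrt \<bar>\<tau>\<bar>) ^ 3) * ennreal (norm (g z')) \<partial>RT2)"
  proof (intro nn_integral_mono)
    fix z'
    have "norm (g z' * (LINT \<zeta>|RZ2. ?I \<zeta> * cis (phase (z - z') \<zeta> - \<tau> * hyp \<zeta>))) \<le> 48 ^ 3 / (sqrt \<bar>\<tau>\<bar>) ^ 3 * norm (g z')"
      unfolding norm_mult by (subst mult.commute) (intro mult_right_mono kernel_bound[OF t M] norm_ge_zero)
    then show "ennreal (norm (g z' * (LINT \<zeta>|RZ2. ?I \<zeta> * cis (phase (z - z') \<zeta> - \<tau> * hyp \<zeta>)))) \<le> ennreal (48 ^ 3 / (sqrt \<bar>\<tau>\<bar>) ^ 3) * ennreal (norm (g z'))"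
      by (simp add: ennreal_mult'[symmetric] ennreal_leI)
  qed
  also have "\<dots> = ennreal (48 ^ 3 / (sqrt \<bar>\<tau>\<bar>) ^ 3) * (\<integral>\<^sup>+z. ennreal (norm (g z)) \<partial>RT2)"
    by (simp add: nn_integral_cmult)
  finally show ?thesis .
qed

lemma box_propagator_energy:
  assumes g: "integrable RT2 g"
  shows "energy RT2 (box_propagator M \<tau> g) \<le> ennreal ((2 * pi) ^ 6) * energy RT2 g"
proof -
  have [measurable]: "g \<in> borel_measurable RT2" using g by auto
  let ?H = "\<lambda>\<zeta>. indicator (freq_box (real M)) \<zeta> * fourier_raw g \<zeta>"
  have "energy RT2 (box_propagator M \<tau> g) \<le> ennreal ((2 * pi) ^ 3) * energy RZ2 ?H"
    unfolding box_propagator_def by (rule energy_ext_le[OF integrable_box_fourier[OF g], of M]) auto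
  also have "energy RZ2 ?H \<le> energy RZ2 (fourier_raw g)"
    unfolding energy_def by (intro nn_integral_mono ennreal_leI) (auto simp: indicator_def)
  also have "\<dots> \<le> ennreal ((2 * pi) ^ 3) * energy RT2 g"
    unfolding energy_def fourier_raw_def by (rule bessel_analysis[OF g])
  finally have "energy RT2 (box_propagator M \<tau> g) \<le> ennreal ((2 * pi) ^ 3) * (ennreal ((2 * pi) ^ 3) * energy RT2 g)"
    by (simp add: mult_left_mono)
  also have "\<dots> = ennreal ((2 * pi) ^ 6) * energy RT2 g"
    by (subst mult.assoc[symmetric], subst ennreal_mult[symmetric]) (simp_all add: power_add[symmetric])
  finally show ?thesis .
qed

text \<open>Interpolation between the decay \<open>\<bar>\<tau>\<bar> powr (- 3/2)\<close> of the kernel and the boundedness on energies.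
  The exponents 10/7 and 10/3 are dual and retain the share 2/5 of the decay, that is,
  \<open>\<bar>\<tau>\<bar> powr (- 3/5)\<close>.  Only the pairing of two functions enters the \<open>TT*\<close> argument.\<close>

lemma dispersive_dual:
  obtains C where "C > 0"
    "\<And>M \<tau> g (h :: real \<times> real \<times> real \<Rightarrow> complex) Sg Sh. M \<ge> 1 \<Longrightarrow> 0 < \<bar>\<tau>\<bar> \<Longrightarrow> \<bar>\<tau>\<bar> * (8 * real M) \<le> 1 \<Longrightarrow>
       integrable RT2 g \<Longrightarrow> h \<in> borel_measurable RT2 \<Longrightarrow> Sg \<ge> 0 \<Longrightarrow> Sh \<ge> 0 \<Longrightarrow>
       (\<integral>\<^sup>+z. ennreal (norm (g z) powr (10/7)) \<partial>RT2) = ennreal Sg \<Longrightarrow>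
       (\<integral>\<^sup>+z. ennreal (norm (h z) powr (10/7)) \<partial>RT2) = ennreal Sh \<Longrightarrow>
       (\<integral>\<^sup>+z. ennreal (norm (h z) * norm (box_propagator M \<tau> g z)) \<partial>RT2)
         \<le> ennreal (C * (Sh powr (7/10) * Sg powr (7/10) * \<bar>\<tau>\<bar> powr (- (3/5))))"
proof -
  define K where "K = (10 * 2 powr (4/3) * (2 * pi) ^ 6 :: real)"
  have K: "K > 0" by (simp add: K_def)
  define C where "C = K powr (3/10) * (48 ^ 3) powr (2/5)"
  have C: "C > 0" using K by (simp add: C_def)
  show thesis
  proof (rule that[OF C])
    fix M :: nat and \<tau> Sg Sh :: real and g h :: "real \<times> real \<times> real \<Rightarrow> complex"
    assume M: "M \<ge> 1" and t: "0 < \<bar>\<tau>\<bar>" "\<bar>\<tau>\<bar> * (8 * real M) \<le> 1" and g: "integrable RT2 g"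
      and [measurable]: "h \<in> borel_measurable RT2" and S0: "Sg \<ge> 0" "Sh \<ge> 0"
      and Sg: "(\<integral>\<^sup>+z. ennreal (norm (g z) powr (10/7)) \<partial>RT2) = ennreal Sg"
      and Sh: "(\<integral>\<^sup>+z. ennreal (norm (h z) powr (10/7)) \<partial>RT2) = ennreal Sh"
    have [measurable]: "g \<in> borel_measurable RT2" using g by auto
    let ?U = "box_propagator M \<tau>"
    have Um: "?U k \<in> borel_measurable RT2" if "integrable RT2 k" for k
    proof -
      have [measurable]: "k \<in> borel_measurable RT2" using that by auto
      show ?thesis unfolding box_propagator_def by measurable
    qed
    note Um[OF g, measurable]
    define D where "D = 48 ^ 3 / (sqrt \<bar>\<tau>\<bar>) ^ 3"
    have D: "D > 0" using t by (simp add: D_def)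
    \<comment> \<open>Hoelder's inequality and the interpolation require positive masses\<close>
    have zero: "(\<integral>\<^sup>+z. ennreal (norm (h z) * norm (?U g z)) \<partial>RT2) = 0" if "Sg = 0 \<or> Sh = 0"
    proof -
      have "AE z in RT2. norm (h z) * norm (?U g z) = 0"
        using that
      proof
        assume "Sg = 0"
        then have "AE z in RT2. ennreal (norm (g z) powr (10/7)) = 0"
          using Sg by (subst nn_integral_0_iff_AE[symmetric]) auto
        then have "AE z in RT2. ennreal (norm (g z)) = 0" by eventually_elim simp
        then have "(\<integral>\<^sup>+z. ennreal (norm (g z)) \<partial>RT2) = 0" by (subst nn_integral_0_iff_AE) auto
        then have "?U g z = 0" for z using box_propagator_sup[OF g t M, of z] by simp
        then show ?thesis by simp
      next
        assume "Sh = 0"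
        then have "AE z in RT2. ennreal (norm (h z) powr (10/7)) = 0"
          using Sh by (subst nn_integral_0_iff_AE[symmetric]) auto
        then show ?thesis by eventually_elim simp
      qed
      then show ?thesis by (subst nn_integral_0_iff_AE) auto
    qed
    show "(\<integral>\<^sup>+z. ennreal (norm (h z) * norm (?U g z)) \<partial>RT2)
         \<le> ennreal (C * (Sh powr (7/10) * Sg powr (7/10) * \<bar>\<tau>\<bar> powr (- (3/5))))"
    proof (cases "Sg = 0 \<or> Sh = 0")
      case False
      then have pos: "Sg > 0" "Sh > 0" using S0 by auto
      have "(\<integral>\<^sup>+z. ennreal (norm (?U g z) powr (10/3)) \<partial>RT2)
          \<le> ennreal (4 * (10/3) / (10/3 - 2) * (2 * D * Sg) powr (10/3 - 2) * Sg) * ennreal ((2 * pi) ^ 6)"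
      proof (rule dual_exponent_interpolation[where p = "10/7" and U = ?U, OF sigma_finite_RT2])
        show "?U k \<in> borel_measurable RT2" if "integrable RT2 k" for k using Um[OF that] .
        show "?U (\<lambda>x. k x + k' x) z = ?U k z + ?U k' z" if k: "integrable RT2 k" "integrable RT2 k'" for k k' z
          unfolding box_propagator_def ext_def fourier_raw_add[OF k] distrib_left distrib_right
          by (rule Bochner_Integration.integral_add)
            (auto intro!: integrable_times_cis integrable_box_fourier k)
        show "ennreal (norm (?U k z)) \<le> ennreal D * (\<integral>\<^sup>+x. ennreal (norm (k x)) \<partial>RT2)" if "integrable RT2 k" for k z
          unfolding D_def by (rule box_propagator_sup[OF that t M])
        show "energy RT2 (?U k) \<le> ennreal ((2 * pi) ^ 6) * energy RT2 k" if "integrable RT2 k" for k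
          by (rule box_propagator_energy[OF that])
      qed (use g Sg D pos in auto)
      also have "\<dots> = ennreal (K * (D * Sg) powr (4/3) * Sg)"
        using D pos by (subst ennreal_mult[symmetric]) (simp_all add: K_def powr_mult mult_ac)
      finally have Y: "(\<integral>\<^sup>+z. ennreal (norm (?U g z) powr (10/3)) \<partial>RT2) \<le> ennreal (K * (D * Sg) powr (4/3) * Sg)" .
      have "(\<integral>\<^sup>+z. ennreal (norm (h z) * norm (?U g z)) \<partial>RT2)
         \<le> ennreal (Sh powr (1 / (10/7)) * (K * (D * Sg) powr (4/3) * Sg) powr (1 / (10/3)))"
        by (rule holder_nn_integral) (use Sh Y pos D K in auto)
      also have "Sh powr (1 / (10/7)) * (K * (D * Sg) powr (4/3) * Sg) powr (1 / (10/3)) = C * (Sh powr (7/10) * Sg powr (7/10) * \<bar>\<tau>\<bar> powr (- (3/5)))"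
      proof -
        have s: "sqrt \<bar>\<tau>\<bar> ^ 3 = \<bar>\<tau>\<bar> powr (3/2)"
          using t by (simp add: powr_half_sqrt[symmetric] powr_powr powr_numeral[symmetric] del: powr_numeral)
        have Dpow: "D powr (2/5) = (48 ^ 3) powr (2/5) * \<bar>\<tau>\<bar> powr (- (3/5))"
          using t unfolding D_def s by (simp add: powr_divide powr_powr powr_minus_divide)
        have "(K * (D * Sg) powr (4/3) * Sg) powr (3/10) = K powr (3/10) * (D powr (2/5) * (Sg powr (2/5) * Sg powr (3/10)))"
          using K D pos by (simp add: powr_mult powr_powr mult_ac)
        also have "Sg powr (2/5) * Sg powr (3/10) = Sg powr (7/10)"
          using pos by (simp add: powr_add[symmetric])
        finally show ?thesis unfolding C_def Dpow by (simp add: mult_ac)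
      qed
      finally show ?thesis .
    qed (use zero in simp)
  qed
qed

section \<open>The Strichartz estimate on a short time interval\<close>

definition strichartz_mass :: "(real \<times> int \<times> int \<Rightarrow> complex) \<Rightarrow> real \<Rightarrow> real \<Rightarrow> ennreal" where
  "strichartz_mass F a b = (\<integral>\<^sup>+t. indicator {a..b} t * (\<integral>\<^sup>+z. ennreal (norm (ext F t z) powr (10/3)) \<partial>RT2) \<partial>lborel)"

lemma powr_ten_thirds_bound:
  fixes x :: real
  assumes "0 \<le> x" "x \<le> B"
  shows "x powr (10/3) \<le> B powr (4/3) * x\<^sup>2"
proof (cases "x = 0")
  case False
  then have "x powr (10/3) = x powr (4/3) * x\<^sup>2"
    using assms powr_add[of x "4/3" 2] by (simp add: powr_numeral)
  also have "\<dots> \<le> B powr (4/3) * x\<^sup>2" using assms by (intro mult_right_mono powr_mono2) auto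
  finally show ?thesis .
qed simp

text \<open>The modulus is bounded by the square root \<open>B\<close> of the volume of the box, and the power 10/3 of the
  modulus by \<open>B powr (4/3)\<close> times its square, whose integral is bounded at every time.\<close>

lemma bernstein_mass:
  assumes F: "F \<in> band M" and T: "T \<ge> 0"
  shows "strichartz_mass F 0 T \<le> ennreal (sqrt (box_volume M) powr (4/3) * (2 * pi) ^ 3 * T)"
proof -
  have [measurable]: "F \<in> borel_measurable RZ2" using F by (auto simp: band_def)
  let ?B = "sqrt (box_volume M)"
  have inner: "(\<integral>\<^sup>+z. ennreal (norm (ext F t z) powr (10/3)) \<partial>RT2) \<le> ennreal (?B powr (4/3) * (2 * pi) ^ 3)" for t
  proof -
    have "(\<integral>\<^sup>+z. ennreal (norm (ext F t z) powr (10/3)) \<partial>RT2) \<le> (\<integral>\<^sup>+z. ennreal (?B powr (4/3)) * ennreal ((norm (ext F t z))\<^sup>2) \<partial>RT2)"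
      using powr_ten_thirds_bound[OF norm_ge_zero ext_bound[OF F]]
      by (intro nn_integral_mono) (simp add: ennreal_mult[symmetric] ennreal_leI)
    also have "\<dots> = ennreal (?B powr (4/3)) * energy RT2 (ext F t)"
      unfolding energy_def by (simp add: nn_integral_cmult)
    also have "\<dots> \<le> ennreal (?B powr (4/3)) * ennreal ((2 * pi) ^ 3)"
      by (intro mult_left_mono energy_ext[OF F]) auto
    finally show ?thesis by (simp add: ennreal_mult)
  qed
  have "strichartz_mass F 0 T \<le> (\<integral>\<^sup>+t. indicator {0..T} t * ennreal (?B powr (4/3) * (2 * pi) ^ 3) \<partial>lborel)"
    unfolding strichartz_mass_def by (intro nn_integral_mono mult_left_mono inner) auto
  also have "\<dots> = ennreal (?B powr (4/3) * (2 * pi) ^ 3 * T)"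
    using T by (simp add: nn_integral_multc ennreal_mult[symmetric] mult_ac)
  finally show ?thesis .
qed

text \<open>The \<open>TT*\<close> argument.  The mass \<open>J\<close> is the pairing of the solution \<open>u\<close> with the function
  \<open>G = u * norm u powr (4/3)\<close>, restricted to the times in \<open>{0..T}\<close>.  Moving the extension operator to the other
  side, \<open>J\<close> is the pairing of \<open>F\<close> with the space-time transform \<open>H\<close> of \<open>G\<close>, so \<open>J\<^sup>2\<close> is at most the
  energy \<open>X\<close> of \<open>H\<close>.  Moving it back, \<open>X\<close> is the pairing of \<open>G\<close> with \<open>ext H\<close>, a double integral over
  times \<open>t\<close> and \<open>s\<close> of the interactions of \<open>G t\<close> with the propagated \<open>G s\<close>.  The dispersive estimate bounds
  these by \<open>\<phi> t * \<phi> s * \<bar>t - s\<bar> powr (- 3/5)\<close>, where the integral of \<open>\<phi> powr (10/7)\<close> is \<open>J\<close>, and fractional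
  integration gives \<open>X \<le> C1 * J powr (7/5)\<close>.  Since \<open>J\<close> is finite, \<open>J\<^sup>2 \<le> C1 * J powr (7/5)\<close> bounds it.\<close>

lemma strichartz_short_time:
  obtains C where "C > 0" "\<And>M F. M \<ge> 1 \<Longrightarrow> F \<in> band M \<Longrightarrow> strichartz_mass F 0 (1 / (8 * real M)) \<le> ennreal C"
proof -
  obtain C0 where C0: "C0 > 0" and disp:
    "\<And>M \<tau> g (h :: real \<times> real \<times> real \<Rightarrow> complex) Sg Sh. M \<ge> 1 \<Longrightarrow> 0 < \<bar>\<tau>\<bar> \<Longrightarrow> \<bar>\<tau>\<bar> * (8 * real M) \<le> 1 \<Longrightarrow>
       integrable RT2 g \<Longrightarrow> h \<in> borel_measurable RT2 \<Longrightarrow> Sg \<ge> 0 \<Longrightarrow> Sh \<ge> 0 \<Longrightarrow>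
       (\<integral>\<^sup>+z. ennreal (norm (g z) powr (10/7)) \<partial>RT2) = ennreal Sg \<Longrightarrow>
       (\<integral>\<^sup>+z. ennreal (norm (h z) powr (10/7)) \<partial>RT2) = ennreal Sh \<Longrightarrow>
       (\<integral>\<^sup>+z. ennreal (norm (h z) * norm (box_propagator M \<tau> g z)) \<partial>RT2)
         \<le> ennreal (C0 * (Sh powr (7/10) * Sg powr (7/10) * \<bar>\<tau>\<bar> powr (- (3/5))))"
    by (rule dispersive_dual) (rule that)
  define C1 where "C1 = C0 * (2 * (2 / (1 - 3/5) + 1) / (10/7 - 1))"
  have C1: "C1 > 0" using C0 by (simp add: C1_def)
  show thesis
  proof (rule that[of "C1 powr (5/3)"])
    show "C1 powr (5/3) > 0" using C1 by simp
    fix M :: nat and F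
    assume M: "M \<ge> 1" and F: "F \<in> band M"
    interpret R: sigma_finite_measure RT2 by (rule sigma_finite_RT2)
    interpret Z: sigma_finite_measure RZ2 by (rule sigma_finite_RZ2)
    interpret LR: pair_sigma_finite lborel RT2
      by (intro pair_sigma_finite.intro sigma_finite_lborel sigma_finite_RT2)
    interpret ZL: pair_sigma_finite RZ2 lborel
      by (intro pair_sigma_finite.intro sigma_finite_lborel sigma_finite_RZ2)
    interpret ZS: pair_sigma_finite RZ2 "lborel \<Otimes>\<^sub>M RT2"
      by (intro pair_sigma_finite.intro sigma_finite_RZ2 sigma_finite_pair_measure sigma_finite_lborel sigma_finite_RT2)
    have F_meas[measurable]: "F \<in> borel_measurable RZ2" and Fsupp: "\<And>\<zeta>. \<zeta> \<notin> freq_box (real M) \<Longrightarrow> F \<zeta> = 0"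
      and Fen: "energy RZ2 F \<le> 1" using F by (auto simp: band_def)
    define T where "T = 1 / (8 * real M)"
    have T: "T > 0" "T * (8 * real M) = 1" using M by (auto simp: T_def)
    define B where "B = sqrt (box_volume M)"
    define u where "u t z = ext F t z" for t z
    have [measurable]: "(\<lambda>(t, z). u t z) \<in> borel_measurable (lborel \<Otimes>\<^sub>M RT2)" unfolding u_def by measurable
    have [measurable]: "u t \<in> borel_measurable RT2" for t unfolding u_def[abs_def] by measurable
    have uB: "norm (u t z) \<le> B" for t z unfolding u_def B_def by (rule ext_bound[OF F])
    then have B0: "B \<ge> 0" using norm_ge_zero order.trans by blast
    \<comment> \<open>the dual function: its power 10/7 is the power 10/3 of the solution\<close>
    define G where "G t z = indicator {0..T} t * (u t z * of_real (norm (u t z) powr (4/3)))" for t z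
    have G_meas[measurable]: "(\<lambda>(t, z). G t z) \<in> borel_measurable (lborel \<Otimes>\<^sub>M RT2)" unfolding G_def by measurable
    have G_meas'[measurable]: "G t \<in> borel_measurable RT2" for t unfolding G_def[abs_def] by measurable
    have normG: "norm (G t z) = indicator {0..T} t * norm (u t z) powr (7/3)" for t z
    proof -
      have "norm (u t z) * norm (u t z) powr (4/3) = norm (u t z) powr (7/3)"
        using powr_mult_base[of "norm (u t z)" "4/3"] by simp
      then show ?thesis by (simp add: G_def norm_mult indicator_def)
    qed
    have G_le: "norm (G t z) \<le> indicator {0..T} t * (B powr (1/3) * (norm (u t z))\<^sup>2)" for t z
    proof (cases "u t z = 0")
      case False
      then have "norm (u t z) powr (7/3) = norm (u t z) powr (1/3) * (norm (u t z))\<^sup>2"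
        using powr_add[of "norm (u t z)" "1/3" 2] by (simp add: powr_numeral)
      also have "\<dots> \<le> B powr (1/3) * (norm (u t z))\<^sup>2" using uB by (intro mult_right_mono powr_mono2) auto
      finally show ?thesis unfolding normG by (intro mult_left_mono) auto
    qed (simp add: normG)
    have G_pow: "norm (G t z) powr (10/7) = indicator {0..T} t * norm (u t z) powr (10/3)" for t z
      unfolding normG by (auto simp: indicator_def powr_powr)
    have slice: "(\<integral>\<^sup>+z. ennreal (norm (G t z)) \<partial>RT2) \<le> indicator {0..T} t * ennreal (B powr (1/3) * (2 * pi) ^ 3)" for t
    proof -
      have "(\<integral>\<^sup>+z. ennreal (norm (G t z)) \<partial>RT2) \<le> (\<integral>\<^sup>+z. ennreal (indicator {0..T} t * B powr (1/3)) * ennreal ((norm (u t z))\<^sup>2) \<partial>RT2)"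
        using G_le by (intro nn_integral_mono) (simp add: ennreal_mult[symmetric] ennreal_leI mult.assoc)
      also have "\<dots> = ennreal (indicator {0..T} t * B powr (1/3)) * energy RT2 (u t)"
        unfolding energy_def by (rule nn_integral_cmult) measurable
      also have "\<dots> \<le> ennreal (indicator {0..T} t * B powr (1/3)) * ennreal ((2 * pi) ^ 3)"
        using energy_ext[OF F, of t] by (intro mult_left_mono) (auto simp: u_def[abs_def])
      also have "\<dots> = indicator {0..T} t * ennreal (B powr (1/3) * (2 * pi) ^ 3)"
        by (auto simp: indicator_def ennreal_mult)
      finally show ?thesis .
    qed
    have Gt: "integrable RT2 (G t)" for t
    proof (rule integrableI_bounded)
      show "(\<integral>\<^sup>+z. ennreal (norm (G t z)) \<partial>RT2) < \<infinity>"
        by (rule le_less_trans[OF slice]) (auto simp: indicator_def)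
    qed measurable
    have G: "integrable (lborel \<Otimes>\<^sub>M RT2) (\<lambda>p. G (fst p) (snd p))"
    proof (rule integrableI_bounded)
      have "(\<integral>\<^sup>+p. ennreal (norm (G (fst p) (snd p))) \<partial>(lborel \<Otimes>\<^sub>M RT2)) = (\<integral>\<^sup>+t. \<integral>\<^sup>+z. ennreal (norm (G t z)) \<partial>RT2 \<partial>lborel)"
        by (subst R.nn_integral_fst[symmetric]) (simp_all, measurable)
      also have "\<dots> \<le> (\<integral>\<^sup>+t. indicator {0..T} t * ennreal (B powr (1/3) * (2 * pi) ^ 3) \<partial>lborel)"
        by (intro nn_integral_mono slice)
      also have "\<dots> < \<infinity>" using T by (simp add: nn_integral_multc ennreal_mult_less_top)
      finally show "(\<integral>\<^sup>+p. ennreal (norm (G (fst p) (snd p))) \<partial>(lborel \<Otimes>\<^sub>M RT2)) < \<infinity>" .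
    qed measurable
    define \<sigma> where "\<sigma> t = (\<integral>\<^sup>+z. ennreal (norm (G t z) powr (10/7)) \<partial>RT2)" for t
    have [measurable]: "\<sigma> \<in> borel_measurable borel" unfolding \<sigma>_def by measurable
    have \<sigma>_eq: "\<sigma> t = indicator {0..T} t * (\<integral>\<^sup>+z. ennreal (norm (u t z) powr (10/3)) \<partial>RT2)" for t
      unfolding \<sigma>_def G_pow by (auto simp: indicator_def)
    have mass: "strichartz_mass F 0 T = (\<integral>\<^sup>+t. \<sigma> t \<partial>lborel)"
      unfolding strichartz_mass_def \<sigma>_eq u_def ..
    have \<sigma>_fin: "\<sigma> t < \<infinity>" for t
    proof -
      have "\<sigma> t \<le> (\<integral>\<^sup>+z. ennreal (B powr (4/3)) * ennreal ((norm (u t z))\<^sup>2) \<partial>RT2)"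
        unfolding \<sigma>_eq using powr_ten_thirds_bound[OF norm_ge_zero uB[of t]]
        by (cases "t \<in> {0..T}") (auto simp: ennreal_mult[symmetric] intro!: ennreal_leI nn_integral_mono)
      also have "\<dots> = ennreal (B powr (4/3)) * energy RT2 (u t)"
        unfolding energy_def by (rule nn_integral_cmult) measurable
      also have "\<dots> < \<infinity>"
        using energy_ext[OF F, of t] by (auto simp: u_def[abs_def] ennreal_mult_less_top intro: le_less_trans)
      finally show ?thesis .
    qed
    obtain J where J: "strichartz_mass F 0 T = ennreal J" "J \<ge> 0"
      using bernstein_mass[OF F less_imp_le[OF T(1)]]
      by (cases "strichartz_mass F 0 T" rule: ennreal_cases) (auto simp: top_unique)
    let ?e = "\<lambda>\<zeta> p. cis (phase (snd p) \<zeta> - fst p * hyp \<zeta>)"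
    have e_meas: "case_prod ?e \<in> borel_measurable (RZ2 \<Otimes>\<^sub>M (lborel \<Otimes>\<^sub>M RT2))" by measurable
    define Gh where "Gh \<zeta> = (LINT p|(lborel \<Otimes>\<^sub>M RT2). G (fst p) (snd p) * cnj (?e \<zeta> p))" for \<zeta>
    \<comment> \<open>only the values of \<open>Gh\<close> on the box are paired with \<open>F\<close>\<close>
    define H where "H \<zeta> = indicator (freq_box (real M)) \<zeta> * Gh \<zeta>" for \<zeta>
    have [measurable]: "Gh \<in> borel_measurable RZ2"
    proof -
      interpret S: sigma_finite_measure "lborel \<Otimes>\<^sub>M RT2"
        by (intro sigma_finite_pair_measure sigma_finite_lborel sigma_finite_RT2)
      show ?thesis unfolding Gh_def[abs_def] by measurable
    qed
    have [measurable]: "H \<in> borel_measurable RZ2" unfolding H_def[abs_def] by measurable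
    have Hb: "norm (H \<zeta>) \<le> (LINT p|(lborel \<Otimes>\<^sub>M RT2). norm (G (fst p) (snd p)))" for \<zeta>
    proof -
      have "norm (Gh \<zeta>) \<le> (LINT p|(lborel \<Otimes>\<^sub>M RT2). norm (G (fst p) (snd p)))"
        unfolding Gh_def by (rule order.trans[OF Bochner_Integration.integral_norm_bound]) (simp add: norm_mult)
      then show ?thesis by (auto simp: H_def indicator_def norm_mult)
    qed
    have H: "integrable RZ2 H"
      by (rule integrable_on_freq_box[where M = "real M", OF _ _ Hb]) (auto simp: H_def)
    have Hsq: "integrable RZ2 (\<lambda>\<zeta>. (norm (H \<zeta>))\<^sup>2)"
    proof (rule Bochner_Integration.integrable_bound)
      let ?b = "LINT p|(lborel \<Otimes>\<^sub>M RT2). norm (G (fst p) (snd p))"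
      show "integrable RZ2 (\<lambda>\<zeta>. ?b * norm (H \<zeta>))" using H by simp
      show "AE \<zeta> in RZ2. norm ((norm (H \<zeta>))\<^sup>2) \<le> norm (?b * norm (H \<zeta>))"
        using Hb by (intro AE_I2) (auto simp: power2_eq_square abs_mult intro!: mult_right_mono order.trans[OF _ abs_ge_self])
    qed measurable
    define X where "X = (LINT \<zeta>|RZ2. (norm (H \<zeta>))\<^sup>2)"
    have X0: "X \<ge> 0" unfolding X_def by simp
    have X: "energy RZ2 H = ennreal X"
      unfolding energy_def X_def using Hsq by (intro nn_integral_eq_integral) auto
    have J_X: "J\<^sup>2 \<le> X"
    proof -
      have pt: "u t z * cnj (G t z) = complex_of_real (norm (G t z) powr (10/7))" for t z
      proof -
        have "u t z * cnj (G t z) = indicator {0..T} t * (complex_of_real ((norm (u t z))\<^sup>2) * of_real (norm (u t z) powr (4/3)))"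
          unfolding complex_norm_square by (simp add: G_def indicator_def)
        also have "(norm (u t z))\<^sup>2 * norm (u t z) powr (4/3) = norm (u t z) powr (10/3)"
          using powr_add[of "norm (u t z)" 2 "4/3"] by (cases "u t z = 0") (simp_all add: powr_numeral)
        then have "complex_of_real ((norm (u t z))\<^sup>2) * of_real (norm (u t z) powr (4/3)) = of_real (norm (u t z) powr (10/3))"
          by (simp only: of_real_mult[symmetric])
        finally show ?thesis unfolding G_pow by (simp add: indicator_def)
      qed
      have "(\<integral>\<^sup>+p. ennreal (norm (G (fst p) (snd p)) powr (10/7)) \<partial>(lborel \<Otimes>\<^sub>M RT2)) = ennreal J"
        unfolding J(1)[symmetric] mass \<sigma>_def by (subst R.nn_integral_fst[symmetric]) (simp_all, measurable)
      then have "(LINT p|(lborel \<Otimes>\<^sub>M RT2). norm (G (fst p) (snd p)) powr (10/7)) = J"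
        using J(2) by (subst integral_eq_nn_integral) auto
      then have "complex_of_real J = (LINT p|(lborel \<Otimes>\<^sub>M RT2). u (fst p) (snd p) * cnj (G (fst p) (snd p)))"
        unfolding pt by (subst integral_complex_of_real) simp
      also have "\<dots> = (LINT p|(lborel \<Otimes>\<^sub>M RT2). (LINT \<zeta>|RZ2. F \<zeta> * ?e \<zeta> p) * cnj (G (fst p) (snd p)))"
        unfolding u_def ext_def ..
      also have "\<dots> = (LINT \<zeta>|RZ2. F \<zeta> * cnj (Gh \<zeta>))"
        unfolding Gh_def by (rule ZS.adjoint_kernel_operator[OF band_L1(1)[OF F] G e_meas]) simp
      also have "\<dots> = (LINT \<zeta>|RZ2. F \<zeta> * cnj (H \<zeta>))"
        by (intro Bochner_Integration.integral_cong refl) (use Fsupp in \<open>auto simp: H_def indicator_def\<close>)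
      finally have "ennreal (J\<^sup>2) = ennreal ((norm (LINT \<zeta>|RZ2. F \<zeta> * cnj (H \<zeta>)))\<^sup>2)"
        by (metis norm_of_real power2_abs)
      also have "\<dots> \<le> energy RZ2 F * (\<integral>\<^sup>+\<zeta>. ennreal ((norm (cnj (H \<zeta>)))\<^sup>2) \<partial>RZ2)"
        unfolding energy_def by (rule cauchy_schwarz_integral) measurable
      also have "\<dots> \<le> 1 * ennreal X"
        using Fen X by (intro mult_mono) (auto simp: energy_def)
      finally show ?thesis using X0 by simp
    qed
    define V where "V t z = ext H t z" for t z
    have X_V: "ennreal X \<le> (\<integral>\<^sup>+t. \<integral>\<^sup>+z. ennreal (norm (G t z)) * ennreal (norm (V t z)) \<partial>RT2 \<partial>lborel)"
    proof -
      have "complex_of_real X = (LINT \<zeta>|RZ2. complex_of_real ((norm (H \<zeta>))\<^sup>2))"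
        unfolding X_def by (rule integral_complex_of_real[symmetric])
      also have "\<dots> = (LINT \<zeta>|RZ2. H \<zeta> * cnj (Gh \<zeta>))"
        unfolding complex_norm_square
        by (intro Bochner_Integration.integral_cong refl) (auto simp: H_def indicator_def)
      also have "\<dots> = (LINT p|(lborel \<Otimes>\<^sub>M RT2). (LINT \<zeta>|RZ2. H \<zeta> * ?e \<zeta> p) * cnj (G (fst p) (snd p)))"
        unfolding Gh_def by (rule ZS.adjoint_kernel_operator[OF H G e_meas, symmetric]) simp
      finally have "ennreal X = ennreal (norm (LINT p|(lborel \<Otimes>\<^sub>M RT2). V (fst p) (snd p) * cnj (G (fst p) (snd p))))"
        unfolding V_def ext_def by (metis X0 abs_of_nonneg norm_of_real)
      also have "\<dots> \<le> (\<integral>\<^sup>+p. ennreal (norm (V (fst p) (snd p) * cnj (G (fst p) (snd p)))) \<partial>(lborel \<Otimes>\<^sub>M RT2))"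
        by (rule norm_integral_le_nn_integral)
      also have "\<dots> = (\<integral>\<^sup>+t. \<integral>\<^sup>+z. ennreal (norm (G t z)) * ennreal (norm (V t z)) \<partial>RT2 \<partial>lborel)"
        unfolding V_def by (subst R.nn_integral_fst[symmetric]) (simp_all add: norm_mult ennreal_mult mult.commute, measurable)
      finally show ?thesis .
    qed
    define W where "W t s z = box_propagator M (t - s) (G s) z" for t s z
    have [measurable]: "(\<lambda>p. fourier_raw (G (fst p)) (snd p)) \<in> borel_measurable (lborel \<Otimes>\<^sub>M RZ2)"
      unfolding fourier_raw_def by measurable
    have W_meas: "(\<lambda>(s, z). W t s z) \<in> borel_measurable (lborel \<Otimes>\<^sub>M RT2)" for t
      unfolding W_def box_propagator_def ext_def fourier_raw_def by measurable
    \<comment> \<open>\<open>ext H\<close> is the superposition of the propagated time slices of \<open>G\<close>, as in Duhamel's formula\<close>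
    have V_W: "ennreal (norm (V t z)) \<le> (\<integral>\<^sup>+s. ennreal (norm (W t s z)) \<partial>lborel)" for t z
    proof -
      let ?I = "\<lambda>\<zeta>. indicator (freq_box (real M)) \<zeta> :: complex"
      have Gh_eq: "Gh \<zeta> = (LINT s|lborel. cis (s * hyp \<zeta>) * fourier_raw (G s) \<zeta>)" for \<zeta>
      proof -
        have "integrable (lborel \<Otimes>\<^sub>M RT2) (\<lambda>p. G (fst p) (snd p) * cnj (?e \<zeta> p))"
          unfolding cis_cnj by (intro integrable_times_cis G) measurable
        from LR.integral_fst'[OF this]
        have "Gh \<zeta> = (LINT s|lborel. LINT z|RT2. G s z * cnj (cis (phase z \<zeta> - s * hyp \<zeta>)))"
          unfolding Gh_def by simp
        also have "\<dots> = (LINT s|lborel. cis (s * hyp \<zeta>) * fourier_raw (G s) \<zeta>)"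
        proof (intro Bochner_Integration.integral_cong refl)
          fix s
          have "G s z * cnj (cis (phase z \<zeta> - s * hyp \<zeta>)) = cis (s * hyp \<zeta>) * (G s z * cis (- phase z \<zeta>))" for z
          proof -
            have "cnj (cis (phase z \<zeta> - s * hyp \<zeta>)) = cis (s * hyp \<zeta>) * cis (- phase z \<zeta>)"
              by (simp add: cis_cnj cis_mult)
            then show ?thesis by simp
          qed
          then show "(LINT z|RT2. G s z * cnj (cis (phase z \<zeta> - s * hyp \<zeta>))) = cis (s * hyp \<zeta>) * fourier_raw (G s) \<zeta>"
            unfolding fourier_raw_def by (simp only: integral_mult_right_zero)
        qed
        finally show ?thesis .
      qed
      let ?f = "\<lambda>\<zeta> s. ?I \<zeta> * fourier_raw (G s) \<zeta> * cis (phase z \<zeta> - (t - s) * hyp \<zeta>)"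
      have "V t z = (LINT \<zeta>|RZ2. LINT s|lborel. ?f \<zeta> s)"
        unfolding V_def ext_def H_def Gh_eq
      proof (intro Bochner_Integration.integral_cong refl)
        fix \<zeta>
        have "?f \<zeta> s = ?I \<zeta> * cis (phase z \<zeta> - t * hyp \<zeta>) * (cis (s * hyp \<zeta>) * fourier_raw (G s) \<zeta>)" for s
        proof -
          have "cis (phase z \<zeta> - (t - s) * hyp \<zeta>) = cis (phase z \<zeta> - t * hyp \<zeta>) * cis (s * hyp \<zeta>)"
            by (simp add: cis_mult algebra_simps)
          then show ?thesis by simp
        qed
        then show "?I \<zeta> * (LINT s|lborel. cis (s * hyp \<zeta>) * fourier_raw (G s) \<zeta>) * cis (phase z \<zeta> - t * hyp \<zeta>) = (LINT s|lborel. ?f \<zeta> s)"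
          by (simp only: integral_mult_right_zero, simp only: mult_ac)
      qed
      also have "\<dots> = (LINT s|lborel. LINT \<zeta>|RZ2. ?f \<zeta> s)"
      proof (rule ZL.Fubini_integral[symmetric])
        have I: "integrable RZ2 ?I"
          by (rule integrable_on_freq_box[of _ "real M" 1]) (auto simp: indicator_def)
        have nG: "integrable lborel (\<lambda>s. complex_of_real (LINT z|RT2. norm (G s z)))"
          using LR.integrable_fst'[OF integrable_norm[OF G]] by simp
        show "integrable (RZ2 \<Otimes>\<^sub>M lborel) (\<lambda>(\<zeta>, s). ?f \<zeta> s)"
        proof (rule Bochner_Integration.integrable_bound[OF ZL.integrable_product[OF I nG]])
          show "(\<lambda>(\<zeta>, s). ?f \<zeta> s) \<in> borel_measurable (RZ2 \<Otimes>\<^sub>M lborel)"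
            unfolding fourier_raw_def by measurable
          show "AE p in RZ2 \<Otimes>\<^sub>M lborel. norm (case p of (\<zeta>, s) \<Rightarrow> ?f \<zeta> s) \<le> norm (case p of (\<zeta>, s) \<Rightarrow> ?I \<zeta> * complex_of_real (LINT z|RT2. norm (G s z)))"
            using fourier_raw_bound
            by (intro AE_I2) (auto simp: norm_mult split: prod.split intro!: mult_left_mono order.trans[OF _ abs_ge_self])
        qed
      qed
      also have "\<dots> = (LINT s|lborel. W t s z)"
        unfolding W_def box_propagator_def ext_def ..
      finally show ?thesis by (simp add: norm_integral_le_nn_integral)
    qed
    \<comment> \<open>the norm of \<open>G t\<close> for the exponent 10/7\<close>
    define \<phi> where "\<phi> t = enn2real (\<sigma> t) powr (7/10)" for t
    have [measurable]: "\<phi> \<in> borel_measurable borel" unfolding \<phi>_def by measurable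
    have inter: "(\<integral>\<^sup>+z. ennreal (norm (G t z)) * ennreal (norm (W t s z)) \<partial>RT2)
        \<le> ennreal C0 * ennreal (\<phi> t * \<phi> s * \<bar>t - s\<bar> powr (- (3/5)))" if "s \<noteq> t" for t s
    proof (cases "t \<in> {0..T} \<and> s \<in> {0..T}")
      case True
      have sg: "\<sigma> t = ennreal (enn2real (\<sigma> t))" for t using \<sigma>_fin[of t] by simp
      have "\<bar>t - s\<bar> * (8 * real M) \<le> T * (8 * real M)" using True by (intro mult_right_mono) auto
      then have ts: "0 < \<bar>t - s\<bar>" "\<bar>t - s\<bar> * (8 * real M) \<le> 1" using T that by auto
      have "(\<integral>\<^sup>+z. ennreal (norm (G t z) * norm (box_propagator M (t - s) (G s) z)) \<partial>RT2)
         \<le> ennreal (C0 * (enn2real (\<sigma> t) powr (7/10) * enn2real (\<sigma> s) powr (7/10) * \<bar>t - s\<bar> powr (- (3/5))))"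
        by (rule disp[OF M ts Gt]) (use sg in \<open>auto simp: \<sigma>_def\<close>)
      then show ?thesis using C0 by (simp add: W_def \<phi>_def ennreal_mult)
    next
      case False
      have "norm (G t z) * norm (W t s z) = 0" for z
      proof (cases "t \<in> {0..T}")
        case True
        with False have "G s = (\<lambda>_. 0)" by (auto simp: G_def indicator_def)
        then have "W t s z = 0" by (simp add: W_def box_propagator_def ext_def fourier_raw_def)
        then show ?thesis by simp
      qed (simp add: G_def)
      then have "(\<integral>\<^sup>+z. ennreal (norm (G t z)) * ennreal (norm (W t s z)) \<partial>RT2) = (\<integral>\<^sup>+z. 0 \<partial>RT2)"
        by (intro nn_integral_cong) (simp only: ennreal_mult[symmetric] norm_ge_zero ennreal_0)
      then show ?thesis by simp
    qed
    have X_le: "ennreal X \<le> ennreal C0 * (\<integral>\<^sup>+t. \<integral>\<^sup>+s. ennreal (\<phi> t * \<phi> s * \<bar>t - s\<bar> powr (- (3/5))) \<partial>lborel \<partial>lborel)"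
    proof -
      have "ennreal X \<le> (\<integral>\<^sup>+t. \<integral>\<^sup>+s. ennreal C0 * ennreal (\<phi> t * \<phi> s * \<bar>t - s\<bar> powr (- (3/5))) \<partial>lborel \<partial>lborel)"
      proof (rule order.trans[OF X_V], intro nn_integral_mono)
        fix t
        note W_meas[of t, measurable]
        have "(\<integral>\<^sup>+z. ennreal (norm (G t z)) * ennreal (norm (V t z)) \<partial>RT2)
           \<le> (\<integral>\<^sup>+z. \<integral>\<^sup>+s. ennreal (norm (G t z)) * ennreal (norm (W t s z)) \<partial>lborel \<partial>RT2)"
        proof (intro nn_integral_mono)
          fix z assume z: "z \<in> space RT2"
          note [measurable] = measurable_compose[OF measurable_Pair2'[OF z] W_meas[of t], simplified]
          have "ennreal (norm (G t z)) * ennreal (norm (V t z)) \<le> ennreal (norm (G t z)) * (\<integral>\<^sup>+s. ennreal (norm (W t s z)) \<partial>lborel)"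
            by (intro mult_left_mono V_W) auto
          also have "\<dots> = (\<integral>\<^sup>+s. ennreal (norm (G t z)) * ennreal (norm (W t s z)) \<partial>lborel)"
            by (rule nn_integral_cmult[symmetric]) measurable
          finally show "ennreal (norm (G t z)) * ennreal (norm (V t z)) \<le> (\<integral>\<^sup>+s. ennreal (norm (G t z)) * ennreal (norm (W t s z)) \<partial>lborel)" .
        qed
        also have "\<dots> = (\<integral>\<^sup>+s. \<integral>\<^sup>+z. ennreal (norm (G t z)) * ennreal (norm (W t s z)) \<partial>RT2 \<partial>lborel)"
          by (rule LR.Fubini') measurable
        also have "\<dots> \<le> (\<integral>\<^sup>+s. ennreal C0 * ennreal (\<phi> t * \<phi> s * \<bar>t - s\<bar> powr (- (3/5))) \<partial>lborel)"
        proof (rule nn_integral_mono_AE)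
          have "AE s in lborel. s \<noteq> t" by (rule AE_lborel_singleton)
          then show "AE s in lborel. (\<integral>\<^sup>+z. ennreal (norm (G t z)) * ennreal (norm (W t s z)) \<partial>RT2) \<le> ennreal C0 * ennreal (\<phi> t * \<phi> s * \<bar>t - s\<bar> powr (- (3/5)))"
            by eventually_elim (rule inter)
        qed
        finally show "(\<integral>\<^sup>+z. ennreal (norm (G t z)) * ennreal (norm (V t z)) \<partial>RT2)
          \<le> (\<integral>\<^sup>+s. ennreal C0 * ennreal (\<phi> t * \<phi> s * \<bar>t - s\<bar> powr (- (3/5))) \<partial>lborel)" .
      qed
      also have "\<dots> = ennreal C0 * (\<integral>\<^sup>+t. \<integral>\<^sup>+s. ennreal (\<phi> t * \<phi> s * \<bar>t - s\<bar> powr (- (3/5))) \<partial>lborel \<partial>lborel)"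
        by (simp add: nn_integral_cmult)
      finally show ?thesis .
    qed
    have "J \<le> C1 powr (5/3)"
    proof (cases "J = 0")
      case False
      then have Jpos: "J > 0" using J by simp
      have "(\<integral>\<^sup>+t. ennreal (\<phi> t powr (10/7)) \<partial>lborel) = (\<integral>\<^sup>+t. \<sigma> t \<partial>lborel)"
      proof (intro nn_integral_cong)
        fix t
        have "\<phi> t powr (10/7) = enn2real (\<sigma> t)" unfolding \<phi>_def by (simp add: powr_powr)
        then show "ennreal (\<phi> t powr (10/7)) = \<sigma> t" using \<sigma>_fin[of t] by simp
      qed
      then have \<phi>J: "(\<integral>\<^sup>+t. ennreal (\<phi> t powr (10/7)) \<partial>lborel) \<le> ennreal J"
        using mass J by simp
      have "ennreal X \<le> ennreal C0 * ennreal (2 * (2 / (1 - 3/5) + 1) / (10/7 - 1) * J powr (2 / (10/7)))"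
        by (rule order.trans[OF X_le], intro mult_left_mono hardy_littlewood_sobolev_quadratic)
          (use Jpos \<phi>J in \<open>auto simp: \<phi>_def\<close>)
      also have "\<dots> = ennreal (C1 * J powr (7/5))"
        using C0 by (simp add: C1_def ennreal_mult[symmetric])
      finally have "X \<le> C1 * J powr (7/5)" using C1 by simp
      then have "J\<^sup>2 \<le> C1 * J powr (7/5)" using J_X by simp
      moreover have "J\<^sup>2 = J powr (3/5) * J powr (7/5)"
        using Jpos powr_add[of J "3/5" "7/5"] by (simp add: powr_numeral)
      ultimately have "J powr (3/5) \<le> C1" using Jpos by simp
      then have "(J powr (3/5)) powr (5/3) \<le> C1 powr (5/3)" by (intro powr_mono2) auto
      then show ?thesis using Jpos by (simp add: powr_powr)
    qed simp
    then show "strichartz_mass F 0 (1 / (8 * real M)) \<le> ennreal (C1 powr (5/3))"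
      using J unfolding T_def by (simp add: ennreal_leI)
  qed
qed

section \<open>Counting lattice points near a hyperbolic cone\<close>

text \<open>The sum is largest for an initial segment of the positive integers: the largest of \<open>n + 1\<close> distinct positive
  integers is at least \<open>n + 1\<close>, and the bound increases by at least \<open>1 / sqrt (n + 1)\<close>.\<close>

lemma sum_inverse_sqrt_le:
  fixes S :: "nat set"
  assumes "finite S" "0 \<notin> S"
  shows "(\<Sum>j\<in>S. 1 / sqrt (real j)) \<le> 2 * sqrt (real (card S))"
  using assms
proof (induction S rule: finite_linorder_max_induct)
  case (insert m S)
  define n where "n = card S"
  have S: "S \<subseteq> {1..<m}"
  proof
    fix x assume "x \<in> S"
    then have "x < m" using insert by auto
    moreover have "x \<noteq> 0" using \<open>x \<in> S\<close> insert.prems by (metis insert_iff)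
    ultimately have "x < m" "x \<noteq> 0" by blast+
    then show "x \<in> {1..<m}" by simp
  qed
  then have "n \<le> m - 1" unfolding n_def using card_mono[OF _ S] by simp
  moreover have "m > 0" using insert by (auto intro: gr0I)
  ultimately have nm: "real (Suc n) \<le> real m" by simp
  have "1 / sqrt (real m) \<le> 1 / sqrt (real (Suc n))"
    using nm by (intro divide_left_mono real_sqrt_le_mono mult_pos_pos) auto
  also have "\<dots> \<le> 2 * (sqrt (real (Suc n)) - sqrt (real n))"
  proof -
    have "1 = (sqrt (real (Suc n)) - sqrt (real n)) * (sqrt (real (Suc n)) + sqrt (real n))"
      by (simp add: algebra_simps)
    also have "\<dots> \<le> (sqrt (real (Suc n)) - sqrt (real n)) * (2 * sqrt (real (Suc n)))"
      by (intro mult_left_mono) auto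
    finally show ?thesis by (simp add: field_simps)
  qed
  finally have "1 / sqrt (real m) \<le> 2 * sqrt (real (Suc n)) - 2 * sqrt (real n)" by simp
  moreover have "m \<notin> S" using insert by auto
  ultimately show ?case using insert by (simp add: n_def)
qed simp

lemma sum_inverse_sqrt_inj_le:
  fixes S :: "'a set" and f :: "'a \<Rightarrow> nat"
  assumes "finite S" "inj_on f S" "\<And>x. x \<in> S \<Longrightarrow> f x > 0" "card S \<le> L"
  shows "(\<Sum>x\<in>S. 1 / sqrt (real (f x))) \<le> 2 * sqrt (real L)"
proof -
  have "(\<Sum>x\<in>S. 1 / sqrt (real (f x))) = (\<Sum>j\<in>f ` S. 1 / sqrt (real j))"
    using assms by (simp add: sum.reindex)
  also have "\<dots> \<le> 2 * sqrt (real (card (f ` S)))"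
    using assms by (intro sum_inverse_sqrt_le) force+
  also have "\<dots> \<le> 2 * sqrt (real L)" using assms by (simp add: card_image)
  finally show ?thesis .
qed

definition level :: "real \<Rightarrow> real \<Rightarrow> real set" where "level \<delta> c = {\<xi>. \<bar>\<xi>\<^sup>2 - c\<bar> \<le> \<delta>}"

lemma sets_level [measurable]: "level \<delta> c \<in> sets borel"
  unfolding level_def by measurable

lemma level_interval:
  assumes "c + \<delta> \<ge> 0" "\<delta> \<ge> 0"
  shows "emeasure lborel (level \<delta> c) \<le> ennreal (2 * (sqrt (c + \<delta>) - sqrt (max 0 (c - \<delta>))))"
proof -
  let ?u = "sqrt (c + \<delta>)" and ?l = "sqrt (max 0 (c - \<delta>))"
  have lu: "?l \<le> ?u" using assms by (intro real_sqrt_le_mono) auto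
  have "level \<delta> c \<subseteq> {-?u..-?l} \<union> {?l..?u}"
  proof
    fix \<xi> assume "\<xi> \<in> level \<delta> c"
    then have "c - \<delta> \<le> \<xi>\<^sup>2" "\<xi>\<^sup>2 \<le> c + \<delta>" by (auto simp: level_def abs_le_iff)
    then have "?l \<le> sqrt (\<xi>\<^sup>2)" "sqrt (\<xi>\<^sup>2) \<le> ?u" by (intro real_sqrt_le_mono; simp)+
    then show "\<xi> \<in> {-?u..-?l} \<union> {?l..?u}" by (cases "\<xi> \<ge> 0") auto
  qed
  then have "emeasure lborel (level \<delta> c) \<le> emeasure lborel ({-?u..-?l} \<union> {?l..?u})"
    by (intro emeasure_mono) auto
  also have "\<dots> \<le> emeasure lborel {-?u..-?l} + emeasure lborel {?l..?u}"
    by (intro emeasure_subadditive) auto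
  also have "\<dots> = ennreal (?u - ?l) + ennreal (?u - ?l)" using lu by simp
  also have "\<dots> = ennreal (2 * (?u - ?l))" using lu by (subst ennreal_plus[symmetric]) auto
  finally show ?thesis .
qed

lemma level_measure_le:
  assumes "\<delta> > 0"
  shows "emeasure lborel (level \<delta> c) \<le> ennreal (4 * sqrt \<delta>)"
proof (cases "c + \<delta> \<ge> 0")
  case True
  have "sqrt (c + \<delta>) \<le> sqrt (max 0 (c - \<delta>)) + sqrt (2 * \<delta>)"
  proof -
    have "sqrt (c + \<delta>) \<le> sqrt (max 0 (c - \<delta>) + 2 * \<delta>)" by (intro real_sqrt_le_mono) auto
    also have "\<dots> \<le> sqrt (max 0 (c - \<delta>)) + sqrt (2 * \<delta>)" using assms by (intro sqrt_add_le_add_sqrt) auto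
    finally show ?thesis .
  qed
  moreover have "sqrt (2 * \<delta>) \<le> sqrt (4 * \<delta>)" using assms by (intro real_sqrt_le_mono) auto
  then have "sqrt (2 * \<delta>) \<le> 2 * sqrt \<delta>" by (simp add: real_sqrt_mult)
  ultimately have "2 * (sqrt (c + \<delta>) - sqrt (max 0 (c - \<delta>))) \<le> 4 * sqrt \<delta>" by simp
  from ennreal_leI[OF this] level_interval[OF True less_imp_le[OF assms]] show ?thesis by (rule order.trans[rotated])
next
  case False
  then have "level \<delta> c = {}" by (auto simp: level_def abs_le_iff) (smt (verit) zero_le_power2)
  then show ?thesis by simp
qed

text \<open>Away from the vertex of the parabola its slope is of size \<open>sqrt c\<close>, which improves \<open>sqrt \<delta>\<close> to
  \<open>\<delta> / sqrt c\<close>.\<close>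

lemma level_measure_le_far:
  assumes "\<delta> > 0" "c \<noteq> 0"
  shows "emeasure lborel (level \<delta> c) \<le> ennreal (4 * \<delta> / sqrt \<bar>c\<bar>)"
proof -
  consider "c \<ge> \<delta>" | "\<bar>c\<bar> < \<delta>" | "c \<le> - \<delta>" by linarith
  then show ?thesis
  proof cases
    case 1
    let ?u = "sqrt (c + \<delta>)" and ?l = "sqrt (c - \<delta>)"
    have "(?u - ?l) * (?u + ?l) = 2 * \<delta>" using 1 assms by (simp add: algebra_simps)
    moreover have "(?u - ?l) * sqrt c \<le> (?u - ?l) * (?u + ?l)"
      using 1 assms by (intro mult_left_mono) (auto intro: add_increasing2)
    ultimately have "?u - ?l \<le> 2 * \<delta> / sqrt c" using 1 assms by (simp add: field_simps)
    then have "2 * (?u - ?l) \<le> 4 * \<delta> / sqrt \<bar>c\<bar>" using 1 assms by simp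
    from ennreal_leI[OF this] have "ennreal (2 * (sqrt (c + \<delta>) - sqrt (max 0 (c - \<delta>)))) \<le> ennreal (4 * \<delta> / sqrt \<bar>c\<bar>)"
      using 1 by (simp only: max_absorb2 diff_ge_0_iff_ge)
    then show ?thesis using level_interval[of c \<delta>] 1 assms by (meson add_nonneg_nonneg less_imp_le order.trans)
  next
    case 2
    have "sqrt \<bar>c\<bar> \<le> sqrt \<delta>" using 2 by (intro real_sqrt_le_mono) auto
    then have "sqrt \<delta> * sqrt \<bar>c\<bar> \<le> sqrt \<delta> * sqrt \<delta>" using assms by (intro mult_left_mono) auto
    then have "sqrt \<delta> * sqrt \<bar>c\<bar> \<le> \<delta>" using assms by simp
    then have "4 * sqrt \<delta> \<le> 4 * \<delta> / sqrt \<bar>c\<bar>" using assms by (simp add: field_simps)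
    then show ?thesis using level_measure_le[OF assms(1), of c] by (elim order.trans) (rule ennreal_leI)
  next
    case 3
    have "level \<delta> c \<subseteq> {0}"
    proof
      fix \<xi> assume "\<xi> \<in> level \<delta> c"
      then have "\<xi>\<^sup>2 - c \<le> \<delta>" by (simp add: level_def abs_le_iff)
      then have "\<xi>\<^sup>2 \<le> 0" using 3 by linarith
      then show "\<xi> \<in> {0}" by simp
    qed
    then have "emeasure lborel (level \<delta> c) \<le> emeasure lborel {0::real}" by (intro emeasure_mono) auto
    then show ?thesis by simp
  qed
qed

text \<open>On either side of \<open>r\<close> the distances rounded down are distinct positive integers.\<close>

lemma sum_inverse_sqrt_distance:
  fixes R :: "int set" and r :: real
  assumes R: "finite R" "card R \<le> L"
  shows "(\<Sum>b\<in>{b \<in> R. \<bar>r - of_int b\<bar> \<ge> 1}. 1 / sqrt \<bar>r - of_int b\<bar>) \<le> 4 * sqrt (real L)"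
proof -
  let ?P = "{b \<in> R. of_int b - r \<ge> 1}" and ?N = "{b \<in> R. r - of_int b \<ge> 1}"
  have "\<bar>r - of_int b\<bar> \<ge> 1 \<longleftrightarrow> of_int b - r \<ge> 1 \<or> r - of_int b \<ge> 1" for b by linarith
  then have eq: "{b \<in> R. \<bar>r - of_int b\<bar> \<ge> 1} = ?P \<union> ?N" by auto
  have disj: "?P \<inter> ?N = {}" by auto
  have cards: "card ?P \<le> L" "card ?N \<le> L"
    using R card_mono[of R ?P] card_mono[of R ?N] by auto
  have "(\<Sum>b\<in>?P. 1 / sqrt \<bar>r - of_int b\<bar>) \<le> (\<Sum>b\<in>?P. 1 / sqrt (real (nat \<lfloor>of_int b - r\<rfloor>)))"
  proof (intro sum_mono)
    fix b assume b: "b \<in> ?P"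
    then have "1 \<le> \<lfloor>of_int b - r\<rfloor>" by (simp add: le_floor_iff)
    then have "real (nat \<lfloor>of_int b - r\<rfloor>) > 0" by simp
    moreover have "real (nat \<lfloor>of_int b - r\<rfloor>) \<le> \<bar>r - of_int b\<bar>"
      using b of_nat_floor[of "of_int b - r"] by simp
    ultimately show "1 / sqrt \<bar>r - of_int b\<bar> \<le> 1 / sqrt (real (nat \<lfloor>of_int b - r\<rfloor>))"
      by (intro divide_left_mono real_sqrt_le_mono mult_pos_pos) auto
  qed
  also have "\<dots> \<le> 2 * sqrt (real L)"
  proof (rule sum_inverse_sqrt_inj_le)
    have fl: "\<lfloor>of_int b - r\<rfloor> = b + \<lfloor>- r\<rfloor>" for b using floor_add_int[of "- r" b] by (simp add: add.commute)
    show "inj_on (\<lambda>b. nat \<lfloor>of_int b - r\<rfloor>) ?P"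
    proof (rule inj_onI)
      fix b b' assume "b \<in> ?P" "b' \<in> ?P" and e: "nat \<lfloor>of_int b - r\<rfloor> = nat \<lfloor>of_int b' - r\<rfloor>"
      then have "1 \<le> \<lfloor>of_int b - r\<rfloor>" "1 \<le> \<lfloor>of_int b' - r\<rfloor>" by (auto simp: le_floor_iff)
      then have "\<lfloor>of_int b - r\<rfloor> = \<lfloor>of_int b' - r\<rfloor>"
        using e eq_nat_nat_iff[of "\<lfloor>of_int b - r\<rfloor>" "\<lfloor>of_int b' - r\<rfloor>"] by linarith
      then show "b = b'" unfolding fl by simp
    qed
    show "nat \<lfloor>of_int b - r\<rfloor> > 0" if "b \<in> ?P" for b
      using that by (simp add: le_floor_iff zero_less_nat_eq less_le_trans[of 0 1])
  qed (use R cards in auto)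
  finally have 1: "(\<Sum>b\<in>?P. 1 / sqrt \<bar>r - of_int b\<bar>) \<le> 2 * sqrt (real L)" .
  have "(\<Sum>b\<in>?N. 1 / sqrt \<bar>r - of_int b\<bar>) \<le> (\<Sum>b\<in>?N. 1 / sqrt (real (nat \<lfloor>r - of_int b\<rfloor>)))"
  proof (intro sum_mono)
    fix b assume b: "b \<in> ?N"
    then have "1 \<le> \<lfloor>r - of_int b\<rfloor>" by (simp only: le_floor_iff mem_Collect_eq of_int_1)
    then have "real (nat \<lfloor>r - of_int b\<rfloor>) > 0" by simp
    moreover have "real (nat \<lfloor>r - of_int b\<rfloor>) \<le> \<bar>r - of_int b\<bar>"
      using b of_nat_floor[of "r - of_int b"] by simp
    ultimately show "1 / sqrt \<bar>r - of_int b\<bar> \<le> 1 / sqrt (real (nat \<lfloor>r - of_int b\<rfloor>))"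
      by (intro divide_left_mono real_sqrt_le_mono mult_pos_pos) auto
  qed
  also have "\<dots> \<le> 2 * sqrt (real L)"
  proof (rule sum_inverse_sqrt_inj_le)
    have fl: "\<lfloor>r - of_int b\<rfloor> = \<lfloor>r\<rfloor> - b" for b by (rule floor_diff_of_int)
    show "inj_on (\<lambda>b. nat \<lfloor>r - of_int b\<rfloor>) ?N"
    proof (rule inj_onI)
      fix b b' assume "b \<in> ?N" "b' \<in> ?N" and e: "nat \<lfloor>r - of_int b\<rfloor> = nat \<lfloor>r - of_int b'\<rfloor>"
      then have "1 \<le> \<lfloor>r - of_int b\<rfloor>" "1 \<le> \<lfloor>r - of_int b'\<rfloor>" by (simp_all only: le_floor_iff mem_Collect_eq of_int_1)
      then have "\<lfloor>r - of_int b\<rfloor> = \<lfloor>r - of_int b'\<rfloor>"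
        using e eq_nat_nat_iff[of "\<lfloor>r - of_int b\<rfloor>" "\<lfloor>r - of_int b'\<rfloor>"] by linarith
      then show "b = b'" unfolding fl by simp
    qed
    show "nat \<lfloor>r - of_int b\<rfloor> > 0" if "b \<in> ?N" for b
    proof -
      have "1 \<le> \<lfloor>r - of_int b\<rfloor>" using that by (simp only: le_floor_iff mem_Collect_eq of_int_1)
      then show ?thesis by simp
    qed
  qed (use R cards in auto)
  finally have 2: "(\<Sum>b\<in>?N. 1 / sqrt \<bar>r - of_int b\<bar>) \<le> 2 * sqrt (real L)" .
  show ?thesis unfolding eq using 1 2 R disj by (subst sum.union_disjoint) auto
qed

text \<open>In a fixed row at most two integers \<open>b\<close> lie within the distance one of the zero \<open>r\<close> of \<open>\<tau> - a * b\<close> and cost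
  \<open>sqrt \<delta>\<close>; the others profit from the slope of the parabola.\<close>

lemma hyperbola_row:
  fixes R :: "int set" and a :: int
  assumes \<delta>: "\<delta> > 0" and R: "finite R" "card R \<le> L" and a: "a \<noteq> 0"
  shows "(\<Sum>b\<in>R. emeasure lborel (level \<delta> (\<tau> - of_int a * of_int b)))
     \<le> ennreal (8 * sqrt \<delta> + 16 * \<delta> * sqrt (real L) / sqrt \<bar>of_int a\<bar>)"
proof -
  define r where "r = \<tau> / of_int a"
  have dist: "\<bar>\<tau> - of_int a * of_int b\<bar> = \<bar>of_int a\<bar> * \<bar>r - of_int b\<bar>" for b
    unfolding r_def using a by (subst abs_mult[symmetric]) (simp add: right_diff_distrib)
  let ?near = "{b \<in> R. \<bar>r - of_int b\<bar> < 1}" and ?far = "{b \<in> R. \<bar>r - of_int b\<bar> \<ge> 1}"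
  have "?near \<subseteq> {\<lfloor>r\<rfloor>, \<lceil>r\<rceil>}"
  proof
    fix b assume "b \<in> ?near"
    then have "of_int b < r + 1" "r - 1 < of_int b" by auto
    then have "b = \<lfloor>r\<rfloor> \<or> b = \<lceil>r\<rceil>"
      by (cases "of_int b \<le> r") (auto simp: floor_eq_iff ceiling_eq_iff eq_commute[of b])
    then show "b \<in> {\<lfloor>r\<rfloor>, \<lceil>r\<rceil>}" by simp
  qed
  then have "card ?near \<le> card {\<lfloor>r\<rfloor>, \<lceil>r\<rceil>}" by (intro card_mono) auto
  also have "\<dots> \<le> 2" by (simp add: card_insert_if)
  finally have near2: "card ?near \<le> 2" .
  have near: "(\<Sum>b\<in>?near. emeasure lborel (level \<delta> (\<tau> - of_int a * of_int b))) \<le> ennreal (8 * sqrt \<delta>)"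
  proof -
    have "(\<Sum>b\<in>?near. emeasure lborel (level \<delta> (\<tau> - of_int a * of_int b))) \<le> (\<Sum>b\<in>?near. ennreal (4 * sqrt \<delta>))"
      by (intro sum_mono level_measure_le \<delta>)
    also have "\<dots> = ennreal (\<Sum>b\<in>?near. 4 * sqrt \<delta>)" using \<delta> by (intro sum_ennreal) auto
    also have "(\<Sum>b\<in>?near. 4 * sqrt \<delta>) = real (card ?near) * (4 * sqrt \<delta>)" by simp
    also have "ennreal \<dots> \<le> ennreal (2 * (4 * sqrt \<delta>))" using near2 \<delta> by (intro ennreal_leI mult_right_mono) auto
    finally show ?thesis by simp
  qed
  have far: "(\<Sum>b\<in>?far. emeasure lborel (level \<delta> (\<tau> - of_int a * of_int b))) \<le> ennreal (16 * \<delta> * sqrt (real L) / sqrt \<bar>of_int a\<bar>)"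
  proof -
    have "(\<Sum>b\<in>?far. emeasure lborel (level \<delta> (\<tau> - of_int a * of_int b))) \<le> (\<Sum>b\<in>?far. ennreal (4 * \<delta> / sqrt \<bar>of_int a\<bar> * (1 / sqrt \<bar>r - of_int b\<bar>)))"
    proof (intro sum_mono)
      fix b assume b: "b \<in> ?far"
      then have "\<bar>\<tau> - of_int a * of_int b\<bar> > 0" unfolding dist using a by (intro mult_pos_pos) auto
      then have "emeasure lborel (level \<delta> (\<tau> - of_int a * of_int b)) \<le> ennreal (4 * \<delta> / sqrt \<bar>\<tau> - of_int a * of_int b\<bar>)"
        by (intro level_measure_le_far \<delta>) auto
      then show "emeasure lborel (level \<delta> (\<tau> - of_int a * of_int b)) \<le> ennreal (4 * \<delta> / sqrt \<bar>of_int a\<bar> * (1 / sqrt \<bar>r - of_int b\<bar>))"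
        unfolding dist by (simp add: real_sqrt_mult)
    qed
    also have "\<dots> = ennreal (\<Sum>b\<in>?far. 4 * \<delta> / sqrt \<bar>of_int a\<bar> * (1 / sqrt \<bar>r - of_int b\<bar>))"
      using \<delta> by (intro sum_ennreal) auto
    also have "(\<Sum>b\<in>?far. 4 * \<delta> / sqrt \<bar>of_int a\<bar> * (1 / sqrt \<bar>r - of_int b\<bar>)) = 4 * \<delta> / sqrt \<bar>of_int a\<bar> * (\<Sum>b\<in>?far. 1 / sqrt \<bar>r - of_int b\<bar>)"
      by (rule sum_distrib_left[symmetric])
    also have "ennreal \<dots> \<le> ennreal (4 * \<delta> / sqrt \<bar>of_int a\<bar> * (4 * sqrt (real L)))"
      using \<delta> by (intro ennreal_leI mult_left_mono sum_inverse_sqrt_distance R) auto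
    also have "4 * \<delta> / sqrt \<bar>of_int a\<bar> * (4 * sqrt (real L)) = 16 * \<delta> * sqrt (real L) / sqrt \<bar>of_int a\<bar>" by simp
    finally show ?thesis .
  qed
  have "R = ?near \<union> ?far" by auto
  then have "(\<Sum>b\<in>R. emeasure lborel (level \<delta> (\<tau> - of_int a * of_int b)))
     = (\<Sum>b\<in>?near. emeasure lborel (level \<delta> (\<tau> - of_int a * of_int b))) + (\<Sum>b\<in>?far. emeasure lborel (level \<delta> (\<tau> - of_int a * of_int b)))"
    using R by (subst sum.union_disjoint[symmetric]) auto
  also have "\<dots> \<le> ennreal (8 * sqrt \<delta>) + ennreal (16 * \<delta> * sqrt (real L) / sqrt \<bar>of_int a\<bar>)"
    by (intro add_mono near far)
  also have "\<dots> = ennreal (8 * sqrt \<delta> + 16 * \<delta> * sqrt (real L) / sqrt \<bar>of_int a\<bar>)"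
    using \<delta> by (subst ennreal_plus) auto
  finally show ?thesis .
qed

text \<open>The square roots in the bound for a row are summable over \<open>a\<close> without a logarithmic loss.  The row
  \<open>a = 0\<close>, where the product \<open>a * b\<close> does not depend on \<open>b\<close>, costs \<open>L * sqrt \<delta>\<close> by itself, the same
  order as all the others together.\<close>

lemma hyperbola_count:
  fixes P R :: "int set"
  assumes \<delta>: "0 < \<delta>" "\<delta> \<le> 2" and P: "finite P" "card P \<le> L" and R: "finite R" "card R \<le> L"
  shows "(\<Sum>a\<in>P. \<Sum>b\<in>R. emeasure lborel (level \<delta> (\<tau> - of_int a * of_int b))) \<le> ennreal (140 * real L * sqrt \<delta>)"
proof -
  let ?S = "\<lambda>a. \<Sum>b\<in>R. emeasure lborel (level \<delta> (\<tau> - of_int a * of_int b))"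
  let ?P = "{a \<in> P. \<bar>0 - real_of_int a\<bar> \<ge> 1}"
  have zero: "?S 0 \<le> ennreal (4 * real L * sqrt \<delta>)"
  proof -
    have "?S 0 \<le> (\<Sum>b\<in>R. ennreal (4 * sqrt \<delta>))" by (intro sum_mono level_measure_le \<delta>)
    also have "\<dots> = ennreal (\<Sum>b\<in>R. 4 * sqrt \<delta>)" using \<delta> by (intro sum_ennreal) auto
    also have "\<dots> \<le> ennreal (real L * (4 * sqrt \<delta>))" using R \<delta> by (auto intro!: ennreal_leI mult_right_mono)
    finally show ?thesis by (simp add: mult_ac)
  qed
  have rest: "(\<Sum>a\<in>?P. ?S a) \<le> ennreal (8 * real L * sqrt \<delta> + 64 * \<delta> * real L)"
  proof -
    have "(\<Sum>a\<in>?P. ?S a) \<le> (\<Sum>a\<in>?P. ennreal (8 * sqrt \<delta> + 16 * \<delta> * sqrt (real L) * (1 / sqrt \<bar>0 - of_int a\<bar>)))"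
    proof (intro sum_mono)
      fix a assume "a \<in> ?P"
      then have "a \<noteq> 0" by auto
      then show "?S a \<le> ennreal (8 * sqrt \<delta> + 16 * \<delta> * sqrt (real L) * (1 / sqrt \<bar>0 - of_int a\<bar>))"
        using hyperbola_row[OF \<delta>(1) R, of a \<tau>] by simp
    qed
    also have "\<dots> = ennreal (\<Sum>a\<in>?P. 8 * sqrt \<delta> + 16 * \<delta> * sqrt (real L) * (1 / sqrt \<bar>0 - of_int a\<bar>))"
      using \<delta> by (intro sum_ennreal) auto
    also have "(\<Sum>a\<in>?P. 8 * sqrt \<delta> + 16 * \<delta> * sqrt (real L) * (1 / sqrt \<bar>0 - of_int a\<bar>))
       = real (card ?P) * (8 * sqrt \<delta>) + 16 * \<delta> * sqrt (real L) * (\<Sum>a\<in>?P. 1 / sqrt \<bar>0 - of_int a\<bar>)"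
      by (simp only: sum.distrib sum_distrib_left[symmetric] sum_constant)
    also have "\<dots> \<le> real L * (8 * sqrt \<delta>) + 16 * \<delta> * sqrt (real L) * (4 * sqrt (real L))"
    proof (intro add_mono mult_right_mono mult_left_mono sum_inverse_sqrt_distance P)
      have "card ?P \<le> card P" using P by (intro card_mono) auto
      then show "real (card ?P) \<le> real L" using P by simp
    qed (use \<delta> in auto)
    also have "\<dots> = 8 * real L * sqrt \<delta> + 64 * \<delta> * real L" by (simp add: mult_ac)
    finally show ?thesis by (simp add: ennreal_leI)
  qed
  have "P \<subseteq> insert 0 ?P"
  proof
    fix a assume "a \<in> P"
    moreover have "a = 0 \<or> \<bar>real_of_int a\<bar> \<ge> 1" by linarith
    ultimately show "a \<in> insert 0 ?P" by auto
  qed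
  then have "(\<Sum>a\<in>P. ?S a) \<le> (\<Sum>a\<in>insert 0 ?P. ?S a)" using P by (intro sum_mono2) auto
  also have "\<dots> = ?S 0 + (\<Sum>a\<in>?P. ?S a)" using P by (subst sum.insert) auto
  also have "\<dots> \<le> ennreal (4 * real L * sqrt \<delta>) + ennreal (8 * real L * sqrt \<delta> + 64 * \<delta> * real L)"
    by (intro add_mono zero rest)
  also have "\<dots> = ennreal (4 * real L * sqrt \<delta> + (8 * real L * sqrt \<delta> + 64 * \<delta> * real L))"
    using \<delta> by (intro ennreal_plus[symmetric]) auto
  also have "\<dots> \<le> ennreal (140 * real L * sqrt \<delta>)"
  proof (rule ennreal_leI)
    have "sqrt \<delta> \<le> sqrt 4" using \<delta> by (intro real_sqrt_le_mono) auto
    then have "sqrt \<delta> \<le> 2" by simp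
    then have "sqrt \<delta> * sqrt \<delta> \<le> 2 * sqrt \<delta>" using \<delta> by (intro mult_right_mono) auto
    then have "real L * \<delta> \<le> real L * (2 * sqrt \<delta>)" using \<delta> by (intro mult_left_mono) auto
    then show "4 * real L * sqrt \<delta> + (8 * real L * sqrt \<delta> + 64 * \<delta> * real L) \<le> 140 * real L * sqrt \<delta>"
      by (simp add: mult_ac)
  qed
  finally show ?thesis .
qed

text \<open>The form factors as \<open>(k1 + k2) * (k1 - k2)\<close>.  Completing squares in \<open>\<xi>\<close> and in both factors turns the condition into
  the statement that \<open>(2 * \<xi> - \<eta>)\<^sup>2 + a * b\<close> is within \<open>2 * \<delta>\<close> of a constant, where \<open>a\<close> and \<open>b\<close> are
  integers that range over at most \<open>5 * M\<close> values each.\<close>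

lemma cone_count:
  fixes M :: nat
  assumes M: "M \<ge> 1" and \<delta>: "0 < \<delta>" "\<delta> \<le> 1"
  shows "emeasure RZ2 {\<zeta>' \<in> freq_box (real M). \<bar>hyp \<zeta>' + hyp (\<zeta> - \<zeta>') - \<tau>\<bar> \<le> \<delta>} \<le> ennreal (1400 * real M * sqrt \<delta>)"
proof -
  interpret P: pair_sigma_finite lborel Z2
    by (intro pair_sigma_finite.intro sigma_finite_lborel sigma_finite_Z2)
  obtain \<eta> \<kappa>1 \<kappa>2 where \<zeta>: "\<zeta> = (\<eta>, \<kappa>1, \<kappa>2)" by (cases \<zeta>)
  define \<tau>' where "\<tau>' = 2 * \<tau> - \<eta>\<^sup>2 - (of_int \<kappa>1)\<^sup>2 + (of_int \<kappa>2)\<^sup>2"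
  define A where "A k = 2 * (fst k + snd k) - (\<kappa>1 + \<kappa>2)" for k :: "int \<times> int"
  define B where "B k = 2 * (fst k - snd k) - (\<kappa>1 - \<kappa>2)" for k :: "int \<times> int"
  let ?S = "{\<zeta>' \<in> freq_box (real M). \<bar>hyp \<zeta>' + hyp (\<zeta> - \<zeta>') - \<tau>\<bar> \<le> \<delta>}"
  have expand: "2 * (hyp (\<xi>, k) + hyp (\<zeta> - (\<xi>, k)) - \<tau>) = (- \<eta> + 2 * \<xi>)\<^sup>2 - (\<tau>' - of_int (A k) * of_int (B k))" for \<xi> k
    by (cases k) (simp add: hyp_def \<zeta> \<tau>'_def A_def B_def power2_eq_square algebra_simps)
  have mem: "\<bar>hyp (\<xi>, k) + hyp (\<zeta> - (\<xi>, k)) - \<tau>\<bar> \<le> \<delta> \<longleftrightarrow> - \<eta> + 2 * \<xi> \<in> level (2 * \<delta>) (\<tau>' - of_int (A k) * of_int (B k))" for \<xi> k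
  proof -
    have "\<bar>2 * x\<bar> \<le> 2 * \<delta> \<longleftrightarrow> \<bar>x\<bar> \<le> \<delta>" for x :: real by (simp only: abs_mult) simp
    then show ?thesis unfolding level_def mem_Collect_eq expand[symmetric] by blast
  qed
  have S: "?S \<in> sets RZ2"
  proof -
    have [measurable]: "(\<lambda>\<zeta>'. hyp \<zeta>' + hyp (\<zeta> - \<zeta>') - \<tau>) \<in> borel_measurable RZ2" (is "?q \<in> _")
    proof -
      have [measurable]: "(\<lambda>\<zeta>'. fst \<zeta>') \<in> borel_measurable RZ2"
        "(\<lambda>\<zeta>'. real_of_int (fst (snd \<zeta>'))) \<in> borel_measurable RZ2" "(\<lambda>\<zeta>'. real_of_int (snd (snd \<zeta>'))) \<in> borel_measurable RZ2"
        by measurable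
      show ?thesis unfolding hyp_def fst_diff snd_diff of_int_diff by measurable
    qed
    have "?q -` {\<tau>'. \<bar>\<tau>'\<bar> \<le> \<delta>} \<inter> space RZ2 \<in> sets RZ2" by (rule measurable_sets[where A = borel]) measurable
    then have "{\<zeta>' \<in> space RZ2. \<bar>hyp \<zeta>' + hyp (\<zeta> - \<zeta>') - \<tau>\<bar> \<le> \<delta>} \<in> sets RZ2" by (simp add: vimage_def)
    then have "freq_box (real M) \<inter> {\<zeta>' \<in> space RZ2. \<bar>hyp \<zeta>' + hyp (\<zeta> - \<zeta>') - \<tau>\<bar> \<le> \<delta>} \<in> sets RZ2" by (intro sets.Int) auto
    moreover have "?S = freq_box (real M) \<inter> {\<zeta>' \<in> space RZ2. \<bar>hyp \<zeta>' + hyp (\<zeta> - \<zeta>') - \<tau>\<bar> \<le> \<delta>}" by auto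
    ultimately show ?thesis by (simp only:)
  qed
  let ?E = "\<lambda>k. emeasure lborel (level (2 * \<delta>) (\<tau>' - of_int (A k) * of_int (B k)))"
  have "emeasure RZ2 ?S = (\<integral>\<^sup>+k. \<integral>\<^sup>+\<xi>. indicator ?S (\<xi>, k) \<partial>lborel \<partial>Z2)"
    using P.nn_integral_snd[of "indicator ?S"] S unfolding RZ2_eq[symmetric]
    by (simp add: nn_integral_indicator)
  also have "\<dots> = (\<Sum>k\<in>box_support M. \<integral>\<^sup>+\<xi>. indicator ?S (\<xi>, k) \<partial>lborel)"
    by (rule nn_integral_count_space') (use finite_box_support not_in_box_support in auto)
  also have "\<dots> \<le> (\<Sum>k\<in>box_support M. ?E k)"
  proof (intro sum_mono)
    fix k
    let ?L = "level (2 * \<delta>) (\<tau>' - of_int (A k) * of_int (B k))"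
    have "(\<integral>\<^sup>+\<xi>. indicator ?S (\<xi>, k) \<partial>lborel) \<le> (\<integral>\<^sup>+\<xi>. indicator ?L (- \<eta> + 2 * \<xi>) \<partial>lborel)"
      using mem by (intro nn_integral_mono) (auto simp: indicator_def)
    also have "\<dots> = 1 * \<dots>" by (rule mult_1_left[symmetric])
    also have "\<dots> \<le> ennreal \<bar>2\<bar> * (\<integral>\<^sup>+\<xi>. indicator ?L (- \<eta> + 2 * \<xi>) \<partial>lborel)"
      by (intro mult_right_mono) auto
    also have "\<dots> = (\<integral>\<^sup>+\<xi>. indicator ?L \<xi> \<partial>lborel)"
      by (subst nn_integral_real_affine[where c = 2 and t = "- \<eta>"]) auto
    also have "\<dots> = ?E k" by simp
    finally show "(\<integral>\<^sup>+\<xi>. indicator ?S (\<xi>, k) \<partial>lborel) \<le> ?E k" .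
  qed
  also have "\<dots> = (\<Sum>ab\<in>(\<lambda>k. (A k, B k)) ` box_support M. emeasure lborel (level (2 * \<delta>) (\<tau>' - of_int (fst ab) * of_int (snd ab))))"
  proof (subst sum.reindex)
    show "inj_on (\<lambda>k. (A k, B k)) (box_support M)" by (auto simp: inj_on_def A_def B_def)
  qed simp
  also have "\<dots> \<le> (\<Sum>ab\<in>(\<lambda>p. 2 * p - (\<kappa>1 + \<kappa>2)) ` {-2 * int M..2 * int M} \<times> (\<lambda>p. 2 * p - (\<kappa>1 - \<kappa>2)) ` {-2 * int M..2 * int M}.
       emeasure lborel (level (2 * \<delta>) (\<tau>' - of_int (fst ab) * of_int (snd ab))))"
  proof (intro sum_mono2)
    show "(\<lambda>k. (A k, B k)) ` box_support M \<subseteq> (\<lambda>p. 2 * p - (\<kappa>1 + \<kappa>2)) ` {-2 * int M..2 * int M} \<times> (\<lambda>p. 2 * p - (\<kappa>1 - \<kappa>2)) ` {-2 * int M..2 * int M}"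
    proof (rule image_subsetI)
      fix k assume "k \<in> box_support M"
      then have "fst k + snd k \<in> {-2 * int M..2 * int M}" "fst k - snd k \<in> {-2 * int M..2 * int M}"
        by (auto simp: box_support_def)
      then show "(A k, B k) \<in> (\<lambda>p. 2 * p - (\<kappa>1 + \<kappa>2)) ` {-2 * int M..2 * int M} \<times> (\<lambda>p. 2 * p - (\<kappa>1 - \<kappa>2)) ` {-2 * int M..2 * int M}"
        unfolding A_def B_def by (intro SigmaI imageI)
    qed
  qed auto
  also have "\<dots> = (\<Sum>a\<in>(\<lambda>p. 2 * p - (\<kappa>1 + \<kappa>2)) ` {-2 * int M..2 * int M}. \<Sum>b\<in>(\<lambda>p. 2 * p - (\<kappa>1 - \<kappa>2)) ` {-2 * int M..2 * int M}.
       emeasure lborel (level (2 * \<delta>) (\<tau>' - of_int a * of_int b)))"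
    by (simp add: sum.cartesian_product case_prod_beta')
  also have "\<dots> \<le> ennreal (140 * real (5 * M) * sqrt (2 * \<delta>))"
  proof (rule hyperbola_count)
    show "card ((\<lambda>p. 2 * p - (\<kappa>1 + \<kappa>2)) ` {-2 * int M..2 * int M}) \<le> 5 * M"
      using M by (intro order.trans[OF card_image_le]) auto
    show "card ((\<lambda>p. 2 * p - (\<kappa>1 - \<kappa>2)) ` {-2 * int M..2 * int M}) \<le> 5 * M"
      using M by (intro order.trans[OF card_image_le]) auto
  qed (use \<delta> in auto)
  also have "\<dots> \<le> ennreal (1400 * real M * sqrt \<delta>)"
  proof (rule ennreal_leI)
    have "sqrt (2 * \<delta>) \<le> sqrt (4 * \<delta>)" using \<delta> by (intro real_sqrt_le_mono) auto
    then have "sqrt (2 * \<delta>) \<le> 2 * sqrt \<delta>" by (simp add: real_sqrt_mult)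
    then have "700 * real M * sqrt (2 * \<delta>) \<le> 700 * real M * (2 * sqrt \<delta>)" by (intro mult_left_mono) auto
    then show "140 * real (5 * M) * sqrt (2 * \<delta>) \<le> 1400 * real M * sqrt \<delta>" by simp
  qed
  finally show ?thesis .
qed

section \<open>The bilinear estimate in the fourth power\<close>

lemma measurable_diff_RZ2 [measurable (raw)]:
  assumes f: "f \<in> measurable M RZ2" and g: "g \<in> measurable M RZ2"
  shows "(\<lambda>x. f x - g x) \<in> measurable M RZ2"
proof -
  have [measurable]: "(\<lambda>x. fst (f x)) \<in> borel_measurable M" "(\<lambda>x. fst (g x)) \<in> borel_measurable M"
    using measurable_compose[OF f measurable_RZ2(1)] measurable_compose[OF g measurable_RZ2(1)] by simp_all
  have snd: "snd \<in> measurable RZ2 Z2" unfolding RZ2_eq by measurable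
  have "(\<lambda>x. (snd (f x), snd (g x))) \<in> measurable M (Z2 \<Otimes>\<^sub>M Z2)"
    by (intro measurable_Pair measurable_compose[OF f snd] measurable_compose[OF g snd])
  then have "(\<lambda>x. (snd (f x), snd (g x))) \<in> measurable M (count_space UNIV)"
    by (simp add: pair_measure_countable)
  from measurable_compose[OF this, of "\<lambda>(a, b). a - b" Z2]
  have "(\<lambda>x. snd (f x) - snd (g x)) \<in> measurable M Z2" by simp
  then have "(\<lambda>x. (fst (f x) - fst (g x), snd (f x) - snd (g x))) \<in> measurable M RZ2"
    unfolding RZ2_eq by measurable
  then show ?thesis by (simp add: minus_prod_def)
qed

lemma nn_integral_RZ2_translate:
  assumes f[measurable]: "f \<in> borel_measurable RZ2"
  shows "(\<integral>\<^sup>+\<zeta>. f (\<zeta> - \<zeta>') \<partial>RZ2) = (\<integral>\<^sup>+\<zeta>. f \<zeta> \<partial>RZ2)"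
proof -
  interpret P: pair_sigma_finite lborel Z2
    by (intro pair_sigma_finite.intro sigma_finite_lborel sigma_finite_Z2)
  have slice: "(\<lambda>\<xi>. f (\<xi>, k)) \<in> borel_measurable borel" for k
    using f unfolding RZ2_eq by measurable
  have "(\<integral>\<^sup>+\<zeta>. f (\<zeta> - \<zeta>') \<partial>RZ2) = (\<integral>\<^sup>+k. \<integral>\<^sup>+\<xi>. f ((\<xi>, k) - \<zeta>') \<partial>lborel \<partial>Z2)"
    using P.nn_integral_snd[of "\<lambda>\<zeta>. f (\<zeta> - \<zeta>')"] unfolding RZ2_eq[symmetric] by simp
  also have "\<dots> = (\<integral>\<^sup>+k. \<integral>\<^sup>+\<xi>. f (\<xi>, k - snd \<zeta>') \<partial>lborel \<partial>Z2)"
  proof (rule nn_integral_cong)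
    fix k
    show "(\<integral>\<^sup>+\<xi>. f ((\<xi>, k) - \<zeta>') \<partial>lborel) = (\<integral>\<^sup>+\<xi>. f (\<xi>, k - snd \<zeta>') \<partial>lborel)"
      using nn_integral_real_affine[OF slice, of 1 "k - snd \<zeta>'" "- fst \<zeta>'"] by (simp add: minus_prod_def)
  qed
  also have "\<dots> = (\<integral>\<^sup>+k. \<integral>\<^sup>+\<xi>. f (\<xi>, k) \<partial>lborel \<partial>Z2)"
    by (rule nn_integral_bij_count_space) (auto simp: bij_betw_def inj_on_def image_iff intro!: exI[of _ "_ + snd \<zeta>'"])
  also have "\<dots> = (\<integral>\<^sup>+\<zeta>. f \<zeta> \<partial>RZ2)"
    using P.nn_integral_snd[of f] f unfolding RZ2_eq[symmetric] by simp
  finally show ?thesis .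
qed

lemma distr_RZ2_translate: "distr RZ2 RZ2 (\<lambda>\<zeta>. \<zeta> - \<zeta>') = RZ2"
proof (rule measure_eqI)
  fix A assume "A \<in> sets (distr RZ2 RZ2 (\<lambda>\<zeta>. \<zeta> - \<zeta>'))"
  then have A[measurable]: "A \<in> sets RZ2" by simp
  have "emeasure (distr RZ2 RZ2 (\<lambda>\<zeta>. \<zeta> - \<zeta>')) A = (\<integral>\<^sup>+\<zeta>. indicator A \<zeta> \<partial>distr RZ2 RZ2 (\<lambda>\<zeta>. \<zeta> - \<zeta>'))" by simp
  also have "\<dots> = (\<integral>\<^sup>+\<zeta>. indicator A (\<zeta> - \<zeta>') \<partial>RZ2)" by (subst nn_integral_distr) auto
  also have "\<dots> = emeasure RZ2 A" by (subst nn_integral_RZ2_translate) auto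
  finally show "emeasure (distr RZ2 RZ2 (\<lambda>\<zeta>. \<zeta> - \<zeta>')) A = emeasure RZ2 A" .
qed simp

lemma integral_RZ2_translate:
  fixes f :: "_ \<Rightarrow> complex"
  assumes "f \<in> borel_measurable RZ2"
  shows "(LINT \<zeta>|RZ2. f (\<zeta> - \<zeta>')) = (LINT \<zeta>|RZ2. f \<zeta>)"
  using integral_distr[of "\<lambda>\<zeta>. \<zeta> - \<zeta>'" RZ2 RZ2 f] assms unfolding distr_RZ2_translate by simp

text \<open>The frequency density of the square of \<open>ext F t\<close>: the square becomes a convolution.\<close>

definition bilinear_density :: "(real \<times> int \<times> int \<Rightarrow> complex) \<Rightarrow> real \<Rightarrow> real \<times> int \<times> int \<Rightarrow> complex" where
  "bilinear_density F t \<zeta> = (LINT \<zeta>'|RZ2. F \<zeta>' * F (\<zeta> - \<zeta>') * cis (t * (- (hyp \<zeta>' + hyp (\<zeta> - \<zeta>')))))"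

lemma convolution_integrable:
  fixes F :: "_ \<Rightarrow> complex"
  assumes F: "integrable RZ2 F"
  shows "integrable (RZ2 \<Otimes>\<^sub>M RZ2) (\<lambda>(\<zeta>', \<zeta>). F \<zeta>' * F (\<zeta> - \<zeta>'))"
proof (rule integrableI_bounded)
  interpret R: sigma_finite_measure RZ2 by (rule sigma_finite_RZ2)
  have [measurable]: "F \<in> borel_measurable RZ2" using F by auto
  show "(\<lambda>(\<zeta>', \<zeta>). F \<zeta>' * F (\<zeta> - \<zeta>')) \<in> borel_measurable (RZ2 \<Otimes>\<^sub>M RZ2)" by measurable
  have "(\<integral>\<^sup>+p. ennreal (norm (case p of (\<zeta>', \<zeta>) \<Rightarrow> F \<zeta>' * F (\<zeta> - \<zeta>'))) \<partial>(RZ2 \<Otimes>\<^sub>M RZ2))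
     = (\<integral>\<^sup>+\<zeta>'. \<integral>\<^sup>+\<zeta>. ennreal (norm (F \<zeta>')) * ennreal (norm (F (\<zeta> - \<zeta>'))) \<partial>RZ2 \<partial>RZ2)"
    by (subst R.nn_integral_fst[symmetric]) (auto simp: norm_mult ennreal_mult)
  also have "\<dots> = (\<integral>\<^sup>+\<zeta>'. ennreal (norm (F \<zeta>')) * (\<integral>\<^sup>+\<zeta>. ennreal (norm (F \<zeta>)) \<partial>RZ2) \<partial>RZ2)"
    by (simp add: nn_integral_cmult nn_integral_RZ2_translate[of "\<lambda>\<zeta>. ennreal (norm (F \<zeta>))"])
  also have "\<dots> = (\<integral>\<^sup>+\<zeta>. ennreal (norm (F \<zeta>)) \<partial>RZ2) * (\<integral>\<^sup>+\<zeta>. ennreal (norm (F \<zeta>)) \<partial>RZ2)"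
    by (simp add: nn_integral_multc)
  also have "\<dots> < \<infinity>" using F by (simp add: integrable_iff_bounded ennreal_mult_less_top)
  finally show "(\<integral>\<^sup>+p. ennreal (norm (case p of (\<zeta>', \<zeta>) \<Rightarrow> F \<zeta>' * F (\<zeta> - \<zeta>'))) \<partial>(RZ2 \<Otimes>\<^sub>M RZ2)) < \<infinity>" .
qed

lemma convolution_phase_integrable:
  fixes F :: "_ \<Rightarrow> complex"
  assumes F: "integrable RZ2 F"
  shows "integrable (RZ2 \<Otimes>\<^sub>M RZ2) (\<lambda>(\<zeta>', \<zeta>). F \<zeta>' * F (\<zeta> - \<zeta>') * cis (t * (- (hyp \<zeta>' + hyp (\<zeta> - \<zeta>')))))"
  using integrable_times_cis[OF convolution_integrable[OF F], of "\<lambda>p. t * (- (hyp (fst p) + hyp (snd p - fst p)))"]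
  by (simp add: case_prod_beta')

lemma ext_square:
  assumes F: "integrable RZ2 F"
  shows "(ext F t z)\<^sup>2 = (LINT \<zeta>|RZ2. bilinear_density F t \<zeta> * cis (phase z \<zeta>))"
proof -
  interpret P: pair_sigma_finite RZ2 RZ2 by (intro pair_sigma_finite.intro sigma_finite_RZ2)
  have [measurable]: "F \<in> borel_measurable RZ2" using F by auto
  let ?E = "\<lambda>\<zeta>. F \<zeta> * cis (phase z \<zeta> - t * hyp \<zeta>)"
  let ?f = "\<lambda>\<zeta>' \<zeta>. F \<zeta>' * F (\<zeta> - \<zeta>') * cis (t * (- (hyp \<zeta>' + hyp (\<zeta> - \<zeta>')))) * cis (phase z \<zeta>)"
  have pt: "?E \<zeta>' * ?E (\<zeta> - \<zeta>') = ?f \<zeta>' \<zeta>" for \<zeta> \<zeta>'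
  proof -
    have "phase z \<zeta> = phase z \<zeta>' + phase z (\<zeta> - \<zeta>')" using phase_add[of z \<zeta>' "\<zeta> - \<zeta>'"] by simp
    then have "cis (phase z \<zeta>' - t * hyp \<zeta>') * cis (phase z (\<zeta> - \<zeta>') - t * hyp (\<zeta> - \<zeta>'))
       = cis (t * (- (hyp \<zeta>' + hyp (\<zeta> - \<zeta>')))) * cis (phase z \<zeta>)"
      by (simp add: cis_mult algebra_simps)
    then show ?thesis by (simp add: mult_ac)
  qed
  have "(ext F t z)\<^sup>2 = (LINT \<zeta>'|RZ2. ?E \<zeta>' * ext F t z)"
    unfolding power2_eq_square by (simp add: ext_def)
  also have "\<dots> = (LINT \<zeta>'|RZ2. LINT \<zeta>|RZ2. ?f \<zeta>' \<zeta>)"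
  proof (intro Bochner_Integration.integral_cong refl)
    fix \<zeta>'
    have "ext F t z = (LINT \<zeta>|RZ2. ?E (\<zeta> - \<zeta>'))"
      unfolding ext_def by (rule integral_RZ2_translate[symmetric]) measurable
    then show "?E \<zeta>' * ext F t z = (LINT \<zeta>|RZ2. ?f \<zeta>' \<zeta>)"
      unfolding pt[symmetric] by simp
  qed
  also have "\<dots> = (LINT \<zeta>|RZ2. LINT \<zeta>'|RZ2. ?f \<zeta>' \<zeta>)"
  proof (rule P.Fubini_integral[symmetric])
    have "integrable (RZ2 \<Otimes>\<^sub>M RZ2) (\<lambda>p. (case p of (\<zeta>', \<zeta>) \<Rightarrow> F \<zeta>' * F (\<zeta> - \<zeta>') * cis (t * (- (hyp \<zeta>' + hyp (\<zeta> - \<zeta>'))))) * cis (phase z (snd p)))"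
      by (rule integrable_times_cis[OF convolution_phase_integrable[OF F]]) measurable
    then show "integrable (RZ2 \<Otimes>\<^sub>M RZ2) (\<lambda>(\<zeta>', \<zeta>). ?f \<zeta>' \<zeta>)" by (simp add: case_prod_beta')
  qed
  also have "\<dots> = (LINT \<zeta>|RZ2. bilinear_density F t \<zeta> * cis (phase z \<zeta>))"
    unfolding bilinear_density_def by simp
  finally show ?thesis .
qed

text \<open>Where the phase is at distance between \<open>j / T\<close> and \<open>(j + 1) / T\<close> from the centre, the Gaussian is at most
  \<open>q ^ j\<close>.  Each such shell consists of two parts of the kind that \<open>cone_count\<close> measures with
  \<open>\<delta> = 1 / T\<close>.\<close>

lemma gaussian_cone_mass:
  obtains C where "C > 0" "\<And>M T \<zeta> \<tau>. M \<ge> 1 \<Longrightarrow> T \<ge> 1 \<Longrightarrow>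
    (\<integral>\<^sup>+\<zeta>'. indicator (freq_box (real M)) \<zeta>' * ennreal (sqrt (2 * pi) / (1 / T) * exp (- (- (hyp \<zeta>' + hyp (\<zeta> - \<zeta>')) - \<tau>)\<^sup>2 / (2 * (1 / T)\<^sup>2))) \<partial>RZ2)
     \<le> ennreal (C * real M * sqrt T)"
proof -
  define q where "q = exp (- (1 / 2) :: real)"
  have q: "0 < q" "q < 1" by (auto simp: q_def)
  define Q where "Q = (\<Sum>j. q ^ j)"
  have Q: "Q = 1 / (1 - q)" unfolding Q_def using q by (intro suminf_geometric) auto
  then have Qpos: "Q > 0" using q by simp
  show thesis
  proof (rule that[of "sqrt (2 * pi) * 2800 * Q"])
    show "sqrt (2 * pi) * 2800 * Q > 0" using Qpos by simp
    fix M :: nat and T \<tau> :: real and \<zeta> :: "real \<times> int \<times> int"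
    assume M: "M \<ge> 1" and T: "T \<ge> 1"
    define \<psi> where "\<psi> \<zeta>' = hyp \<zeta>' + hyp (\<zeta> - \<zeta>')" for \<zeta>'
    have [measurable]: "\<psi> \<in> borel_measurable RZ2" unfolding \<psi>_def by measurable
    define A where "A j = {\<zeta>' \<in> freq_box (real M). \<bar>\<psi> \<zeta>' - (- \<tau> + (real j + 1/2) / T)\<bar> \<le> 1 / T}" for j :: nat
    define B where "B j = {\<zeta>' \<in> freq_box (real M). \<bar>\<psi> \<zeta>' - (- \<tau> - (real j + 1/2) / T)\<bar> \<le> 1 / T}" for j :: nat
    have meas: "{\<zeta>' \<in> freq_box (real M). \<bar>\<psi> \<zeta>' - s\<bar> \<le> d} \<in> sets RZ2" for s d
    proof -
      have "{\<zeta>' \<in> space RZ2. \<zeta>' \<in> freq_box (real M) \<and> \<bar>\<psi> \<zeta>' - s\<bar> \<le> d} \<in> sets RZ2" by measurable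
      then show ?thesis by simp
    qed
    have [measurable]: "A j \<in> sets RZ2" "B j \<in> sets RZ2" for j unfolding A_def B_def by (rule meas)+
    have sqT: "sqrt (1 / T) = sqrt T / T" using T by (simp add: real_sqrt_divide field_simps)
    have AB: "emeasure RZ2 (A j) \<le> ennreal (1400 * real M * sqrt (1 / T))" "emeasure RZ2 (B j) \<le> ennreal (1400 * real M * sqrt (1 / T))" for j
      unfolding A_def B_def \<psi>_def using T by (intro cone_count M; simp)+
    have pt: "indicator (freq_box (real M)) \<zeta>' * ennreal (sqrt (2 * pi) / (1 / T) * exp (- (- \<psi> \<zeta>' - \<tau>)\<^sup>2 / (2 * (1 / T)\<^sup>2)))
       \<le> ennreal (sqrt (2 * pi) * T) * (\<Sum>j. ennreal (q ^ j) * (indicator (A j) \<zeta>' + indicator (B j) \<zeta>'))" for \<zeta>'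
    proof (cases "\<zeta>' \<in> freq_box (real M)")
      case True
      define s where "s = T * (\<psi> \<zeta>' + \<tau>)"
      define j where "j = nat \<lfloor>\<bar>s\<bar>\<rfloor>"
      have j: "real j \<le> \<bar>s\<bar>" "\<bar>s\<bar> < real j + 1" unfolding j_def by (auto simp: of_nat_nat)
      have "- (- \<psi> \<zeta>' - \<tau>)\<^sup>2 / (2 * (1 / T)\<^sup>2) = - s\<^sup>2 / 2"
        using T by (simp add: s_def power2_eq_square field_simps)
      also have "\<dots> \<le> real j * (- (1 / 2))"
      proof -
        have "real j \<le> (real j)\<^sup>2" by (cases j) (auto simp: power2_eq_square)
        also have "\<dots> \<le> s\<^sup>2" using j(1) by (metis abs_of_nat abs_le_square_iff)
        finally show ?thesis by simp
      qed
      finally have "exp (- (- \<psi> \<zeta>' - \<tau>)\<^sup>2 / (2 * (1 / T)\<^sup>2)) \<le> q ^ j"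
        unfolding q_def exp_of_nat_mult[symmetric] by simp
      then have "sqrt (2 * pi) / (1 / T) * exp (- (- \<psi> \<zeta>' - \<tau>)\<^sup>2 / (2 * (1 / T)\<^sup>2)) \<le> sqrt (2 * pi) * T * q ^ j"
        using T by (simp add: mult_left_mono)
      then have 1: "ennreal (sqrt (2 * pi) / (1 / T) * exp (- (- \<psi> \<zeta>' - \<tau>)\<^sup>2 / (2 * (1 / T)\<^sup>2))) \<le> ennreal (sqrt (2 * pi) * T) * ennreal (q ^ j)"
        using T q by (subst ennreal_mult[symmetric]) (auto intro!: ennreal_leI)
      have "\<zeta>' \<in> A j \<or> \<zeta>' \<in> B j"
      proof (cases "s \<ge> 0")
        case s: True
        then have "\<bar>s - (real j + 1/2)\<bar> \<le> 1" using j by (auto simp: abs_le_iff)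
        moreover have "\<psi> \<zeta>' - (- \<tau> + (real j + 1/2) / T) = (s - (real j + 1/2)) / T" using T by (simp add: s_def field_simps)
        ultimately have "\<bar>\<psi> \<zeta>' - (- \<tau> + (real j + 1/2) / T)\<bar> \<le> 1 / T" using T by (simp add: divide_right_mono)
        then show ?thesis using True by (simp add: A_def)
      next
        case s: False
        then have "\<bar>s + (real j + 1/2)\<bar> \<le> 1" using j by (auto simp: abs_le_iff)
        moreover have "\<psi> \<zeta>' - (- \<tau> - (real j + 1/2) / T) = (s + (real j + 1/2)) / T" using T by (simp add: s_def field_simps)
        ultimately have "\<bar>\<psi> \<zeta>' - (- \<tau> - (real j + 1/2) / T)\<bar> \<le> 1 / T" using T by (simp add: divide_right_mono)
        then show ?thesis using True by (simp add: B_def)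
      qed
      then have "1 \<le> indicator (A j) \<zeta>' + (indicator (B j) \<zeta>' :: ennreal)" by (auto simp: indicator_def)
      then have "ennreal (q ^ j) * 1 \<le> ennreal (q ^ j) * (indicator (A j) \<zeta>' + indicator (B j) \<zeta>')" by (intro mult_left_mono) auto
      also have "\<dots> \<le> (\<Sum>j. ennreal (q ^ j) * (indicator (A j) \<zeta>' + indicator (B j) \<zeta>'))"
        using sum_le_suminf[of "\<lambda>j. ennreal (q ^ j) * (indicator (A j) \<zeta>' + indicator (B j) \<zeta>')" "{j}"] by simp
      finally have "ennreal (sqrt (2 * pi) * T) * ennreal (q ^ j) \<le> ennreal (sqrt (2 * pi) * T) * (\<Sum>j. ennreal (q ^ j) * (indicator (A j) \<zeta>' + indicator (B j) \<zeta>'))"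
        by (intro mult_left_mono) auto
      from order.trans[OF 1 this] show ?thesis using True by (simp only: indicator_simps mult_1_left)
    qed simp
    have "(\<integral>\<^sup>+\<zeta>'. indicator (freq_box (real M)) \<zeta>' * ennreal (sqrt (2 * pi) / (1 / T) * exp (- (- (hyp \<zeta>' + hyp (\<zeta> - \<zeta>')) - \<tau>)\<^sup>2 / (2 * (1 / T)\<^sup>2))) \<partial>RZ2)
      \<le> (\<integral>\<^sup>+\<zeta>'. ennreal (sqrt (2 * pi) * T) * (\<Sum>j. ennreal (q ^ j) * (indicator (A j) \<zeta>' + indicator (B j) \<zeta>')) \<partial>RZ2)"
      unfolding \<psi>_def[symmetric] by (intro nn_integral_mono pt)
    also have "\<dots> = ennreal (sqrt (2 * pi) * T) * (\<Sum>j. ennreal (q ^ j) * (emeasure RZ2 (A j) + emeasure RZ2 (B j)))"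
      by (simp add: nn_integral_cmult nn_integral_suminf nn_integral_add)
    also have "\<dots> \<le> ennreal (sqrt (2 * pi) * T) * (\<Sum>j. ennreal (q ^ j) * ennreal (2800 * real M * sqrt (1 / T)))"
    proof (intro mult_left_mono suminf_le)
      fix j
      have "emeasure RZ2 (A j) + emeasure RZ2 (B j) \<le> ennreal (1400 * real M * sqrt (1 / T)) + ennreal (1400 * real M * sqrt (1 / T))"
        by (intro add_mono AB)
      also have "\<dots> = ennreal (2800 * real M * sqrt (1 / T))"
        using T by (subst ennreal_plus[symmetric]) auto
      finally show "emeasure RZ2 (A j) + emeasure RZ2 (B j) \<le> ennreal (2800 * real M * sqrt (1 / T))" .
    qed auto
    also have "(\<Sum>j. ennreal (q ^ j) * ennreal (2800 * real M * sqrt (1 / T))) = ennreal Q * ennreal (2800 * real M * sqrt (1 / T))"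
    proof -
      have "(\<Sum>j. ennreal (q ^ j)) = ennreal Q"
        unfolding Q_def using q by (intro suminf_ennreal2) (auto intro: summable_geometric)
      then show ?thesis by (subst ennreal_suminf_multc) simp
    qed
    also have "ennreal (sqrt (2 * pi) * T) * (ennreal Q * ennreal (2800 * real M * sqrt (1 / T))) = ennreal (sqrt (2 * pi) * 2800 * Q * real M * sqrt T)"
    proof -
      have nn: "0 \<le> sqrt (2 * pi) * T" "0 \<le> Q" "0 \<le> 2800 * real M * (sqrt T / T)"
        using T Qpos by auto
      have "sqrt (2 * pi) * T * (Q * (2800 * real M * (sqrt T / T))) = sqrt (2 * pi) * 2800 * Q * real M * sqrt T"
        using T by simp
      then show ?thesis
        unfolding sqT using nn by (metis ennreal_mult mult_nonneg_nonneg)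
    qed
    finally show "(\<integral>\<^sup>+\<zeta>'. indicator (freq_box (real M)) \<zeta>' * ennreal (sqrt (2 * pi) / (1 / T) * exp (- (- (hyp \<zeta>' + hyp (\<zeta> - \<zeta>')) - \<tau>)\<^sup>2 / (2 * (1 / T)\<^sup>2))) \<partial>RZ2)
      \<le> ennreal (sqrt (2 * pi) * 2800 * Q * real M * sqrt T)" .
  qed
qed

text \<open>The Bessel inequality in space turns the fourth power of the solution into the energy of its
  bilinear density.  At each frequency that density is, as a function of time, a superposition of oscillations whose
  phases are counted by \<open>gaussian_cone_mass\<close>, and the large sieve with the weight of width \<open>T\<close>
  applies.  What remains is the total energy of a convolution without phases, the product of two energies.\<close>

lemma quartic_estimate:
  obtains C where "C > 0" "\<And>M F T. M \<ge> 1 \<Longrightarrow> F \<in> band M \<Longrightarrow> T \<ge> 1 \<Longrightarrow>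
    (\<integral>\<^sup>+t. indicator {0..T} t * (\<integral>\<^sup>+z. ennreal ((norm (ext F t z)) ^ 4) \<partial>RT2) \<partial>lborel) \<le> ennreal (C * real M * sqrt T)"
proof -
  obtain C0 where C0: "C0 > 0" and cone: "\<And>M T \<zeta> \<tau>. M \<ge> 1 \<Longrightarrow> T \<ge> 1 \<Longrightarrow>
    (\<integral>\<^sup>+\<zeta>'. indicator (freq_box (real M)) \<zeta>' * ennreal (sqrt (2 * pi) / (1 / T) * exp (- (- (hyp \<zeta>' + hyp (\<zeta> - \<zeta>')) - \<tau>)\<^sup>2 / (2 * (1 / T)\<^sup>2))) \<partial>RZ2)
     \<le> ennreal (C0 * real M * sqrt T)"
    by (rule gaussian_cone_mass) (rule that)
  show thesis
  proof (rule that[of "(2 * pi) ^ 3 * exp (1/2) * C0"])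
    show "(2 * pi) ^ 3 * exp (1/2) * C0 > 0" using C0 by simp
    fix M :: nat and F and T :: real
    assume M: "M \<ge> 1" and F: "F \<in> band M" and T: "T \<ge> 1"
    interpret R: sigma_finite_measure RZ2 by (rule sigma_finite_RZ2)
    interpret RT: sigma_finite_measure RT2 by (rule sigma_finite_RT2)
    interpret P: pair_sigma_finite RZ2 RZ2 by (intro pair_sigma_finite.intro sigma_finite_RZ2)
    interpret LR: pair_sigma_finite lborel RZ2
      by (intro pair_sigma_finite.intro sigma_finite_lborel sigma_finite_RZ2)
    have [measurable]: "F \<in> borel_measurable RZ2" and supp: "\<And>\<zeta>. \<zeta> \<notin> freq_box (real M) \<Longrightarrow> F \<zeta> = 0"
      and en: "energy RZ2 F \<le> 1" using F by (auto simp: band_def)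
    note Fi = band_L1(1)[OF F]
    let ?H = "bilinear_density F"
    have [measurable]: "(\<lambda>p. ?H (fst p) (snd p)) \<in> borel_measurable (lborel \<Otimes>\<^sub>M RZ2)" "?H t \<in> borel_measurable RZ2"
      "(\<lambda>t. ?H t \<zeta>) \<in> borel_measurable borel" for t \<zeta>
      unfolding bilinear_density_def[abs_def] by measurable
    have step1: "(\<integral>\<^sup>+z. ennreal ((norm (ext F t z)) ^ 4) \<partial>RT2) \<le> ennreal ((2 * pi) ^ 3) * energy RZ2 (?H t)" for t
    proof -
      have "(\<integral>\<^sup>+z. ennreal ((norm (ext F t z)) ^ 4) \<partial>RT2) = (\<integral>\<^sup>+z. ennreal ((norm (LINT \<zeta>|RZ2. ?H t \<zeta> * cis (phase z \<zeta>)))\<^sup>2) \<partial>RT2)"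
        unfolding ext_square[OF Fi, symmetric] by (simp add: norm_power power_mult[symmetric])
      also have "\<dots> \<le> ennreal ((2 * pi) ^ 3) * (\<integral>\<^sup>+\<zeta>. ennreal ((norm (?H t \<zeta>))\<^sup>2) \<partial>RZ2)"
      \<comment> \<open>sums of two frequencies in the box lie in the box of twice the size\<close>
      proof (rule bessel_synthesis[OF _ finite_box_support[of "2 * M"]])
        show "integrable RZ2 (?H t)"
          using P.integrable_snd[OF convolution_phase_integrable[OF Fi, of t]] unfolding bilinear_density_def[abs_def] .
        fix \<xi> k assume k: "k \<notin> box_support (2 * M)"
        have "F \<zeta>' * F ((\<xi>, k) - \<zeta>') = 0" for \<zeta>'
        proof (rule ccontr)
          assume "F \<zeta>' * F ((\<xi>, k) - \<zeta>') \<noteq> 0"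
          then have "F \<zeta>' \<noteq> 0" "F ((\<xi>, k) - \<zeta>') \<noteq> 0" by auto
          then have "\<zeta>' \<in> freq_box (real M)" "(\<xi>, k) - \<zeta>' \<in> freq_box (real M)" using supp by blast+
          then show False using k
            by (cases \<zeta>', cases k) (auto simp: freq_box_def box_support_def)
        qed
        then show "?H t (\<xi>, k) = 0" by (simp only: bilinear_density_def mult_zero_left) simp
      qed
      finally show ?thesis unfolding energy_def .
    qed
    have conv_sq: "AE \<zeta> in RZ2. integrable RZ2 (\<lambda>\<zeta>'. F \<zeta>' * F (\<zeta> - \<zeta>'))"
      using P.AE_integrable_snd[of "\<lambda>\<zeta>' \<zeta>. F \<zeta>' * F (\<zeta> - \<zeta>')"] convolution_integrable[OF Fi] by simp
    have step2: "AE \<zeta> in RZ2. (\<integral>\<^sup>+t. indicator {0..T} t * ennreal ((norm (?H t \<zeta>))\<^sup>2) \<partial>lborel)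
       \<le> ennreal (exp (1/2)) * (ennreal (C0 * real M * sqrt T) * (\<integral>\<^sup>+\<zeta>'. ennreal ((norm (F \<zeta>' * F (\<zeta> - \<zeta>')))\<^sup>2) \<partial>RZ2))"
      using conv_sq
    proof eventually_elim
      fix \<zeta> assume int: "integrable RZ2 (\<lambda>\<zeta>'. F \<zeta>' * F (\<zeta> - \<zeta>'))"
      let ?X = "restrict_space RZ2 (freq_box (real M))"
      let ?a = "\<lambda>\<zeta>'. F \<zeta>' * F (\<zeta> - \<zeta>')"
      let ?\<phi> = "\<lambda>\<zeta>'. - (hyp \<zeta>' + hyp (\<zeta> - \<zeta>'))"
      have \<Omega>: "freq_box (real M) \<inter> space RZ2 \<in> sets RZ2" by simp
      have H_eq: "?H t \<zeta> = (LINT \<zeta>'|?X. ?a \<zeta>' * cis (t * ?\<phi> \<zeta>'))" for t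
        unfolding bilinear_density_def by (subst integral_restrict_space[OF \<Omega>])
          (intro Bochner_Integration.integral_cong refl, use supp in \<open>auto simp: indicator_def\<close>)
      have "(\<integral>\<^sup>+t. ennreal (exp (- (1 / T * t)\<^sup>2 / 2) * (norm (LINT \<zeta>'|?X. ?a \<zeta>' * cis (t * ?\<phi> \<zeta>')))\<^sup>2) \<partial>lborel)
         \<le> ennreal (C0 * real M * sqrt T) * (\<integral>\<^sup>+\<zeta>'. ennreal ((norm (?a \<zeta>'))\<^sup>2) \<partial>?X)"
      proof (rule gaussian_large_sieve)
        show "sigma_finite_measure ?X" by (rule sigma_finite_measure_restrict_space[OF sigma_finite_RZ2]) simp
        show "integrable ?X ?a" using int by (subst integrable_restrict_space[OF \<Omega>]) (rule integrable_mult_indicator, auto)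
        show "?\<phi> \<in> borel_measurable ?X" by (rule measurable_restrict_space1) measurable
        show "1 / T > 0" using T by simp
        show "(\<integral>\<^sup>+x. ennreal (sqrt (2 * pi) / (1 / T) * exp (- (?\<phi> x - \<tau>)\<^sup>2 / (2 * (1 / T)\<^sup>2))) \<partial>?X) \<le> ennreal (C0 * real M * sqrt T)" for \<tau>
          using cone[OF M T, of \<zeta> \<tau>] by (subst nn_integral_restrict_space[OF \<Omega>]) (simp add: mult.commute)
      qed
      also have "(\<integral>\<^sup>+\<zeta>'. ennreal ((norm (?a \<zeta>'))\<^sup>2) \<partial>?X) \<le> (\<integral>\<^sup>+\<zeta>'. ennreal ((norm (?a \<zeta>'))\<^sup>2) \<partial>RZ2)"
        by (subst nn_integral_restrict_space[OF \<Omega>]) (intro nn_integral_mono, auto simp: indicator_def)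
      finally have main: "(\<integral>\<^sup>+t. ennreal (exp (- (1 / T * t)\<^sup>2 / 2) * (norm (?H t \<zeta>))\<^sup>2) \<partial>lborel)
         \<le> ennreal (C0 * real M * sqrt T) * (\<integral>\<^sup>+\<zeta>'. ennreal ((norm (?a \<zeta>'))\<^sup>2) \<partial>RZ2)"
        unfolding H_eq by (simp add: mult_left_mono)
      have "(\<integral>\<^sup>+t. indicator {0..T} t * ennreal ((norm (?H t \<zeta>))\<^sup>2) \<partial>lborel)
         \<le> (\<integral>\<^sup>+t. ennreal (exp (1/2)) * ennreal (exp (- (1 / T * t)\<^sup>2 / 2) * (norm (?H t \<zeta>))\<^sup>2) \<partial>lborel)"
      proof (intro nn_integral_mono)
        fix t
        \<comment> \<open>the Gaussian weight is at least \<open>exp (- 1/2)\<close> up to the time \<open>T\<close>\<close>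
        have "1 \<le> exp (1/2) * exp (- (1 / T * t)\<^sup>2 / 2)" if "t \<in> {0..T}"
        proof -
          have "(1 / T * t)\<^sup>2 \<le> 1\<^sup>2" using that T by (intro power_mono) auto
          then have "0 \<le> 1/2 + - (1 / T * t)\<^sup>2 / 2" by simp
          then have "exp 0 \<le> exp (1/2 + - (1 / T * t)\<^sup>2 / 2)" by (simp only: exp_le_cancel_iff)
          then show ?thesis by (simp only: exp_zero exp_add)
        qed
        then have "(norm (?H t \<zeta>))\<^sup>2 \<le> exp (1/2) * (exp (- (1 / T * t)\<^sup>2 / 2) * (norm (?H t \<zeta>))\<^sup>2)" if "t \<in> {0..T}"
          using that mult_right_mono[of 1 "exp (1/2) * exp (- (1 / T * t)\<^sup>2 / 2)" "(norm (?H t \<zeta>))\<^sup>2"] by (simp add: mult.assoc)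
        then show "indicator {0..T} t * ennreal ((norm (?H t \<zeta>))\<^sup>2) \<le> ennreal (exp (1/2)) * ennreal (exp (- (1 / T * t)\<^sup>2 / 2) * (norm (?H t \<zeta>))\<^sup>2)"
          by (subst ennreal_mult[symmetric]) (auto simp: indicator_def intro!: ennreal_leI)
      qed
      also have "\<dots> = ennreal (exp (1/2)) * (\<integral>\<^sup>+t. ennreal (exp (- (1 / T * t)\<^sup>2 / 2) * (norm (?H t \<zeta>))\<^sup>2) \<partial>lborel)"
        by (rule nn_integral_cmult) measurable
      also have "\<dots> \<le> ennreal (exp (1/2)) * (ennreal (C0 * real M * sqrt T) * (\<integral>\<^sup>+\<zeta>'. ennreal ((norm (?a \<zeta>'))\<^sup>2) \<partial>RZ2))"
        by (intro mult_left_mono main) auto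
      finally show "(\<integral>\<^sup>+t. indicator {0..T} t * ennreal ((norm (?H t \<zeta>))\<^sup>2) \<partial>lborel)
         \<le> ennreal (exp (1/2)) * (ennreal (C0 * real M * sqrt T) * (\<integral>\<^sup>+\<zeta>'. ennreal ((norm (?a \<zeta>'))\<^sup>2) \<partial>RZ2))" .
    qed
    have step3: "(\<integral>\<^sup>+\<zeta>. \<integral>\<^sup>+\<zeta>'. ennreal ((norm (F \<zeta>' * F (\<zeta> - \<zeta>')))\<^sup>2) \<partial>RZ2 \<partial>RZ2) \<le> 1"
    proof -
      have "(\<integral>\<^sup>+\<zeta>. \<integral>\<^sup>+\<zeta>'. ennreal ((norm (F \<zeta>' * F (\<zeta> - \<zeta>')))\<^sup>2) \<partial>RZ2 \<partial>RZ2)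
         = (\<integral>\<^sup>+\<zeta>'. \<integral>\<^sup>+\<zeta>. ennreal ((norm (F \<zeta>'))\<^sup>2) * ennreal ((norm (F (\<zeta> - \<zeta>')))\<^sup>2) \<partial>RZ2 \<partial>RZ2)"
        by (subst P.Fubini') (simp_all add: norm_mult power_mult_distrib ennreal_mult, measurable)
      also have "\<dots> = (\<integral>\<^sup>+\<zeta>'. ennreal ((norm (F \<zeta>'))\<^sup>2) * energy RZ2 F \<partial>RZ2)"
        unfolding energy_def by (simp add: nn_integral_cmult nn_integral_RZ2_translate[of "\<lambda>\<zeta>. ennreal ((norm (F \<zeta>))\<^sup>2)"])
      also have "\<dots> = energy RZ2 F * energy RZ2 F"
        unfolding energy_def by (simp add: nn_integral_multc)
      also have "\<dots> \<le> 1 * 1" by (intro mult_mono en) auto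
      finally show ?thesis by simp
    qed
    have "(\<integral>\<^sup>+t. indicator {0..T} t * (\<integral>\<^sup>+z. ennreal ((norm (ext F t z)) ^ 4) \<partial>RT2) \<partial>lborel)
       \<le> (\<integral>\<^sup>+t. indicator {0..T} t * (ennreal ((2 * pi) ^ 3) * energy RZ2 (?H t)) \<partial>lborel)"
      by (intro nn_integral_mono mult_left_mono step1) auto
    also have "\<dots> = (\<integral>\<^sup>+t. ennreal ((2 * pi) ^ 3) * (\<integral>\<^sup>+\<zeta>. indicator {0..T} t * ennreal ((norm (?H t \<zeta>))\<^sup>2) \<partial>RZ2) \<partial>lborel)"
      unfolding energy_def by (intro nn_integral_cong) (simp add: nn_integral_cmult mult.left_commute)
    also have "\<dots> = ennreal ((2 * pi) ^ 3) * (\<integral>\<^sup>+t. \<integral>\<^sup>+\<zeta>. indicator {0..T} t * ennreal ((norm (?H t \<zeta>))\<^sup>2) \<partial>RZ2 \<partial>lborel)"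
      by (rule nn_integral_cmult) measurable
    also have "(\<integral>\<^sup>+t. \<integral>\<^sup>+\<zeta>. indicator {0..T} t * ennreal ((norm (?H t \<zeta>))\<^sup>2) \<partial>RZ2 \<partial>lborel)
       = (\<integral>\<^sup>+\<zeta>. \<integral>\<^sup>+t. indicator {0..T} t * ennreal ((norm (?H t \<zeta>))\<^sup>2) \<partial>lborel \<partial>RZ2)"
      by (rule LR.Fubini'[symmetric]) measurable
    also have "\<dots> \<le> (\<integral>\<^sup>+\<zeta>. ennreal (exp (1/2)) * (ennreal (C0 * real M * sqrt T) * (\<integral>\<^sup>+\<zeta>'. ennreal ((norm (F \<zeta>' * F (\<zeta> - \<zeta>')))\<^sup>2) \<partial>RZ2)) \<partial>RZ2)"
      by (rule nn_integral_mono_AE[OF step2])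
    also have "\<dots> = ennreal (exp (1/2)) * (ennreal (C0 * real M * sqrt T) * (\<integral>\<^sup>+\<zeta>. \<integral>\<^sup>+\<zeta>'. ennreal ((norm (F \<zeta>' * F (\<zeta> - \<zeta>')))\<^sup>2) \<partial>RZ2 \<partial>RZ2))"
      by (simp add: nn_integral_cmult)
    also have "\<dots> \<le> ennreal (exp (1/2)) * (ennreal (C0 * real M * sqrt T) * 1)"
      by (intro mult_left_mono step3) auto
    also have "ennreal ((2 * pi) ^ 3) * (ennreal (exp (1/2)) * (ennreal (C0 * real M * sqrt T) * 1)) = ennreal ((2 * pi) ^ 3 * exp (1/2) * C0 * real M * sqrt T)"
      using C0 T by (simp add: ennreal_mult[symmetric] mult_ac)
    finally show "(\<integral>\<^sup>+t. indicator {0..T} t * (\<integral>\<^sup>+z. ennreal ((norm (ext F t z)) ^ 4) \<partial>RT2) \<partial>lborel) \<le> ennreal ((2 * pi) ^ 3 * exp (1/2) * C0 * real M * sqrt T)"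
      by (simp add: mult_left_mono)
  qed
qed

section \<open>Upper bounds for the space-time norm\<close>

lemma strichartz_mass_mono: "a \<le> a' \<Longrightarrow> b' \<le> b \<Longrightarrow> strichartz_mass F a' b' \<le> strichartz_mass F a b"
  unfolding strichartz_mass_def by (intro nn_integral_mono mult_right_mono) (auto simp: indicator_def)

text \<open>A translation in time multiplies \<open>F\<close> by a unimodular function.\<close>

lemma strichartz_mass_translate:
  assumes F: "F \<in> band M"
  shows "\<exists>F'\<in>band M. strichartz_mass F a (a + h) = strichartz_mass F' 0 h"
proof
  have [measurable]: "F \<in> borel_measurable RZ2" using F by (auto simp: band_def)
  let ?F = "\<lambda>\<zeta>. F \<zeta> * cis (- a * hyp \<zeta>)"
  show "?F \<in> band M" using F by (auto simp: band_def energy_def norm_mult)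
  interpret RT: sigma_finite_measure RT2 by (rule sigma_finite_RT2)
  have shift: "ext ?F t z = ext F (a + 1 * t) z" for t z
    unfolding ext_def
    by (intro Bochner_Integration.integral_cong refl) (simp add: mult.assoc cis_mult algebra_simps)
  have ind: "indicator {a..a + h} (a + 1 * t) = (indicator {0..h} t :: ennreal)" for t
    by (auto simp: indicator_def)
  have "strichartz_mass F a (a + h)
      = (\<integral>\<^sup>+t. indicator {a..a + h} (a + 1 * t) * (\<integral>\<^sup>+z. ennreal (norm (ext F (a + 1 * t) z) powr (10/3)) \<partial>RT2) \<partial>lborel)"
    unfolding strichartz_mass_def by (subst nn_integral_real_affine[where c = 1 and t = a]) auto
  then show "strichartz_mass F a (a + h) = strichartz_mass ?F 0 h"
    unfolding strichartz_mass_def shift[symmetric] ind .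
qed

lemma strichartz_mass_pieces:
  assumes F: "F \<in> band M" and h: "h > 0" and C: "\<And>F. F \<in> band M \<Longrightarrow> strichartz_mass F 0 h \<le> ennreal C" "C \<ge> 0"
  shows "strichartz_mass F 0 (real n * h) \<le> ennreal (real (Suc n) * C)"
proof (induction n)
  case 0
  have "strichartz_mass F 0 (real 0 * h) \<le> strichartz_mass F 0 h"
    using h by (intro strichartz_mass_mono) auto
  then show ?case using C(1)[OF F] by simp
next
  case (Suc n)
  have [measurable]: "F \<in> borel_measurable RZ2" using F by (auto simp: band_def)
  interpret RT: sigma_finite_measure RT2 by (rule sigma_finite_RT2)
  have "strichartz_mass F 0 (real (Suc n) * h) \<le> strichartz_mass F 0 (real n * h) + strichartz_mass F (real n * h) (real n * h + h)"
    unfolding strichartz_mass_def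
    by (subst nn_integral_add[symmetric])
      (auto simp: indicator_def algebra_simps intro!: nn_integral_mono)
  also have "\<dots> \<le> ennreal (real (Suc n) * C) + ennreal C"
    using strichartz_mass_translate[OF F, of "real n * h" h] C(1) Suc by (intro add_mono) auto
  also have "\<dots> = ennreal (real (Suc (Suc n)) * C)"
    using C(2) by (subst ennreal_plus[symmetric]) (auto simp: algebra_simps)
  finally show ?case .
qed

text \<open>The interval is covered by intervals of the length to which the short-time estimate applies.\<close>

lemma strichartz_mass_dispersive:
  obtains C where "C > 0" "\<And>M F T. M \<ge> 1 \<Longrightarrow> F \<in> band M \<Longrightarrow> T > 0 \<Longrightarrow> strichartz_mass F 0 T \<le> ennreal (C * (8 * real M * T + 2))"
proof -
  obtain C where C: "C > 0" "\<And>M F. M \<ge> 1 \<Longrightarrow> F \<in> band M \<Longrightarrow> strichartz_mass F 0 (1 / (8 * real M)) \<le> ennreal C"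
    by (rule strichartz_short_time) (rule that)
  show thesis
  proof (rule that[OF C(1)])
    fix M :: nat and F and T :: real
    assume M: "M \<ge> 1" and F: "F \<in> band M" and T: "T > 0"
    define n where "n = nat \<lceil>8 * real M * T\<rceil>"
    have n1: "8 * real M * T \<le> real n" unfolding n_def by (rule real_nat_ceiling_ge)
    have "0 \<le> \<lceil>8 * real M * T\<rceil>" using T by (simp add: less_le_trans[of "-1" 0])
    then have "real n = of_int \<lceil>8 * real M * T\<rceil>" unfolding n_def by simp
    then have n2: "real n \<le> 8 * real M * T + 1" using of_int_ceiling_le_add_one[of "8 * real M * T"] by (simp only:)
    note n = n1 n2
    have "strichartz_mass F 0 T \<le> strichartz_mass F 0 (real n * (1 / (8 * real M)))"
      using n(1) M by (intro strichartz_mass_mono) (auto simp: field_simps)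
    also have "\<dots> \<le> ennreal (real (Suc n) * C)"
      using M C by (intro strichartz_mass_pieces[OF F]) auto
    also have "\<dots> \<le> ennreal (C * (8 * real M * T + 2))"
    proof (rule ennreal_leI)
      have "real (Suc n) * C \<le> (8 * real M * T + 2) * C" using n(2) C(1) by (intro mult_right_mono) auto
      then show "real (Suc n) * C \<le> C * (8 * real M * T + 2)" by (simp add: mult.commute)
    qed
    finally show "strichartz_mass F 0 T \<le> ennreal (C * (8 * real M * T + 2))" .
  qed
qed

lemma powr_ten_thirds_split:
  fixes x c :: real
  assumes "0 \<le> x" "0 < c"
  shows "x powr (10/3) \<le> c powr (4/3) * x\<^sup>2 + c powr (- (2/3)) * x ^ 4"
proof (cases "x \<le> c")
  case True
  then have "x powr (10/3) \<le> c powr (4/3) * x\<^sup>2" using assms by (intro powr_ten_thirds_bound) auto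
  then show ?thesis using assms by (simp add: add_increasing2)
next
  case False
  then have "x powr (10/3) = x powr (- (2/3)) * x ^ 4"
    using assms powr_add[of x "- (2/3)" 4] by (simp add: powr_numeral)
  also have "\<dots> \<le> c powr (- (2/3)) * x ^ 4" using False assms by (intro mult_right_mono powr_mono2') auto
  finally show ?thesis using assms by (simp add: add_increasing)
qed

text \<open>Interpolation between the energy, with the bound \<open>X\<close>, and the fourth power, with the bound \<open>Y\<close>.  For
  times below one the fourth power is bounded by its integral up to the time one.\<close>

lemma strichartz_mass_quartic:
  obtains C where "C > 0" "\<And>M F T. M \<ge> 1 \<Longrightarrow> F \<in> band M \<Longrightarrow> T > 0 \<Longrightarrow>
    strichartz_mass F 0 T \<le> ennreal (C * (T powr (1/3) * (real M * sqrt (max 1 T)) powr (2/3)))"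
proof -
  obtain C0 where C0: "C0 > 0" and quartic: "\<And>M F T. M \<ge> 1 \<Longrightarrow> F \<in> band M \<Longrightarrow> T \<ge> 1 \<Longrightarrow>
    (\<integral>\<^sup>+t. indicator {0..T} t * (\<integral>\<^sup>+z. ennreal ((norm (ext F t z)) ^ 4) \<partial>RT2) \<partial>lborel) \<le> ennreal (C0 * real M * sqrt T)"
    by (rule quartic_estimate) (rule that)
  show thesis
  proof (rule that[of "2 * (((2 * pi) ^ 3) powr (1/3) * C0 powr (2/3))"])
    show "2 * (((2 * pi) ^ 3) powr (1/3) * C0 powr (2/3)) > 0" using C0 by simp
    fix M :: nat and F and T :: real
    assume M: "M \<ge> 1" and F: "F \<in> band M" and T: "T > 0"
    have [measurable]: "F \<in> borel_measurable RZ2" using F by (auto simp: band_def)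
    interpret RT: sigma_finite_measure RT2 by (rule sigma_finite_RT2)
    define X where "X = (2 * pi) ^ 3 * T"
    define Y where "Y = C0 * (real M * sqrt (max 1 T))"
    have XY: "X > 0" "Y > 0" using T M C0 by (auto simp: X_def Y_def)
    \<comment> \<open>the height at which both contributions are equal\<close>
    define c where "c = sqrt (Y / X)"
    have c: "c > 0" using XY by (simp add: c_def)
    have cpow: "c powr (2 * s) = (Y / X) powr s" for s
      unfolding c_def using XY by (simp add: powr_half_sqrt[symmetric] powr_powr)
    have q2: "(\<integral>\<^sup>+t. indicator {0..T} t * energy RT2 (ext F t) \<partial>lborel) \<le> ennreal X"
    proof -
      have "(\<integral>\<^sup>+t. indicator {0..T} t * energy RT2 (ext F t) \<partial>lborel) \<le> (\<integral>\<^sup>+t. indicator {0..T} t * ennreal ((2 * pi) ^ 3) \<partial>lborel)"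
        by (intro nn_integral_mono mult_left_mono energy_ext[OF F]) auto
      also have "\<dots> = ennreal X" using T by (simp add: nn_integral_multc X_def ennreal_mult[symmetric] mult.commute)
      finally show ?thesis .
    qed
    have q4: "(\<integral>\<^sup>+t. indicator {0..T} t * (\<integral>\<^sup>+z. ennreal ((norm (ext F t z)) ^ 4) \<partial>RT2) \<partial>lborel) \<le> ennreal Y"
    proof -
      have "(\<integral>\<^sup>+t. indicator {0..T} t * (\<integral>\<^sup>+z. ennreal ((norm (ext F t z)) ^ 4) \<partial>RT2) \<partial>lborel)
        \<le> (\<integral>\<^sup>+t. indicator {0..max 1 T} t * (\<integral>\<^sup>+z. ennreal ((norm (ext F t z)) ^ 4) \<partial>RT2) \<partial>lborel)"
        by (intro nn_integral_mono mult_right_mono) (auto simp: indicator_def)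
      also have "\<dots> \<le> ennreal Y" using quartic[OF M F, of "max 1 T"] by (simp add: Y_def mult.assoc)
      finally show ?thesis .
    qed
    have pt: "ennreal (norm (ext F t z) powr (10/3)) \<le> ennreal (c powr (4/3)) * ennreal ((norm (ext F t z))\<^sup>2) + ennreal (c powr (- (2/3))) * ennreal ((norm (ext F t z)) ^ 4)" for t z
      using ennreal_le_add[OF powr_ten_thirds_split[OF norm_ge_zero c, of "ext F t z"]] by (simp add: ennreal_mult)
    have "strichartz_mass F 0 T \<le> (\<integral>\<^sup>+t. indicator {0..T} t * (\<integral>\<^sup>+z. ennreal (c powr (4/3)) * ennreal ((norm (ext F t z))\<^sup>2) + ennreal (c powr (- (2/3))) * ennreal ((norm (ext F t z)) ^ 4) \<partial>RT2) \<partial>lborel)"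
      unfolding strichartz_mass_def by (intro nn_integral_mono mult_left_mono pt) auto
    also have "\<dots> = (\<integral>\<^sup>+t. ennreal (c powr (4/3)) * (indicator {0..T} t * energy RT2 (ext F t))
        + ennreal (c powr (- (2/3))) * (indicator {0..T} t * (\<integral>\<^sup>+z. ennreal ((norm (ext F t z)) ^ 4) \<partial>RT2)) \<partial>lborel)"
      unfolding energy_def
      by (intro nn_integral_cong) (simp add: nn_integral_add nn_integral_cmult distrib_left mult.left_commute)
    also have "\<dots> = ennreal (c powr (4/3)) * (\<integral>\<^sup>+t. indicator {0..T} t * energy RT2 (ext F t) \<partial>lborel)
       + ennreal (c powr (- (2/3))) * (\<integral>\<^sup>+t. indicator {0..T} t * (\<integral>\<^sup>+z. ennreal ((norm (ext F t z)) ^ 4) \<partial>RT2) \<partial>lborel)"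
      unfolding energy_def by (simp add: nn_integral_add nn_integral_cmult)
    also have "\<dots> \<le> ennreal (c powr (4/3)) * ennreal X + ennreal (c powr (- (2/3))) * ennreal Y"
      by (intro add_mono mult_left_mono q2 q4) auto
    also have "\<dots> = ennreal (c powr (4/3) * X + c powr (- (2/3)) * Y)"
      using XY c by (subst ennreal_plus) (auto simp: ennreal_mult)
    also have "c powr (4/3) * X + c powr (- (2/3)) * Y = 2 * (X powr (1/3) * Y powr (2/3))"
    proof -
      have "c powr (4/3) * X = X powr (1/3) * Y powr (2/3)"
      proof -
        have e: "c powr (4/3) = Y powr (2/3) / X powr (2/3)" using cpow[of "2/3"] XY by (simp add: powr_divide)
        have d: "X / X powr (2/3) = X powr (1/3)" using XY powr_diff[of X 1 "2/3"] by simp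
        have "c powr (4/3) * X = X / X powr (2/3) * Y powr (2/3)" unfolding e by (simp only: times_divide_eq_left times_divide_eq_right mult.commute)
        then show ?thesis unfolding d .
      qed
      moreover have "c powr (- (2/3)) * Y = X powr (1/3) * Y powr (2/3)"
      proof -
        have "c powr (- (2/3)) = (Y / X) powr (- (1/3))" using cpow[of "- (1/3)"] by simp
        also have "\<dots> = X powr (1/3) / Y powr (1/3)"
          using XY by (simp only: powr_minus powr_divide inverse_divide)
        finally have e: "c powr (- (2/3)) = X powr (1/3) / Y powr (1/3)" .
        have d: "Y / Y powr (1/3) = Y powr (2/3)" using XY powr_diff[of Y 1 "1/3"] by simp
        have "c powr (- (2/3)) * Y = X powr (1/3) * (Y / Y powr (1/3))" unfolding e by (simp only: times_divide_eq_left times_divide_eq_right)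
        then show ?thesis unfolding d .
      qed
      ultimately show ?thesis by simp
    qed
    also have "2 * (X powr (1/3) * Y powr (2/3)) = 2 * (((2 * pi) ^ 3) powr (1/3) * C0 powr (2/3)) * (T powr (1/3) * (real M * sqrt (max 1 T)) powr (2/3))"
      unfolding X_def Y_def using T M C0 by (simp add: powr_mult mult_ac)
    finally show "strichartz_mass F 0 T \<le> ennreal (2 * (((2 * pi) ^ 3) powr (1/3) * C0 powr (2/3)) * (T powr (1/3) * (real M * sqrt (max 1 T)) powr (2/3)))" .
  qed
qed

section \<open>The operator norm in terms of the extension operator\<close>

definition cut_transform :: "(real \<Rightarrow> real) \<Rightarrow> nat \<Rightarrow> (real \<times> real \<times> real \<Rightarrow> complex) \<Rightarrow> real \<times> int \<times> int \<Rightarrow> complex" where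
  "cut_transform \<eta> N f \<zeta> = projection_symbol \<eta> N \<zeta> * fourier_L2 f \<zeta>"

lemma localised_propagator_eq:
  "localised_propagator \<eta> N t f z = of_real ((2 * pi) powr (- 3 / 2)) * ext (cut_transform \<eta> N f) t z"
proof -
  have "propagator_symbol t \<zeta> * projection_symbol \<eta> N \<zeta> * fourier_L2 f \<zeta> * cis (phase z \<zeta>)
     = cut_transform \<eta> N f \<zeta> * cis (phase z \<zeta> - t * hyp \<zeta>)" for \<zeta>
  proof -
    have "propagator_symbol t \<zeta> = cis (- t * hyp \<zeta>)" by (simp add: propagator_symbol_def hyp_def case_prod_beta)
    moreover have "cis (- t * hyp \<zeta>) * cis (phase z \<zeta>) = cis (phase z \<zeta> - t * hyp \<zeta>)"
      by (simp add: cis_mult)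
    ultimately show ?thesis by (simp add: cut_transform_def mult_ac)
  qed
  then show ?thesis
    unfolding localised_propagator_def fourier_multiplier_def inverse_fourier_def ext_def by simp
qed

lemma projection_symbol_eq:
  "projection_symbol \<eta> N \<zeta> = of_real (\<eta> (sqrt ((fst \<zeta>)\<^sup>2 + (of_int (fst (snd \<zeta>)))\<^sup>2 + (of_int (snd (snd \<zeta>)))\<^sup>2) / real N))"
  by (simp add: projection_symbol_def case_prod_beta)

lemma cutoff_measurable:
  assumes "smooth_cutoff \<eta>"
  shows "\<eta> \<in> borel_measurable borel"
proof -
  have "\<eta> differentiable (at x)" for x
    using assms unfolding smooth_cutoff_def by (metis funpow_0)
  then have "continuous_on UNIV \<eta>"
    by (auto intro!: continuous_at_imp_continuous_on differentiable_imp_continuous_within)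
  then show ?thesis by (rule borel_measurable_continuous_onI)
qed

lemma projection_symbol_measurable:
  assumes "smooth_cutoff \<eta>"
  shows "projection_symbol \<eta> N \<in> borel_measurable RZ2"
proof -
  note [measurable] = cutoff_measurable[OF assms]
  show ?thesis unfolding projection_symbol_eq[abs_def] by measurable
qed

lemma projection_symbol_norm_le:
  assumes "smooth_cutoff \<eta>"
  shows "norm (projection_symbol \<eta> N \<zeta>) \<le> 1"
  using assms unfolding smooth_cutoff_def projection_symbol_eq by simp

text \<open>The cutoff function vanishes beyond 2, so the frequencies reach up to \<open>2 * N\<close>.\<close>

lemma projection_symbol_support:
  assumes \<eta>: "smooth_cutoff \<eta>" and N: "N > 0" and out: "\<zeta> \<notin> freq_box (real (2 * N))"
  shows "projection_symbol \<eta> N \<zeta> = 0"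
proof -
  define a b c where "a = fst \<zeta>" and "b = real_of_int (fst (snd \<zeta>))" and "c = real_of_int (snd (snd \<zeta>))"
  define R where "R = sqrt (a\<^sup>2 + b\<^sup>2 + c\<^sup>2)"
  have "\<bar>a\<bar> \<le> R" "\<bar>b\<bar> \<le> R" "\<bar>c\<bar> \<le> R"
    using real_sqrt_le_mono[of "a\<^sup>2" "a\<^sup>2 + b\<^sup>2 + c\<^sup>2"] real_sqrt_le_mono[of "b\<^sup>2" "a\<^sup>2 + b\<^sup>2 + c\<^sup>2"]
      real_sqrt_le_mono[of "c\<^sup>2" "a\<^sup>2 + b\<^sup>2 + c\<^sup>2"]
    unfolding R_def by simp_all
  then have "R > 2 * real N" using out unfolding mem_freq_box a_def b_def c_def by auto
  then have "R / real N > 2" using N by (simp add: field_simps)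
  moreover have "\<eta> x = 0" if "x > 2" for x
  proof (rule ccontr)
    have supp: "closure {x. \<eta> x \<noteq> 0} \<subseteq> {-2..2}"
      using \<eta> unfolding smooth_cutoff_def by (elim conjE)
    assume "\<eta> x \<noteq> 0"
    then have "x \<in> {x. \<eta> x \<noteq> 0}" by simp
    from subsetD[OF supp subsetD[OF closure_subset this]] show False using that by simp
  qed
  ultimately show ?thesis unfolding projection_symbol_eq R_def a_def b_def c_def by simp
qed

lemma cut_transform_band:
  assumes \<eta>: "smooth_cutoff \<eta>" and N: "N > 0" and f: "f \<in> borel_measurable RT2" "energy RT2 f \<le> 1"
  shows "cut_transform \<eta> N f \<in> band (2 * N)"
proof -
  have fin: "energy RT2 f < \<infinity>" using f(2) by (simp add: le_less_trans[OF _ ennreal_one_less_top])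
  note [measurable] = fourier_L2_spec(1)[OF f(1) fin] projection_symbol_measurable[OF \<eta>]
  have "energy RZ2 (cut_transform \<eta> N f) \<le> energy RZ2 (fourier_L2 f)"
    unfolding energy_def
  proof (intro nn_integral_mono ennreal_leI power_mono)
    fix \<zeta>
    show "norm (cut_transform \<eta> N f \<zeta>) \<le> norm (fourier_L2 f \<zeta>)"
      unfolding cut_transform_def norm_mult using projection_symbol_norm_le[OF \<eta>] by (intro mult_left_le_one_le) auto
  qed auto
  also have "\<dots> \<le> 1" by (rule energy_fourier_L2[OF f])
  moreover have "cut_transform \<eta> N f \<in> borel_measurable RZ2" unfolding cut_transform_def[abs_def] by measurable
  ultimately show ?thesis
    using projection_symbol_support[OF \<eta> N] by (auto simp: band_def cut_transform_def)
qed

lemma unit_ball_iff: "f \<in> Lp_space 2 RT2 \<and> Lp_norm 2 RT2 f \<le> 1 \<longleftrightarrow> f \<in> borel_measurable RT2 \<and> energy RT2 f \<le> 1"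
  using Lp_norm_2_le_iff[of 1 RT2 f] le_less_trans[OF _ ennreal_one_less_top]
  by (auto simp: Lp_space_def)

lemma space_time_integral:
  assumes \<eta>: "smooth_cutoff \<eta>" and f: "f \<in> borel_measurable RT2" "energy RT2 f \<le> 1"
  shows "(\<integral>\<^sup>+p. ennreal (norm (case p of (t, z) \<Rightarrow> localised_propagator \<eta> N t f z) powr (10/3)) \<partial>(restrict_space lborel {0..T} \<Otimes>\<^sub>M RT2))
     = ennreal ((2 * pi) powr (- 5)) * strichartz_mass (cut_transform \<eta> N f) 0 T"
proof -
  interpret RT: sigma_finite_measure RT2 by (rule sigma_finite_RT2)
  have fin: "energy RT2 f < \<infinity>" using f(2) by (simp add: le_less_trans[OF _ ennreal_one_less_top])
  note [measurable] = fourier_L2_spec(1)[OF f(1) fin] projection_symbol_measurable[OF \<eta>]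
  let ?F = "cut_transform \<eta> N f"
  have [measurable]: "?F \<in> borel_measurable RZ2" unfolding cut_transform_def[abs_def] by measurable
  let ?I = "restrict_space lborel {0..T}"
  have [measurable]: "(\<lambda>t. t) \<in> borel_measurable ?I" by (intro measurable_restrict_space1) simp
  \<comment> \<open>\<open>3/2 * 10/3 = 5\<close>\<close>
  have pow: "norm (localised_propagator \<eta> N t f z) powr (10/3) = (2 * pi) powr (- 5) * norm (ext ?F t z) powr (10/3)" for t z
    unfolding localised_propagator_eq by (simp add: norm_mult powr_mult powr_powr)
  have "(\<integral>\<^sup>+p. ennreal (norm (case p of (t, z) \<Rightarrow> localised_propagator \<eta> N t f z) powr (10/3)) \<partial>(?I \<Otimes>\<^sub>M RT2))
     = (\<integral>\<^sup>+p. ennreal ((2 * pi) powr (- 5)) * ennreal (norm (ext ?F (fst p) (snd p)) powr (10/3)) \<partial>(?I \<Otimes>\<^sub>M RT2))"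
    by (intro nn_integral_cong) (auto simp: pow ennreal_mult)
  also have "\<dots> = ennreal ((2 * pi) powr (- 5)) * (\<integral>\<^sup>+p. ennreal (norm (ext ?F (fst p) (snd p)) powr (10/3)) \<partial>(?I \<Otimes>\<^sub>M RT2))"
    by (rule nn_integral_cmult) measurable
  also have "(\<integral>\<^sup>+p. ennreal (norm (ext ?F (fst p) (snd p)) powr (10/3)) \<partial>(?I \<Otimes>\<^sub>M RT2))
      = (\<integral>\<^sup>+t. \<integral>\<^sup>+z. ennreal (norm (ext ?F t z) powr (10/3)) \<partial>RT2 \<partial>?I)"
    by (subst RT.nn_integral_fst[symmetric]) (simp_all, measurable)
  also have "\<dots> = strichartz_mass ?F 0 T"
    unfolding strichartz_mass_def by (subst nn_integral_restrict_space) (auto simp: mult.commute)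
  finally show ?thesis .
qed

lemma strichartz_norm_le:
  assumes \<eta>: "smooth_cutoff \<eta>" and N: "N > 0" and m: "m \<ge> 0"
    and bound: "\<And>F. F \<in> band (2 * N) \<Longrightarrow> strichartz_mass F 0 T \<le> ennreal m"
  shows "strichartz_norm \<eta> N T \<le> ennreal (m powr (3/10))"
  unfolding strichartz_norm_def
proof (rule SUP_least)
  fix f assume "f \<in> {f \<in> Lp_space 2 RT2. Lp_norm 2 RT2 f \<le> 1}"
  then have f: "f \<in> borel_measurable RT2" "energy RT2 f \<le> 1" using unit_ball_iff[of f] by auto
  have "ennreal ((2 * pi) powr (- 5)) * strichartz_mass (cut_transform \<eta> N f) 0 T \<le> 1 * ennreal m"
  proof (intro mult_mono bound cut_transform_band \<eta> N f)
    have "(2 * pi) powr (- 5) \<le> (2 * pi) powr 0" using pi_gt3 by (intro powr_mono) auto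
    then show "ennreal ((2 * pi) powr (- 5)) \<le> 1" by simp
  qed auto
  then have "(\<integral>\<^sup>+p. ennreal (norm (case p of (t, z) \<Rightarrow> localised_propagator \<eta> N t f z) powr (10/3)) \<partial>(restrict_space lborel {0..T} \<Otimes>\<^sub>M RT2))
     \<le> ennreal ((m powr (3/10)) powr (10/3))"
    unfolding space_time_integral[OF \<eta> f] using m by (simp add: powr_powr)
  then show "Lp_norm (10 / 3) (restrict_space lborel {0..T} \<Otimes>\<^sub>M RT2) (\<lambda>(t, z). localised_propagator \<eta> N t f z) \<le> ennreal (m powr (3/10))"
    by (subst Lp_norm_le_iff) (auto simp: case_prod_beta')
qed

lemma ennreal_le_Lp_norm:
  assumes p: "p > 0" and c: "c \<ge> 0" and le: "ennreal (c powr p) \<le> (\<integral>\<^sup>+z. ennreal (norm (f z) powr p) \<partial>M)"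
  shows "ennreal c \<le> Lp_norm p M f"
proof (cases "(\<integral>\<^sup>+z. ennreal (norm (f z) powr p) \<partial>M)" rule: ennreal_cases)
  case (real r)
  then have "c powr p \<le> r" using le by simp
  then have "(c powr p) powr (1/p) \<le> r powr (1/p)" using p by (intro powr_mono2) auto
  then have "c \<le> r powr (1/p)" using p c by (simp add: powr_powr)
  then show ?thesis unfolding Lp_norm_def Let_def using real by (simp add: ennreal_leI)
next
  case top
  then show ?thesis unfolding Lp_norm_def Let_def by simp
qed

lemma strichartz_norm_ge:
  assumes \<eta>: "smooth_cutoff \<eta>" and f: "f \<in> borel_measurable RT2" "energy RT2 f \<le> 1" and m: "m \<ge> 0"
    and bound: "ennreal m \<le> strichartz_mass (cut_transform \<eta> N f) 0 T"
  shows "ennreal (((2 * pi) powr (- 5) * m) powr (3/10)) \<le> strichartz_norm \<eta> N T"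
proof -
  have "ennreal (((2 * pi) powr (- 5) * m) powr (3/10)) \<le> Lp_norm (10 / 3) (restrict_space lborel {0..T} \<Otimes>\<^sub>M RT2) (\<lambda>(t, z). localised_propagator \<eta> N t f z)"
  proof (rule ennreal_le_Lp_norm)
    have "ennreal ((2 * pi) powr (- 5) * m) \<le> ennreal ((2 * pi) powr (- 5)) * strichartz_mass (cut_transform \<eta> N f) 0 T"
      using m bound by (simp add: ennreal_mult mult_left_mono)
    then show "ennreal ((((2 * pi) powr (- 5) * m) powr (3/10)) powr (10/3))
      \<le> (\<integral>\<^sup>+z. ennreal (norm (case z of (t, z) \<Rightarrow> localised_propagator \<eta> N t f z) powr (10/3)) \<partial>(restrict_space lborel {0..T} \<Otimes>\<^sub>M RT2))"
      unfolding space_time_integral[OF \<eta> f] using m by (simp add: powr_powr)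
  qed auto
  also have "\<dots> \<le> strichartz_norm \<eta> N T"
    unfolding strichartz_norm_def using f unit_ball_iff[of f] by (intro SUP_upper) auto
  finally show ?thesis .
qed

section \<open>Lower bounds from Gaussian wave packets\<close>

text \<open>A Gaussian in the first variable, of width \<open>1 / \<sigma>\<close>, times a sum of characters: its transform is a
  positive Gaussian of width \<open>\<sigma>\<close> above each point of \<open>K\<close>, so that all frequencies interfere constructively at
  the origin.\<close>

definition packet :: "real \<Rightarrow> (int \<times> int) set \<Rightarrow> real \<Rightarrow> real \<times> real \<times> real \<Rightarrow> complex" where
  "packet \<sigma> K A z = of_real (A * exp (- (\<sigma> * fst z)\<^sup>2 / 2)) * (\<Sum>k\<in>K. character k (snd z))"

lemma pair_RT2: "pair_sigma_finite lborel (torus \<Otimes>\<^sub>M torus)"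
  by (intro pair_sigma_finite.intro sigma_finite_lborel sigma_finite_pair_measure sigma_finite_torus)

lemma measurable_character [measurable]: "(\<lambda>y. character k y) \<in> borel_measurable (torus \<Otimes>\<^sub>M torus)"
proof -
  note measurable_torus_id [measurable]
  show ?thesis by measurable
qed

lemma integrable_character: "integrable (torus \<Otimes>\<^sub>M torus) (\<lambda>y. character k y)"
  using character_orthogonality(1)[of k "(0, 0)"] by simp

lemma packet_energy:
  assumes \<sigma>: "\<sigma> > 0" and K: "finite K"
  shows "energy RT2 (packet \<sigma> K A) = ennreal (A\<^sup>2 * (sqrt pi / \<sigma>) * ((2 * pi)\<^sup>2 * real (card K)))"
    and "packet \<sigma> K A \<in> borel_measurable RT2"
    and "integrable RT2 (packet \<sigma> K A)"
proof -
  interpret P: pair_sigma_finite lborel "torus \<Otimes>\<^sub>M torus" by (rule pair_RT2)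
  let ?g = "\<lambda>x. complex_of_real (A * exp (- (\<sigma> * x)\<^sup>2 / 2))" and ?h = "\<lambda>y. \<Sum>k\<in>K. character k y"
  have gi: "integrable lborel ?g"
    using gaussian_integral(1)[OF \<sigma>] by (intro integrable_of_real integrable_mult_right)
  have hi: "integrable (torus \<Otimes>\<^sub>M torus) ?h"
    by (intro Bochner_Integration.integrable_sum integrable_character)
  show int: "integrable RT2 (packet \<sigma> K A)"
    using P.integrable_product[OF gi hi] unfolding RT2_def packet_def[abs_def] by (simp only: case_prod_beta')
  then show "packet \<sigma> K A \<in> borel_measurable RT2" by auto
  have two: "sqrt 2 * \<sigma> > 0" using \<sigma> by simp
  have "energy RT2 (packet \<sigma> K A) = (\<integral>\<^sup>+x. \<integral>\<^sup>+y. ennreal (A\<^sup>2 * exp (- (sqrt 2 * \<sigma> * x)\<^sup>2 / 2)) * ennreal ((norm (?h y))\<^sup>2) \<partial>(torus \<Otimes>\<^sub>M torus) \<partial>lborel)"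
  proof -
    have "A\<^sup>2 * (exp (- (\<sigma> * x)\<^sup>2 / 2))\<^sup>2 = A\<^sup>2 * exp (- (sqrt 2 * \<sigma> * x)\<^sup>2 / 2)" for x
      by (simp add: power2_eq_square exp_add[symmetric] field_simps)
    then have "(norm (packet \<sigma> K A (x, y)))\<^sup>2 = A\<^sup>2 * exp (- (sqrt 2 * \<sigma> * x)\<^sup>2 / 2) * (norm (?h y))\<^sup>2" for x y
      unfolding packet_def by (simp add: norm_mult power_mult_distrib)
    then have eq: "ennreal ((norm (packet \<sigma> K A (x, y)))\<^sup>2) = ennreal (A\<^sup>2 * exp (- (sqrt 2 * \<sigma> * x)\<^sup>2 / 2)) * ennreal ((norm (?h y))\<^sup>2)" for x y
      by (simp add: ennreal_mult)
    have "packet \<sigma> K A \<in> borel_measurable (lborel \<Otimes>\<^sub>M (torus \<Otimes>\<^sub>M torus))"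
      using int unfolding RT2_def by auto
    then show ?thesis
      unfolding energy_def RT2_def eq[symmetric] by (subst P.M2.nn_integral_fst) auto
  qed
  also have "\<dots> = (\<integral>\<^sup>+x. ennreal (A\<^sup>2 * exp (- (sqrt 2 * \<sigma> * x)\<^sup>2 / 2)) * ennreal ((2 * pi)\<^sup>2 * real (card K)) \<partial>lborel)"
    using torus_parseval[OF K, of "\<lambda>_. 1"] by (simp add: nn_integral_cmult)
  also have "\<dots> = ennreal (A\<^sup>2) * ennreal (sqrt (2 * pi) / (sqrt 2 * \<sigma>)) * ennreal ((2 * pi)\<^sup>2 * real (card K))"
    using gaussian_nn_integral[OF two] by (simp add: nn_integral_multc nn_integral_cmult ennreal_mult)
  also have "sqrt (2 * pi) / (sqrt 2 * \<sigma>) = sqrt pi / \<sigma>" by (simp add: real_sqrt_mult)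
  finally have "energy RT2 (packet \<sigma> K A) = ennreal (A\<^sup>2) * ennreal (sqrt pi / \<sigma>) * ennreal ((2 * pi)\<^sup>2 * real (card K))" .
  moreover have "0 \<le> A\<^sup>2" "0 \<le> sqrt pi / \<sigma>" "0 \<le> (2 * pi)\<^sup>2 * real (card K)" using \<sigma> by auto
  ultimately show "energy RT2 (packet \<sigma> K A) = ennreal (A\<^sup>2 * (sqrt pi / \<sigma>) * ((2 * pi)\<^sup>2 * real (card K)))"
    by (simp only: ennreal_mult mult_nonneg_nonneg)
qed

lemma packet_transform:
  assumes \<sigma>: "\<sigma> > 0" and K: "finite K"
  shows "fourier_L1 (packet \<sigma> K A) \<zeta>
    = of_real (2 * pi * A / \<sigma> * exp (- (fst \<zeta>)\<^sup>2 / (2 * \<sigma>\<^sup>2))) * indicator K (snd \<zeta>)"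
proof -
  interpret P: pair_sigma_finite lborel "torus \<Otimes>\<^sub>M torus" by (rule pair_RT2)
  obtain \<xi> k where \<zeta>: "\<zeta> = (\<xi>, k)" by (cases \<zeta>)
  let ?g = "\<lambda>x. complex_of_real (exp (- (\<sigma> * x)\<^sup>2 / 2)) * cis (x * (- \<xi>))"
  let ?h = "\<lambda>y. \<Sum>l\<in>K. character l y * cnj (character k y)"
  have gi: "integrable lborel ?g" by (rule gaussian_fourier_transform(1)[OF \<sigma>])
  have hi: "integrable (torus \<Otimes>\<^sub>M torus) ?h"
    by (intro Bochner_Integration.integrable_sum character_orthogonality)
  have hval: "(LINT y|(torus \<Otimes>\<^sub>M torus). ?h y) = of_real ((2 * pi)\<^sup>2) * indicator K k"
  proof -
    have "(LINT y|(torus \<Otimes>\<^sub>M torus). ?h y) = (\<Sum>l\<in>K. complex_of_real (if l = k then (2 * pi)\<^sup>2 else 0))"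
      by (subst Bochner_Integration.integral_sum, intro character_orthogonality,
          intro sum.cong refl, simp only: character_orthogonality)
    also have "\<dots> = (\<Sum>l\<in>K. if l = k then complex_of_real ((2 * pi)\<^sup>2) else 0)"
      by (intro sum.cong refl) simp
    finally have "(LINT y|(torus \<Otimes>\<^sub>M torus). ?h y) = (\<Sum>l\<in>K. if l = k then complex_of_real ((2 * pi)\<^sup>2) else 0)" .
    then show ?thesis using K by (simp add: sum.delta indicator_def)
  qed
  have pt: "packet \<sigma> K A z * cis (- phase z \<zeta>) = of_real A * (?g (fst z) * ?h (snd z))" for z
  proof -
    have "cis (- phase z \<zeta>) = cis (fst z * (- \<xi>)) * cnj (character k (snd z))"
      by (simp add: \<zeta> phase_eq cis_cnj cis_mult algebra_simps)
    then show ?thesis unfolding packet_def sum_distrib_right[symmetric] by (simp add: mult_ac)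
  qed
  have "(LINT z|RT2. packet \<sigma> K A z * cis (- phase z \<zeta>)) = of_real A * ((LINT x|lborel. ?g x) * (LINT y|(torus \<Otimes>\<^sub>M torus). ?h y))"
    unfolding pt RT2_def integral_mult_right_zero using P.integral_product[OF gi hi] by (simp only:)
  also have "\<dots> = of_real A * (of_real (sqrt (2 * pi) / \<sigma> * exp (- \<xi>\<^sup>2 / (2 * \<sigma>\<^sup>2))) * (of_real ((2 * pi)\<^sup>2) * indicator K k))"
    unfolding hval gaussian_fourier_transform(2)[OF \<sigma>] by simp
  finally have "fourier_L1 (packet \<sigma> K A) \<zeta> = of_real ((2 * pi) powr (- 3 / 2) * sqrt (2 * pi) * (2 * pi)\<^sup>2) * (of_real (A / \<sigma> * exp (- \<xi>\<^sup>2 / (2 * \<sigma>\<^sup>2))) * indicator K k)"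
    unfolding fourier_L1_def by (simp add: mult_ac)
  also have "(2 * pi) powr (- 3 / 2) * sqrt (2 * pi) * (2 * pi)\<^sup>2 = 2 * pi"
  proof -
    have "(2 * pi) powr (- 3 / 2) * (2 * pi) powr (1 / 2) * (2 * pi) powr 2 = (2 * pi) powr 1"
      by (simp only: powr_add[symmetric]) simp
    then show ?thesis by (simp add: powr_half_sqrt powr_numeral)
  qed
  finally show ?thesis by (simp add: \<zeta> mult_ac)
qed

lemma cos_ge_one_minus_abs: "1 - \<bar>\<theta>\<bar> \<le> cos (\<theta>::real)"
proof -
  have "1 - cos \<theta> = 2 * (sin (\<theta> / 2))\<^sup>2" using cos_double_sin[of "\<theta> / 2"] by simp
  also have "\<dots> = 2 * (\<bar>sin (\<theta> / 2)\<bar> * \<bar>sin (\<theta> / 2)\<bar>)" by (simp add: power2_eq_square abs_mult[symmetric])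
  also have "\<dots> \<le> 2 * (\<bar>\<theta> / 2\<bar> * 1)"
    by (intro mult_left_mono mult_mono abs_sin_x_le_abs_x abs_sin_le_one) auto
  finally show ?thesis by simp
qed

text \<open>Since \<open>cos \<theta> \<ge> 1 - \<bar>\<theta>\<bar>\<close>, the loss is at most the average of the phase against the
  Gaussian.  A polynomial in \<open>\<xi> / \<sigma>\<close> is absorbed by a small part of the Gaussian's exponent; the constant 1/64 makes
  the loss smaller than the integral over the interval on which the cutoff equals one.\<close>

lemma gaussian_no_cancellation:
  fixes \<kappa> \<theta> :: "real \<Rightarrow> real"
  assumes \<sigma>: "\<sigma> > 0" and [measurable]: "\<kappa> \<in> borel_measurable borel" "\<theta> \<in> borel_measurable borel"
    and \<kappa>: "\<And>\<xi>. 0 \<le> \<kappa> \<xi>" "\<And>\<xi>. \<kappa> \<xi> \<le> 1" "\<And>\<xi>. \<bar>\<xi>\<bar> \<le> \<sigma> / 2 \<Longrightarrow> \<kappa> \<xi> = 1"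
    and \<theta>: "\<And>\<xi>. \<bar>\<theta> \<xi>\<bar> \<le> 1 / 64 * (1 + \<bar>\<xi> / \<sigma>\<bar> + (\<xi> / \<sigma>)\<^sup>2)"
  shows "\<sigma> / 4 \<le> Re (LINT \<xi>|lborel. of_real (exp (- \<xi>\<^sup>2 / (2 * \<sigma>\<^sup>2)) * \<kappa> \<xi>) * cis (\<theta> \<xi>))"
    and "integrable lborel (\<lambda>\<xi>. of_real (exp (- \<xi>\<^sup>2 / (2 * \<sigma>\<^sup>2)) * \<kappa> \<xi>) * cis (\<theta> \<xi>))"
proof -
  have eg: "exp (- (1 / \<sigma> * \<xi>)\<^sup>2 / 2) = exp (- \<xi>\<^sup>2 / (2 * \<sigma>\<^sup>2))" for \<xi>
    using \<sigma> by (simp add: power_divide)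
  have gi: "integrable lborel (\<lambda>\<xi>. exp (- \<xi>\<^sup>2 / (2 * \<sigma>\<^sup>2)))"
    using gaussian_integral(1)[of "1 / \<sigma>"] \<sigma> unfolding eg by simp
  show int: "integrable lborel (\<lambda>\<xi>. complex_of_real (exp (- \<xi>\<^sup>2 / (2 * \<sigma>\<^sup>2)) * \<kappa> \<xi>) * cis (\<theta> \<xi>))"
  proof (rule Bochner_Integration.integrable_bound[OF gi])
    show "AE \<xi> in lborel. norm (complex_of_real (exp (- \<xi>\<^sup>2 / (2 * \<sigma>\<^sup>2)) * \<kappa> \<xi>) * cis (\<theta> \<xi>)) \<le> norm (exp (- \<xi>\<^sup>2 / (2 * \<sigma>\<^sup>2)))"
      using \<kappa> by (intro AE_I2) (simp add: norm_mult mult_left_le)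
  qed measurable
  \<comment> \<open>half of the exponent of the Gaussian remains after the phase has been absorbed\<close>
  define e where "e = 1 / (sqrt 2 * \<sigma>)"
  have e: "e > 0" using \<sigma> by (simp add: e_def)
  have hi: "integrable lborel (\<lambda>\<xi>. exp (- (e * \<xi>)\<^sup>2 / 2))" "(LINT \<xi>|lborel. exp (- (e * \<xi>)\<^sup>2 / 2)) = sqrt (2 * pi) / e"
    by (rule gaussian_integral[OF e])+
  have lower: "7 / 8 * indicator {- (\<sigma> / 2)..\<sigma> / 2} \<xi> - 1 / 8 * exp (- (e * \<xi>)\<^sup>2 / 2)
      \<le> Re (complex_of_real (exp (- \<xi>\<^sup>2 / (2 * \<sigma>\<^sup>2)) * \<kappa> \<xi>) * cis (\<theta> \<xi>))" for \<xi>
  proof -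
    define s where "s = \<xi> / \<sigma>"
    define E where "E = exp (s\<^sup>2 / 4)"
    have E1: "1 + s\<^sup>2 / 4 \<le> E" unfolding E_def by (rule exp_ge_add_one_self)
    have gE: "exp (- \<xi>\<^sup>2 / (2 * \<sigma>\<^sup>2)) = exp (- s\<^sup>2 / 2)" using \<sigma> by (simp add: s_def power_divide)
    have hE: "exp (- (e * \<xi>)\<^sup>2 / 2) = exp (- s\<^sup>2 / 4)"
      using \<sigma> by (simp add: s_def e_def power_divide power_mult_distrib)
    have "2 * \<bar>s\<bar> \<le> 1 + s\<^sup>2" using zero_le_power2[of "\<bar>s\<bar> - 1"] by (simp add: power2_diff)
    then have "1 + \<bar>s\<bar> + s\<^sup>2 \<le> 8 * E" using E1 zero_le_power2[of s] by linarith
    then have th: "\<bar>\<theta> \<xi>\<bar> \<le> 1 / 8 * E" using \<theta>[of \<xi>] unfolding s_def by simp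
    have prod: "exp (- s\<^sup>2 / 2) * E = exp (- s\<^sup>2 / 4)" unfolding E_def exp_add[symmetric] by simp
    have "exp (- s\<^sup>2 / 2) * \<kappa> \<xi> * \<bar>\<theta> \<xi>\<bar> \<le> exp (- s\<^sup>2 / 2) * 1 * (1 / 8 * E)"
      using \<kappa> th by (intro mult_mono) auto
    also have "exp (- s\<^sup>2 / 2) * 1 * (1 / 8 * E) = 1 / 8 * exp (- s\<^sup>2 / 4)" unfolding prod[symmetric] by simp
    finally have loss: "exp (- s\<^sup>2 / 2) * \<kappa> \<xi> * \<bar>\<theta> \<xi>\<bar> \<le> 1 / 8 * exp (- s\<^sup>2 / 4)" .
    have gain: "7 / 8 * indicator {- (\<sigma> / 2)..\<sigma> / 2} \<xi> \<le> exp (- s\<^sup>2 / 2) * \<kappa> \<xi>"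
    proof (cases "\<xi> \<in> {- (\<sigma> / 2)..\<sigma> / 2}")
      case True
      then have xi: "\<bar>\<xi>\<bar> \<le> \<sigma> / 2" by auto
      then have "\<bar>s\<bar> \<le> 1 / 2" using \<sigma> by (simp add: s_def abs_divide field_simps)
      then have "\<bar>s\<bar>\<^sup>2 \<le> (1 / 2)\<^sup>2" by (intro power_mono) auto
      then have "7 / 8 \<le> 1 + - s\<^sup>2 / 2" by (simp add: power2_eq_square)
      also have "\<dots> \<le> exp (- s\<^sup>2 / 2)" by (rule exp_ge_add_one_self)
      finally show ?thesis using True \<kappa>(3)[OF xi] by simp
    qed (use \<kappa> in simp)
    have "exp (- s\<^sup>2 / 2) * \<kappa> \<xi> * (1 - \<bar>\<theta> \<xi>\<bar>) \<le> exp (- s\<^sup>2 / 2) * \<kappa> \<xi> * cos (\<theta> \<xi>)"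
      using \<kappa> by (intro mult_left_mono cos_ge_one_minus_abs) auto
    then show ?thesis using loss gain unfolding gE hE by (simp add: right_diff_distrib)
  qed
  have "(LINT \<xi>|lborel. 7 / 8 * indicator {- (\<sigma> / 2)..\<sigma> / 2} \<xi> - 1 / 8 * exp (- (e * \<xi>)\<^sup>2 / 2)) = 7 / 8 * \<sigma> - 1 / 8 * (sqrt (2 * pi) / e)"
    using hi \<sigma> by (subst Bochner_Integration.integral_diff) (auto intro!: integrable_mult_right)
  moreover have "(LINT \<xi>|lborel. 7 / 8 * indicator {- (\<sigma> / 2)..\<sigma> / 2} \<xi> - 1 / 8 * exp (- (e * \<xi>)\<^sup>2 / 2))
     \<le> (LINT \<xi>|lborel. Re (complex_of_real (exp (- \<xi>\<^sup>2 / (2 * \<sigma>\<^sup>2)) * \<kappa> \<xi>) * cis (\<theta> \<xi>)))"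
    using hi int \<sigma>
    by (intro Bochner_Integration.integral_mono lower integrable_Re Bochner_Integration.integrable_diff integrable_mult_right)
      auto
  moreover have "sqrt (2 * pi) / e \<le> 4 * \<sigma>"
  proof -
    have "sqrt pi \<le> 2" using pi_less_4 real_sqrt_le_mono[of pi 4] by simp
    then have "2 * \<sigma> * sqrt pi \<le> 2 * \<sigma> * 2" using \<sigma> by (intro mult_left_mono) auto
    moreover have "sqrt (2 * pi) / e = 2 * \<sigma> * sqrt pi"
      by (simp add: e_def real_sqrt_mult)
    ultimately show ?thesis by simp
  qed
  ultimately show "\<sigma> / 4 \<le> Re (LINT \<xi>|lborel. complex_of_real (exp (- \<xi>\<^sup>2 / (2 * \<sigma>\<^sup>2)) * \<kappa> \<xi>) * cis (\<theta> \<xi>))"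
    using integral_Re[OF int] \<sigma> by simp
qed

text \<open>As long as the phases are small, the contributions of all frequencies in \<open>K\<close> have positive real
  parts and add up.\<close>

lemma ext_packet_lower:
  assumes \<eta>: "smooth_cutoff \<eta>" and N: "N > 0" and \<sigma>: "\<sigma> > 0" "\<sigma> \<le> real N" and K: "finite K"
    and Kle: "\<And>k. k \<in> K \<Longrightarrow> (real_of_int (fst k))\<^sup>2 + (real_of_int (snd k))\<^sup>2 \<le> (real N)\<^sup>2 / 2" and A: "A \<ge> 0"
    and x: "\<bar>x\<bar> \<le> 1 / (64 * \<sigma>)" and t: "0 \<le> t" "t \<le> 1 / (64 * \<sigma>\<^sup>2)"
    and y: "\<And>k. k \<in> K \<Longrightarrow> \<bar>fst y * of_int (fst k) + snd y * of_int (snd k) - t * ((of_int (fst k))\<^sup>2 - (of_int (snd k))\<^sup>2)\<bar> \<le> 1 / 64"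
  shows "2 * pi * A * real (card K) / 4 \<le> norm (ext (cut_transform \<eta> N (packet \<sigma> K A)) t (x, y))"
proof -
  interpret P: pair_sigma_finite lborel Z2
    by (intro pair_sigma_finite.intro sigma_finite_lborel sigma_finite_Z2)
  note pk = packet_energy[OF \<sigma>(1) K, of A]
  have fin: "energy RT2 (packet \<sigma> K A) < \<infinity>" unfolding pk(1) by simp
  note [measurable] = fourier_L2_spec(1)[OF pk(2) fin] projection_symbol_measurable[OF \<eta>] pk(2) cutoff_measurable[OF \<eta>]
  define \<kappa> where "\<kappa> k \<xi> = \<eta> (sqrt (\<xi>\<^sup>2 + (of_int (fst k))\<^sup>2 + (of_int (snd k))\<^sup>2) / real N)" for k :: "int \<times> int" and \<xi>
  define \<theta> where "\<theta> k \<xi> = phase (x, y) (\<xi>, k) - t * hyp (\<xi>, k)" for k \<xi>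
  define B where "B = 2 * pi * A / \<sigma>"
  have B: "B \<ge> 0" using A \<sigma> by (simp add: B_def)
  have \<kappa>_meas[measurable]: "\<kappa> k \<in> borel_measurable borel" for k unfolding \<kappa>_def by measurable
  have \<theta>_meas[measurable]: "\<theta> k \<in> borel_measurable borel" for k unfolding \<theta>_def phase_eq hyp_def by simp
  let ?c = "\<lambda>k \<xi>. complex_of_real (exp (- \<xi>\<^sup>2 / (2 * \<sigma>\<^sup>2)) * \<kappa> k \<xi>) * cis (\<theta> k \<xi>)"
  have lower: "\<sigma> / 4 \<le> Re (LINT \<xi>|lborel. ?c k \<xi>)" and cint: "integrable lborel (?c k)" if k: "k \<in> K" for k
  proof -
    have \<kappa>1: "0 \<le> \<kappa> k \<xi>" "\<kappa> k \<xi> \<le> 1" for \<xi> using \<eta> unfolding smooth_cutoff_def \<kappa>_def by simp_all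
    have \<kappa>2: "\<kappa> k \<xi> = 1" if "\<bar>\<xi>\<bar> \<le> \<sigma> / 2" for \<xi>
    proof -
      have "\<xi>\<^sup>2 \<le> (real N / 2)\<^sup>2" using that \<sigma> by (intro power2_le_iff_abs_le[THEN iffD2]) auto
      then have "\<xi>\<^sup>2 + (of_int (fst k))\<^sup>2 + (of_int (snd k))\<^sup>2 \<le> (real N)\<^sup>2" using Kle[OF k] by (simp add: power_divide) (smt (verit) zero_le_power2)
      then have "sqrt (\<xi>\<^sup>2 + (of_int (fst k))\<^sup>2 + (of_int (snd k))\<^sup>2) \<le> real N" by (intro real_le_lsqrt) auto
      then have "sqrt (\<xi>\<^sup>2 + (of_int (fst k))\<^sup>2 + (of_int (snd k))\<^sup>2) / real N \<in> {-1..1}" using N by (simp add: field_simps) (smt (verit) of_nat_0_le_iff real_sqrt_ge_zero sum_power2_ge_zero zero_le_power2)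
      then show ?thesis using \<eta> unfolding smooth_cutoff_def \<kappa>_def by blast
    qed
    have \<theta>1: "\<bar>\<theta> k \<xi>\<bar> \<le> 1 / 64 * (1 + \<bar>\<xi> / \<sigma>\<bar> + (\<xi> / \<sigma>)\<^sup>2)" for \<xi>
    proof -
      have "\<theta> k \<xi> = (fst y * of_int (fst k) + snd y * of_int (snd k) - t * ((of_int (fst k))\<^sup>2 - (of_int (snd k))\<^sup>2)) + x * \<xi> + - (t * \<xi>\<^sup>2)"
        by (simp add: \<theta>_def phase_eq hyp_def algebra_simps)
      also have "\<bar>\<dots>\<bar> \<le> 1 / 64 + \<bar>x * \<xi>\<bar> + \<bar>t * \<xi>\<^sup>2\<bar>"
        using y[OF k] by linarith
      also have "\<bar>x * \<xi>\<bar> \<le> 1 / (64 * \<sigma>) * \<bar>\<xi>\<bar>" unfolding abs_mult using x by (intro mult_right_mono) auto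
      also have "\<bar>t * \<xi>\<^sup>2\<bar> \<le> 1 / (64 * \<sigma>\<^sup>2) * \<xi>\<^sup>2"
        using mult_right_mono[OF t(2) zero_le_power2[of \<xi>]] t(1) by (simp only: abs_mult abs_of_nonneg zero_le_power2)
      also have "1 / 64 + 1 / (64 * \<sigma>) * \<bar>\<xi>\<bar> + 1 / (64 * \<sigma>\<^sup>2) * \<xi>\<^sup>2 = 1 / 64 * (1 + \<bar>\<xi> / \<sigma>\<bar> + (\<xi> / \<sigma>)\<^sup>2)"
        using \<sigma> by (simp add: abs_divide power_divide algebra_simps)
      finally show ?thesis by simp
    qed
    show "\<sigma> / 4 \<le> Re (LINT \<xi>|lborel. ?c k \<xi>)" "integrable lborel (?c k)"
      by (rule gaussian_no_cancellation[OF \<sigma>(1) \<kappa>_meas \<theta>_meas \<kappa>1 \<kappa>2 \<theta>1]; assumption)+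
  qed
  have "ext (cut_transform \<eta> N (packet \<sigma> K A)) t (x, y)
      = (LINT \<zeta>|RZ2. projection_symbol \<eta> N \<zeta> * fourier_L1 (packet \<sigma> K A) \<zeta> * cis (phase (x, y) \<zeta> - t * hyp \<zeta>))"
    unfolding ext_def cut_transform_def
  proof (rule integral_cong_AE)
    show "AE \<zeta> in RZ2. projection_symbol \<eta> N \<zeta> * fourier_L2 (packet \<sigma> K A) \<zeta> * cis (phase (x, y) \<zeta> - t * hyp \<zeta>)
       = projection_symbol \<eta> N \<zeta> * fourier_L1 (packet \<sigma> K A) \<zeta> * cis (phase (x, y) \<zeta> - t * hyp \<zeta>)"
      using fourier_L2_eq_fourier_L1[OF pk(3) fin] by eventually_elim simp
  qed measurable
  also have "\<dots> = (LINT \<zeta>|RZ2. of_real B * (indicator K (snd \<zeta>) * ?c (snd \<zeta>) (fst \<zeta>)))"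
    by (intro Bochner_Integration.integral_cong refl)
      (simp add: packet_transform[OF \<sigma>(1) K] projection_symbol_eq \<kappa>_def \<theta>_def B_def mult_ac)
  also have "\<dots> = of_real B * (LINT \<zeta>|RZ2. indicator K (snd \<zeta>) * ?c (snd \<zeta>) (fst \<zeta>))"
    by (rule integral_mult_right_zero)
  also have "(LINT \<zeta>|RZ2. indicator K (snd \<zeta>) * ?c (snd \<zeta>) (fst \<zeta>)) = (\<Sum>k\<in>K. LINT \<xi>|lborel. ?c k \<xi>)"
  proof -
    have int: "integrable (lborel \<Otimes>\<^sub>M Z2) (\<lambda>\<zeta>. \<Sum>k\<in>K. ?c k (fst \<zeta>) * indicator {k} (snd \<zeta>))"
    proof (intro Bochner_Integration.integrable_sum)
      fix k assume k: "k \<in> K"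
      have "integrable Z2 (\<lambda>l. indicator {k} l :: complex)"
      proof (rule integrableI_bounded)
        have "(\<integral>\<^sup>+l. ennreal (norm (indicator {k} l :: complex)) \<partial>Z2) = (\<Sum>l\<in>{k}. ennreal (norm (indicator {k} l :: complex)))"
          by (rule nn_integral_count_space') auto
        then show "(\<integral>\<^sup>+l. ennreal (norm (indicator {k} l :: complex)) \<partial>Z2) < \<infinity>" by simp
      qed simp
      from P.integrable_product[OF cint[OF k] this]
      show "integrable (lborel \<Otimes>\<^sub>M Z2) (\<lambda>\<zeta>. ?c k (fst \<zeta>) * indicator {k} (snd \<zeta>))" by (simp only: case_prod_beta')
    qed
    have pt: "indicator K l * ?c l \<xi> = (\<Sum>k\<in>K. ?c k \<xi> * indicator {k} l)" for l \<xi>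
    proof -
      have "(\<Sum>k\<in>K. ?c k \<xi> * indicator {k} l) = (\<Sum>k\<in>K. if k = l then ?c k \<xi> else 0)"
        by (intro sum.cong refl) (auto simp: indicator_def)
      then show ?thesis using K by (simp add: sum.delta indicator_def)
    qed
    have "(LINT \<zeta>|RZ2. indicator K (snd \<zeta>) * ?c (snd \<zeta>) (fst \<zeta>)) = (LINT l|Z2. LINT \<xi>|lborel. indicator K l * ?c l \<xi>)"
      using P.integral_snd[of "\<lambda>\<xi> l. \<Sum>k\<in>K. ?c k \<xi> * indicator {k} l"] int
      unfolding RZ2_eq pt by (simp only: case_prod_beta')
    also have "\<dots> = (LINT l|Z2. indicator K l * (LINT \<xi>|lborel. ?c l \<xi>))" by (simp only: integral_mult_right_zero)
    also have "\<dots> = (\<Sum>l | l \<in> UNIV \<and> indicator K l * (LINT \<xi>|lborel. ?c l \<xi>) \<noteq> 0. indicator K l * (LINT \<xi>|lborel. ?c l \<xi>))"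
      by (rule lebesgue_integral_count_space_finite_support) (rule finite_subset[OF _ K], auto simp: indicator_def)
    also have "\<dots> = (\<Sum>l\<in>K. indicator K l * (LINT \<xi>|lborel. ?c l \<xi>))"
      using K by (intro sum.mono_neutral_left) (auto simp: indicator_def)
    also have "\<dots> = (\<Sum>l\<in>K. LINT \<xi>|lborel. ?c l \<xi>)" by (intro sum.cong refl) simp
    finally show ?thesis .
  qed
  finally have eq: "ext (cut_transform \<eta> N (packet \<sigma> K A)) t (x, y) = of_real B * (\<Sum>k\<in>K. LINT \<xi>|lborel. ?c k \<xi>)" .
  have "real (card K) * (\<sigma> / 4) \<le> (\<Sum>k\<in>K. Re (LINT \<xi>|lborel. ?c k \<xi>))"
    using sum_mono[of K "\<lambda>_. \<sigma> / 4" "\<lambda>k. Re (LINT \<xi>|lborel. ?c k \<xi>)"] lower by simp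
  also have "\<dots> \<le> norm (\<Sum>k\<in>K. LINT \<xi>|lborel. ?c k \<xi>)"
    using complex_Re_le_cmod[of "\<Sum>k\<in>K. LINT \<xi>|lborel. ?c k \<xi>"] by simp
  finally have "B * (real (card K) * (\<sigma> / 4)) \<le> B * norm (\<Sum>k\<in>K. LINT \<xi>|lborel. ?c k \<xi>)" using B by (intro mult_left_mono)
  moreover have "B * (real (card K) * (\<sigma> / 4)) = 2 * pi * A * real (card K) / 4" using \<sigma> by (simp add: B_def)
  ultimately have "2 * pi * A * real (card K) / 4 \<le> B * norm (\<Sum>k\<in>K. LINT \<xi>|lborel. ?c k \<xi>)" by (simp only:)
  then show ?thesis unfolding eq norm_mult norm_of_real using B by (simp only: abs_of_nonneg)
qed

text \<open>The factors are the normalisation of the inverse transform, the size of the packet of unit energy on the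
  set where it is focused, and, raised to the power 3/10, the length 1/32 of the interval of \<open>\<sigma> * x\<close>.\<close>

definition packet_constant :: real where
  "packet_constant = (2 * pi) powr (- (3/2)) * (2 * pi * (1 / sqrt (sqrt pi * (2 * pi)\<^sup>2)) / 4) * (1 / 32) powr (3/10)"

lemma packet_constant_pos: "packet_constant > 0"
  by (simp add: packet_constant_def)

text \<open>A packet of unit energy is of size \<open>sqrt (\<sigma> * card K)\<close>, up to a constant, on a set of points of volume
  comparable to \<open>v / \<sigma>\<close> and during the time \<open>t1\<close>.\<close>

lemma strichartz_norm_packet:
  fixes \<eta> :: "real \<Rightarrow> real" and N :: nat and \<sigma> t1 T v :: real and K :: "(int \<times> int) set"
  assumes \<eta>: "smooth_cutoff \<eta>" and N: "N > 0" and \<sigma>: "\<sigma> > 0" "\<sigma> \<le> real N" and K: "finite K" "K \<noteq> {}"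
    and Kle: "\<And>k. k \<in> K \<Longrightarrow> (real_of_int (fst k))\<^sup>2 + (real_of_int (snd k))\<^sup>2 \<le> (real N)\<^sup>2 / 2"
    and t1: "0 \<le> t1" "t1 \<le> T" "t1 \<le> 1 / (64 * \<sigma>\<^sup>2)" and Y: "Y \<in> sets (torus \<Otimes>\<^sub>M torus)"
    and v: "0 \<le> v" "ennreal v \<le> emeasure (torus \<Otimes>\<^sub>M torus) Y"
    and phases: "\<And>k t y. k \<in> K \<Longrightarrow> 0 \<le> t \<Longrightarrow> t \<le> t1 \<Longrightarrow> y \<in> Y \<Longrightarrow> \<bar>fst y * of_int (fst k) + snd y * of_int (snd k) - t * ((of_int (fst k))\<^sup>2 - (of_int (snd k))\<^sup>2)\<bar> \<le> 1 / 64"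
  shows "ennreal (packet_constant * (sqrt (\<sigma> * real (card K)) * (t1 * v / \<sigma>) powr (3/10))) \<le> strichartz_norm \<eta> N T"
proof -
  define a where "a = 1 / sqrt (sqrt pi * (2 * pi)\<^sup>2)"
  have a: "a > 0" by (simp add: a_def)
  interpret TT: sigma_finite_measure "torus \<Otimes>\<^sub>M torus" by (intro sigma_finite_pair_measure sigma_finite_torus)
  define n where "n = real (card K)"
  have n: "n > 0" using K by (simp add: n_def card_gt_0_iff)
  \<comment> \<open>the amplitude of unit energy\<close>
  define A where "A = a * sqrt (\<sigma> / n)"
  have A: "A \<ge> 0" using a \<sigma> n by (simp add: A_def)
  note pk = packet_energy[OF \<sigma>(1) K(1), of A]
  have "A\<^sup>2 * (sqrt pi / \<sigma>) * ((2 * pi)\<^sup>2 * n) = 1"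
  proof -
    have "a\<^sup>2 = 1 / (sqrt pi * (2 * pi)\<^sup>2)" by (simp add: a_def power_divide)
    then show ?thesis unfolding A_def power_mult_distrib using \<sigma> n by (simp add: field_simps)
  qed
  then have en: "energy RT2 (packet \<sigma> K A) \<le> 1" unfolding pk(1) n_def by simp
  let ?F = "cut_transform \<eta> N (packet \<sigma> K A)"
  define L where "L = 2 * pi * A * n / 4"
  have L: "L \<ge> 0" using A n by (simp add: L_def)
  define S where "S = {- (1 / (64 * \<sigma>))..1 / (64 * \<sigma>)} \<times> Y"
  have S[measurable]: "S \<in> sets RT2" unfolding S_def RT2_def using Y by (intro pair_measureI) auto
  have volS: "ennreal (1 / 32 * v / \<sigma>) \<le> emeasure RT2 S"
  proof -
    have "emeasure RT2 S = emeasure lborel {- (1 / (64 * \<sigma>))..1 / (64 * \<sigma>)} * emeasure (torus \<Otimes>\<^sub>M torus) Y"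
      unfolding S_def RT2_def using Y by (intro TT.emeasure_pair_measure_Times) auto
    also have "emeasure lborel {- (1 / (64 * \<sigma>))..1 / (64 * \<sigma>)} = ennreal (1 / (32 * \<sigma>))" using \<sigma> by simp
    finally have "ennreal (1 / (32 * \<sigma>)) * ennreal v \<le> emeasure RT2 S" using v by (simp add: mult_left_mono)
    then show ?thesis using v \<sigma> by (simp add: ennreal_mult[symmetric])
  qed
  have "ennreal (L powr (10/3) * (t1 * (1 / 32 * v / \<sigma>))) \<le> strichartz_mass ?F 0 T"
  proof -
    have "ennreal (L powr (10/3) * (t1 * (1 / 32 * v / \<sigma>))) = ennreal t1 * (ennreal (L powr (10/3)) * ennreal (1 / 32 * v / \<sigma>))"
      using L t1 v \<sigma> by (simp add: ennreal_mult[symmetric] mult_ac)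
    also have "\<dots> \<le> ennreal t1 * (ennreal (L powr (10/3)) * emeasure RT2 S)"
      by (intro mult_left_mono volS) auto
    also have "\<dots> = (\<integral>\<^sup>+t. indicator {0..t1} t * (ennreal (L powr (10/3)) * emeasure RT2 S) \<partial>lborel)"
      using t1 by (simp add: nn_integral_multc)
    also have "\<dots> \<le> strichartz_mass ?F 0 T"
      unfolding strichartz_mass_def
    proof (intro nn_integral_mono)
      fix t
      show "indicator {0..t1} t * (ennreal (L powr (10/3)) * emeasure RT2 S) \<le> indicator {0..T} t * (\<integral>\<^sup>+z. ennreal (norm (ext ?F t z) powr (10/3)) \<partial>RT2)"
      proof (cases "t \<in> {0..t1}")
        case True
        have "ennreal (L powr (10/3)) * emeasure RT2 S = (\<integral>\<^sup>+z. ennreal (L powr (10/3)) * indicator S z \<partial>RT2)"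
          by (simp add: nn_integral_cmult)
        also have "\<dots> \<le> (\<integral>\<^sup>+z. ennreal (norm (ext ?F t z) powr (10/3)) \<partial>RT2)"
        proof (intro nn_integral_mono)
          fix z
          show "ennreal (L powr (10/3)) * indicator S z \<le> ennreal (norm (ext ?F t z) powr (10/3))"
          proof (cases "z \<in> S")
            case z: True
            obtain x y where xy: "z = (x, y)" by (cases z)
            have "L \<le> norm (ext ?F t (x, y))"
              unfolding L_def n_def
              by (rule ext_packet_lower[OF \<eta> N \<sigma> K(1) Kle A]) (use z xy True t1 phases in \<open>auto simp: S_def abs_le_iff\<close>)
            then show ?thesis using z xy L by (auto intro!: ennreal_leI powr_mono2)
          qed simp
        qed
        finally show ?thesis using True t1 by simp
      qed simp
    qed
    finally show ?thesis .
  qed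
  from strichartz_norm_ge[OF \<eta> pk(2) en _ this]
  have "ennreal (((2 * pi) powr (- 5) * (L powr (10/3) * (t1 * (1 / 32 * v / \<sigma>)))) powr (3/10)) \<le> strichartz_norm \<eta> N T"
    using L t1 v \<sigma> by simp
  also have "((2 * pi) powr (- 5) * (L powr (10/3) * (t1 * (1 / 32 * v / \<sigma>)))) powr (3/10) = packet_constant * (sqrt (\<sigma> * n) * (t1 * v / \<sigma>) powr (3/10))"
  proof -
    have "t1 * (1 / 32 * v / \<sigma>) = 1 / 32 * (t1 * v / \<sigma>)" by simp
    then have E1: "((2 * pi) powr (- 5) * (L powr (10/3) * (t1 * (1 / 32 * v / \<sigma>)))) powr (3/10)
       = (2 * pi) powr (- (3/2)) * (L * ((1 / 32) powr (3/10) * (t1 * v / \<sigma>) powr (3/10)))"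
      using L t1 v \<sigma> by (simp only: powr_mult powr_powr mult_nonneg_nonneg divide_nonneg_nonneg powr_ge_zero less_imp_le zero_le_divide_iff zero_le_numeral zero_le_one)
        (simp add: powr_one_gt_zero_iff)
    have Leq: "L = 2 * pi * a / 4 * sqrt (\<sigma> * n)"
    proof -
      have "sqrt (\<sigma> / n) * n = sqrt (\<sigma> * n)"
      proof -
        have "sqrt (\<sigma> * n) = sqrt (\<sigma> / n * (n * n))" using n by simp
        also have "\<dots> = sqrt (\<sigma> / n) * n" using n by (subst real_sqrt_mult) simp
        finally show ?thesis by simp
      qed
      then show ?thesis unfolding L_def A_def by (simp add: mult_ac)
    qed
    show ?thesis by (subst E1, subst Leq, simp add: packet_constant_def a_def mult_ac)
  qed
  finally show ?thesis unfolding n_def .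
qed

section \<open>The two extremal packets\<close>

lemma emeasure_torus_Icc: "0 \<le> a \<Longrightarrow> a \<le> b \<Longrightarrow> b < 2 * pi \<Longrightarrow> emeasure torus {a..b} = ennreal (b - a)"
  unfolding torus_def by (subst emeasure_restrict_space) auto

lemma sets_torus_Icc: "0 \<le> a \<Longrightarrow> b < 2 * pi \<Longrightarrow> {a..b} \<in> sets torus"
  unfolding torus_def by (subst sets_restrict_space_iff) auto

text \<open>On the line \<open>k2 = - k1\<close> the form \<open>k1\<^sup>2 - k2\<^sup>2\<close> vanishes, so a packet of such frequencies stays focused near the
  diagonal of the torus at all times.  In the first variable it begins to disperse at the time \<open>1 / \<sigma>\<^sup>2\<close>, which is
  made equal to \<open>T\<close>; the restriction \<open>T \<ge> 1 / N\<^sup>2\<close> keeps \<open>\<sigma>\<close> below \<open>N\<close>.\<close>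

lemma lower_bound_null_line:
  obtains C where "C > 0" "\<And>\<eta> N T. smooth_cutoff \<eta> \<Longrightarrow> N \<ge> 2 \<Longrightarrow> T \<ge> 1 / (real N)\<^sup>2 \<Longrightarrow>
    ennreal (C * (real N * T) powr (1/5)) \<le> strichartz_norm \<eta> N T"
proof -
  define C0 where "C0 = packet_constant"
  have C0: "C0 > 0" unfolding C0_def by (rule packet_constant_pos)
  note packet = strichartz_norm_packet[folded C0_def]
  define C where "C = C0 * (sqrt (1 / 2) * (1 / 2048) powr (3/10))"
  have C: "C > 0" using C0 by (simp add: C_def)
  show thesis
  proof (rule that[OF C])
    fix \<eta> :: "real \<Rightarrow> real" and N :: nat and T :: real
    assume \<eta>: "smooth_cutoff \<eta>" and N: "N \<ge> 2" and T: "T \<ge> 1 / (real N)\<^sup>2"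
    interpret TS: sigma_finite_measure torus by (rule sigma_finite_torus)
    have "1 / (real N)\<^sup>2 > 0" using N by simp
    then have T0: "T > 0" using T by linarith
    define \<sigma> where "\<sigma> = 1 / sqrt T"
    have \<sigma>: "\<sigma> > 0" using T0 by (simp add: \<sigma>_def)
    have \<sigma>2: "\<sigma>\<^sup>2 = 1 / T" using T0 by (simp add: \<sigma>_def power_divide)
    have "\<sigma>\<^sup>2 \<le> (real N)\<^sup>2" unfolding \<sigma>2 using T T0 N by (simp add: field_simps)
    then have \<sigma>N: "\<sigma> \<le> real N" by (rule power2_le_imp_le) simp
    define n where "n = int (N div 2)"
    have n: "real_of_int n \<le> real N / 2" "real N / 2 \<le> real_of_int n + 1" "n \<ge> 0" unfolding n_def by linarith+
    define K where "K = (\<lambda>k. (k, - k)) ` {0..n}"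
    have cardK: "card K = nat (n + 1)" unfolding K_def by (subst card_image) (auto simp: inj_on_def)
    \<comment> \<open>frequencies up to \<open>N / 2\<close> then have phases at most 1/64 at distance \<open>d\<close> from the diagonal\<close>
    define d where "d = 1 / (32 * real N)"
    have d: "0 < d" "d \<le> 1" "d * real N = 1 / 32" using N by (auto simp: d_def field_simps)
    \<comment> \<open>away from the sides of the fundamental domain no case distinction is needed\<close>
    define Y where "Y = {y \<in> space (torus \<Otimes>\<^sub>M torus). fst y \<in> {1..2} \<and> snd y - fst y \<in> {0..d}}"
    note measurable_torus_id [measurable]
    have Y: "Y \<in> sets (torus \<Otimes>\<^sub>M torus)" unfolding Y_def by measurable
    have pi3: "3 < pi" using pi_gt3 .
    have sp: "x \<in> space torus \<longleftrightarrow> 0 \<le> x \<and> x < 2 * pi" for x by (auto simp: torus_def space_restrict_space)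
    have volY: "ennreal d \<le> emeasure (torus \<Otimes>\<^sub>M torus) Y"
    proof -
      have "emeasure (torus \<Otimes>\<^sub>M torus) Y = (\<integral>\<^sup>+x. emeasure torus (Pair x -` Y) \<partial>torus)"
        by (rule TS.emeasure_pair_measure_alt[OF Y])
      also have "\<dots> \<ge> (\<integral>\<^sup>+x. ennreal d * indicator {1..2} x \<partial>torus)"
      proof (intro nn_integral_mono)
        fix x
        show "ennreal d * indicator {1..2} x \<le> emeasure torus (Pair x -` Y)"
        proof (cases "x \<in> {1..2}")
          case True
          have "Pair x -` Y = {x..x + d}"
            using True d pi3 by (auto simp: Y_def space_pair_measure sp)
          also have "emeasure torus {x..x + d} = ennreal (x + d - x)"
            using True d pi3 by (intro emeasure_torus_Icc) auto
          finally show ?thesis using True by simp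
        qed simp
      qed
      also have "(\<integral>\<^sup>+x. ennreal d * indicator {1..2} x \<partial>torus) = ennreal d * emeasure torus {1..2}"
        using sets_torus_Icc[of 1 2] pi3 by (intro nn_integral_cmult_indicator) auto
      also have "emeasure torus {1..2} = 1" using pi3 by (subst emeasure_torus_Icc) auto
      finally show ?thesis by simp
    qed
    have "ennreal (C0 * (sqrt (\<sigma> * real (card K)) * (T / 64 * d / \<sigma>) powr (3/10))) \<le> strichartz_norm \<eta> N T"
    proof (rule packet[OF \<eta> _ \<sigma> \<sigma>N])
      show "(real_of_int (fst k))\<^sup>2 + (real_of_int (snd k))\<^sup>2 \<le> (real N)\<^sup>2 / 2" if kK: "k \<in> K" for k
      proof -
        obtain l where l: "k = (l, - l)" "0 \<le> l" "l \<le> n" using kK unfolding K_def by auto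
        then have "(real_of_int l)\<^sup>2 \<le> (real N / 2)\<^sup>2" using n by (intro power_mono) auto
        then show ?thesis using l by (simp add: power_divide)
      qed
      show "\<bar>fst y * of_int (fst k) + snd y * of_int (snd k) - t * ((of_int (fst k))\<^sup>2 - (of_int (snd k))\<^sup>2)\<bar> \<le> 1 / 64"
        if kK: "k \<in> K" and yY: "y \<in> Y" for k t y
      proof -
        obtain l where l: "k = (l, - l)" "0 \<le> l" "l \<le> n" using kK unfolding K_def by auto
        have "fst y * of_int (fst k) + snd y * of_int (snd k) - t * ((of_int (fst k))\<^sup>2 - (of_int (snd k))\<^sup>2) = - ((snd y - fst y) * of_int l)"
          using l by (simp add: algebra_simps)
        moreover have "\<bar>(snd y - fst y) * of_int l\<bar> \<le> d * (real N / 2)"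
          unfolding abs_mult using yY l n by (intro mult_mono) (auto simp: Y_def)
        ultimately show ?thesis using d(3) by simp
      qed
      show "T / 64 \<le> 1 / (64 * \<sigma>\<^sup>2)" unfolding \<sigma>2 using T0 by simp
      show "K \<noteq> {}" unfolding K_def using n by auto
    qed (use N T0 d Y volY in \<open>auto simp: K_def\<close>)
    moreover have "C * (real N * T) powr (1/5) \<le> C0 * (sqrt (\<sigma> * real (card K)) * (T / 64 * d / \<sigma>) powr (3/10))"
    proof -
      have sT: "sqrt T = T powr (1/2)" using T0 by (simp add: powr_half_sqrt)
      have "T / 64 * d / \<sigma> = 1 / 2048 * (T * sqrt T / real N)" by (simp add: \<sigma>_def d_def)
      also have "T * sqrt T = T powr (3/2)" unfolding sT using T0 powr_add[of T 1 "1/2"] by simp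
      finally have e1: "(T / 64 * d / \<sigma>) powr (3/10) = (1 / 2048) powr (3/10) * (T powr (9/20) * real N powr (- (3/10)))"
        using T0 N by (simp add: powr_mult powr_divide powr_powr powr_minus_divide)
      have "sqrt (1 / 2) * (T powr (- (1/4)) * real N powr (1/2)) \<le> sqrt (\<sigma> * real (card K))"
      proof -
        have "real (card K) = real_of_int n + 1" unfolding cardK using n by simp
        then have "\<sigma> * (real N / 2) \<le> \<sigma> * real (card K)" using n \<sigma> by (intro mult_left_mono) auto
        then have le: "sqrt (\<sigma> * (real N / 2)) \<le> sqrt (\<sigma> * real (card K))" by (rule real_sqrt_le_mono)
        have eq: "sqrt (\<sigma> * (real N / 2)) = sqrt (1 / 2) * (T powr (- (1/4)) * real N powr (1/2))"
        proof -
          have "\<sigma> * (real N / 2) = 1 / 2 * (\<sigma> * real N)" by simp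
          moreover have "sqrt \<sigma> = T powr (- (1/4))"
            unfolding \<sigma>_def sT using T0 by (simp add: real_sqrt_divide powr_half_sqrt[symmetric] powr_powr powr_minus_divide)
          ultimately show ?thesis by (simp only: real_sqrt_mult powr_half_sqrt of_nat_0_le_iff)
        qed
        show ?thesis using le unfolding eq .
      qed
      then have "sqrt (1 / 2) * (T powr (- (1/4)) * real N powr (1/2)) * ((1 / 2048) powr (3/10) * (T powr (9/20) * real N powr (- (3/10))))
         \<le> sqrt (\<sigma> * real (card K)) * (T / 64 * d / \<sigma>) powr (3/10)"
        unfolding e1 by (rule mult_right_mono) simp
      moreover have "sqrt (1 / 2) * (T powr (- (1/4)) * real N powr (1/2)) * ((1 / 2048) powr (3/10) * (T powr (9/20) * real N powr (- (3/10))))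
         = sqrt (1 / 2) * (1 / 2048) powr (3/10) * (real N * T) powr (1/5)"
      proof -
        have "T powr (- (1/4)) * T powr (9/20) = T powr (1/5)" by (simp add: powr_add[symmetric])
        moreover have "real N powr (1/2) * real N powr (- (3/10)) = real N powr (1/5)" by (simp add: powr_add[symmetric])
        moreover have "(real N * T) powr (1/5) = real N powr (1/5) * T powr (1/5)" using T0 by (simp add: powr_mult)
        moreover have "a * (b * c) * (e * (f * g)) = a * e * ((c * g) * (b * f))" for a b c e f g :: real by (simp only: mult_ac)
        ultimately show ?thesis by metis
      qed
      ultimately have "sqrt (1 / 2) * (1 / 2048) powr (3/10) * (real N * T) powr (1/5) \<le> sqrt (\<sigma> * real (card K)) * (T / 64 * d / \<sigma>) powr (3/10)"
        by (simp only:)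
      then have "C0 * (sqrt (1 / 2) * (1 / 2048) powr (3/10) * (real N * T) powr (1/5)) \<le> C0 * (sqrt (\<sigma> * real (card K)) * (T / 64 * d / \<sigma>) powr (3/10))"
        using C0 by (intro mult_left_mono) auto
      then show ?thesis unfolding C_def by (simp only: mult.assoc)
    qed
    ultimately show "ennreal (C * (real N * T) powr (1/5)) \<le> strichartz_norm \<eta> N T"
      using ennreal_leI order.trans by blast
  qed
qed

text \<open>The packet of all frequencies of size at most \<open>N\<close> is focused in a ball of radius of order \<open>1 / N\<close> around the
  origin, during a time of order \<open>1 / N\<^sup>2\<close>.\<close>

lemma lower_bound_point_mass:
  obtains C where "C > 0" "\<And>\<eta> N T. smooth_cutoff \<eta> \<Longrightarrow> N \<ge> 2 \<Longrightarrow> 0 < T \<Longrightarrow> T \<le> 1 / (real N)\<^sup>2 \<Longrightarrow>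
    ennreal (C * ((real N)\<^sup>2 * T) powr (3/10)) \<le> strichartz_norm \<eta> N T"
proof -
  define C0 where "C0 = packet_constant"
  have C0: "C0 > 0" unfolding C0_def by (rule packet_constant_pos)
  note packet = strichartz_norm_packet[folded C0_def]
  define a :: real where "a = 1 / (64 * 128\<^sup>2)"
  have a: "a > 0" by (simp add: a_def)
  define C where "C = C0 * (1 / 2 * a powr (3/10))"
  have C: "C > 0" using C0 a by (simp add: C_def)
  show thesis
  proof (rule that[OF C])
    fix \<eta> :: "real \<Rightarrow> real" and N :: nat and T :: real
    assume \<eta>: "smooth_cutoff \<eta>" and N: "N \<ge> 2" and T: "0 < T" "T \<le> 1 / (real N)\<^sup>2"
    interpret TS: sigma_finite_measure torus by (rule sigma_finite_torus)
    define n where "n = int (N div 2)"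
    have n: "real_of_int n \<le> real N / 2" "real N / 2 \<le> real_of_int n + 1" "n \<ge> 0" unfolding n_def by linarith+
    define K where "K = {0..n} \<times> {0..n}"
    have cardK: "real (card K) = (real_of_int n + 1)\<^sup>2" unfolding K_def using n by (simp add: power2_eq_square)
    \<comment> \<open>each torus variable contributes at most 1/256 to the phase, and so does the time\<close>
    define d where "d = 1 / (128 * real N)"
    have d: "0 < d" "d \<le> 1" "d * real N = 1 / 128" using N by (auto simp: d_def field_simps)
    have pi3: "3 < pi" using pi_gt3 .
    have D: "{0..d} \<in> sets torus" using d pi3 by (intro sets_torus_Icc) auto
    have TN: "T * (real N)\<^sup>2 \<le> 1" using T N by (simp add: field_simps)
    have le: "\<bar>real_of_int l\<bar> \<le> real N / 2" if "0 \<le> l" "l \<le> n" for l using that n by simp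
    have volY: "ennreal (d\<^sup>2) \<le> emeasure (torus \<Otimes>\<^sub>M torus) ({0..d} \<times> {0..d})"
    proof -
      have "emeasure torus {0..d} = ennreal d" using d pi3 by (subst emeasure_torus_Icc) auto
      then have "emeasure (torus \<Otimes>\<^sub>M torus) ({0..d} \<times> {0..d}) = ennreal d * ennreal d"
        using TS.emeasure_pair_measure_Times[OF D D] by simp
      then show ?thesis using d by (simp add: ennreal_mult[symmetric] power2_eq_square)
    qed
    have "ennreal (C0 * (sqrt (real N * real (card K)) * (T / 64 * d\<^sup>2 / real N) powr (3/10))) \<le> strichartz_norm \<eta> N T"
    proof (rule packet[OF \<eta>, where Y = "{0..d} \<times> {0..d}" and K = K and \<sigma> = "real N"])
      show "(real_of_int (fst k))\<^sup>2 + (real_of_int (snd k))\<^sup>2 \<le> (real N)\<^sup>2 / 2" if "k \<in> K" for k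
      proof -
        have "(real_of_int (fst k))\<^sup>2 \<le> (real N / 2)\<^sup>2" "(real_of_int (snd k))\<^sup>2 \<le> (real N / 2)\<^sup>2"
          using that n by (auto simp: K_def intro!: power_mono)
        then show ?thesis by (simp add: power_divide)
      qed
      show "\<bar>fst y * of_int (fst k) + snd y * of_int (snd k) - t * ((of_int (fst k))\<^sup>2 - (of_int (snd k))\<^sup>2)\<bar> \<le> 1 / 64"
        if k: "k \<in> K" and t: "0 \<le> t" "t \<le> T / 64" and y: "y \<in> {0..d} \<times> {0..d}" for k t y
      proof -
        have 1: "\<bar>fst y * of_int (fst k)\<bar> \<le> d * (real N / 2)" "\<bar>snd y * of_int (snd k)\<bar> \<le> d * (real N / 2)"
        proof -
          have "\<bar>real_of_int (fst k)\<bar> \<le> real N / 2" "\<bar>real_of_int (snd k)\<bar> \<le> real N / 2"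
            using k by (intro le; auto simp: K_def)+
          moreover have "\<bar>fst y\<bar> \<le> d" "\<bar>snd y\<bar> \<le> d" using y by auto
          ultimately show "\<bar>fst y * of_int (fst k)\<bar> \<le> d * (real N / 2)" "\<bar>snd y * of_int (snd k)\<bar> \<le> d * (real N / 2)"
            unfolding abs_mult using d by (intro mult_mono; auto)+
        qed
        have "(real_of_int (fst k))\<^sup>2 \<le> (real N / 2)\<^sup>2" "(real_of_int (snd k))\<^sup>2 \<le> (real N / 2)\<^sup>2"
          using k n by (auto simp: K_def intro!: power_mono)
        then have "\<bar>(real_of_int (fst k))\<^sup>2 - (real_of_int (snd k))\<^sup>2\<bar> \<le> (real N / 2)\<^sup>2"
          using zero_le_power2[of "real_of_int (fst k)"] zero_le_power2[of "real_of_int (snd k)"] by linarith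
        then have "\<bar>t * ((real_of_int (fst k))\<^sup>2 - (real_of_int (snd k))\<^sup>2)\<bar> \<le> T / 64 * (real N / 2)\<^sup>2"
          unfolding abs_mult using t by (intro mult_mono) auto
        also have "\<dots> \<le> 1 / 256" using TN by (simp add: power_divide)
        finally show ?thesis using 1 d(3) by linarith
      qed
      show "T / 64 \<le> 1 / (64 * (real N)\<^sup>2)" using T by simp
    qed (use N T d D volY n in \<open>auto simp: K_def\<close>)
    moreover have "C * ((real N)\<^sup>2 * T) powr (3/10) \<le> C0 * (sqrt (real N * real (card K)) * (T / 64 * d\<^sup>2 / real N) powr (3/10))"
    proof -
      have N0: "real N > 0" using N by simp
      have "T / 64 * d\<^sup>2 / real N = a * (T * real N powr (- 3))"
        using N0 by (simp add: a_def d_def power_divide power_mult_distrib powr_minus_divide powr_numeral power2_eq_square power3_eq_cube)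
      then have e1: "(T / 64 * d\<^sup>2 / real N) powr (3/10) = a powr (3/10) * (T powr (3/10) * real N powr (- (9/10)))"
        using T a by (simp add: powr_mult powr_powr)
      have "1 / 2 * real N powr (3/2) \<le> sqrt (real N * real (card K))"
      proof -
        have "(real N / 2)\<^sup>2 \<le> real (card K)" unfolding cardK using n by (intro power_mono) auto
        then have "sqrt (real N * (real N / 2)\<^sup>2) \<le> sqrt (real N * real (card K))" by (simp add: mult_left_mono)
        moreover have "sqrt (real N * (real N / 2)\<^sup>2) = 1 / 2 * real N powr (3/2)"
          using N0 powr_add[of "real N" 1 "1/2"] by (simp add: real_sqrt_mult powr_half_sqrt)
        ultimately show ?thesis by simp
      qed
      then have "1 / 2 * real N powr (3/2) * (a powr (3/10) * (T powr (3/10) * real N powr (- (9/10))))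
         \<le> sqrt (real N * real (card K)) * (T / 64 * d\<^sup>2 / real N) powr (3/10)"
        unfolding e1 by (rule mult_right_mono) simp
      moreover have "1 / 2 * real N powr (3/2) * (a powr (3/10) * (T powr (3/10) * real N powr (- (9/10)))) = 1 / 2 * a powr (3/10) * ((real N)\<^sup>2 * T) powr (3/10)"
      proof -
        have "real N powr (3/2) * real N powr (- (9/10)) = real N powr (3/5)" by (simp add: powr_add[symmetric])
        moreover have "((real N)\<^sup>2 * T) powr (3/10) = real N powr (3/5) * T powr (3/10)"
          using T N0 by (simp add: powr_mult powr_powr powr_numeral[symmetric] del: powr_numeral)
        moreover have "b * c * (e * (f * g)) = b * e * ((c * g) * f)" for b c e f g :: real by (simp only: mult_ac)
        ultimately show ?thesis by metis
      qed
      ultimately have "1 / 2 * a powr (3/10) * ((real N)\<^sup>2 * T) powr (3/10) \<le> sqrt (real N * real (card K)) * (T / 64 * d\<^sup>2 / real N) powr (3/10)"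
        by (simp only:)
      then have "C0 * (1 / 2 * a powr (3/10) * ((real N)\<^sup>2 * T) powr (3/10)) \<le> C0 * (sqrt (real N * real (card K)) * (T / 64 * d\<^sup>2 / real N) powr (3/10))"
        using C0 by (intro mult_left_mono) auto
      then show ?thesis unfolding C_def by (simp only: mult.assoc)
    qed
    ultimately show "ennreal (C * ((real N)\<^sup>2 * T) powr (3/10)) \<le> strichartz_norm \<eta> N T"
      using ennreal_leI order.trans by blast
  qed
qed

section \<open>The growth of the operator norm\<close>

lemma strichartz_norm_mono:
  assumes \<eta>: "smooth_cutoff \<eta>" and T: "T \<le> T'"
  shows "strichartz_norm \<eta> N T \<le> strichartz_norm \<eta> N T'"
  unfolding strichartz_norm_def
proof (rule SUP_mono)
  fix f assume f: "f \<in> {f \<in> Lp_space 2 RT2. Lp_norm 2 RT2 f \<le> 1}"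
  then have f': "f \<in> borel_measurable RT2" "energy RT2 f \<le> 1" using unit_ball_iff[of f] by auto
  let ?I = "\<lambda>T. \<integral>\<^sup>+p. ennreal (norm (case p of (t, z) \<Rightarrow> localised_propagator \<eta> N t f z) powr (10/3)) \<partial>(restrict_space lborel {0..T} \<Otimes>\<^sub>M RT2)"
  have "?I T \<le> ?I T'"
    unfolding space_time_integral[OF \<eta> f'] using T by (intro mult_left_mono strichartz_mass_mono) auto
  then have "Lp_norm (10 / 3) (restrict_space lborel {0..T} \<Otimes>\<^sub>M RT2) (\<lambda>(t, z). localised_propagator \<eta> N t f z)
     \<le> Lp_norm (10 / 3) (restrict_space lborel {0..T'} \<Otimes>\<^sub>M RT2) (\<lambda>(t, z). localised_propagator \<eta> N t f z)"
    unfolding Lp_norm_def Let_def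
    by (auto simp: top_unique less_top intro!: ennreal_leI powr_mono2 enn2real_mono)
  then show "\<exists>g\<in>{f \<in> Lp_space 2 RT2. Lp_norm 2 RT2 f \<le> 1}.
      Lp_norm (10 / 3) (restrict_space lborel {0..T} \<Otimes>\<^sub>M RT2) (\<lambda>(t, z). localised_propagator \<eta> N t f z)
     \<le> Lp_norm (10 / 3) (restrict_space lborel {0..T'} \<Otimes>\<^sub>M RT2) (\<lambda>(t, z). localised_propagator \<eta> N t g z)"
    using f by blast
qed

lemma upper_bound_bernstein:
  obtains C where "C > 0" "\<And>\<eta> N T. smooth_cutoff \<eta> \<Longrightarrow> N \<ge> 1 \<Longrightarrow> 0 < T \<Longrightarrow>
    strichartz_norm \<eta> N T \<le> ennreal (C * ((real N)\<^sup>2 * T) powr (3/10))"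
proof -
  define B :: real where "B = 100 powr (2/3) * (2 * pi) ^ 3"
  have B: "B > 0" by (simp add: B_def)
  show thesis
  proof (rule that[of "B powr (3/10)"])
    show "B powr (3/10) > 0" using B by simp
    fix \<eta> :: "real \<Rightarrow> real" and N :: nat and T :: real
    assume \<eta>: "smooth_cutoff \<eta>" and N: "N \<ge> 1" and T: "0 < T"
    have vol: "sqrt (box_volume (2 * N)) powr (4/3) \<le> 100 powr (2/3) * (real N)\<^sup>2"
    proof -
      have "(4 * real N + 1)\<^sup>2 \<le> (5 * real N)\<^sup>2" using N by (intro power_mono) auto
      then have "4 * real N * (4 * real N + 1)\<^sup>2 \<le> 4 * real N * (5 * real N)\<^sup>2" by (intro mult_left_mono) auto
      then have "box_volume (2 * N) \<le> 100 * real N ^ 3" by (simp add: box_volume_def power2_eq_square power3_eq_cube)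
      then have "box_volume (2 * N) powr (2/3) \<le> (100 * real N ^ 3) powr (2/3)" by (intro powr_mono2) (auto simp: box_volume_def)
      also have "\<dots> = 100 powr (2/3) * (real N)\<^sup>2"
        using N by (simp add: powr_mult powr_powr powr_numeral[symmetric] del: powr_numeral)
      finally show ?thesis by (simp add: powr_half_sqrt[symmetric] powr_powr box_volume_def)
    qed
    have "strichartz_norm \<eta> N T \<le> ennreal ((B * ((real N)\<^sup>2 * T)) powr (3/10))"
    proof (rule strichartz_norm_le[OF \<eta>])
      fix F assume F: "F \<in> band (2 * N)"
      have "strichartz_mass F 0 T \<le> ennreal (sqrt (box_volume (2 * N)) powr (4/3) * (2 * pi) ^ 3 * T)"
        using T by (intro bernstein_mass[OF F]) auto
      also have "\<dots> \<le> ennreal (B * ((real N)\<^sup>2 * T))"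
      proof (rule ennreal_leI)
        have "sqrt (box_volume (2 * N)) powr (4/3) * ((2 * pi) ^ 3 * T) \<le> 100 powr (2/3) * (real N)\<^sup>2 * ((2 * pi) ^ 3 * T)"
          using vol T by (intro mult_right_mono) auto
        then show "sqrt (box_volume (2 * N)) powr (4/3) * (2 * pi) ^ 3 * T \<le> B * ((real N)\<^sup>2 * T)"
          by (simp add: B_def mult_ac)
      qed
      finally show "strichartz_mass F 0 T \<le> ennreal (B * ((real N)\<^sup>2 * T))" .
    qed (use N T B in auto)
    then show "strichartz_norm \<eta> N T \<le> ennreal (B powr (3/10) * ((real N)\<^sup>2 * T) powr (3/10))"
      using B T by (simp add: powr_mult)
  qed
qed

lemma upper_bound_dispersive:
  obtains C where "C > 0" "\<And>\<eta> N T. smooth_cutoff \<eta> \<Longrightarrow> N \<ge> 1 \<Longrightarrow> 0 < T \<Longrightarrow>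
    strichartz_norm \<eta> N T \<le> ennreal (C * (real N * T + 1) powr (3/10))"
proof -
  obtain C0 where C0: "C0 > 0" and mass: "\<And>M F T. M \<ge> 1 \<Longrightarrow> F \<in> band M \<Longrightarrow> T > 0 \<Longrightarrow> strichartz_mass F 0 T \<le> ennreal (C0 * (8 * real M * T + 2))"
    by (rule strichartz_mass_dispersive) (rule that)
  show thesis
  proof (rule that[of "(16 * C0) powr (3/10)"])
    show "(16 * C0) powr (3/10) > 0" using C0 by simp
    fix \<eta> :: "real \<Rightarrow> real" and N :: nat and T :: real
    assume \<eta>: "smooth_cutoff \<eta>" and N: "N \<ge> 1" and T: "0 < T"
    have "strichartz_norm \<eta> N T \<le> ennreal ((16 * C0 * (real N * T + 1)) powr (3/10))"
    proof (rule strichartz_norm_le[OF \<eta>])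
      fix F assume F: "F \<in> band (2 * N)"
      have "strichartz_mass F 0 T \<le> ennreal (C0 * (8 * real (2 * N) * T + 2))"
        using N T by (intro mass[OF _ F]) auto
      also have "\<dots> \<le> ennreal (16 * C0 * (real N * T + 1))"
        using C0 by (intro ennreal_leI) (simp add: algebra_simps)
      finally show "strichartz_mass F 0 T \<le> ennreal (16 * C0 * (real N * T + 1))" .
    qed (use N T C0 in auto)
    then show "strichartz_norm \<eta> N T \<le> ennreal ((16 * C0) powr (3/10) * (real N * T + 1) powr (3/10))"
      using C0 T by (simp add: powr_mult)
  qed
qed

lemma upper_bound_quartic:
  obtains C where "C > 0" "\<And>\<eta> N T. smooth_cutoff \<eta> \<Longrightarrow> N \<ge> 1 \<Longrightarrow> 0 < T \<Longrightarrow>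
    strichartz_norm \<eta> N T \<le> ennreal (C * (T powr (1/10) * (real N * sqrt (max 1 T)) powr (1/5)))"
proof -
  obtain C0 where C0: "C0 > 0" and mass: "\<And>M F T. M \<ge> 1 \<Longrightarrow> F \<in> band M \<Longrightarrow> T > 0 \<Longrightarrow>
    strichartz_mass F 0 T \<le> ennreal (C0 * (T powr (1/3) * (real M * sqrt (max 1 T)) powr (2/3)))"
    by (rule strichartz_mass_quartic) (rule that)
  show thesis
  proof (rule that[of "(C0 * 2 powr (2/3)) powr (3/10)"])
    show "(C0 * 2 powr (2/3)) powr (3/10) > 0" using C0 by simp
    fix \<eta> :: "real \<Rightarrow> real" and N :: nat and T :: real
    assume \<eta>: "smooth_cutoff \<eta>" and N: "N \<ge> 1" and T: "0 < T"
    let ?R = "real N * sqrt (max 1 T)"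
    have R: "?R > 0" using N by simp
    have "strichartz_norm \<eta> N T \<le> ennreal ((C0 * 2 powr (2/3) * (T powr (1/3) * ?R powr (2/3))) powr (3/10))"
    proof (rule strichartz_norm_le[OF \<eta>])
      fix F assume F: "F \<in> band (2 * N)"
      have "strichartz_mass F 0 T \<le> ennreal (C0 * (T powr (1/3) * (real (2 * N) * sqrt (max 1 T)) powr (2/3)))"
        using N T by (intro mass[OF _ F]) auto
      also have "(real (2 * N) * sqrt (max 1 T)) powr (2/3) = 2 powr (2/3) * ?R powr (2/3)"
        using R powr_mult[of 2 ?R "2/3"] by (simp add: mult.assoc)
      finally show "strichartz_mass F 0 T \<le> ennreal (C0 * 2 powr (2/3) * (T powr (1/3) * ?R powr (2/3)))"
        by (simp add: mult_ac)
    qed (use N T C0 in auto)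
    moreover have "(C0 * 2 powr (2/3) * (T powr (1/3) * ?R powr (2/3))) powr (3/10)
       = (C0 * 2 powr (2/3)) powr (3/10) * (T powr (1/10) * ?R powr (1/5))"
      using C0 T R by (subst powr_mult, simp, simp, subst powr_mult, simp, simp, simp only: powr_powr) simp
    ultimately show "strichartz_norm \<eta> N T \<le> ennreal ((C0 * 2 powr (2/3)) powr (3/10) * (T powr (1/10) * ?R powr (1/5)))"
      by (simp only:)
  qed
qed

lemma ennreal_le_cancel_constant:
  assumes "c > 0" "x \<ge> 0" "ennreal (c * x) \<le> S"
  shows "ennreal x \<le> ennreal (1 / c) * S"
proof -
  have "ennreal x = ennreal (1 / c) * ennreal (c * x)" using assms by (simp add: ennreal_mult[symmetric])
  also have "\<dots> \<le> ennreal (1 / c) * S" using assms by (intro mult_left_mono) auto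
  finally show ?thesis .
qed

theorem corollary1p2:
  fixes \<eta> :: "real \<Rightarrow> real"
  assumes "smooth_cutoff \<eta>"
  shows
    "(eqsim_on {(N, T). N \<in> dyadic_scales \<and> 0 < T \<and> T \<le> 1 / (real N)\<^sup>2}
       (\<lambda>(N, T). strichartz_norm \<eta> N T)
       (\<lambda>(N, T). ennreal (((real N)\<^sup>2 * T) powr (3 / 10))))
     \<and>
     (eqsim_on {(N, T). N \<in> dyadic_scales \<and> 1 / (real N)\<^sup>2 \<le> T \<and> T \<le> 1 / real N}
       (\<lambda>(N, T). strichartz_norm \<eta> N T)
       (\<lambda>(N, T). 1))
     \<and>
     (eqsim_on {(N, T). N \<in> dyadic_scales \<and> 1 \<le> T}
       (\<lambda>(N, T). strichartz_norm \<eta> N T)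
       (\<lambda>(N, T). ennreal ((real N * T) powr (1 / 5))))
     \<and>
     (lesssim_on {(N, T). N \<in> dyadic_scales \<and> 1 / real N < T \<and> T < 1}
       (\<lambda>(N, T). ennreal ((real N * T) powr (1 / 5)))
       (\<lambda>(N, T). strichartz_norm \<eta> N T)
     \<and> lesssim_on {(N, T). N \<in> dyadic_scales \<and> 1 / real N < T \<and> T < 1}
       (\<lambda>(N, T). strichartz_norm \<eta> N T)
       (\<lambda>(N, T). ennreal (min ((real N * T) powr (3 / 10))
                              (T powr (1 / 10) * real N powr (1 / 5)))))
     \<and>
     (\<forall>T\<^sub>0 > 0. eqsim_on dyadic_scales
       (\<lambda>N. strichartz_norm \<eta> N T\<^sub>0)
       (\<lambda>N. ennreal (real N powr (1 / 5))))
     \<and>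
     (\<forall>\<tau> :: nat \<Rightarrow> real. (\<forall>N \<in> dyadic_scales. 0 < \<tau> N \<and> \<tau> N \<le> 1) \<longrightarrow>
       ((SUP N \<in> dyadic_scales. strichartz_norm \<eta> N (\<tau> N)) < \<infinity> \<longleftrightarrow>
        (SUP N \<in> dyadic_scales. ennreal (real N * \<tau> N)) < \<infinity>))"
proof -
  let ?S = "strichartz_norm \<eta>"
  obtain A where A: "A > 0" and bern: "\<And>N T. N \<ge> 1 \<Longrightarrow> 0 < T \<Longrightarrow> ?S N T \<le> ennreal (A * ((real N)\<^sup>2 * T) powr (3/10))"
    using upper_bound_bernstein assms by metis
  obtain B where B: "B > 0" and disp: "\<And>N T. N \<ge> 1 \<Longrightarrow> 0 < T \<Longrightarrow> ?S N T \<le> ennreal (B * (real N * T + 1) powr (3/10))"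
    using upper_bound_dispersive assms by metis
  obtain Q where Q: "Q > 0" and quart: "\<And>N T. N \<ge> 1 \<Longrightarrow> 0 < T \<Longrightarrow> ?S N T \<le> ennreal (Q * (T powr (1/10) * (real N * sqrt (max 1 T)) powr (1/5)))"
    using upper_bound_quartic assms by metis
  obtain c where c: "c > 0" and line: "\<And>N T. N \<ge> 2 \<Longrightarrow> T \<ge> 1 / (real N)\<^sup>2 \<Longrightarrow> ennreal (c * (real N * T) powr (1/5)) \<le> ?S N T"
    using lower_bound_null_line assms by metis
  obtain b where b: "b > 0" and point: "\<And>N T. N \<ge> 2 \<Longrightarrow> 0 < T \<Longrightarrow> T \<le> 1 / (real N)\<^sup>2 \<Longrightarrow> ennreal (b * ((real N)\<^sup>2 * T) powr (3/10)) \<le> ?S N T"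
    using lower_bound_point_mass assms by metis
  have dy: "N \<ge> 2" "N \<ge> 1" "real N \<ge> 2" "1 / (real N)\<^sup>2 > 0" "1 / (real N)\<^sup>2 \<le> 1 / real N" "1 / real N \<le> 1" if "N \<in> dyadic_scales" for N
    using that by (auto simp: dyadic_scales_def power2_eq_square field_simps)
  have line': "ennreal ((real N * T) powr (1/5)) \<le> ennreal (1 / c) * ?S N T" if "N \<in> dyadic_scales" "T \<ge> 1 / (real N)\<^sup>2" for N T
    using line[of N T] dy[OF that(1)] that c by (intro ennreal_le_cancel_constant) auto
  have point': "ennreal (((real N)\<^sup>2 * T) powr (3/10)) \<le> ennreal (1 / b) * ?S N T" if "N \<in> dyadic_scales" "0 < T" "T \<le> 1 / (real N)\<^sup>2" for N T
    using point[of N T] dy[OF that(1)] that b by (intro ennreal_le_cancel_constant) auto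
  have disp_small: "?S N T \<le> ennreal (B * 2 powr (3/10))" if "N \<in> dyadic_scales" "0 < T" "real N * T \<le> 1" for N T
  proof -
    have "(real N * T + 1) powr (3/10) \<le> 2 powr (3/10)" using that by (intro powr_mono2) auto
    then show ?thesis using disp[of N T] dy[OF that(1)] that B
      by (meson ennreal_leI less_imp_le mult_left_mono order.trans)
  qed
  have quart_small: "?S N T \<le> ennreal Q * ennreal (T powr (1/10) * real N powr (1/5))" if "N \<in> dyadic_scales" "0 < T" "T \<le> 1" for N T
    using quart[of N T] dy[OF that(1)] that Q by (simp add: ennreal_mult max_absorb1)
  have i: "eqsim_on {(N, T). N \<in> dyadic_scales \<and> 0 < T \<and> T \<le> 1 / (real N)\<^sup>2}
       (\<lambda>(N, T). ?S N T) (\<lambda>(N, T). ennreal (((real N)\<^sup>2 * T) powr (3 / 10)))"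
    unfolding eqsim_on_def lesssim_on_def
  proof (intro conjI)
    show "\<exists>C>0. \<forall>i\<in>{(N, T). N \<in> dyadic_scales \<and> 0 < T \<and> T \<le> 1 / (real N)\<^sup>2}.
        (case i of (N, T) \<Rightarrow> ?S N T) \<le> ennreal C * (case i of (N, T) \<Rightarrow> ennreal (((real N)\<^sup>2 * T) powr (3 / 10)))"
      using A bern dy by (intro exI[of _ A]) (auto simp: ennreal_mult[symmetric])
    show "\<exists>C>0. \<forall>i\<in>{(N, T). N \<in> dyadic_scales \<and> 0 < T \<and> T \<le> 1 / (real N)\<^sup>2}.
        (case i of (N, T) \<Rightarrow> ennreal (((real N)\<^sup>2 * T) powr (3 / 10))) \<le> ennreal C * (case i of (N, T) \<Rightarrow> ?S N T)"
      using b point' by (intro exI[of _ "1 / b"]) auto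
  qed
  have ii: "eqsim_on {(N, T). N \<in> dyadic_scales \<and> 1 / (real N)\<^sup>2 \<le> T \<and> T \<le> 1 / real N} (\<lambda>(N, T). ?S N T) (\<lambda>(N, T). 1)"
    unfolding eqsim_on_def lesssim_on_def
  proof (intro conjI)
    have "?S N T \<le> ennreal (B * 2 powr (3/10)) * 1" if "N \<in> dyadic_scales" "1 / (real N)\<^sup>2 \<le> T" "T \<le> 1 / real N" for N T
    proof -
      have "T > 0" using dy(4)[OF that(1)] that(2) by linarith
      moreover have "real N * T \<le> 1" using that dy(3)[OF that(1)] by (simp add: field_simps)
      ultimately show ?thesis using disp_small[OF that(1)] by simp
    qed
    then show "\<exists>C>0. \<forall>i\<in>{(N, T). N \<in> dyadic_scales \<and> 1 / (real N)\<^sup>2 \<le> T \<and> T \<le> 1 / real N}.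
        (case i of (N, T) \<Rightarrow> ?S N T) \<le> ennreal C * (case i of (N, T) \<Rightarrow> 1)"
      using B by (intro exI[of _ "B * 2 powr (3/10)"]) auto
    \<comment> \<open>the norm at the time \<open>T\<close> is at least that at the time \<open>1 / N\<^sup>2\<close>\<close>
    have "1 \<le> ennreal (1 / b) * ?S N T" if "N \<in> dyadic_scales" "1 / (real N)\<^sup>2 \<le> T" for N T
    proof -
      have "(real N)\<^sup>2 * (1 / (real N)\<^sup>2) = 1" using dy(3)[OF that(1)] by simp
      then have "1 \<le> ennreal (1 / b) * ?S N (1 / (real N)\<^sup>2)"
        using point'[OF that(1) dy(4)[OF that(1)] order_refl] by simp
      also have "\<dots> \<le> ennreal (1 / b) * ?S N T" by (intro mult_left_mono strichartz_norm_mono assms that) auto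
      finally show ?thesis .
    qed
    then show "\<exists>C>0. \<forall>i\<in>{(N, T). N \<in> dyadic_scales \<and> 1 / (real N)\<^sup>2 \<le> T \<and> T \<le> 1 / real N}.
        (case i of (N, T) \<Rightarrow> 1) \<le> ennreal C * (case i of (N, T) \<Rightarrow> ?S N T)"
      using b by (intro exI[of _ "1 / b"]) auto
  qed
  have iii: "eqsim_on {(N, T). N \<in> dyadic_scales \<and> 1 \<le> T} (\<lambda>(N, T). ?S N T) (\<lambda>(N, T). ennreal ((real N * T) powr (1 / 5)))"
    unfolding eqsim_on_def lesssim_on_def
  proof (intro conjI)
    have "?S N T \<le> ennreal Q * ennreal ((real N * T) powr (1/5))" if "N \<in> dyadic_scales" "1 \<le> T" for N T
    proof -
      have "sqrt T powr (1/5) = T powr (1/10)" using that by (simp add: powr_half_sqrt[symmetric] powr_powr)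
      then have "T powr (1/10) * (real N * sqrt T) powr (1/5) = real N powr (1/5) * (T powr (1/10) * T powr (1/10))"
        using that by (simp add: powr_mult)
      also have "T powr (1/10) * T powr (1/10) = T powr (1/5)" by (simp add: powr_add[symmetric])
      finally have "T powr (1/10) * (real N * sqrt T) powr (1/5) = (real N * T) powr (1/5)" using that by (simp add: powr_mult)
      then show ?thesis using quart[of N T] dy[OF that(1)] that Q by (simp add: ennreal_mult[symmetric] max_def split: if_splits)
    qed
    then show "\<exists>C>0. \<forall>i\<in>{(N, T). N \<in> dyadic_scales \<and> 1 \<le> T}.
        (case i of (N, T) \<Rightarrow> ?S N T) \<le> ennreal C * (case i of (N, T) \<Rightarrow> ennreal ((real N * T) powr (1 / 5)))"
      using Q by (intro exI[of _ Q]) auto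
    have "ennreal ((real N * T) powr (1/5)) \<le> ennreal (1 / c) * ?S N T" if "N \<in> dyadic_scales" "1 \<le> T" for N T
      using dy(5,6)[OF that(1)] that by (intro line') auto
    then show "\<exists>C>0. \<forall>i\<in>{(N, T). N \<in> dyadic_scales \<and> 1 \<le> T}.
        (case i of (N, T) \<Rightarrow> ennreal ((real N * T) powr (1 / 5))) \<le> ennreal C * (case i of (N, T) \<Rightarrow> ?S N T)"
      using c by (intro exI[of _ "1 / c"]) auto
  qed
  have iv1: "lesssim_on {(N, T). N \<in> dyadic_scales \<and> 1 / real N < T \<and> T < 1}
       (\<lambda>(N, T). ennreal ((real N * T) powr (1 / 5))) (\<lambda>(N, T). ?S N T)"
  proof -
    have "ennreal ((real N * T) powr (1/5)) \<le> ennreal (1 / c) * ?S N T" if "N \<in> dyadic_scales" "1 / real N < T" for N T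
      using dy(5)[OF that(1)] that by (intro line') auto
    then show ?thesis unfolding lesssim_on_def using c by (intro exI[of _ "1 / c"]) auto
  qed
  have iv2: "lesssim_on {(N, T). N \<in> dyadic_scales \<and> 1 / real N < T \<and> T < 1} (\<lambda>(N, T). ?S N T)
       (\<lambda>(N, T). ennreal (min ((real N * T) powr (3 / 10)) (T powr (1 / 10) * real N powr (1 / 5))))"
  proof -
    define D where "D = max (B * 2 powr (3/10)) Q"
    have D: "D > 0" using Q by (simp add: D_def)
    have "?S N T \<le> ennreal D * ennreal (min ((real N * T) powr (3 / 10)) (T powr (1 / 10) * real N powr (1 / 5)))"
      if "N \<in> dyadic_scales" "1 / real N < T" "T < 1" for N T
    proof -
      have T: "T > 0" using that dy[OF that(1)] by (meson less_trans zero_less_divide_1_iff less_le_trans zero_less_numeral)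
      have NT: "1 < real N * T" using that dy(3)[OF that(1)] by (simp add: field_simps)
      have "(real N * T + 1) powr (3/10) \<le> (2 * (real N * T)) powr (3/10)" using NT by (intro powr_mono2) linarith+
      also have "\<dots> = 2 powr (3/10) * (real N * T) powr (3/10)" using NT by (simp add: powr_mult)
      finally have "B * (real N * T + 1) powr (3/10) \<le> B * (2 powr (3/10) * (real N * T) powr (3/10))" using B by (intro mult_left_mono) auto
      also have "\<dots> \<le> D * (real N * T) powr (3/10)" unfolding mult.assoc[symmetric] by (intro mult_right_mono) (auto simp: D_def)
      finally have 1: "?S N T \<le> ennreal (D * (real N * T) powr (3/10))"
        using disp[of N T] dy(2)[OF that(1)] T by (meson ennreal_leI order.trans)
      have "Q * (T powr (1/10) * real N powr (1/5)) \<le> D * (T powr (1/10) * real N powr (1/5))"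
        by (intro mult_right_mono) (auto simp: D_def)
      then have 2: "?S N T \<le> ennreal (D * (T powr (1/10) * real N powr (1/5)))"
        using quart_small[OF that(1) T] that Q by (simp add: ennreal_mult[symmetric]) (meson ennreal_leI order.trans)
      have "?S N T \<le> ennreal (D * min ((real N * T) powr (3 / 10)) (T powr (1 / 10) * real N powr (1 / 5)))"
        using 1 2 by (auto simp: min_def)
      then show ?thesis using D by (simp add: ennreal_mult)
    qed
    then show ?thesis unfolding lesssim_on_def using D by (intro exI[of _ D]) auto
  qed
  have v: "\<forall>T\<^sub>0 > 0. eqsim_on dyadic_scales (\<lambda>N. ?S N T\<^sub>0) (\<lambda>N. ennreal (real N powr (1 / 5)))"
  proof (intro allI impI)
    fix T :: real assume T: "0 < T"
    show "eqsim_on dyadic_scales (\<lambda>N. ?S N T) (\<lambda>N. ennreal (real N powr (1 / 5)))"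
      unfolding eqsim_on_def lesssim_on_def
    proof (intro conjI)
      define D where "D = Q * (T powr (1/10) * sqrt (max 1 T) powr (1/5))"
      have D: "D > 0" using Q T by (simp add: D_def)
      have "?S N T \<le> ennreal D * ennreal (real N powr (1/5))" if "N \<in> dyadic_scales" for N
        using quart[of N T] dy(2)[OF that] T D by (simp add: D_def ennreal_mult[symmetric] powr_mult mult_ac)
      then show "\<exists>C>0. \<forall>i\<in>dyadic_scales. ?S i T \<le> ennreal C * ennreal (real i powr (1 / 5))"
        using D by blast
      define E where "E = max (1 / (c * T powr (1/5))) (1 / (b * T powr (3/10)))"
      have E: "E > 0" using c T by (simp add: E_def less_max_iff_disj)
      \<comment> \<open>for small \<open>N\<close> the time \<open>T\<close> can be less than \<open>1 / N\<^sup>2\<close>, where only the point mass is available\<close>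
      have "ennreal (real N powr (1/5)) \<le> ennreal E * ?S N T" if N: "N \<in> dyadic_scales" for N
      proof (cases "T \<ge> 1 / (real N)\<^sup>2")
        case True
        have "ennreal (c * T powr (1/5) * real N powr (1/5)) \<le> ?S N T"
          using line[OF dy(1)[OF N] True] T by (simp add: powr_mult mult_ac)
        then have "ennreal (real N powr (1/5)) \<le> ennreal (1 / (c * T powr (1/5))) * ?S N T"
          using c T by (intro ennreal_le_cancel_constant) auto
        also have "\<dots> \<le> ennreal E * ?S N T" by (intro mult_right_mono ennreal_leI) (auto simp: E_def)
        finally show ?thesis .
      next
        case False
        have "real N powr (1/5) \<le> real N powr (3/5)" using dy(3)[OF N] by (intro powr_mono) auto
        then have "b * T powr (3/10) * real N powr (1/5) \<le> b * T powr (3/10) * real N powr (3/5)"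
          using b by (intro mult_left_mono) auto
        also have "\<dots> = b * ((real N)\<^sup>2 * T) powr (3/10)"
          using T dy(3)[OF N] by (simp add: powr_mult powr_powr powr_numeral[symmetric] del: powr_numeral)
        finally have "ennreal (b * T powr (3/10) * real N powr (1/5)) \<le> ?S N T"
          using point[OF dy(1)[OF N] T] False by (meson ennreal_leI less_imp_le not_le order.trans)
        then have "ennreal (real N powr (1/5)) \<le> ennreal (1 / (b * T powr (3/10))) * ?S N T"
          using b T by (intro ennreal_le_cancel_constant) auto
        also have "\<dots> \<le> ennreal E * ?S N T" by (intro mult_right_mono ennreal_leI) (auto simp: E_def)
        finally show ?thesis .
      qed
      then show "\<exists>C>0. \<forall>i\<in>dyadic_scales. ennreal (real i powr (1 / 5)) \<le> ennreal C * ?S i T"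
        using E by blast
    qed
  qed
  have vi: "\<forall>\<tau> :: nat \<Rightarrow> real. (\<forall>N \<in> dyadic_scales. 0 < \<tau> N \<and> \<tau> N \<le> 1) \<longrightarrow>
       ((SUP N \<in> dyadic_scales. ?S N (\<tau> N)) < \<infinity> \<longleftrightarrow> (SUP N \<in> dyadic_scales. ennreal (real N * \<tau> N)) < \<infinity>)"
  proof (intro allI impI iffI)
    fix \<tau> :: "nat \<Rightarrow> real" assume \<tau>: "\<forall>N \<in> dyadic_scales. 0 < \<tau> N \<and> \<tau> N \<le> 1"
    assume "(SUP N \<in> dyadic_scales. ?S N (\<tau> N)) < \<infinity>"
    then obtain R where R: "(SUP N \<in> dyadic_scales. ?S N (\<tau> N)) = ennreal R" "R \<ge> 0"
      by (cases "SUP N \<in> dyadic_scales. ?S N (\<tau> N)" rule: ennreal_cases) auto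
    have "ennreal (real N * \<tau> N) \<le> ennreal (max 1 ((R / c) powr 5))" if N: "N \<in> dyadic_scales" for N
    proof (rule ennreal_leI, cases "real N * \<tau> N \<le> 1")
      case False
      then have "\<tau> N \<ge> 1 / real N" using dy(3)[OF N] by (simp add: field_simps)
      then have "\<tau> N \<ge> 1 / (real N)\<^sup>2" using dy(5)[OF N] by linarith
      then have "ennreal (c * (real N * \<tau> N) powr (1/5)) \<le> ?S N (\<tau> N)" by (rule line[OF dy(1)[OF N]])
      also have "\<dots> \<le> ennreal R" unfolding R(1)[symmetric] by (rule SUP_upper[OF N])
      finally have "(real N * \<tau> N) powr (1/5) \<le> R / c" using c R(2) by (simp add: field_simps)
      then have "((real N * \<tau> N) powr (1/5)) powr 5 \<le> (R / c) powr 5" by (intro powr_mono2) auto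
      then show "real N * \<tau> N \<le> max 1 ((R / c) powr 5)" using False by (simp add: powr_powr)
    qed simp
    then have "(SUP N \<in> dyadic_scales. ennreal (real N * \<tau> N)) \<le> ennreal (max 1 ((R / c) powr 5))" by (rule SUP_least)
    then show "(SUP N \<in> dyadic_scales. ennreal (real N * \<tau> N)) < \<infinity>" by (rule le_less_trans) simp
  next
    fix \<tau> :: "nat \<Rightarrow> real" assume \<tau>: "\<forall>N \<in> dyadic_scales. 0 < \<tau> N \<and> \<tau> N \<le> 1"
    assume "(SUP N \<in> dyadic_scales. ennreal (real N * \<tau> N)) < \<infinity>"
    then obtain R where R: "(SUP N \<in> dyadic_scales. ennreal (real N * \<tau> N)) = ennreal R" "R \<ge> 0"
      by (cases "SUP N \<in> dyadic_scales. ennreal (real N * \<tau> N)" rule: ennreal_cases) auto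
    have "?S N (\<tau> N) \<le> ennreal (B * (R + 1) powr (3/10))" if N: "N \<in> dyadic_scales" for N
    proof -
      have "ennreal (real N * \<tau> N) \<le> ennreal R" unfolding R(1)[symmetric] by (rule SUP_upper[OF N])
      then have "real N * \<tau> N \<le> R" using R(2) by simp
      moreover have "\<tau> N > 0" using \<tau> N by blast
      ultimately have "(real N * \<tau> N + 1) powr (3/10) \<le> (R + 1) powr (3/10)" by (intro powr_mono2) auto
      then have "B * (real N * \<tau> N + 1) powr (3/10) \<le> B * (R + 1) powr (3/10)" using B by (intro mult_left_mono) auto
      then show ?thesis using disp[OF dy(2)[OF N] \<open>\<tau> N > 0\<close>] by (meson ennreal_leI order.trans)
    qed
    then have "(SUP N \<in> dyadic_scales. ?S N (\<tau> N)) \<le> ennreal (B * (R + 1) powr (3/10))" by (rule SUP_least)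
    then show "(SUP N \<in> dyadic_scales. ?S N (\<tau> N)) < \<infinity>" by (rule le_less_trans) simp
  qed
  show ?thesis using i ii iii iv1 iv2 v vi by blast
qed

end
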